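(* Let $R=S\times_kT$ be a fiber product as in the setting described in the context. Let $M$, $N$ and $V$ be modules over $S$, $T$ and $k$ respectively, together with surjective homomorphisms $\mu\colon M\to V$ and $\nu\colon N\to V$ that are $\pi_S$-equivariant and $\pi_T$-equivariant respectively, with $\ker\mu=\mathfrak pM$ and $\ker\nu=\mathfrak qN$. Let $M\times_VN=\{(m,n)\in M\times N:\mu(m)=\nu(n)\}$, regarded as an $R$-module, and let $\iota\colon M\times_V N\to M\times N$ be the inclusion. Then the exact sequence of $R$-modules $$0\to M\times_VN\xrightarrow{\ \iota\ }M\times N\xrightarrow{\ \mu-\nu\ }V\to0$$ induces an exact sequence of graded left $\operatorname{Ext}_R(k,k)$-modules $$0\to\operatorname{Ext}_R(V,k)\xrightarrow{\binom{\mu^*}{-\nu^*}}\operatorname{Ext}_R(M,k)\oplus\operatorname{Ext}_R(N,k)\xrightarrow{\ \iota^*\ }\operatorname{Ext}_R(M\times_VN,k)\to0.$$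
   Context: Setting. $\pi_S\colon S\to k$ and $\pi_T\colon T\to k$ are surjective ring homomorphisms onto a field $k$; $R = S\times_k T=\{(s,t)\in S\times T : \pi_S(s)=\pi_T(t)\}$. Put $\mathfrak p=\ker\pi_S$, $\mathfrak q=\ker\pi_T$. One of the following holds: (local case) $S$ and $T$ are commutative noetherian local rings with common residue field $k$ and maximal ideals $\mathfrak p$, $\mathfrak q$, and modules are finitely generated; or (graded case) $S$ and $T$ are non-negatively graded, connected, degree-wise finite (not necessarily commutative) $k$-algebras, $\mathfrak p=S_+$, $\mathfrak q=T_+$, and modules are graded, bounded below and degree-wise finite (and homomorphisms are homogeneous of degree $0$). All modules are left modules. The modules considered (including $k$ over $S$ and over $T$) are assumed to have minimal free resolutions in which each free module is finitely generated. $S$-modules, $T$-modules and $k$-modules are regarded as $R$-modules via the canonical surjections from $R$. $\operatorname{Ext}_R(k,k)$ is a graded $k$-algebra under the Yoneda product and $\operatorname{Ext}_R(X,k)=\bigoplus_i\operatorname{Ext}_R^i(X,k)$ is a graded left module over it. *)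

theory Defs
  imports "HOL-Algebra.Module" "HOL-Algebra.Ring_Divisibility" "HOL-Algebra.Chinese_Remainder"
    "HOL-Algebra.Generated_Groups"
begin

section \<open>Left modules over a not necessarily commutative ring\<close>

text \<open>The library locale \<^locale>\<open>module\<close> requires a commutative base ring. The records are the
  library's; their \<open>mult\<close> and \<open>one\<close> fields carry no meaning for modules.\<close>

locale left_module = R?: ring R + M?: abelian_group M 
  for R :: "('r, 'z) ring_scheme" (structure) and M :: "('r, 'm, 'w) module_scheme" (structure) +
  assumes smult_closed [simp, intro]:
      "\<lbrakk>a \<in> carrier R; x \<in> carrier M\<rbrakk> \<Longrightarrow> a \<odot>\<^bsub>M\<^esub> x \<in> carrier M"
    and smult_l_distr:
      "\<lbrakk>a \<in> carrier R; b \<in> carrier R; x \<in> carrier M\<rbrakk> \<Longrightarrow>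
        (a \<oplus> b) \<odot>\<^bsub>M\<^esub> x = a \<odot>\<^bsub>M\<^esub> x \<oplus>\<^bsub>M\<^esub> b \<odot>\<^bsub>M\<^esub> x"
    and smult_r_distr:
      "\<lbrakk>a \<in> carrier R; x \<in> carrier M; y \<in> carrier M\<rbrakk> \<Longrightarrow>
        a \<odot>\<^bsub>M\<^esub> (x \<oplus>\<^bsub>M\<^esub> y) = a \<odot>\<^bsub>M\<^esub> x \<oplus>\<^bsub>M\<^esub> a \<odot>\<^bsub>M\<^esub> y"
    and smult_assoc1:
      "\<lbrakk>a \<in> carrier R; b \<in> carrier R; x \<in> carrier M\<rbrakk> \<Longrightarrow>
        (a \<otimes> b) \<odot>\<^bsub>M\<^esub> x = a \<odot>\<^bsub>M\<^esub> (b \<odot>\<^bsub>M\<^esub> x)"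
    and smult_one [simp]:
      "x \<in> carrier M \<Longrightarrow> \<one> \<odot>\<^bsub>M\<^esub> x = x"

lemma left_module_iff_module: "cring R \<Longrightarrow> left_module R M \<longleftrightarrow> module R M"
  by (auto simp: left_module_def left_module_axioms_def module_def module_axioms_def
      cring.axioms(1))

definition mod_hom ::
  "('r, 'z) ring_scheme \<Rightarrow> ('r, 'm) module \<Rightarrow> ('r, 'n) module \<Rightarrow> ('m \<Rightarrow> 'n) set" where
  "mod_hom R M N = {f. f \<in> carrier M \<rightarrow> carrier N \<and>
     (\<forall>x\<in>carrier M. \<forall>y\<in>carrier M. f (x \<oplus>\<^bsub>M\<^esub> y) = f x \<oplus>\<^bsub>N\<^esub> f y) \<and>
     (\<forall>a\<in>carrier R. \<forall>x\<in>carrier M. f (a \<odot>\<^bsub>M\<^esub> x) = a \<odot>\<^bsub>N\<^esub> f x)}"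

definition short_exact ::
  "('r, 'z) ring_scheme \<Rightarrow> ('r, 'x) module \<Rightarrow> ('r, 'y) module \<Rightarrow> ('r, 'w) module \<Rightarrow>
   ('x \<Rightarrow> 'y) \<Rightarrow> ('y \<Rightarrow> 'w) \<Rightarrow> bool" where
  "short_exact R X Y Z f g \<longleftrightarrow>
     left_module R X \<and> left_module R Y \<and> left_module R Z \<and>
     f \<in> mod_hom R X Y \<and> g \<in> mod_hom R Y Z \<and>
     inj_on f (carrier X) \<and> f ` carrier X = {y \<in> carrier Y. g y = \<zero>\<^bsub>Z\<^esub>} \<and>
     g ` carrier Y = carrier Z"

definition self_module :: "'r ring \<Rightarrow> ('r, 'r) module" where
  "self_module R = \<lparr>carrier = carrier R, mult = mult R, one = one R, zero = zero R, add = add R,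
     smult = mult R\<rparr>"

definition restrict_scalars :: "('r \<Rightarrow> 's) \<Rightarrow> ('s, 'm) module \<Rightarrow> ('r, 'm) module" where
  "restrict_scalars \<phi> M = \<lparr>carrier = carrier M, mult = mult M, one = one M, zero = zero M,
     add = add M, smult = (\<lambda>r x. \<phi> r \<odot>\<^bsub>M\<^esub> x)\<rparr>"

definition module_prod :: "('r, 'm) module \<Rightarrow> ('r, 'n) module \<Rightarrow> ('r, 'm \<times> 'n) module" where
  "module_prod M N = \<lparr>carrier = carrier M \<times> carrier N, mult = undefined, one = undefined,
     zero = (\<zero>\<^bsub>M\<^esub>, \<zero>\<^bsub>N\<^esub>), add = (\<lambda>(x, y) (x', y'). (x \<oplus>\<^bsub>M\<^esub> x', y \<oplus>\<^bsub>N\<^esub> y')),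
     smult = (\<lambda>a (x, y). (a \<odot>\<^bsub>M\<^esub> x, a \<odot>\<^bsub>N\<^esub> y))\<rparr>"

definition lin_span :: "('r, 'z) ring_scheme \<Rightarrow> ('r, 'm) module \<Rightarrow> 'm set \<Rightarrow> 'm set" where
  "lin_span R M B = {finsum M (\<lambda>b. c b \<odot>\<^bsub>M\<^esub> b) A | A c.
     finite A \<and> A \<subseteq> B \<and> c \<in> A \<rightarrow> carrier R}"

definition fin_gen :: "('r, 'z) ring_scheme \<Rightarrow> ('r, 'm) module \<Rightarrow> bool" where
  "fin_gen R M \<longleftrightarrow> (\<exists>A. finite A \<and> A \<subseteq> carrier M \<and> lin_span R M A = carrier M)"

definition is_basis :: "('r, 'z) ring_scheme \<Rightarrow> ('r, 'm) module \<Rightarrow> 'm set \<Rightarrow> bool" where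
  "is_basis R M B \<longleftrightarrow> B \<subseteq> carrier M \<and> lin_span R M B = carrier M \<and>
     (\<forall>A c. finite A \<and> A \<subseteq> B \<and> c \<in> A \<rightarrow> carrier R \<and>
        finsum M (\<lambda>b. c b \<odot>\<^bsub>M\<^esub> b) A = \<zero>\<^bsub>M\<^esub> \<longrightarrow> (\<forall>b\<in>A. c b = \<zero>\<^bsub>R\<^esub>))"

definition free_module :: "('r, 'z) ring_scheme \<Rightarrow> ('r, 'm) module \<Rightarrow> bool" where
  "free_module R M \<longleftrightarrow> left_module R M \<and> (\<exists>B. is_basis R M B)"

definition ideal_smult :: "'r set \<Rightarrow> ('r, 'm) module \<Rightarrow> 'm set" where
  "ideal_smult I M = generate (add_monoid M) {a \<odot>\<^bsub>M\<^esub> x | a x. a \<in> I \<and> x \<in> carrier M}"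


section \<open>Gradings\<close>

text \<open>All gradings are internal and indexed by the integers.\<close>

definition grading :: "('a, 'z) ring_scheme \<Rightarrow> (int \<Rightarrow> 'a set) \<Rightarrow> bool" where
  "grading A g \<longleftrightarrow> abelian_group A \<and> (\<forall>i. additive_subgroup (g i) A) \<and>
     (\<forall>x\<in>carrier A. \<exists>!c. (\<forall>i. c i \<in> g i) \<and> finite {i. c i \<noteq> \<zero>\<^bsub>A\<^esub>} \<and>
        x = finsum A c {i. c i \<noteq> \<zero>\<^bsub>A\<^esub>})"

definition graded_ring :: "'a ring \<Rightarrow> (int \<Rightarrow> 'a set) \<Rightarrow> bool" where
  "graded_ring A g \<longleftrightarrow> ring A \<and> grading A g \<and> \<one>\<^bsub>A\<^esub> \<in> g 0 \<and>
     (\<forall>i j. \<forall>a\<in>g i. \<forall>b\<in>g j. a \<otimes>\<^bsub>A\<^esub> b \<in> g (i + j))"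

definition graded_module ::
  "'a ring \<Rightarrow> (int \<Rightarrow> 'a set) \<Rightarrow> ('a, 'm) module \<Rightarrow> (int \<Rightarrow> 'm set) \<Rightarrow> bool" where
  "graded_module A gA M gM \<longleftrightarrow> graded_ring A gA \<and> left_module A M \<and> grading M gM \<and>
     (\<forall>i j. \<forall>a\<in>gA i. \<forall>x\<in>gM j. a \<odot>\<^bsub>M\<^esub> x \<in> gM (i + j))"

definition deg_zero_map :: "(int \<Rightarrow> 'm set) \<Rightarrow> (int \<Rightarrow> 'n set) \<Rightarrow> ('m \<Rightarrow> 'n) \<Rightarrow> bool" where
  "deg_zero_map gM gN f \<longleftrightarrow> (\<forall>i. f ` gM i \<subseteq> gN i)"

definition concentrated :: "('a, 'z) ring_scheme \<Rightarrow> int \<Rightarrow> 'a set" where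
  "concentrated A i = (if i = 0 then carrier A else {\<zero>\<^bsub>A\<^esub>})"

definition graded_short_exact ::
  "'a ring \<Rightarrow> (int \<Rightarrow> 'a set) \<Rightarrow> ('a, 'x) module \<Rightarrow> (int \<Rightarrow> 'x set) \<Rightarrow>
   ('a, 'y) module \<Rightarrow> (int \<Rightarrow> 'y set) \<Rightarrow> ('a, 'w) module \<Rightarrow> (int \<Rightarrow> 'w set) \<Rightarrow>
   ('x \<Rightarrow> 'y) \<Rightarrow> ('y \<Rightarrow> 'w) \<Rightarrow> bool" where
  "graded_short_exact A gA X gX Y gY Z gZ f g \<longleftrightarrow>
     graded_module A gA X gX \<and> graded_module A gA Y gY \<and> graded_module A gA Z gZ \<and>
     deg_zero_map gX gY f \<and> deg_zero_map gY gZ g \<and> short_exact A X Y Z f g"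


section \<open>Free resolutions\<close>

text \<open>\<open>diff F n\<close> is the differential from degree \<open>Suc n\<close> to degree \<open>n\<close>.\<close>

record ('r, 'f, 'x) resolution =
  cmod :: "nat \<Rightarrow> ('r, 'f) module"
  diff :: "nat \<Rightarrow> 'f \<Rightarrow> 'f"
  aug :: "'f \<Rightarrow> 'x"

definition free_resolution ::
  "('r, 'z) ring_scheme \<Rightarrow> ('r, 'x) module \<Rightarrow> ('r, 'f, 'x) resolution \<Rightarrow> bool" where
  "free_resolution R X F \<longleftrightarrow>
     left_module R X \<and> (\<forall>n. free_module R (cmod F n)) \<and>
     (\<forall>n. diff F n \<in> mod_hom R (cmod F (Suc n)) (cmod F n)) \<and>
     (\<forall>n. diff F (Suc n) ` carrier (cmod F (Suc (Suc n))) =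
        {x \<in> carrier (cmod F (Suc n)). diff F n x = \<zero>\<^bsub>cmod F n\<^esub>}) \<and>
     aug F \<in> mod_hom R (cmod F 0) X \<and>
     diff F 0 ` carrier (cmod F (Suc 0)) = {x \<in> carrier (cmod F 0). aug F x = \<zero>\<^bsub>X\<^esub>} \<and>
     aug F ` carrier (cmod F 0) = carrier X"

definition minimal_fg ::
  "('r, 'z) ring_scheme \<Rightarrow> 'r set \<Rightarrow> ('r, 'f, 'x) resolution \<Rightarrow> bool" where
  "minimal_fg R I F \<longleftrightarrow> (\<forall>n. fin_gen R (cmod F n) \<and>
     diff F n ` carrier (cmod F (Suc n)) \<subseteq> ideal_smult I (cmod F n))"

text \<open>A finitely generated free module over a ring with carrier type \<open>'r\<close> is isomorphic to one
  with carrier type \<open>nat \<Rightarrow> 'r\<close>, so fixing this type in the following two existence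
  statements is no restriction.\<close>

definition has_minimal_fg_resolution ::
  "'r ring \<Rightarrow> 'r set \<Rightarrow> ('r, 'x) module \<Rightarrow> bool" where
  "has_minimal_fg_resolution R I X \<longleftrightarrow>
     (\<exists>F :: ('r, nat \<Rightarrow> 'r, 'x) resolution. free_resolution R X F \<and> minimal_fg R I F)"

definition has_graded_minimal_fg_resolution ::
  "'r ring \<Rightarrow> (int \<Rightarrow> 'r set) \<Rightarrow> 'r set \<Rightarrow> ('r, 'x) module \<Rightarrow> (int \<Rightarrow> 'x set) \<Rightarrow> bool" where
  "has_graded_minimal_fg_resolution R gR I X gX \<longleftrightarrow>
     (\<exists>(F :: ('r, nat \<Rightarrow> 'r, 'x) resolution) gF. free_resolution R X F \<and> minimal_fg R I F \<and>
        (\<forall>n. graded_module R gR (cmod F n) (gF n) \<and>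
             (\<exists>B. is_basis R (cmod F n) B \<and> B \<subseteq> (\<Union>i. gF n i)) \<and>
             deg_zero_map (gF (Suc n)) (gF n) (diff F n)) \<and>
        deg_zero_map (gF 0) gX (aug F))"


section \<open>Ext and the Yoneda product\<close>

text \<open>\<open>F\<close> is a free resolution of an \<open>R\<close>-module \<open>X\<close>, and the groups below
  compute \<open>Ext\<^sub>R(X, K)\<close> as the cohomology of \<open>Hom\<^sub>R(F, K)\<close>. Homomorphisms are made
  extensional so that they form a group; groups are written multiplicatively, as in the
  library.\<close>

definition hom_group ::
  "('r, 'z) ring_scheme \<Rightarrow> ('r, 'm) module \<Rightarrow> ('r, 'n) module \<Rightarrow> ('m \<Rightarrow> 'n) monoid" where
  "hom_group R M N = \<lparr>carrier = mod_hom R M N \<inter> extensional (carrier M),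
     mult = (\<lambda>f g. \<lambda>x\<in>carrier M. f x \<oplus>\<^bsub>N\<^esub> g x), one = (\<lambda>x\<in>carrier M. \<zero>\<^bsub>N\<^esub>)\<rparr>"

definition cocycles ::
  "('r, 'z) ring_scheme \<Rightarrow> ('r, 'k) module \<Rightarrow> ('r, 'f, 'x) resolution \<Rightarrow> nat \<Rightarrow> ('f \<Rightarrow> 'k) set" where
  "cocycles R K F n = {f \<in> carrier (hom_group R (cmod F n) K).
     \<forall>x\<in>carrier (cmod F (Suc n)). f (diff F n x) = \<zero>\<^bsub>K\<^esub>}"

fun coboundaries ::
  "('r, 'z) ring_scheme \<Rightarrow> ('r, 'k) module \<Rightarrow> ('r, 'f, 'x) resolution \<Rightarrow> nat \<Rightarrow> ('f \<Rightarrow> 'k) set" where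
  "coboundaries R K F 0 = {\<one>\<^bsub>hom_group R (cmod F 0) K\<^esub>}"
| "coboundaries R K F (Suc n) =
     (\<lambda>g. restrict (g \<circ> diff F n) (carrier (cmod F (Suc n)))) ` carrier (hom_group R (cmod F n) K)"

definition cocycle_group ::
  "('r, 'z) ring_scheme \<Rightarrow> ('r, 'k) module \<Rightarrow> ('r, 'f, 'x) resolution \<Rightarrow> nat \<Rightarrow> ('f \<Rightarrow> 'k) monoid" where
  "cocycle_group R K F n = (hom_group R (cmod F n) K)\<lparr>carrier := cocycles R K F n\<rparr>"

definition ext_group ::
  "('r, 'z) ring_scheme \<Rightarrow> ('r, 'k) module \<Rightarrow> ('r, 'f, 'x) resolution \<Rightarrow> nat \<Rightarrow> ('f \<Rightarrow> 'k) set monoid" where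
  "ext_group R K F n = cocycle_group R K F n Mod coboundaries R K F n"

definition ext_class ::
  "('r, 'z) ring_scheme \<Rightarrow> ('r, 'k) module \<Rightarrow> ('r, 'f, 'x) resolution \<Rightarrow> nat \<Rightarrow> ('f \<Rightarrow> 'k) \<Rightarrow>
   ('f \<Rightarrow> 'k) set" where
  "ext_class R K F n f =
     coboundaries R K F n #>\<^bsub>cocycle_group R K F n\<^esub> restrict f (carrier (cmod F n))"

text \<open>\<open>chain_lifts R F j G f\<close> consists of the families \<open>h m : F (j + m) \<rightarrow> G m\<close> that
  commute with the differentials and lift a homomorphism \<open>f\<close> from \<open>F j\<close> to the module resolved
  by \<open>G\<close>. No sign is introduced for odd \<open>j\<close>.\<close>

definition chain_lifts ::
  "('r, 'z) ring_scheme \<Rightarrow> ('r, 'f, 'x) resolution \<Rightarrow> nat \<Rightarrow> ('r, 'g, 'y) resolution \<Rightarrow> ('f \<Rightarrow> 'y) \<Rightarrow>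
   (nat \<Rightarrow> 'f \<Rightarrow> 'g) set" where
  "chain_lifts R F j G f = {h.
     (\<forall>m. h m \<in> mod_hom R (cmod F (j + m)) (cmod G m)) \<and>
     (\<forall>x\<in>carrier (cmod F j). aug G (h 0 x) = f x) \<and>
     (\<forall>m. \<forall>x\<in>carrier (cmod F (Suc (j + m))). diff G m (h (Suc m) x) = h m (diff F (j + m) x))}"

text \<open>The Yoneda (composition) product of a class \<open>a\<close> in \<open>Ext\<^sup>i(K, K)\<close>, computed by a resolution
  \<open>G\<close> of \<open>K\<close>, with a class \<open>x\<close> in \<open>Ext\<^sup>j(X, K)\<close>, computed by a resolution \<open>F\<close> of \<open>X\<close>. The set
  below is a singleton because the class does not depend on representatives and lifts.\<close>

definition yoneda ::
  "('r, 'z) ring_scheme \<Rightarrow> ('r, 'k) module \<Rightarrow> ('r, 'g, 'k) resolution \<Rightarrow> ('r, 'f, 'x) resolution \<Rightarrow>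
   nat \<Rightarrow> ('g \<Rightarrow> 'k) set \<Rightarrow> nat \<Rightarrow> ('f \<Rightarrow> 'k) set \<Rightarrow> ('f \<Rightarrow> 'k) set" where
  "yoneda R K G F i a j x =
     the_elem {ext_class R K F (j + i) (\<alpha> \<circ> h i) | \<alpha> f h.
       \<alpha> \<in> a \<and> f \<in> x \<and> h \<in> chain_lifts R F j G f}"

text \<open>The map \<open>Ext\<^sup>n(Y, K) \<rightarrow> Ext\<^sup>n(X, K)\<close> induced by \<open>\<phi> : X \<rightarrow> Y\<close>, for resolutions \<open>F\<close> of \<open>X\<close> and
  \<open>G\<close> of \<open>Y\<close>.\<close>

definition ext_map_deg ::
  "('r, 'z) ring_scheme \<Rightarrow> ('r, 'k) module \<Rightarrow> ('r, 'f, 'x) resolution \<Rightarrow> ('r, 'g, 'y) resolution \<Rightarrow>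
   ('x \<Rightarrow> 'y) \<Rightarrow> nat \<Rightarrow> ('g \<Rightarrow> 'k) set \<Rightarrow> ('f \<Rightarrow> 'k) set" where
  "ext_map_deg R K F G \<phi> n a =
     the_elem {ext_class R K F n (\<alpha> \<circ> h n) | \<alpha> h.
       \<alpha> \<in> a \<and> h \<in> chain_lifts R F 0 G (\<phi> \<circ> aug F)}"

text \<open>The direct sum of all \<open>Ext\<^sup>n(X, K)\<close>, as finitely supported families.\<close>

definition ext_carrier ::
  "('r, 'z) ring_scheme \<Rightarrow> ('r, 'k) module \<Rightarrow> ('r, 'f, 'x) resolution \<Rightarrow> (nat \<Rightarrow> ('f \<Rightarrow> 'k) set) set" where
  "ext_carrier R K F = {x. (\<forall>n. x n \<in> carrier (ext_group R K F n)) \<and>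
     finite {n. x n \<noteq> \<one>\<^bsub>ext_group R K F n\<^esub>}}"

definition ext_prod ::
  "('r, 'z) ring_scheme \<Rightarrow> ('r, 'k) module \<Rightarrow> ('r, 'g, 'k) resolution \<Rightarrow> ('r, 'f, 'x) resolution \<Rightarrow>
   (nat \<Rightarrow> ('g \<Rightarrow> 'k) set) \<Rightarrow> (nat \<Rightarrow> ('f \<Rightarrow> 'k) set) \<Rightarrow> nat \<Rightarrow> ('f \<Rightarrow> 'k) set" where
  "ext_prod R K G F a x = (\<lambda>n. finprod (ext_group R K F n)
     (\<lambda>i. yoneda R K G F i (a i) (n - i) (x (n - i))) {..n})"

definition ext_algebra ::
  "('r, 'z) ring_scheme \<Rightarrow> ('r, 'k) module \<Rightarrow> ('r, 'g, 'k) resolution \<Rightarrow>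
   (nat \<Rightarrow> ('g \<Rightarrow> 'k) set) ring" where
  "ext_algebra R K G = \<lparr>carrier = ext_carrier R K G,
     mult = ext_prod R K G G,
     one = (\<lambda>n. if n = 0 then ext_class R K G 0 (aug G) else \<one>\<^bsub>ext_group R K G n\<^esub>),
     zero = (\<lambda>n. \<one>\<^bsub>ext_group R K G n\<^esub>),
     add = (\<lambda>x y n. x n \<otimes>\<^bsub>ext_group R K G n\<^esub> y n)\<rparr>"

definition ext_module ::
  "('r, 'z) ring_scheme \<Rightarrow> ('r, 'k) module \<Rightarrow> ('r, 'g, 'k) resolution \<Rightarrow> ('r, 'f, 'x) resolution \<Rightarrow>
   (nat \<Rightarrow> ('g \<Rightarrow> 'k) set, nat \<Rightarrow> ('f \<Rightarrow> 'k) set) module" where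
  "ext_module R K G F = \<lparr>carrier = ext_carrier R K F, mult = undefined, one = undefined,
     zero = (\<lambda>n. \<one>\<^bsub>ext_group R K F n\<^esub>),
     add = (\<lambda>x y n. x n \<otimes>\<^bsub>ext_group R K F n\<^esub> y n),
     smult = ext_prod R K G F\<rparr>"

definition ext_grading ::
  "('r, 'z) ring_scheme \<Rightarrow> ('r, 'k) module \<Rightarrow> ('r, 'f, 'x) resolution \<Rightarrow>
   int \<Rightarrow> (nat \<Rightarrow> ('f \<Rightarrow> 'k) set) set" where
  "ext_grading R K F i =
     {x \<in> ext_carrier R K F. \<forall>n. int n \<noteq> i \<longrightarrow> x n = \<one>\<^bsub>ext_group R K F n\<^esub>}"

definition ext_map ::
  "('r, 'z) ring_scheme \<Rightarrow> ('r, 'k) module \<Rightarrow> ('r, 'f, 'x) resolution \<Rightarrow> ('r, 'g, 'y) resolution \<Rightarrow>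
   ('x \<Rightarrow> 'y) \<Rightarrow> (nat \<Rightarrow> ('g \<Rightarrow> 'k) set) \<Rightarrow> nat \<Rightarrow> ('f \<Rightarrow> 'k) set" where
  "ext_map R K F G \<phi> x = (\<lambda>n. ext_map_deg R K F G \<phi> n (x n))"


section \<open>Fiber products\<close>

definition fiber_ring :: "'s ring \<Rightarrow> 't ring \<Rightarrow> ('s \<Rightarrow> 'k) \<Rightarrow> ('t \<Rightarrow> 'k) \<Rightarrow> ('s \<times> 't) ring" where
  "fiber_ring S T \<pi>S \<pi>T =
     (RDirProd S T)\<lparr>carrier := {(s, t) \<in> carrier S \<times> carrier T. \<pi>S s = \<pi>T t}\<rparr>"

text \<open>Here \<open>M\<close> and \<open>N\<close> are already modules over the fiber product ring.\<close>

definition fiber_module ::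
  "('r, 'm) module \<Rightarrow> ('r, 'n) module \<Rightarrow> ('m \<Rightarrow> 'v) \<Rightarrow> ('n \<Rightarrow> 'v) \<Rightarrow> ('r, 'm \<times> 'n) module" where
  "fiber_module M N \<mu> \<nu> =
     (module_prod M N)\<lparr>carrier := {(m, n) \<in> carrier M \<times> carrier N. \<mu> m = \<nu> n}\<rparr>"

definition noetherian_local :: "'s ring \<Rightarrow> 's set \<Rightarrow> bool" where
  "noetherian_local S p \<longleftrightarrow> cring S \<and> noetherian_ring S \<and>
     maximalideal p S \<and> (\<forall>I. maximalideal I S \<longrightarrow> I = p)"

definition local_case ::
  "'k ring \<Rightarrow> 's ring \<Rightarrow> ('s \<Rightarrow> 'k) \<Rightarrow> 't ring \<Rightarrow> ('t \<Rightarrow> 'k) \<Rightarrow>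
   ('s, 'm) module \<Rightarrow> ('t, 'n) module \<Rightarrow> ('k, 'v) module \<Rightarrow> bool" where
  "local_case K S \<pi>S T \<pi>T M N V \<longleftrightarrow>
     noetherian_local S (a_kernel S K \<pi>S) \<and> noetherian_local T (a_kernel T K \<pi>T) \<and>
     fin_gen S M \<and> fin_gen T N \<and> fin_gen K V \<and>
     has_minimal_fg_resolution S (a_kernel S K \<pi>S) M \<and>
     has_minimal_fg_resolution T (a_kernel T K \<pi>T) N \<and>
     has_minimal_fg_resolution K {\<zero>\<^bsub>K\<^esub>} V \<and>
     has_minimal_fg_resolution S (a_kernel S K \<pi>S) (restrict_scalars \<pi>S (self_module K)) \<and>
     has_minimal_fg_resolution T (a_kernel T K \<pi>T) (restrict_scalars \<pi>T (self_module K))"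

text \<open>\<open>\<sigma>\<close> is the structure map of a \<open>K\<close>-algebra \<open>S\<close>.\<close>

definition degreewise_finite ::
  "'k ring \<Rightarrow> ('k \<Rightarrow> 's) \<Rightarrow> ('s, 'm) module \<Rightarrow> (int \<Rightarrow> 'm set) \<Rightarrow> bool" where
  "degreewise_finite K \<sigma> M gM \<longleftrightarrow>
     (\<forall>i. \<exists>A. finite A \<and> A \<subseteq> gM i \<and> lin_span K (restrict_scalars \<sigma> M) A = gM i)"

definition bounded_below :: "('s, 'm) module \<Rightarrow> (int \<Rightarrow> 'm set) \<Rightarrow> bool" where
  "bounded_below M gM \<longleftrightarrow> (\<exists>b. \<forall>i<b. gM i = {\<zero>\<^bsub>M\<^esub>})"

definition connected_algebra ::
  "'k ring \<Rightarrow> 's ring \<Rightarrow> ('k \<Rightarrow> 's) \<Rightarrow> (int \<Rightarrow> 's set) \<Rightarrow> bool" where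
  "connected_algebra K S \<sigma> gS \<longleftrightarrow> graded_ring S gS \<and> (\<forall>i<0. gS i = {\<zero>\<^bsub>S\<^esub>}) \<and>
     \<sigma> \<in> ring_hom K S \<and> (\<forall>c\<in>carrier K. \<forall>s\<in>carrier S. \<sigma> c \<otimes>\<^bsub>S\<^esub> s = s \<otimes>\<^bsub>S\<^esub> \<sigma> c) \<and>
     bij_betw \<sigma> (carrier K) (gS 0) \<and> degreewise_finite K \<sigma> (self_module S) gS"

definition augmentation ::
  "'k ring \<Rightarrow> 's ring \<Rightarrow> ('k \<Rightarrow> 's) \<Rightarrow> (int \<Rightarrow> 's set) \<Rightarrow> ('s \<Rightarrow> 'k) \<Rightarrow> bool" where
  "augmentation K S \<sigma> gS \<pi> \<longleftrightarrow> (\<forall>c\<in>carrier K. \<pi> (\<sigma> c) = c) \<and>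
     a_kernel S K \<pi> = generate (add_monoid S) (\<Union>i\<in>{0<..}. gS i)"

definition graded_case ::
  "'k ring \<Rightarrow> 's ring \<Rightarrow> ('s \<Rightarrow> 'k) \<Rightarrow> 't ring \<Rightarrow> ('t \<Rightarrow> 'k) \<Rightarrow>
   ('s, 'm) module \<Rightarrow> ('t, 'n) module \<Rightarrow> ('k, 'v) module \<Rightarrow> ('m \<Rightarrow> 'v) \<Rightarrow> ('n \<Rightarrow> 'v) \<Rightarrow>
   ('k \<Rightarrow> 's) \<Rightarrow> ('k \<Rightarrow> 't) \<Rightarrow> (int \<Rightarrow> 's set) \<Rightarrow> (int \<Rightarrow> 't set) \<Rightarrow>
   (int \<Rightarrow> 'm set) \<Rightarrow> (int \<Rightarrow> 'n set) \<Rightarrow> (int \<Rightarrow> 'v set) \<Rightarrow> bool" where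
  "graded_case K S \<pi>S T \<pi>T M N V \<mu> \<nu> \<sigma>S \<sigma>T gS gT gM gN gV \<longleftrightarrow>
     connected_algebra K S \<sigma>S gS \<and> augmentation K S \<sigma>S gS \<pi>S \<and>
     connected_algebra K T \<sigma>T gT \<and> augmentation K T \<sigma>T gT \<pi>T \<and>
     graded_module S gS M gM \<and> bounded_below M gM \<and> degreewise_finite K \<sigma>S M gM \<and>
     graded_module T gT N gN \<and> bounded_below N gN \<and> degreewise_finite K \<sigma>T N gN \<and>
     graded_module K (concentrated K) V gV \<and> bounded_below V gV \<and>
     degreewise_finite K (\<lambda>c. c) V gV \<and>
     deg_zero_map gM gV \<mu> \<and> deg_zero_map gN gV \<nu> \<and>
     has_graded_minimal_fg_resolution S gS (a_kernel S K \<pi>S) M gM \<and>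
     has_graded_minimal_fg_resolution T gT (a_kernel T K \<pi>T) N gN \<and>
     has_graded_minimal_fg_resolution K (concentrated K) {\<zero>\<^bsub>K\<^esub>} V gV \<and>
     has_graded_minimal_fg_resolution S gS (a_kernel S K \<pi>S)
       (restrict_scalars \<pi>S (self_module K)) (concentrated K) \<and>
     has_graded_minimal_fg_resolution T gT (a_kernel T K \<pi>T)
       (restrict_scalars \<pi>T (self_module K)) (concentrated K)"

end

(* The crux is that a class z in Ext^j_R(V,k) restricting to 0 in Ext^j_R(M,k) and in Ext^j_R(N,k) is 0.
   Let FV, FM, FN be free resolutions, h^M : FM -> FV and h^N : FN -> FV lifts of mu and nu. Choose
   u_b in M and v_b in N over the elements b of a basis of V, and lift the coordinates of V to R-linear
   maps t_b : FV_0 -> S. For a boundary y in FV_0 the pair (t_b(y), 0) lies in R; it acts on M as t_b(y)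
   and annihilates N and k. Since x |-> sum_b t_b(x) u_b lifts the augmentation FV_0 -> V to M, and
   sum_b (t_b(y), 0) v_b = 0 in N for boundaries y, one obtains chain maps a^M : FV -> FM and
   a^N : FV -> FN in degrees >= 1, whose lowest terms contain the corrections sum_b (t_b(y), 0) e_b.
   They can be compared by homotopy: h^M a^M - h^N a^N is the identity of FV in degrees >= 1, up to
   terms that no cocycle with values in k can see. So z is the difference of the pullbacks along a^M and
   a^N of its restrictions to M and N, hence 0. Degree 0 is immediate, as mu is surjective.
   The long exact sequence of Ext(-,k) therefore breaks up into short exact sequences. It is obtained by
   replacing FV by the mapping cone of a lift of the inclusion of the pullback into M x N. *)
theory Submission
  imports Defs
begin

section \<open>Left modules and their homomorphisms\<close>

text \<open>The obstacle is that \<open>\<mu>\<close> need not split: a map from \<open>FV 0\<close>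
  to \<open>M\<close> over \<open>V\<close> does not kill boundaries, so the identity of
  \<open>V\<close> cannot be factored through \<open>M\<close> alone. On a boundary such a map is a
  combination with coefficients in the kernel of \<open>\<pi>S\<close>. That kernel, paired with 0,
  is an ideal of \<open>R\<close> which acts on \<open>M\<close> but annihilates \<open>N\<close>
  and \<open>k\<close>. Subtracting a correction with these coefficients repairs the lift on the
  side of \<open>M\<close>; on the side of \<open>N\<close> the same combination is zero, so there
  the correction alone can be lifted. Since u_b and v_b have the same image in \<open>V\<close>, the
  two corrections become homotopic in \<open>FV\<close> and cancel. The comparison maps exist only
  from \<open>FV 1\<close> on, so they are treated as lifts into resolutions of first syzygies. All
  Ext groups refer to arbitrary given resolutions, hence every identification, such as that of the
  cone with \<open>FV\<close>, is made by lifts of identity maps.\<close>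

context abelian_group begin

lemma minus_eq_iff_eq_add:
  "\<lbrakk>x \<in> carrier G; y \<in> carrier G; z \<in> carrier G\<rbrakk> \<Longrightarrow> x \<ominus> y = z \<longleftrightarrow> x = z \<oplus> y"
  by (auto simp: minus_eq a_assoc l_neg r_neg)

lemma minus_eq_zero_iff: "\<lbrakk>x \<in> carrier G; y \<in> carrier G\<rbrakk> \<Longrightarrow> x \<ominus> y = \<zero> \<longleftrightarrow> x = y"
  by (simp add: minus_eq_iff_eq_add)

end

context left_module begin

lemma smult_r_null [simp]: "a \<in> carrier R \<Longrightarrow> a \<odot>\<^bsub>M\<^esub> \<zero>\<^bsub>M\<^esub> = \<zero>\<^bsub>M\<^esub>"
proof -
  assume a: "a \<in> carrier R"
  have "a \<odot>\<^bsub>M\<^esub> \<zero>\<^bsub>M\<^esub> = a \<odot>\<^bsub>M\<^esub> \<zero>\<^bsub>M\<^esub> \<oplus>\<^bsub>M\<^esub> a \<odot>\<^bsub>M\<^esub> \<zero>\<^bsub>M\<^esub>"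
    using smult_r_distr[OF a M.zero_closed M.zero_closed] by simp
  then show ?thesis using a by (simp add: M.add.l_cancel_one')
qed

lemma smult_l_null [simp]: "x \<in> carrier M \<Longrightarrow> \<zero> \<odot>\<^bsub>M\<^esub> x = \<zero>\<^bsub>M\<^esub>"
proof -
  assume x: "x \<in> carrier M"
  have "\<zero> \<odot>\<^bsub>M\<^esub> x = \<zero> \<odot>\<^bsub>M\<^esub> x \<oplus>\<^bsub>M\<^esub> \<zero> \<odot>\<^bsub>M\<^esub> x"
    using smult_l_distr[OF R.zero_closed R.zero_closed x] by simp
  then show ?thesis using x by (simp add: M.add.l_cancel_one')
qed

lemma smult_l_minus: "\<lbrakk>a \<in> carrier R; x \<in> carrier M\<rbrakk> \<Longrightarrow> (\<ominus> a) \<odot>\<^bsub>M\<^esub> x = \<ominus>\<^bsub>M\<^esub> (a \<odot>\<^bsub>M\<^esub> x)"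
  using smult_l_distr[of "\<ominus> a" a x] by (simp add: R.l_neg M.minus_equality)

lemma smult_r_minus: "\<lbrakk>a \<in> carrier R; x \<in> carrier M\<rbrakk> \<Longrightarrow> a \<odot>\<^bsub>M\<^esub> (\<ominus>\<^bsub>M\<^esub> x) = \<ominus>\<^bsub>M\<^esub> (a \<odot>\<^bsub>M\<^esub> x)"
  using smult_r_distr[of a "\<ominus>\<^bsub>M\<^esub> x" x] by (simp add: M.l_neg M.minus_equality)

lemma finsum_smult:
  "\<lbrakk>finite A; a \<in> carrier R; e \<in> A \<rightarrow> carrier M\<rbrakk> \<Longrightarrow>
    a \<odot>\<^bsub>M\<^esub> finsum M e A = finsum M (\<lambda>b. a \<odot>\<^bsub>M\<^esub> e b) A"
proof (induction A rule: finite_induct)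
  case (insert b A)
  then have "e \<in> A \<rightarrow> carrier M" "e b \<in> carrier M" by auto
  with insert show ?case
    by (subst M.finsum_insert, auto simp: smult_r_distr)
qed simp

text \<open>Two finite combinations with different supports are brought to the common support
  \<open>A \<union> A'\<close> by padding the coefficients with zero. This is what closes spans, and
  graphs of maps given by combinations, under addition.\<close>

lemma finsum_smult_Un:
  assumes "finite A" "finite A'" "c \<in> A \<rightarrow> carrier R" "c' \<in> A' \<rightarrow> carrier R"
    and "e \<in> A \<union> A' \<rightarrow> carrier M"
  shows "finsum M (\<lambda>b. c b \<odot>\<^bsub>M\<^esub> e b) A \<oplus>\<^bsub>M\<^esub> finsum M (\<lambda>b. c' b \<odot>\<^bsub>M\<^esub> e b) A' =
    finsum M (\<lambda>b. ((if b \<in> A then c b else \<zero>) \<oplus> (if b \<in> A' then c' b else \<zero>)) \<odot>\<^bsub>M\<^esub> e b) (A \<union> A')"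
proof -
  have e: "e b \<in> carrier M" if "b \<in> A \<union> A'" for b using assms that by auto
  have c: "c b \<in> carrier R" if "b \<in> A" for b using assms that by auto
  have c': "c' b \<in> carrier R" if "b \<in> A'" for b using assms that by auto
  have *: "finsum M (\<lambda>b. c b \<odot>\<^bsub>M\<^esub> e b) A = finsum M (\<lambda>b. (if b \<in> A then c b else \<zero>) \<odot>\<^bsub>M\<^esub> e b) (A \<union> A')"
    by (rule M.add.finprod_mono_neutral_cong_left) (use assms(1,2) e c c' in auto)
  have **: "finsum M (\<lambda>b. c' b \<odot>\<^bsub>M\<^esub> e b) A' = finsum M (\<lambda>b. (if b \<in> A' then c' b else \<zero>) \<odot>\<^bsub>M\<^esub> e b) (A \<union> A')"
    by (rule M.add.finprod_mono_neutral_cong_left) (use assms(1,2) e c c' in auto)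
  show ?thesis unfolding * **
    by (rule trans[OF M.finsum_addf[symmetric] M.finsum_cong'])
      (use assms(1,2) e c c' in \<open>auto simp: smult_l_distr\<close>)
qed

end

lemma mod_homI:
  assumes "\<And>x. x \<in> carrier M \<Longrightarrow> f x \<in> carrier N"
    and "\<And>x y. \<lbrakk>x \<in> carrier M; y \<in> carrier M\<rbrakk> \<Longrightarrow> f (x \<oplus>\<^bsub>M\<^esub> y) = f x \<oplus>\<^bsub>N\<^esub> f y"
    and "\<And>a x. \<lbrakk>a \<in> carrier R; x \<in> carrier M\<rbrakk> \<Longrightarrow> f (a \<odot>\<^bsub>M\<^esub> x) = a \<odot>\<^bsub>N\<^esub> f x"
  shows "f \<in> mod_hom R M N"
  using assms by (auto simp: mod_hom_def)

lemma mod_hom_closed: "\<lbrakk>f \<in> mod_hom R M N; x \<in> carrier M\<rbrakk> \<Longrightarrow> f x \<in> carrier N"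
  by (auto simp: mod_hom_def)

lemma mod_hom_add:
  "\<lbrakk>f \<in> mod_hom R M N; x \<in> carrier M; y \<in> carrier M\<rbrakk> \<Longrightarrow> f (x \<oplus>\<^bsub>M\<^esub> y) = f x \<oplus>\<^bsub>N\<^esub> f y"
  by (auto simp: mod_hom_def)

lemma mod_hom_smult:
  "\<lbrakk>f \<in> mod_hom R M N; a \<in> carrier R; x \<in> carrier M\<rbrakk> \<Longrightarrow> f (a \<odot>\<^bsub>M\<^esub> x) = a \<odot>\<^bsub>N\<^esub> f x"
  by (auto simp: mod_hom_def)

text \<open>Only the values on the carrier matter for \<open>mod_hom\<close>; that \<open>M\<close>
  is a module guarantees that the sums and multiples occurring in the conditions stay in the
  carrier.\<close>

lemma mod_hom_cong:
  assumes "f \<in> mod_hom R M N" "\<And>x. x \<in> carrier M \<Longrightarrow> f x = g x" "left_module R M"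
  shows "g \<in> mod_hom R M N"
proof -
  interpret left_module R M by fact
  show ?thesis
    by (rule mod_homI)
      (use assms(2)[symmetric] in \<open>auto simp: mod_hom_closed[OF assms(1)] mod_hom_add[OF assms(1)] mod_hom_smult[OF assms(1)]\<close>)
qed

lemma mod_hom_comp:
  "\<lbrakk>f \<in> mod_hom R M N; g \<in> mod_hom R N L\<rbrakk> \<Longrightarrow> g \<circ> f \<in> mod_hom R M L"
  by (rule mod_homI) (simp_all add: mod_hom_closed[of f R M N] mod_hom_closed[of g R N L]
      mod_hom_add[of f R M N] mod_hom_add[of g R N L] mod_hom_smult[of f R M N] mod_hom_smult[of g R N L])

lemma mod_hom_id: "(\<lambda>x. x) \<in> mod_hom R M M"
  by (auto simp: mod_hom_def)

lemma mod_hom_sum: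
  assumes f: "f \<in> mod_hom R M N" and g: "g \<in> mod_hom R M N" and "left_module R N"
  shows "(\<lambda>x. f x \<oplus>\<^bsub>N\<^esub> g x) \<in> mod_hom R M N"
proof -
  interpret left_module R N by fact
  show ?thesis
    by (rule mod_homI)
      (auto simp: mod_hom_closed[OF f] mod_hom_add[OF f] mod_hom_smult[OF f]
        mod_hom_closed[OF g] mod_hom_add[OF g] mod_hom_smult[OF g] smult_r_distr M.a_ac)
qed

lemma mod_hom_zero_map: "left_module R N \<Longrightarrow> (\<lambda>x. \<zero>\<^bsub>N\<^esub>) \<in> mod_hom R M N"
  by (rule mod_homI) (auto simp: left_module.smult_r_null abelian_group.axioms abelian_monoid.l_zero
      abelian_monoid.zero_closed left_module_def)

lemma mod_hom_uminus:
  assumes f: "f \<in> mod_hom R M N" and "left_module R N"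
  shows "(\<lambda>x. \<ominus>\<^bsub>N\<^esub> f x) \<in> mod_hom R M N"
proof -
  interpret left_module R N by fact
  show ?thesis
    by (rule mod_homI)
      (auto simp: mod_hom_closed[OF f] mod_hom_add[OF f] mod_hom_smult[OF f] smult_r_minus
        M.minus_add)
qed

lemma mod_hom_minus:
  assumes "f \<in> mod_hom R M N" "g \<in> mod_hom R M N" "left_module R N"
  shows "(\<lambda>x. f x \<ominus>\<^bsub>N\<^esub> g x) \<in> mod_hom R M N"
  unfolding a_minus_def by (intro mod_hom_sum mod_hom_uminus assms)

lemma mod_hom_zero:
  assumes f: "f \<in> mod_hom R M N" and "left_module R M" and "left_module R N"
  shows "f \<zero>\<^bsub>M\<^esub> = \<zero>\<^bsub>N\<^esub>"
proof -
  interpret M: left_module R M by fact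
  interpret N: left_module R N by fact
  have "f \<zero>\<^bsub>M\<^esub> = f \<zero>\<^bsub>M\<^esub> \<oplus>\<^bsub>N\<^esub> f \<zero>\<^bsub>M\<^esub>"
    using mod_hom_add[OF f M.M.zero_closed M.M.zero_closed] by simp
  then show ?thesis using mod_hom_closed[OF f M.M.zero_closed] by (simp add: N.M.add.l_cancel_one')
qed

lemma mod_hom_a_inv:
  assumes f: "f \<in> mod_hom R M N" and "left_module R M" and "left_module R N" and x: "x \<in> carrier M"
  shows "f (\<ominus>\<^bsub>M\<^esub> x) = \<ominus>\<^bsub>N\<^esub> f x"
proof -
  interpret M: left_module R M by fact
  interpret N: left_module R N by fact
  have "f (\<ominus>\<^bsub>M\<^esub> x) \<oplus>\<^bsub>N\<^esub> f x = \<zero>\<^bsub>N\<^esub>"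
    using mod_hom_add[OF f M.M.a_inv_closed[OF x] x] mod_hom_zero[OF assms(1-3)] x
    by (simp add: M.M.l_neg)
  then show ?thesis using mod_hom_closed[OF f] x by (simp add: N.M.minus_equality)
qed

lemma mod_hom_a_minus:
  assumes f: "f \<in> mod_hom R M N" and "left_module R M" and "left_module R N"
    and x: "x \<in> carrier M" and y: "y \<in> carrier M"
  shows "f (x \<ominus>\<^bsub>M\<^esub> y) = f x \<ominus>\<^bsub>N\<^esub> f y"
proof -
  interpret M: left_module R M by fact
  show ?thesis
    unfolding a_minus_def using mod_hom_add[OF f x M.M.a_inv_closed[OF y]] mod_hom_a_inv[OF assms(1-3) y]
    by simp
qed

lemma mod_hom_finsum:
  assumes f: "f \<in> mod_hom R M N" and "left_module R M" and "left_module R N"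
  shows "\<lbrakk>finite A; e \<in> A \<rightarrow> carrier M\<rbrakk> \<Longrightarrow> f (finsum M e A) = finsum N (\<lambda>b. f (e b)) A"
proof (induction A rule: finite_induct)
  interpret M: left_module R M by fact
  interpret N: left_module R N by fact
  {
    case empty
    then show ?case by (simp add: mod_hom_zero[OF assms])
  next
    case (insert b A)
    then have "e \<in> A \<rightarrow> carrier M" "e b \<in> carrier M" by auto
    moreover from this have "(\<lambda>b. f (e b)) \<in> A \<rightarrow> carrier N" "f (e b) \<in> carrier N"
      using mod_hom_closed[OF f] by auto
    ultimately show ?case using insert
      by (simp add: M.M.finsum_insert N.M.finsum_insert mod_hom_add[OF f])
  }
qed

lemma mod_hom_finsum_maps:
  assumes M: "left_module R M" and N: "left_module R N" and "finite B" and f: "\<And>b. b \<in> B \<Longrightarrow> f b \<in> mod_hom R M N"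
  shows "(\<lambda>x. finsum N (\<lambda>b. f b x) B) \<in> mod_hom R M N"
  using assms(3) f
proof (induction B rule: finite_induct)
  interpret N: left_module R N by fact
  {
    case empty
    then show ?case by (simp add: mod_hom_zero_map N)
  next
    case (insert b B)
    have hom: "(\<lambda>x. f b x \<oplus>\<^bsub>N\<^esub> finsum N (\<lambda>b. f b x) B) \<in> mod_hom R M N"
      by (rule mod_hom_sum[OF _ _ N]) (use insert in auto)
    have "finsum N (\<lambda>b. f b x) (insert b B) = f b x \<oplus>\<^bsub>N\<^esub> finsum N (\<lambda>b. f b x) B"
      if "x \<in> carrier M" for x
      using insert mod_hom_closed[OF insert.prems that] by (intro N.M.finsum_insert) auto
    then show ?case by (intro mod_hom_cong[OF hom _ M]) (rule sym)
  }
qed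

text \<open>\<open>R\<close> need not be commutative: the coefficients stand on the left, so left
  linearity of each \<open>c b\<close> is exactly what makes the combination linear in
  \<open>x\<close>.\<close>

lemma mod_hom_finsum_smult:
  assumes M: "left_module R M" and N: "left_module R N" and B: "finite B" and e: "\<And>b. b \<in> B \<Longrightarrow> e b \<in> carrier N"
    and c: "\<And>b x. \<lbrakk>b \<in> B; x \<in> carrier M\<rbrakk> \<Longrightarrow> c b x \<in> carrier R"
      "\<And>b x y. \<lbrakk>b \<in> B; x \<in> carrier M; y \<in> carrier M\<rbrakk> \<Longrightarrow> c b (x \<oplus>\<^bsub>M\<^esub> y) = c b x \<oplus>\<^bsub>R\<^esub> c b y"
      "\<And>b a x. \<lbrakk>b \<in> B; a \<in> carrier R; x \<in> carrier M\<rbrakk> \<Longrightarrow> c b (a \<odot>\<^bsub>M\<^esub> x) = a \<otimes>\<^bsub>R\<^esub> c b x"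
  shows "(\<lambda>x. finsum N (\<lambda>b. c b x \<odot>\<^bsub>N\<^esub> e b) B) \<in> mod_hom R M N"
proof (rule mod_hom_finsum_maps[OF M N B])
  interpret N: left_module R N by (rule N)
  show "(\<lambda>x. c b x \<odot>\<^bsub>N\<^esub> e b) \<in> mod_hom R M N" if b: "b \<in> B" for b
    by (rule mod_homI) (simp_all add: b c e N.smult_l_distr N.smult_assoc1)
qed

section \<open>Free modules\<close>

lemma lin_spanE:
  assumes "x \<in> lin_span R M B"
  obtains A c where "finite A" "A \<subseteq> B" "c \<in> A \<rightarrow> carrier R" "x = finsum M (\<lambda>b. c b \<odot>\<^bsub>M\<^esub> b) A"
  using assms by (auto simp: lin_span_def)

lemma is_basis_independent:
  assumes "is_basis R M B" "finite A" "A \<subseteq> B" "c \<in> A \<rightarrow> carrier R"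
    "finsum M (\<lambda>b. c b \<odot>\<^bsub>M\<^esub> b) A = \<zero>\<^bsub>M\<^esub>" "b \<in> A"
  shows "c b = \<zero>\<^bsub>R\<^esub>"
proof -
  have "\<forall>A c. finite A \<and> A \<subseteq> B \<and> c \<in> A \<rightarrow> carrier R \<and>
      finsum M (\<lambda>b. c b \<odot>\<^bsub>M\<^esub> b) A = \<zero>\<^bsub>M\<^esub> \<longrightarrow> (\<forall>b\<in>A. c b = \<zero>\<^bsub>R\<^esub>)"
    using assms(1) by (simp add: is_basis_def)
  from this[rule_format, of A c b] show ?thesis using assms by simp
qed

lemma lin_span_closed:
  assumes "left_module R M" "B \<subseteq> carrier M"
  shows "lin_span R M B \<subseteq> carrier M"
proof -
  interpret left_module R M by fact
  show ?thesis using assms(2) by (auto simp: lin_span_def subset_iff Pi_iff intro!: M.finsum_closed smult_closed)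
qed

lemma lin_span_add:
  assumes "left_module R M" "B \<subseteq> carrier M" and "x \<in> lin_span R M B" "y \<in> lin_span R M B"
  shows "x \<oplus>\<^bsub>M\<^esub> y \<in> lin_span R M B"
proof -
  interpret left_module R M by fact
  obtain A c where x: "finite A" "A \<subseteq> B" "c \<in> A \<rightarrow> carrier R" "x = finsum M (\<lambda>b. c b \<odot>\<^bsub>M\<^esub> b) A"
    using assms(3) by (auto simp: lin_span_def)
  obtain A' c' where y: "finite A'" "A' \<subseteq> B" "c' \<in> A' \<rightarrow> carrier R" "y = finsum M (\<lambda>b. c' b \<odot>\<^bsub>M\<^esub> b) A'"
    using assms(4) by (auto simp: lin_span_def)
  have "x \<oplus>\<^bsub>M\<^esub> y = finsum M (\<lambda>b. ((if b \<in> A then c b else \<zero>\<^bsub>R\<^esub>) \<oplus>\<^bsub>R\<^esub> (if b \<in> A' then c' b else \<zero>\<^bsub>R\<^esub>)) \<odot>\<^bsub>M\<^esub> b) (A \<union> A')"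
    unfolding x(4) y(4) using x y assms(2) by (intro finsum_smult_Un) auto
  moreover have "(\<lambda>b. (if b \<in> A then c b else \<zero>\<^bsub>R\<^esub>) \<oplus>\<^bsub>R\<^esub> (if b \<in> A' then c' b else \<zero>\<^bsub>R\<^esub>)) \<in> A \<union> A' \<rightarrow> carrier R"
    using x(3) y(3) by (auto simp: Pi_iff)
  ultimately show ?thesis unfolding lin_span_def using x y
    by (intro CollectI exI conjI) (assumption | simp)+
qed

text \<open>Projectivity of free modules. The basis may be infinite, and an element is given by
  combinations over varying finite supports, so the lift is built as a relation on combinations
  whose single-valuedness is derived from independence.\<close>

lemma free_module_lift:
  assumes L: "free_module R L" and X: "left_module R X" and Y: "left_module R Y"
    and g: "g \<in> mod_hom R X Y" and f: "f \<in> mod_hom R L Y"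
    and im: "f ` carrier L \<subseteq> g ` carrier X"
  shows "\<exists>h\<in>mod_hom R L X. \<forall>x\<in>carrier L. g (h x) = f x"
proof -
  from L obtain B where "left_module R L" and B: "is_basis R L B"
    by (auto simp: free_module_def)
  then interpret L: left_module R L by simp
  interpret X: left_module R X by fact
  interpret Y: left_module R Y by fact
  have BL: "b \<in> carrier L" if "b \<in> B" for b using B that by (auto simp: is_basis_def)
  have "\<forall>b\<in>B. \<exists>y\<in>carrier X. g y = f b" using im BL by (metis image_iff image_subset_iff)
  then obtain h0 where h0: "\<And>b. b \<in> B \<Longrightarrow> h0 b \<in> carrier X" "\<And>b. b \<in> B \<Longrightarrow> g (h0 b) = f b"
    by metis
  \<comment> \<open>\<open>G x y\<close>: some combination that gives \<open>x\<close> gives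
    \<open>y\<close> once each basis element \<open>b\<close> is replaced by its chosen preimage
    \<open>h0 b\<close>.\<close>
  define G where "G = (\<lambda>x y. \<exists>A c. finite A \<and> A \<subseteq> B \<and> c \<in> A \<rightarrow> carrier R \<and>
    x = finsum L (\<lambda>b. c b \<odot>\<^bsub>L\<^esub> b) A \<and> y = finsum X (\<lambda>b. c b \<odot>\<^bsub>X\<^esub> h0 b) A)"
  have Gcl: "x \<in> carrier L" "y \<in> carrier X" if "G x y" for x y
    using that BL h0 by (auto simp: G_def subset_iff Pi_iff intro!: L.M.finsum_closed X.M.finsum_closed)
  have total: "\<exists>y. G x y" if "x \<in> carrier L" for x
  proof -
    from that B have "x \<in> lin_span R L B" by (auto simp: is_basis_def)
    then show ?thesis by (auto simp: lin_span_def G_def)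
  qed
  have Gadd: "G (x \<oplus>\<^bsub>L\<^esub> x') (y \<oplus>\<^bsub>X\<^esub> y')" if "G x y" "G x' y'" for x y x' y'
  proof -
    from that(1) obtain A c where x: "finite A" "A \<subseteq> B" "c \<in> A \<rightarrow> carrier R"
      "x = finsum L (\<lambda>b. c b \<odot>\<^bsub>L\<^esub> b) A" "y = finsum X (\<lambda>b. c b \<odot>\<^bsub>X\<^esub> h0 b) A" by (auto simp: G_def)
    from that(2) obtain A' c' where x': "finite A'" "A' \<subseteq> B" "c' \<in> A' \<rightarrow> carrier R"
      "x' = finsum L (\<lambda>b. c' b \<odot>\<^bsub>L\<^esub> b) A'" "y' = finsum X (\<lambda>b. c' b \<odot>\<^bsub>X\<^esub> h0 b) A'" by (auto simp: G_def)
    let ?c = "\<lambda>b. (if b \<in> A then c b else \<zero>\<^bsub>R\<^esub>) \<oplus>\<^bsub>R\<^esub> (if b \<in> A' then c' b else \<zero>\<^bsub>R\<^esub>)"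
    have "x \<oplus>\<^bsub>L\<^esub> x' = finsum L (\<lambda>b. ?c b \<odot>\<^bsub>L\<^esub> b) (A \<union> A')"
      unfolding x(4) x'(4) using x x' BL by (intro L.finsum_smult_Un) auto
    moreover have "y \<oplus>\<^bsub>X\<^esub> y' = finsum X (\<lambda>b. ?c b \<odot>\<^bsub>X\<^esub> h0 b) (A \<union> A')"
      unfolding x(5) x'(5) using x x' h0 by (intro X.finsum_smult_Un) auto
    moreover have "?c \<in> A \<union> A' \<rightarrow> carrier R" using x(3) x'(3) by (auto simp: Pi_iff)
    ultimately show ?thesis unfolding G_def using x x' by (intro exI[of _ "A \<union> A'"] exI[of _ ?c]) simp
  qed
  have Gsm: "G (a \<odot>\<^bsub>L\<^esub> x) (a \<odot>\<^bsub>X\<^esub> y)" if "G x y" "a \<in> carrier R" for a x y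
  proof -
    from that(1) obtain A c where x: "finite A" "A \<subseteq> B" "c \<in> A \<rightarrow> carrier R"
      "x = finsum L (\<lambda>b. c b \<odot>\<^bsub>L\<^esub> b) A" "y = finsum X (\<lambda>b. c b \<odot>\<^bsub>X\<^esub> h0 b) A" by (auto simp: G_def)
    have c: "c b \<in> carrier R" "b \<in> carrier L" "h0 b \<in> carrier X" if "b \<in> A" for b
      using that x BL h0 by auto
    have "a \<odot>\<^bsub>L\<^esub> x = finsum L (\<lambda>b. (a \<otimes>\<^bsub>R\<^esub> c b) \<odot>\<^bsub>L\<^esub> b) A"
      unfolding x(4) by (subst L.finsum_smult)
        (use x c that(2) in \<open>auto intro!: L.M.finsum_cong' simp: L.smult_assoc1\<close>)
    moreover have "a \<odot>\<^bsub>X\<^esub> y = finsum X (\<lambda>b. (a \<otimes>\<^bsub>R\<^esub> c b) \<odot>\<^bsub>X\<^esub> h0 b) A"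
      unfolding x(5) by (subst X.finsum_smult)
        (use x c that(2) in \<open>auto intro!: X.M.finsum_cong' simp: X.smult_assoc1\<close>)
    ultimately show ?thesis unfolding G_def using x c that(2)
      by (intro exI[of _ A] exI[of _ "\<lambda>b. a \<otimes>\<^bsub>R\<^esub> c b"]) auto
  qed
  have G0: "y = \<zero>\<^bsub>X\<^esub>" if "G \<zero>\<^bsub>L\<^esub> y" for y
  proof -
    from that obtain A c where x: "finite A" "A \<subseteq> B" "c \<in> A \<rightarrow> carrier R"
      "\<zero>\<^bsub>L\<^esub> = finsum L (\<lambda>b. c b \<odot>\<^bsub>L\<^esub> b) A" "y = finsum X (\<lambda>b. c b \<odot>\<^bsub>X\<^esub> h0 b) A" by (auto simp: G_def)
    then have "\<forall>b\<in>A. c b = \<zero>\<^bsub>R\<^esub>" using B by (auto simp: is_basis_def)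
    then show ?thesis unfolding x(5) using h0 x(2) by (intro X.M.add.finprod_one_eqI) auto
  qed
  have uniq: "y = y'" if "G x y" "G x y'" for x y y'
  proof -
    note cl = Gcl[OF that(1)] Gcl[OF that(2)]
    \<comment> \<open>The closure rules of \<open>G\<close> know only sums and multiples, so the
      difference is formed with the scalar \<open>- 1\<close>. The first component becomes zero, and
      \<open>G0\<close> forces the second to vanish.\<close>
    have "G (x \<oplus>\<^bsub>L\<^esub> (\<ominus>\<^bsub>R\<^esub> \<one>\<^bsub>R\<^esub>) \<odot>\<^bsub>L\<^esub> x) (y \<oplus>\<^bsub>X\<^esub> (\<ominus>\<^bsub>R\<^esub> \<one>\<^bsub>R\<^esub>) \<odot>\<^bsub>X\<^esub> y')"
      by (intro Gadd Gsm that) simp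
    then have "G \<zero>\<^bsub>L\<^esub> (y \<ominus>\<^bsub>X\<^esub> y')"
      using cl by (simp add: L.smult_l_minus X.smult_l_minus L.M.r_neg a_minus_def)
    then have "y \<ominus>\<^bsub>X\<^esub> y' = \<zero>\<^bsub>X\<^esub>" by (rule G0)
    then show ?thesis using cl by (simp add: X.M.minus_eq_zero_iff)
  qed
  define h where "h = (\<lambda>x. THE y. G x y)"
  have Gh: "G x (h x)" if "x \<in> carrier L" for x
    using total[OF that] uniq unfolding h_def by (metis theI)
  have hG: "h x = y" if "G x y" for x y using Gh Gcl uniq that by metis
  have "h \<in> mod_hom R L X"
  proof (rule mod_homI)
    fix x assume "x \<in> carrier L"
    then show "h x \<in> carrier X" by (rule Gcl(2)[OF Gh])
  next
    fix x y assume "x \<in> carrier L" "y \<in> carrier L"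
    then show "h (x \<oplus>\<^bsub>L\<^esub> y) = h x \<oplus>\<^bsub>X\<^esub> h y" by (intro hG Gadd Gh)
  next
    fix a x assume "a \<in> carrier R" "x \<in> carrier L"
    then show "h (a \<odot>\<^bsub>L\<^esub> x) = a \<odot>\<^bsub>X\<^esub> h x" by (intro hG Gsm Gh)
  qed
  moreover have "g (h x) = f x" if "x \<in> carrier L" for x
  proof -
    from Gh[OF that] obtain A c where x: "finite A" "A \<subseteq> B" "c \<in> A \<rightarrow> carrier R"
      "x = finsum L (\<lambda>b. c b \<odot>\<^bsub>L\<^esub> b) A" "h x = finsum X (\<lambda>b. c b \<odot>\<^bsub>X\<^esub> h0 b) A" by (auto simp: G_def)
    have c: "c b \<in> carrier R" "b \<in> carrier L" "h0 b \<in> carrier X" "g (h0 b) = f b" "f b \<in> carrier Y" if "b \<in> A" for b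
      using that x BL h0 mod_hom_closed[OF f] by auto
    have "g (h x) = finsum Y (\<lambda>b. g (c b \<odot>\<^bsub>X\<^esub> h0 b)) A"
      unfolding x(5) by (rule mod_hom_finsum[OF g X Y x(1)]) (use c in auto)
    also have "\<dots> = finsum Y (\<lambda>b. f (c b \<odot>\<^bsub>L\<^esub> b)) A"
      by (rule Y.M.finsum_cong') (use c in \<open>auto simp: mod_hom_smult[OF g] mod_hom_smult[OF f]\<close>)
    also have "\<dots> = f x"
      unfolding x(4) by (rule mod_hom_finsum[OF f L.left_module_axioms Y x(1), symmetric]) (use c in auto)
    finally show ?thesis .
  qed
  ultimately show ?thesis by blast
qed

section \<open>Submodules and products\<close>

text \<open>Negatives come from closure under multiples, through the scalar
  \<open>- 1\<close>.\<close>

lemma left_module_submodule: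
  assumes "left_module R M" "C \<subseteq> carrier M" "\<zero>\<^bsub>M\<^esub> \<in> C"
    and "\<And>x y. \<lbrakk>x \<in> C; y \<in> C\<rbrakk> \<Longrightarrow> x \<oplus>\<^bsub>M\<^esub> y \<in> C"
    and "\<And>a x. \<lbrakk>a \<in> carrier R; x \<in> C\<rbrakk> \<Longrightarrow> a \<odot>\<^bsub>M\<^esub> x \<in> C"
  shows "left_module R (M\<lparr>carrier := C\<rparr>)"
proof -
  interpret left_module R M by fact
  have C: "x \<in> carrier M" if "x \<in> C" for x using assms(2) that by auto
  have "abelian_group (M\<lparr>carrier := C\<rparr>)"
  proof (rule abelian_groupI)
    fix x assume "x \<in> carrier (M\<lparr>carrier := C\<rparr>)"
    then have x: "x \<in> C" by simp
    show "\<exists>y\<in>carrier (M\<lparr>carrier := C\<rparr>). y \<oplus>\<^bsub>M\<lparr>carrier := C\<rparr>\<^esub> x = \<zero>\<^bsub>M\<lparr>carrier := C\<rparr>\<^esub>"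
      using assms(5)[OF R.a_inv_closed[OF R.one_closed] x] C[OF x]
      by (intro bexI[of _ "(\<ominus>\<^bsub>R\<^esub> \<one>\<^bsub>R\<^esub>) \<odot>\<^bsub>M\<^esub> x"]) (auto simp: smult_l_minus M.l_neg)
  qed (use assms C in \<open>auto simp: M.a_ac\<close>)
  then show ?thesis
    using assms(5) C by (intro left_module.intro left_module_axioms.intro R.ring_axioms)
      (auto simp: smult_l_distr smult_r_distr smult_assoc1)
qed

lemma module_prod_simps [simp]:
  "carrier (module_prod M N) = carrier M \<times> carrier N"
  "\<zero>\<^bsub>module_prod M N\<^esub> = (\<zero>\<^bsub>M\<^esub>, \<zero>\<^bsub>N\<^esub>)"
  "p \<oplus>\<^bsub>module_prod M N\<^esub> q = (fst p \<oplus>\<^bsub>M\<^esub> fst q, snd p \<oplus>\<^bsub>N\<^esub> snd q)"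
  "a \<odot>\<^bsub>module_prod M N\<^esub> p = (a \<odot>\<^bsub>M\<^esub> fst p, a \<odot>\<^bsub>N\<^esub> snd p)"
  by (auto simp: module_prod_def split: prod.splits)

lemma left_module_prod:
  assumes "left_module R M" "left_module R N"
  shows "left_module R (module_prod M N)"
proof -
  interpret M: left_module R M by fact
  interpret N: left_module R N by fact
  have "abelian_group (module_prod M N)"
  proof (rule abelian_groupI)
    fix p assume "p \<in> carrier (module_prod M N)"
    then show "\<exists>q\<in>carrier (module_prod M N). q \<oplus>\<^bsub>module_prod M N\<^esub> p = \<zero>\<^bsub>module_prod M N\<^esub>"
      by (intro bexI[of _ "(\<ominus>\<^bsub>M\<^esub> fst p, \<ominus>\<^bsub>N\<^esub> snd p)"]) (auto simp: M.M.l_neg N.M.l_neg)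
  qed (auto simp: M.M.a_ac N.M.a_ac)
  then show ?thesis
    by (intro left_module.intro left_module_axioms.intro M.R.ring_axioms)
      (auto simp: M.smult_l_distr M.smult_r_distr M.smult_assoc1
        N.smult_l_distr N.smult_r_distr N.smult_assoc1)
qed

lemma module_prod_a_inv:
  assumes "left_module R M" "left_module R N" "x \<in> carrier M" "y \<in> carrier N"
  shows "\<ominus>\<^bsub>module_prod M N\<^esub> (x, y) = (\<ominus>\<^bsub>M\<^esub> x, \<ominus>\<^bsub>N\<^esub> y)"
proof -
  interpret M: left_module R M by fact
  interpret N: left_module R N by fact
  interpret P: left_module R "module_prod M N" by (rule left_module_prod[OF M.left_module_axioms N.left_module_axioms])
  show ?thesis using assms by (intro P.M.minus_equality) (auto simp: M.M.l_neg N.M.l_neg)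
qed

lemma mod_hom_fst: "fst \<in> mod_hom R (module_prod M N) M"
  by (auto simp: mod_hom_def)

lemma mod_hom_snd: "snd \<in> mod_hom R (module_prod M N) N"
  by (auto simp: mod_hom_def)

lemma mod_hom_Pair:
  "\<lbrakk>f \<in> mod_hom R X M; g \<in> mod_hom R X N\<rbrakk> \<Longrightarrow> (\<lambda>x. (f x, g x)) \<in> mod_hom R X (module_prod M N)"
  by (auto simp: mod_hom_def)

text \<open>Supplies the terms of the mapping cone. The basis consists of the two given bases placed
  on the axes, and a relation among its elements is split by the two projections.\<close>

lemma free_module_prod:
  assumes M: "free_module R M" and N: "free_module R N" and nontriv: "\<one>\<^bsub>R\<^esub> \<noteq> \<zero>\<^bsub>R\<^esub>"
  shows "free_module R (module_prod M N)"
proof -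
  obtain A where A: "is_basis R M A" and lM: "left_module R M" using M by (auto simp: free_module_def)
  obtain B where B: "is_basis R N B" and lN: "left_module R N" using N by (auto simp: free_module_def)
  interpret M: left_module R M by fact
  interpret N: left_module R N by fact
  interpret P: left_module R "module_prod M N" by (rule left_module_prod[OF M.left_module_axioms N.left_module_axioms])
  let ?P = "module_prod M N"
  have Ac: "A \<subseteq> carrier M" and Bc: "B \<subseteq> carrier N" using A B by (auto simp: is_basis_def)
  have A0: "\<zero>\<^bsub>M\<^esub> \<notin> A"
  proof
    assume "\<zero>\<^bsub>M\<^esub> \<in> A"
    then have "\<one>\<^bsub>R\<^esub> = \<zero>\<^bsub>R\<^esub>"
      by (intro is_basis_independent[OF A, of "{\<zero>\<^bsub>M\<^esub>}" "\<lambda>_. \<one>\<^bsub>R\<^esub>" "\<zero>\<^bsub>M\<^esub>"])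
        (auto intro!: M.M.add.finprod_one_eqI)
    with nontriv show False by simp
  qed
  let ?C = "(\<lambda>b. (b, \<zero>\<^bsub>N\<^esub>)) ` A \<union> (\<lambda>b. (\<zero>\<^bsub>M\<^esub>, b)) ` B"
  have Cc: "?C \<subseteq> carrier ?P" using Ac Bc by auto
  have spanM: "(x, \<zero>\<^bsub>N\<^esub>) \<in> lin_span R ?P ?C" if "x \<in> carrier M" for x
  proof -
    from that A have "x \<in> lin_span R M A" by (simp add: is_basis_def)
    then obtain D c where D: "finite D" "D \<subseteq> A" "c \<in> D \<rightarrow> carrier R"
      "x = finsum M (\<lambda>b. c b \<odot>\<^bsub>M\<^esub> b) D" by (rule lin_spanE)
    have cD: "c b \<in> carrier R" "b \<in> carrier M" if "b \<in> D" for b using D Ac that by auto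
    have "(x, \<zero>\<^bsub>N\<^esub>) = (\<lambda>x. (x, \<zero>\<^bsub>N\<^esub>)) (finsum M (\<lambda>b. c b \<odot>\<^bsub>M\<^esub> b) D)" using D by simp
    also have "\<dots> = finsum ?P (\<lambda>b. (c b \<odot>\<^bsub>M\<^esub> b, \<zero>\<^bsub>N\<^esub>)) D"
      by (rule mod_hom_finsum[of _ R M])
        (use D cD mod_hom_Pair[OF mod_hom_id mod_hom_zero_map[OF lN]] in
          \<open>auto intro: lM P.left_module_axioms\<close>)
    also have "\<dots> = finsum ?P (\<lambda>p. (c \<circ> fst) p \<odot>\<^bsub>?P\<^esub> p) ((\<lambda>b. (b, \<zero>\<^bsub>N\<^esub>)) ` D)"
      by (subst P.M.add.finprod_reindex) (use cD in \<open>auto simp: inj_on_def intro!: P.M.finsum_cong'\<close>)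
    finally show ?thesis unfolding lin_span_def
      by (intro CollectI exI conjI) (assumption | use D in auto)+
  qed
  have spanN: "(\<zero>\<^bsub>M\<^esub>, x) \<in> lin_span R ?P ?C" if "x \<in> carrier N" for x
  proof -
    from that B have "x \<in> lin_span R N B" by (simp add: is_basis_def)
    then obtain D c where D: "finite D" "D \<subseteq> B" "c \<in> D \<rightarrow> carrier R"
      "x = finsum N (\<lambda>b. c b \<odot>\<^bsub>N\<^esub> b) D" by (rule lin_spanE)
    have cD: "c b \<in> carrier R" "b \<in> carrier N" if "b \<in> D" for b using D Bc that by auto
    have "(\<zero>\<^bsub>M\<^esub>, x) = (\<lambda>x. (\<zero>\<^bsub>M\<^esub>, x)) (finsum N (\<lambda>b. c b \<odot>\<^bsub>N\<^esub> b) D)" using D by simp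
    also have "\<dots> = finsum ?P (\<lambda>b. (\<zero>\<^bsub>M\<^esub>, c b \<odot>\<^bsub>N\<^esub> b)) D"
      by (rule mod_hom_finsum[of _ R N])
        (use D cD mod_hom_Pair[OF mod_hom_zero_map[OF lM] mod_hom_id] in
          \<open>auto intro: lN P.left_module_axioms\<close>)
    also have "\<dots> = finsum ?P (\<lambda>p. (c \<circ> snd) p \<odot>\<^bsub>?P\<^esub> p) ((\<lambda>b. (\<zero>\<^bsub>M\<^esub>, b)) ` D)"
      by (subst P.M.add.finprod_reindex) (use cD in \<open>auto simp: inj_on_def intro!: P.M.finsum_cong'\<close>)
    finally show ?thesis unfolding lin_span_def
      by (intro CollectI exI conjI) (assumption | use D in auto)+
  qed
  have span: "lin_span R ?P ?C = carrier ?P"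
  proof
    show "lin_span R ?P ?C \<subseteq> carrier ?P" by (rule lin_span_closed[OF P.left_module_axioms Cc])
    show "carrier ?P \<subseteq> lin_span R ?P ?C"
    proof
      fix p assume "p \<in> carrier ?P"
      then obtain x y where p: "p = (x, y)" "x \<in> carrier M" "y \<in> carrier N" by auto
      then have "p = (x, \<zero>\<^bsub>N\<^esub>) \<oplus>\<^bsub>?P\<^esub> (\<zero>\<^bsub>M\<^esub>, y)" by simp
      then show "p \<in> lin_span R ?P ?C"
        using lin_span_add[OF P.left_module_axioms Cc spanM[OF p(2)] spanN[OF p(3)]] by metis
    qed
  qed
  have indep: "\<forall>p\<in>D. c p = \<zero>\<^bsub>R\<^esub>"
    if D: "finite D" "D \<subseteq> ?C" "c \<in> D \<rightarrow> carrier R" "finsum ?P (\<lambda>b. c b \<odot>\<^bsub>?P\<^esub> b) D = \<zero>\<^bsub>?P\<^esub>" for D c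
  proof -
    have cD: "c p \<in> carrier R" "p \<in> carrier ?P" if "p \<in> D" for p
      using D(3) subsetD[OF Cc subsetD[OF D(2) that]] that by (simp_all add: Pi_iff)
    let ?A = "{b \<in> A. (b, \<zero>\<^bsub>N\<^esub>) \<in> D}" and ?B = "{b \<in> B. (\<zero>\<^bsub>M\<^esub>, b) \<in> D}"
    have fA: "finite ?A"
      by (rule finite_imageD[of "\<lambda>b. (b, \<zero>\<^bsub>N\<^esub>)"]) (auto intro: finite_subset[OF _ D(1)] simp: inj_on_def)
    have fB: "finite ?B"
      by (rule finite_imageD[of "\<lambda>b. (\<zero>\<^bsub>M\<^esub>, b)"]) (auto intro: finite_subset[OF _ D(1)] simp: inj_on_def)
    \<comment> \<open>Elements of \<open>D\<close> on the \<open>N\<close> axis have first component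
      zero, so the projected relation is one among the elements \<open>?A\<close> of the basis of
      \<open>M\<close>.\<close>
    have "finsum M (\<lambda>b. c (b, \<zero>\<^bsub>N\<^esub>) \<odot>\<^bsub>M\<^esub> b) ?A = finsum M (\<lambda>p. c p \<odot>\<^bsub>M\<^esub> fst p) ((\<lambda>b. (b, \<zero>\<^bsub>N\<^esub>)) ` ?A)"
      by (subst M.M.add.finprod_reindex) (use cD in \<open>auto simp: inj_on_def intro!: M.M.finsum_cong'\<close>)
    also have "\<dots> = finsum M (\<lambda>p. c p \<odot>\<^bsub>M\<^esub> fst p) D"
      by (rule M.M.add.finprod_mono_neutral_cong_left) (use D cD in auto)
    also have "\<dots> = finsum M (\<lambda>p. fst (c p \<odot>\<^bsub>?P\<^esub> p)) D"
      by (rule M.M.finsum_cong') (use cD in auto)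
    also have "\<dots> = fst (finsum ?P (\<lambda>b. c b \<odot>\<^bsub>?P\<^esub> b) D)"
      by (rule mod_hom_finsum[OF mod_hom_fst P.left_module_axioms lM D(1), symmetric]) (use cD in auto)
    also have "\<dots> = \<zero>\<^bsub>M\<^esub>" using D(4) by simp
    finally have a: "\<forall>b\<in>?A. c (b, \<zero>\<^bsub>N\<^esub>) = \<zero>\<^bsub>R\<^esub>"
      using is_basis_independent[OF A fA, of "\<lambda>b. c (b, \<zero>\<^bsub>N\<^esub>)"] cD by blast
    have "finsum N (\<lambda>b. c (\<zero>\<^bsub>M\<^esub>, b) \<odot>\<^bsub>N\<^esub> b) ?B = finsum N (\<lambda>p. c p \<odot>\<^bsub>N\<^esub> snd p) ((\<lambda>b. (\<zero>\<^bsub>M\<^esub>, b)) ` ?B)"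
      by (subst N.M.add.finprod_reindex) (use cD in \<open>auto simp: inj_on_def intro!: N.M.finsum_cong'\<close>)
    also have "\<dots> = finsum N (\<lambda>p. c p \<odot>\<^bsub>N\<^esub> snd p) D"
      by (rule N.M.add.finprod_mono_neutral_cong_left) (use D cD in auto)
    also have "\<dots> = finsum N (\<lambda>p. snd (c p \<odot>\<^bsub>?P\<^esub> p)) D"
      by (rule N.M.finsum_cong') (use cD in auto)
    also have "\<dots> = snd (finsum ?P (\<lambda>b. c b \<odot>\<^bsub>?P\<^esub> b) D)"
      by (rule mod_hom_finsum[OF mod_hom_snd P.left_module_axioms lN D(1), symmetric]) (use cD in auto)
    also have "\<dots> = \<zero>\<^bsub>N\<^esub>" using D(4) by simp
    finally have b: "\<forall>b\<in>?B. c (\<zero>\<^bsub>M\<^esub>, b) = \<zero>\<^bsub>R\<^esub>"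
      using is_basis_independent[OF B fB, of "\<lambda>b. c (\<zero>\<^bsub>M\<^esub>, b)"] cD by blast
    show ?thesis using a b D(2) by auto
  qed
  have "is_basis R ?P ?C" unfolding is_basis_def using span indep Cc by blast
  then show ?thesis unfolding free_module_def using P.left_module_axioms by blast
qed

section \<open>Lifting chain maps\<close>

lemma free_resolution_left_module: "free_resolution R X F \<Longrightarrow> left_module R X"
  by (auto simp: free_resolution_def)

lemma free_resolution_free: "free_resolution R X F \<Longrightarrow> free_module R (cmod F n)"
  by (auto simp: free_resolution_def)

lemma free_resolution_cmod: "free_resolution R X F \<Longrightarrow> left_module R (cmod F n)"
  by (auto simp: free_resolution_def free_module_def)

lemma free_resolution_diff: "free_resolution R X F \<Longrightarrow> diff F n \<in> mod_hom R (cmod F (Suc n)) (cmod F n)"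
  by (auto simp: free_resolution_def)

lemma free_resolution_aug: "free_resolution R X F \<Longrightarrow> aug F \<in> mod_hom R (cmod F 0) X"
  by (auto simp: free_resolution_def)

lemma diff_closed:
  "\<lbrakk>free_resolution R X F; x \<in> carrier (cmod F (Suc n))\<rbrakk> \<Longrightarrow> diff F n x \<in> carrier (cmod F n)"
  by (rule mod_hom_closed[OF free_resolution_diff])

lemma aug_closed: "\<lbrakk>free_resolution R X F; x \<in> carrier (cmod F 0)\<rbrakk> \<Longrightarrow> aug F x \<in> carrier X"
  by (rule mod_hom_closed[OF free_resolution_aug])

lemma diff_diff:
  assumes "free_resolution R X F" "x \<in> carrier (cmod F (Suc (Suc n)))"
  shows "diff F n (diff F (Suc n) x) = \<zero>\<^bsub>cmod F n\<^esub>"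
proof -
  have "diff F (Suc n) x \<in> diff F (Suc n) ` carrier (cmod F (Suc (Suc n)))" using assms by blast
  also have "\<dots> = {x \<in> carrier (cmod F (Suc n)). diff F n x = \<zero>\<^bsub>cmod F n\<^esub>}"
    using assms(1) by (auto simp: free_resolution_def)
  finally show ?thesis by simp
qed

lemma diff_exact:
  assumes "free_resolution R X F" "x \<in> carrier (cmod F (Suc n))" "diff F n x = \<zero>\<^bsub>cmod F n\<^esub>"
  shows "x \<in> diff F (Suc n) ` carrier (cmod F (Suc (Suc n)))"
proof -
  have "diff F (Suc n) ` carrier (cmod F (Suc (Suc n))) =
      {x \<in> carrier (cmod F (Suc n)). diff F n x = \<zero>\<^bsub>cmod F n\<^esub>}"
    using assms(1) by (auto simp: free_resolution_def)
  then show ?thesis using assms by simp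
qed

lemma aug_diff:
  assumes "free_resolution R X F" "x \<in> carrier (cmod F (Suc 0))"
  shows "aug F (diff F 0 x) = \<zero>\<^bsub>X\<^esub>"
  using assms unfolding free_resolution_def by blast

lemma aug_exact:
  assumes "free_resolution R X F" "x \<in> carrier (cmod F 0)" "aug F x = \<zero>\<^bsub>X\<^esub>"
  shows "x \<in> diff F 0 ` carrier (cmod F (Suc 0))"
  using assms unfolding free_resolution_def by blast

lemma aug_surj: "free_resolution R X F \<Longrightarrow> aug F ` carrier (cmod F 0) = carrier X"
  by (auto simp: free_resolution_def)

lemma chain_lifts_mod_hom:
  "h \<in> chain_lifts R F j G f \<Longrightarrow> h m \<in> mod_hom R (cmod F (j + m)) (cmod G m)"
  by (auto simp: chain_lifts_def)

lemma chain_lifts_aug: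
  "\<lbrakk>h \<in> chain_lifts R F j G f; x \<in> carrier (cmod F j)\<rbrakk> \<Longrightarrow> aug G (h 0 x) = f x"
  by (auto simp: chain_lifts_def)

lemma chain_lifts_diff:
  "\<lbrakk>h \<in> chain_lifts R F j G f; x \<in> carrier (cmod F (Suc (j + m)))\<rbrakk> \<Longrightarrow>
    diff G m (h (Suc m) x) = h m (diff F (j + m) x)"
  by (auto simp: chain_lifts_def)

text \<open>Existence half of the comparison theorem, for a map that starts at
  \<open>cmod F j\<close>. The hypothesis \<open>fd\<close> makes the passage from degree 0 to
  degree 1 possible: by it, \<open>aug G\<close> kills \<open>h 0\<close> of a boundary.\<close>

lemma chain_lifts_exist:
  assumes F: "free_resolution R X F" and G: "free_resolution R Y G"
    and f: "f \<in> mod_hom R (cmod F j) Y"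
    and fd: "\<And>x. x \<in> carrier (cmod F (Suc j)) \<Longrightarrow> f (diff F j x) = \<zero>\<^bsub>Y\<^esub>"
  obtains h where "h \<in> chain_lifts R F j G f"
proof -
  \<comment> \<open>\<open>P\<close> is the invariant under which a next component exists: past
    degree 0 it says only that \<open>h\<close> sends boundaries to cycles. \<open>Q\<close> is the
    commuting square with that next component.\<close>
  define P where "P = (\<lambda>m h. h \<in> mod_hom R (cmod F (j + m)) (cmod G m) \<and>
     (if m = 0 then \<forall>x\<in>carrier (cmod F j). aug G (h x) = f x
      else \<forall>x\<in>carrier (cmod F (Suc (j + m))). diff G (m - 1) (h (diff F (j + m) x)) = \<zero>\<^bsub>cmod G (m - 1)\<^esub>))"
  define Q where "Q = (\<lambda>m h h'. \<forall>x\<in>carrier (cmod F (Suc (j + m))).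
     diff G m (h' x) = h (diff F (j + m) x))"
  have "\<exists>h. P 0 h"
  proof -
    have "f ` carrier (cmod F j) \<subseteq> aug G ` carrier (cmod G 0)"
      using aug_surj[OF G] mod_hom_closed[OF f] by auto
    from free_module_lift[OF free_resolution_free[OF F] free_resolution_cmod[OF G]
      free_resolution_left_module[OF G] free_resolution_aug[OF G] f this]
    show ?thesis by (auto simp: P_def)
  qed
  moreover have "\<exists>h'. P (Suc m) h' \<and> Q m h h'" if P: "P m h" for m h
  proof -
    have h: "h \<in> mod_hom R (cmod F (j + m)) (cmod G m)" using P by (simp add: P_def)
    have hd: "h \<circ> diff F (j + m) \<in> mod_hom R (cmod F (Suc (j + m))) (cmod G m)"
      by (rule mod_hom_comp[OF free_resolution_diff[OF F] h])
    have im: "(h \<circ> diff F (j + m)) ` carrier (cmod F (Suc (j + m))) \<subseteq>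
      diff G m ` carrier (cmod G (Suc m))"
    proof
      fix y assume "y \<in> (h \<circ> diff F (j + m)) ` carrier (cmod F (Suc (j + m)))"
      then obtain x where x: "x \<in> carrier (cmod F (Suc (j + m)))" "y = h (diff F (j + m) x)" by auto
      then have y: "y \<in> carrier (cmod G m)" using mod_hom_closed[OF hd] by simp
      show "y \<in> diff G m ` carrier (cmod G (Suc m))"
      proof (cases m)
        case 0
        then have "aug G y = \<zero>\<^bsub>Y\<^esub>" using P x fd diff_closed[OF F] by (simp add: P_def)
        then show ?thesis using aug_exact[OF G] y 0 by simp
      next
        case (Suc m')
        then have "diff G m' y = \<zero>\<^bsub>cmod G m'\<^esub>" using P x by (simp add: P_def)
        then show ?thesis using diff_exact[OF G] y Suc by simp
      qed
    qed
    obtain h' where h': "h' \<in> mod_hom R (cmod F (Suc (j + m))) (cmod G (Suc m))"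
      "\<And>x. x \<in> carrier (cmod F (Suc (j + m))) \<Longrightarrow> diff G m (h' x) = (h \<circ> diff F (j + m)) x"
      using free_module_lift[OF free_resolution_free[OF F] free_resolution_cmod[OF G]
        free_resolution_cmod[OF G] free_resolution_diff[OF G] hd im] by blast
    have "diff G m (h' (diff F (Suc (j + m)) x)) = \<zero>\<^bsub>cmod G m\<^esub>"
      if "x \<in> carrier (cmod F (Suc (Suc (j + m))))" for x
      using h'(2)[OF diff_closed[OF F that]] diff_diff[OF F that]
        mod_hom_zero[OF h free_resolution_cmod[OF F] free_resolution_cmod[OF G]] by simp
    with h' show ?thesis by (auto simp: P_def Q_def)
  qed
  ultimately have "\<exists>h. \<forall>m. P m (h m) \<and> Q m (h m) (h (Suc m))" by (rule dependent_nat_choice) auto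
  then obtain h where h: "\<And>m. P m (h m)" "\<And>m. Q m (h m) (h (Suc m))" by blast
  have "h \<in> chain_lifts R F j G f"
    using h h(1)[of 0] by (auto simp: chain_lifts_def P_def Q_def)
  then show thesis by (rule that)
qed

text \<open>Uniqueness half of the comparison theorem. Each new component of the homotopy solves
  \<open>d s = h - h' - s d\<close>, which requires the right-hand side to consist of
  cycles.\<close>

lemma chain_lifts_homotopic:
  assumes F: "free_resolution R X F" and G: "free_resolution R Y G"
    and h: "h \<in> chain_lifts R F j G f" and h': "h' \<in> chain_lifts R F j G f"
  obtains s where "\<And>m. s m \<in> mod_hom R (cmod F (j + m)) (cmod G (Suc m))"
    and "\<And>x. x \<in> carrier (cmod F j) \<Longrightarrow> h 0 x = h' 0 x \<oplus>\<^bsub>cmod G 0\<^esub> diff G 0 (s 0 x)"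
    and "\<And>m x. x \<in> carrier (cmod F (Suc (j + m))) \<Longrightarrow> h (Suc m) x =
      h' (Suc m) x \<oplus>\<^bsub>cmod G (Suc m)\<^esub> diff G (Suc m) (s (Suc m) x) \<oplus>\<^bsub>cmod G (Suc m)\<^esub> s m (diff F (j + m) x)"
proof -
  note lF = free_resolution_cmod[OF F] and lG = free_resolution_cmod[OF G]
    and dF = free_resolution_diff[OF F] and dG = free_resolution_diff[OF G]
    and hm = chain_lifts_mod_hom[OF h] chain_lifts_mod_hom[OF h']
  \<comment> \<open>On boundaries the term \<open>s d\<close> of the homotopy formula vanishes.
    \<open>P\<close> keeps this reduced form, because it is exactly what makes the next right-hand
    side a cycle.\<close>
  define P where "P = (\<lambda>m s. s \<in> mod_hom R (cmod F (j + m)) (cmod G (Suc m)) \<and>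
     (\<forall>x\<in>carrier (cmod F (Suc (j + m))). h m (diff F (j + m) x) =
        h' m (diff F (j + m) x) \<oplus>\<^bsub>cmod G m\<^esub> diff G m (s (diff F (j + m) x))) \<and>
     (m = 0 \<longrightarrow> (\<forall>x\<in>carrier (cmod F j). h 0 x = h' 0 x \<oplus>\<^bsub>cmod G 0\<^esub> diff G 0 (s x))))"
  define Q where "Q = (\<lambda>m s s'. \<forall>x\<in>carrier (cmod F (Suc (j + m))). h (Suc m) x =
      h' (Suc m) x \<oplus>\<^bsub>cmod G (Suc m)\<^esub> diff G (Suc m) (s' x) \<oplus>\<^bsub>cmod G (Suc m)\<^esub> s (diff F (j + m) x))"
  have "\<exists>s. P 0 s"
  proof -
    interpret G0: left_module R "cmod G 0" by (rule lG)
    let ?f = "\<lambda>x. h 0 x \<ominus>\<^bsub>cmod G 0\<^esub> h' 0 x"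
    have f: "?f \<in> mod_hom R (cmod F j) (cmod G 0)"
      using hm[of 0] by (intro mod_hom_minus lG) simp_all
    have cl: "h 0 x \<in> carrier (cmod G 0)" "h' 0 x \<in> carrier (cmod G 0)" if "x \<in> carrier (cmod F j)" for x
      using hm[of 0] that by (simp_all add: mod_hom_closed[of _ R "cmod F j"])
    have im: "?f ` carrier (cmod F j) \<subseteq> diff G 0 ` carrier (cmod G (Suc 0))"
    proof
      fix y assume "y \<in> ?f ` carrier (cmod F j)"
      then obtain x where x: "x \<in> carrier (cmod F j)" "y = ?f x" by auto
      interpret Y: left_module R Y by (rule free_resolution_left_module[OF G])
      have "aug G y = f x \<ominus>\<^bsub>Y\<^esub> f x"
        using x cl chain_lifts_aug[OF h x(1)] chain_lifts_aug[OF h' x(1)]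
          mod_hom_a_minus[OF free_resolution_aug[OF G] lG free_resolution_left_module[OF G]] by simp
      moreover have "f x \<in> carrier Y"
        using chain_lifts_aug[OF h x(1)] aug_closed[OF G cl(1)[OF x(1)]] by simp
      ultimately have "aug G y = \<zero>\<^bsub>Y\<^esub>" by (simp add: a_minus_def Y.M.r_neg)
      then show "y \<in> diff G 0 ` carrier (cmod G (Suc 0))"
        using aug_exact[OF G] x mod_hom_closed[OF f] by simp
    qed
    obtain s where s: "s \<in> mod_hom R (cmod F j) (cmod G (Suc 0))"
      "\<And>x. x \<in> carrier (cmod F j) \<Longrightarrow> diff G 0 (s x) = ?f x"
      using free_module_lift[OF free_resolution_free[OF F] lG lG dG f im] by blast
    have "h 0 x = h' 0 x \<oplus>\<^bsub>cmod G 0\<^esub> diff G 0 (s x)" if "x \<in> carrier (cmod F j)" for x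
      using s(2)[OF that] cl[OF that] diff_closed[OF G mod_hom_closed[OF s(1) that]]
      by (metis G0.M.minus_eq_iff_eq_add G0.M.a_comm)
    then show ?thesis using s diff_closed[OF F] by (auto simp: P_def)
  qed
  moreover have "\<exists>s'. P (Suc m) s' \<and> Q m s s'" if P: "P m s" for m s
  proof -
    interpret Gm: left_module R "cmod G m" by (rule lG)
    interpret Gs: left_module R "cmod G (Suc m)" by (rule lG)
    have s: "s \<in> mod_hom R (cmod F (j + m)) (cmod G (Suc m))" using P by (simp add: P_def)
    have sd: "s \<circ> diff F (j + m) \<in> mod_hom R (cmod F (Suc (j + m))) (cmod G (Suc m))"
      by (rule mod_hom_comp[OF dF s])
    let ?f = "\<lambda>x. (h (Suc m) x \<ominus>\<^bsub>cmod G (Suc m)\<^esub> h' (Suc m) x) \<ominus>\<^bsub>cmod G (Suc m)\<^esub> (s \<circ> diff F (j + m)) x"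
    have f: "?f \<in> mod_hom R (cmod F (Suc (j + m))) (cmod G (Suc m))"
      using hm[of "Suc m"] by (intro mod_hom_minus lG sd) simp_all
    have cl: "h (Suc m) x \<in> carrier (cmod G (Suc m))" "h' (Suc m) x \<in> carrier (cmod G (Suc m))"
        "s (diff F (j + m) x) \<in> carrier (cmod G (Suc m))"
        if "x \<in> carrier (cmod F (Suc (j + m)))" for x
      using hm[of "Suc m"] that mod_hom_closed[OF sd that]
      by (simp_all add: mod_hom_closed[of _ R "cmod F (Suc (j + m))"])
    have im: "?f ` carrier (cmod F (Suc (j + m))) \<subseteq> diff G (Suc m) ` carrier (cmod G (Suc (Suc m)))"
    proof
      fix y assume "y \<in> ?f ` carrier (cmod F (Suc (j + m)))"
      then obtain x where x: "x \<in> carrier (cmod F (Suc (j + m)))" "y = ?f x" by auto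
      let ?dx = "diff F (j + m) x"
      have dx: "?dx \<in> carrier (cmod F (j + m))" by (rule diff_closed[OF F x(1)])
      have "diff G m y = (h m ?dx \<ominus>\<^bsub>cmod G m\<^esub> h' m ?dx) \<ominus>\<^bsub>cmod G m\<^esub> diff G m (s ?dx)"
        using x cl chain_lifts_diff[OF h x(1)] chain_lifts_diff[OF h' x(1)]
        by (simp add: mod_hom_a_minus[OF dG lG lG])
      also have "\<dots> = \<zero>\<^bsub>cmod G m\<^esub>"
        using P x(1) mod_hom_closed[OF hm(1) dx] mod_hom_closed[OF hm(2) dx] diff_closed[OF G cl(3)[OF x(1)]]
        by (simp add: P_def Gm.M.minus_eq_zero_iff Gm.M.minus_eq_iff_eq_add Gm.M.a_comm)
      finally show "y \<in> diff G (Suc m) ` carrier (cmod G (Suc (Suc m)))"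
        using diff_exact[OF G] x mod_hom_closed[OF f] by simp
    qed
    obtain s' where s': "s' \<in> mod_hom R (cmod F (Suc (j + m))) (cmod G (Suc (Suc m)))"
      "\<And>x. x \<in> carrier (cmod F (Suc (j + m))) \<Longrightarrow> diff G (Suc m) (s' x) = ?f x"
      using free_module_lift[OF free_resolution_free[OF F] lG lG dG f im] by blast
    have Q: "h (Suc m) x = h' (Suc m) x \<oplus>\<^bsub>cmod G (Suc m)\<^esub> diff G (Suc m) (s' x) \<oplus>\<^bsub>cmod G (Suc m)\<^esub> s (diff F (j + m) x)"
      if "x \<in> carrier (cmod F (Suc (j + m)))" for x
    proof -
      note c = cl[OF that] diff_closed[OF G mod_hom_closed[OF s'(1) that]]
      from s'(2)[OF that] c have "h (Suc m) x \<ominus>\<^bsub>cmod G (Suc m)\<^esub> h' (Suc m) x =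
          diff G (Suc m) (s' x) \<oplus>\<^bsub>cmod G (Suc m)\<^esub> s (diff F (j + m) x)"
        by (metis Gs.M.minus_eq_iff_eq_add Gs.M.minus_closed comp_apply)
      then show ?thesis using c by (simp add: Gs.M.minus_eq_iff_eq_add Gs.M.a_ac)
    qed
    have "h (Suc m) (diff F (Suc (j + m)) x) =
        h' (Suc m) (diff F (Suc (j + m)) x) \<oplus>\<^bsub>cmod G (Suc m)\<^esub> diff G (Suc m) (s' (diff F (Suc (j + m)) x))"
      if x: "x \<in> carrier (cmod F (Suc (Suc (j + m))))" for x
      using Q[OF diff_closed[OF F x]] cl(1,2)[OF diff_closed[OF F x]]
        diff_closed[OF G mod_hom_closed[OF s'(1) diff_closed[OF F x]]]
      by (simp add: diff_diff[OF F x] mod_hom_zero[OF s lF lG])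
    with s' Q show ?thesis by (auto simp: P_def Q_def)
  qed
  ultimately have "\<exists>s. \<forall>m. P m (s m) \<and> Q m (s m) (s (Suc m))" by (rule dependent_nat_choice) auto
  then obtain s where s: "\<And>m. P m (s m)" "\<And>m. Q m (s m) (s (Suc m))" by blast
  show thesis
    by (rule that[of s]) (use s s(1)[of 0] in \<open>auto simp: P_def Q_def\<close>)
qed

section \<open>Ext groups by representatives\<close>

text \<open>Cocycles as mere functions, without the extensionality built into
  \<open>hom_group\<close>. Representatives can then be composed and added freely, and the
  restriction is left to \<open>ext_class\<close>.\<close>

definition is_cocycle ::
  "('r, 'z) ring_scheme \<Rightarrow> ('r, 'k) module \<Rightarrow> ('r, 'f, 'x) resolution \<Rightarrow> nat \<Rightarrow> ('f \<Rightarrow> 'k) \<Rightarrow> bool" where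
  "is_cocycle R K F n f \<longleftrightarrow> f \<in> mod_hom R (cmod F n) K \<and>
     (\<forall>x\<in>carrier (cmod F (Suc n)). f (diff F n x) = \<zero>\<^bsub>K\<^esub>)"

text \<open>No differential leads into degree 0 of the cochain complex, so there the relation is
  agreement on the carrier.\<close>

definition cohomologous ::
  "('r, 'z) ring_scheme \<Rightarrow> ('r, 'k) module \<Rightarrow> ('r, 'f, 'x) resolution \<Rightarrow> nat \<Rightarrow>
   ('f \<Rightarrow> 'k) \<Rightarrow> ('f \<Rightarrow> 'k) \<Rightarrow> bool" where
  "cohomologous R K F n f f' \<longleftrightarrow> (case n of
       0 \<Rightarrow> \<forall>x\<in>carrier (cmod F 0). f x = f' x
     | Suc m \<Rightarrow> \<exists>g\<in>mod_hom R (cmod F m) K. \<forall>x\<in>carrier (cmod F (Suc m)). f x = f' x \<oplus>\<^bsub>K\<^esub> g (diff F m x))"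

lemma is_cocycle_mod_hom: "is_cocycle R K F n f \<Longrightarrow> f \<in> mod_hom R (cmod F n) K"
  by (simp add: is_cocycle_def)

lemma is_cocycle_diff:
  "\<lbrakk>is_cocycle R K F n f; x \<in> carrier (cmod F (Suc n))\<rbrakk> \<Longrightarrow> f (diff F n x) = \<zero>\<^bsub>K\<^esub>"
  by (simp add: is_cocycle_def)

lemma is_cocycle_closed:
  "\<lbrakk>is_cocycle R K F n f; x \<in> carrier (cmod F n)\<rbrakk> \<Longrightarrow> f x \<in> carrier K"
  by (rule mod_hom_closed[OF is_cocycle_mod_hom])

locale ext_data =
  fixes R :: "('r, 'z) ring_scheme" and K :: "('r, 'k) module" and X :: "('r, 'x) module"
    and F :: "('r, 'f, 'x) resolution"
  assumes K: "left_module R K" and F: "free_resolution R X F"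
begin

interpretation K: left_module R K by (rule K)

lemma is_cocycle_add:
  "\<lbrakk>is_cocycle R K F n f; is_cocycle R K F n g\<rbrakk> \<Longrightarrow> is_cocycle R K F n (\<lambda>x. f x \<oplus>\<^bsub>K\<^esub> g x)"
  by (simp add: is_cocycle_def mod_hom_sum K)

lemma is_cocycle_uminus: "is_cocycle R K F n f \<Longrightarrow> is_cocycle R K F n (\<lambda>x. \<ominus>\<^bsub>K\<^esub> f x)"
  by (simp add: is_cocycle_def mod_hom_uminus K)

lemma is_cocycle_zero: "is_cocycle R K F n (\<lambda>x. \<zero>\<^bsub>K\<^esub>)"
  by (simp add: is_cocycle_def mod_hom_zero_map K)

lemma is_cocycle_cong:
  assumes "is_cocycle R K F n f" "\<And>x. x \<in> carrier (cmod F n) \<Longrightarrow> f x = g x"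
  shows "is_cocycle R K F n g"
  using assms mod_hom_cong[of f R "cmod F n" K g] diff_closed[OF F, of _ n] free_resolution_cmod[OF F]
  by (auto simp: is_cocycle_def)

lemma is_cocycle_coboundary:
  "g \<in> mod_hom R (cmod F n) K \<Longrightarrow> is_cocycle R K F (Suc n) (g \<circ> diff F n)"
  using mod_hom_comp[OF free_resolution_diff[OF F]] diff_diff[OF F]
    mod_hom_zero[OF _ free_resolution_cmod[OF F] K]
  by (simp add: is_cocycle_def)

lemma cocycles_iff:
  "f \<in> cocycles R K F n \<longleftrightarrow> is_cocycle R K F n f \<and> f \<in> extensional (carrier (cmod F n))"
  by (auto simp: cocycles_def is_cocycle_def hom_group_def)

lemma restrict_cocycles:
  "is_cocycle R K F n f \<Longrightarrow> restrict f (carrier (cmod F n)) \<in> cocycles R K F n"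
  by (auto simp: cocycles_iff intro: is_cocycle_cong)

lemma cocycle_group_simps [simp]:
  "carrier (cocycle_group R K F n) = cocycles R K F n"
  "f \<otimes>\<^bsub>cocycle_group R K F n\<^esub> g = (\<lambda>x\<in>carrier (cmod F n). f x \<oplus>\<^bsub>K\<^esub> g x)"
  "\<one>\<^bsub>cocycle_group R K F n\<^esub> = (\<lambda>x\<in>carrier (cmod F n). \<zero>\<^bsub>K\<^esub>)"
  by (auto simp: cocycle_group_def hom_group_def)

lemma comm_group_cocycle_group: "comm_group (cocycle_group R K F n)"
proof (rule comm_groupI; (simp only: cocycle_group_simps)?)
  show "(\<lambda>x\<in>carrier (cmod F n). f x \<oplus>\<^bsub>K\<^esub> g x) \<in> cocycles R K F n"
    if "f \<in> cocycles R K F n" "g \<in> cocycles R K F n" for f g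
    using that by (intro restrict_cocycles is_cocycle_add) (auto simp: cocycles_iff)
  show "(\<lambda>x\<in>carrier (cmod F n). \<zero>\<^bsub>K\<^esub>) \<in> cocycles R K F n"
    by (intro restrict_cocycles is_cocycle_zero)
  show "(\<lambda>x\<in>carrier (cmod F n). (\<lambda>x\<in>carrier (cmod F n). f x \<oplus>\<^bsub>K\<^esub> g x) x \<oplus>\<^bsub>K\<^esub> h x) =
      (\<lambda>x\<in>carrier (cmod F n). f x \<oplus>\<^bsub>K\<^esub> (\<lambda>x\<in>carrier (cmod F n). g x \<oplus>\<^bsub>K\<^esub> h x) x)"
    if "f \<in> cocycles R K F n" "g \<in> cocycles R K F n" "h \<in> cocycles R K F n" for f g h
    using that by (intro restrict_ext) (auto simp: cocycles_iff is_cocycle_closed K.M.a_assoc)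
  show "(\<lambda>x\<in>carrier (cmod F n). f x \<oplus>\<^bsub>K\<^esub> g x) = (\<lambda>x\<in>carrier (cmod F n). g x \<oplus>\<^bsub>K\<^esub> f x)"
    if "f \<in> cocycles R K F n" "g \<in> cocycles R K F n" for f g
    using that by (intro restrict_ext) (auto simp: cocycles_iff is_cocycle_closed K.M.a_comm)
  show "(\<lambda>x\<in>carrier (cmod F n). (\<lambda>x\<in>carrier (cmod F n). \<zero>\<^bsub>K\<^esub>) x \<oplus>\<^bsub>K\<^esub> f x) = f"
    if "f \<in> cocycles R K F n" for f
    using that by (intro extensionalityI[of _ "carrier (cmod F n)"]) (auto simp: cocycles_iff is_cocycle_closed)
  show "\<exists>g\<in>cocycles R K F n. (\<lambda>x\<in>carrier (cmod F n). g x \<oplus>\<^bsub>K\<^esub> f x) = (\<lambda>x\<in>carrier (cmod F n). \<zero>\<^bsub>K\<^esub>)"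
    if "f \<in> cocycles R K F n" for f
  proof (rule bexI)
    have f: "is_cocycle R K F n f" using that by (simp add: cocycles_iff)
    show "(\<lambda>x\<in>carrier (cmod F n). \<ominus>\<^bsub>K\<^esub> f x) \<in> cocycles R K F n"
      by (intro restrict_cocycles is_cocycle_uminus f)
    show "(\<lambda>x\<in>carrier (cmod F n). (\<lambda>x\<in>carrier (cmod F n). \<ominus>\<^bsub>K\<^esub> f x) x \<oplus>\<^bsub>K\<^esub> f x) =
        (\<lambda>x\<in>carrier (cmod F n). \<zero>\<^bsub>K\<^esub>)"
      by (rule restrict_ext) (simp add: is_cocycle_closed[OF f] K.M.l_neg)
  qed
qed

lemma inv_cocycle_group:
  assumes "f \<in> cocycles R K F n"
  shows "inv\<^bsub>cocycle_group R K F n\<^esub> f = (\<lambda>x\<in>carrier (cmod F n). \<ominus>\<^bsub>K\<^esub> f x)"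
proof -
  interpret Z: comm_group "cocycle_group R K F n" by (rule comm_group_cocycle_group)
  have f: "is_cocycle R K F n f" using assms by (simp add: cocycles_iff)
  have "(\<lambda>x\<in>carrier (cmod F n). (\<lambda>x\<in>carrier (cmod F n). \<ominus>\<^bsub>K\<^esub> f x) x \<oplus>\<^bsub>K\<^esub> f x) =
      (\<lambda>x\<in>carrier (cmod F n). \<zero>\<^bsub>K\<^esub>)"
    by (rule restrict_ext) (simp add: is_cocycle_closed[OF f] K.M.l_neg)
  then show ?thesis
    by (intro Z.inv_equality) (simp_all add: assms restrict_cocycles is_cocycle_uminus f)
qed

text \<open>Puts the two clauses of the recursion into one criterion. In positive degree the
  bounding cochain has to be cut down to an extensional map, which changes nothing on the image of
  the differential.\<close>

lemma coboundaries_iff: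
  "b \<in> coboundaries R K F n \<longleftrightarrow> b \<in> cocycles R K F n \<and> cohomologous R K F n b (\<lambda>x. \<zero>\<^bsub>K\<^esub>)"
proof (cases n)
  case 0
  show ?thesis
  proof
    assume "b \<in> coboundaries R K F n"
    then have "b = (\<lambda>x\<in>carrier (cmod F 0). \<zero>\<^bsub>K\<^esub>)" using 0 by (simp add: hom_group_def)
    then show "b \<in> cocycles R K F n \<and> cohomologous R K F n b (\<lambda>x. \<zero>\<^bsub>K\<^esub>)"
      using restrict_cocycles[OF is_cocycle_zero, of 0] 0 by (simp add: cohomologous_def)
  next
    assume b: "b \<in> cocycles R K F n \<and> cohomologous R K F n b (\<lambda>x. \<zero>\<^bsub>K\<^esub>)"
    have "b = (\<lambda>x\<in>carrier (cmod F 0). \<zero>\<^bsub>K\<^esub>)"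
      by (rule extensionalityI[of _ "carrier (cmod F 0)"]) (use b 0 in \<open>auto simp: cocycles_iff cohomologous_def\<close>)
    then show "b \<in> coboundaries R K F n" using 0 by (simp add: hom_group_def)
  qed
next
  case (Suc m)
  show ?thesis
  proof
    assume "b \<in> coboundaries R K F n"
    then obtain g where g: "g \<in> mod_hom R (cmod F m) K"
      "b = restrict (g \<circ> diff F m) (carrier (cmod F (Suc m)))" using Suc by (auto simp: hom_group_def)
    then show "b \<in> cocycles R K F n \<and> cohomologous R K F n b (\<lambda>x. \<zero>\<^bsub>K\<^esub>)"
      using Suc restrict_cocycles[OF is_cocycle_coboundary[OF g(1)]] diff_closed[OF F, of _ m]
      by (auto simp: cohomologous_def mod_hom_closed[OF g(1)] intro!: bexI[OF _ g(1)])
  next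
    assume b: "b \<in> cocycles R K F n \<and> cohomologous R K F n b (\<lambda>x. \<zero>\<^bsub>K\<^esub>)"
    then obtain g where g: "g \<in> mod_hom R (cmod F m) K"
      "\<And>x. x \<in> carrier (cmod F (Suc m)) \<Longrightarrow> b x = \<zero>\<^bsub>K\<^esub> \<oplus>\<^bsub>K\<^esub> g (diff F m x)"
      using Suc by (auto simp: cohomologous_def)
    let ?g = "restrict g (carrier (cmod F m))"
    have "b = restrict (?g \<circ> diff F m) (carrier (cmod F (Suc m)))"
      by (rule extensionalityI[of _ "carrier (cmod F (Suc m))"])
        (use b g Suc diff_closed[OF F] mod_hom_closed[OF g(1)] in \<open>auto simp: cocycles_iff\<close>)
    moreover have "?g \<in> carrier (hom_group R (cmod F m) K)"
      using mod_hom_cong[OF g(1), of ?g] free_resolution_cmod[OF F] by (simp add: hom_group_def)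
    ultimately show "b \<in> coboundaries R K F n" using Suc by auto
  qed
qed

declare coboundaries.simps [simp del]

lemma cohomologous_iff_minus:
  assumes "is_cocycle R K F n f" "is_cocycle R K F n f'"
  shows "cohomologous R K F n (\<lambda>x. f x \<oplus>\<^bsub>K\<^esub> \<ominus>\<^bsub>K\<^esub> f' x) (\<lambda>x. \<zero>\<^bsub>K\<^esub>) \<longleftrightarrow> cohomologous R K F n f f'"
proof (cases n)
  case 0
  then show ?thesis
    using K.M.minus_eq_zero_iff is_cocycle_closed[OF assms(1)] is_cocycle_closed[OF assms(2)]
    by (simp add: cohomologous_def a_minus_def)
next
  case (Suc m)
  have *: "f x \<oplus>\<^bsub>K\<^esub> \<ominus>\<^bsub>K\<^esub> f' x = \<zero>\<^bsub>K\<^esub> \<oplus>\<^bsub>K\<^esub> g (diff F m x) \<longleftrightarrow> f x = f' x \<oplus>\<^bsub>K\<^esub> g (diff F m x)"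
    if "g \<in> mod_hom R (cmod F m) K" "x \<in> carrier (cmod F (Suc m))" for g x
    using is_cocycle_closed[OF assms(1)] is_cocycle_closed[OF assms(2)] Suc that
      mod_hom_closed[OF that(1)] diff_closed[OF F, of x m] K.M.minus_eq_iff_eq_add[of "f x" "f' x" "g (diff F m x)"]
    by (simp add: a_minus_def K.M.a_comm)
  show ?thesis using Suc * by (auto simp: cohomologous_def)
qed

lemma subgroup_coboundaries: "subgroup (coboundaries R K F n) (cocycle_group R K F n)"
proof -
  interpret Z: comm_group "cocycle_group R K F n" by (rule comm_group_cocycle_group)
  show ?thesis
  proof (rule Z.subgroupI)
    show "coboundaries R K F n \<subseteq> carrier (cocycle_group R K F n)" by (auto simp: coboundaries_iff)
    have "\<one>\<^bsub>cocycle_group R K F n\<^esub> \<in> coboundaries R K F n"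
      using mod_hom_zero_map[OF K]
      by (auto simp: coboundaries_iff cohomologous_def intro!: restrict_cocycles is_cocycle_zero
          bexI[of _ "\<lambda>x. \<zero>\<^bsub>K\<^esub>"] split: nat.split)
    then show "coboundaries R K F n \<noteq> {}" by (metis empty_iff)
  next
    fix b assume b: "b \<in> coboundaries R K F n"
    then have "is_cocycle R K F n b" by (simp add: coboundaries_iff cocycles_iff)
    moreover have "cohomologous R K F n (\<lambda>x\<in>carrier (cmod F n). \<ominus>\<^bsub>K\<^esub> b x) (\<lambda>x. \<zero>\<^bsub>K\<^esub>)"
    proof (cases n)
      case 0
      then show ?thesis using b by (simp add: coboundaries_iff cohomologous_def)
    next
      case (Suc m)
      with b obtain g where g: "g \<in> mod_hom R (cmod F m) K"
        "\<And>x. x \<in> carrier (cmod F (Suc m)) \<Longrightarrow> b x = \<zero>\<^bsub>K\<^esub> \<oplus>\<^bsub>K\<^esub> g (diff F m x)"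
        by (auto simp: coboundaries_iff cohomologous_def)
      then show ?thesis using Suc mod_hom_uminus[OF g(1) K] mod_hom_closed[OF g(1)] diff_closed[OF F, of _ m]
        by (auto simp: cohomologous_def intro!: bexI[of _ "\<lambda>x. \<ominus>\<^bsub>K\<^esub> g x"])
    qed
    ultimately show "inv\<^bsub>cocycle_group R K F n\<^esub> b \<in> coboundaries R K F n"
      using b by (auto simp: coboundaries_iff inv_cocycle_group intro!: restrict_cocycles is_cocycle_uminus)
  next
    fix a b assume ab: "a \<in> coboundaries R K F n" "b \<in> coboundaries R K F n"
    then have "is_cocycle R K F n a" "is_cocycle R K F n b" by (auto simp: coboundaries_iff cocycles_iff)
    moreover have "cohomologous R K F n (\<lambda>x\<in>carrier (cmod F n). a x \<oplus>\<^bsub>K\<^esub> b x) (\<lambda>x. \<zero>\<^bsub>K\<^esub>)"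
    proof (cases n)
      case 0
      then show ?thesis using ab by (simp add: coboundaries_iff cohomologous_def)
    next
      case (Suc m)
      with ab obtain g g' where g: "g \<in> mod_hom R (cmod F m) K"
        "\<And>x. x \<in> carrier (cmod F (Suc m)) \<Longrightarrow> a x = \<zero>\<^bsub>K\<^esub> \<oplus>\<^bsub>K\<^esub> g (diff F m x)"
        and g': "g' \<in> mod_hom R (cmod F m) K"
        "\<And>x. x \<in> carrier (cmod F (Suc m)) \<Longrightarrow> b x = \<zero>\<^bsub>K\<^esub> \<oplus>\<^bsub>K\<^esub> g' (diff F m x)"
        by (auto simp: coboundaries_iff cohomologous_def)
      then show ?thesis using Suc mod_hom_sum[OF g(1) g'(1) K] mod_hom_closed[OF g(1)]
          mod_hom_closed[OF g'(1)] diff_closed[OF F, of _ m]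
        by (auto simp: cohomologous_def intro!: bexI[of _ "\<lambda>x. g x \<oplus>\<^bsub>K\<^esub> g' x"])
    qed
    ultimately show "a \<otimes>\<^bsub>cocycle_group R K F n\<^esub> b \<in> coboundaries R K F n"
      by (auto simp: coboundaries_iff intro!: restrict_cocycles is_cocycle_add)
  qed
qed

lemma normal_coboundaries: "coboundaries R K F n \<lhd> cocycle_group R K F n"
  by (rule comm_group.subgroup_imp_normal[OF comm_group_cocycle_group subgroup_coboundaries])

lemma comm_group_ext_group: "comm_group (ext_group R K F n)"
  unfolding ext_group_def
  by (rule comm_group.abelian_FactGroup[OF comm_group_cocycle_group subgroup_coboundaries])

text \<open>Equality of cosets means that the difference of the representatives is a coboundary;
  this is the form in which classes are compared below.\<close>

lemma ext_class_eq_iff: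
  assumes f: "is_cocycle R K F n f" and f': "is_cocycle R K F n f'"
  shows "ext_class R K F n f = ext_class R K F n f' \<longleftrightarrow> cohomologous R K F n f f'"
proof -
  interpret Z: comm_group "cocycle_group R K F n" by (rule comm_group_cocycle_group)
  let ?B = "coboundaries R K F n" and ?Z = "cocycle_group R K F n"
  let ?f = "restrict f (carrier (cmod F n))" and ?f' = "restrict f' (carrier (cmod F n))"
  note r = restrict_cocycles[OF f] restrict_cocycles[OF f']
  have "?B #>\<^bsub>?Z\<^esub> ?f = ?B #>\<^bsub>?Z\<^esub> ?f' \<longleftrightarrow> ?f \<in> ?B #>\<^bsub>?Z\<^esub> ?f'"
    using Z.rcos_self[OF _ subgroup_coboundaries, of ?f] Z.repr_independence[OF _ _ subgroup_coboundaries, of ?f ?f'] r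
    by auto
  also have "\<dots> \<longleftrightarrow> ?f \<otimes>\<^bsub>?Z\<^esub> inv\<^bsub>?Z\<^esub> ?f' \<in> ?B"
    using subgroup.rcos_module[OF subgroup_coboundaries Z.is_group, of ?f' ?f] r by simp
  also have "?f \<otimes>\<^bsub>?Z\<^esub> inv\<^bsub>?Z\<^esub> ?f' = (\<lambda>x\<in>carrier (cmod F n). f x \<oplus>\<^bsub>K\<^esub> \<ominus>\<^bsub>K\<^esub> f' x)"
    by (auto simp: inv_cocycle_group[OF r(2)] intro!: restrict_ext)
  also have "\<dots> \<in> ?B \<longleftrightarrow> cohomologous R K F n (\<lambda>x. f x \<oplus>\<^bsub>K\<^esub> \<ominus>\<^bsub>K\<^esub> f' x) (\<lambda>x. \<zero>\<^bsub>K\<^esub>)"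
    using restrict_cocycles[OF is_cocycle_add[OF f is_cocycle_uminus[OF f']]]
    by (auto simp: coboundaries_iff cohomologous_def split: nat.splits)
  also have "\<dots> \<longleftrightarrow> cohomologous R K F n f f'" by (rule cohomologous_iff_minus[OF f f'])
  finally show ?thesis unfolding ext_class_def .
qed

lemma ext_class_cong:
  "(\<And>x. x \<in> carrier (cmod F n) \<Longrightarrow> f x = g x) \<Longrightarrow> ext_class R K F n f = ext_class R K F n g"
  by (simp add: ext_class_def cong: restrict_cong)

lemma ext_class_coboundary:
  assumes "is_cocycle R K F (Suc n) f" "is_cocycle R K F (Suc n) f'" "g \<in> mod_hom R (cmod F n) K"
    and "\<And>x. x \<in> carrier (cmod F (Suc n)) \<Longrightarrow> f x = f' x \<oplus>\<^bsub>K\<^esub> g (diff F n x)"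
  shows "ext_class R K F (Suc n) f = ext_class R K F (Suc n) f'"
  unfolding ext_class_eq_iff[OF assms(1,2)] cohomologous_def using assms(3,4) by auto

lemma ext_class_carrier:
  "is_cocycle R K F n f \<Longrightarrow> ext_class R K F n f \<in> carrier (ext_group R K F n)"
  unfolding ext_group_def carrier_FactGroup ext_class_def cocycle_group_simps
  by (intro imageI restrict_cocycles)

lemma ext_group_cases:
  assumes "a \<in> carrier (ext_group R K F n)"
  obtains f where "is_cocycle R K F n f" "a = ext_class R K F n f"
proof -
  from assms obtain f where f: "f \<in> cocycles R K F n" "a = coboundaries R K F n #>\<^bsub>cocycle_group R K F n\<^esub> f"
    by (auto simp: ext_group_def carrier_FactGroup)
  then have "a = ext_class R K F n f" by (simp add: ext_class_def extensional_restrict cocycles_iff)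
  with f show thesis by (intro that[of f]) (simp_all add: cocycles_iff)
qed

text \<open>\<open>yoneda\<close> and \<open>ext_map_deg\<close> range over all elements of a class.
  Each of these is recognised here as a cocycle that represents the same class.\<close>

lemma ext_class_member:
  assumes f0: "is_cocycle R K F n f0" and "f \<in> ext_class R K F n f0"
  shows "is_cocycle R K F n f" "ext_class R K F n f = ext_class R K F n f0"
proof -
  interpret Z: comm_group "cocycle_group R K F n" by (rule comm_group_cocycle_group)
  let ?B = "coboundaries R K F n" and ?Z = "cocycle_group R K F n"
  have "f \<in> ?B #>\<^bsub>?Z\<^esub> restrict f0 (carrier (cmod F n))" using assms(2) by (simp add: ext_class_def)
  moreover from this have "f \<in> cocycles R K F n"
    using Z.r_coset_subset_G[of ?B "restrict f0 (carrier (cmod F n))"] restrict_cocycles[OF f0]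
      subgroup.subset[OF subgroup_coboundaries] by auto
  ultimately have f: "f \<in> ?B #>\<^bsub>?Z\<^esub> restrict f0 (carrier (cmod F n))" "f \<in> cocycles R K F n" by simp_all
  then show "is_cocycle R K F n f" by (simp add: cocycles_iff)
  have "restrict f (carrier (cmod F n)) = f"
    by (rule extensional_restrict) (use f(2) in \<open>simp add: cocycles_iff\<close>)
  moreover have "?B #>\<^bsub>?Z\<^esub> restrict f0 (carrier (cmod F n)) = ?B #>\<^bsub>?Z\<^esub> f"
    by (rule Z.repr_independence[OF f(1) _ subgroup_coboundaries])
      (simp add: restrict_cocycles[OF f0] del: restrict_apply)
  ultimately show "ext_class R K F n f = ext_class R K F n f0" by (simp only: ext_class_def)
qed

lemma ext_class_self: "is_cocycle R K F n f \<Longrightarrow> restrict f (carrier (cmod F n)) \<in> ext_class R K F n f"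
proof -
  interpret Z: comm_group "cocycle_group R K F n" by (rule comm_group_cocycle_group)
  assume "is_cocycle R K F n f"
  then have "restrict f (carrier (cmod F n)) \<in> carrier (cocycle_group R K F n)"
    unfolding cocycle_group_simps by (rule restrict_cocycles)
  from Z.rcos_self[OF this subgroup_coboundaries] show ?thesis unfolding ext_class_def .
qed

lemma ext_class_mult:
  assumes "is_cocycle R K F n f" "is_cocycle R K F n g"
  shows "ext_class R K F n f \<otimes>\<^bsub>ext_group R K F n\<^esub> ext_class R K F n g =
    ext_class R K F n (\<lambda>x. f x \<oplus>\<^bsub>K\<^esub> g x)"
proof -
  have "(\<lambda>x\<in>carrier (cmod F n). restrict f (carrier (cmod F n)) x \<oplus>\<^bsub>K\<^esub> restrict g (carrier (cmod F n)) x) =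
      (\<lambda>x\<in>carrier (cmod F n). f x \<oplus>\<^bsub>K\<^esub> g x)"
    by (rule restrict_ext) simp
  then show ?thesis
    using normal.rcos_sum[OF normal_coboundaries, of "restrict f (carrier (cmod F n))" n
        "restrict g (carrier (cmod F n))"] restrict_cocycles[OF assms(1)] restrict_cocycles[OF assms(2)]
    by (simp only: ext_group_def ext_class_def mult_FactGroup cocycle_group_simps)
qed

lemma ext_class_one: "\<one>\<^bsub>ext_group R K F n\<^esub> = ext_class R K F n (\<lambda>x. \<zero>\<^bsub>K\<^esub>)"
proof -
  interpret Z: comm_group "cocycle_group R K F n" by (rule comm_group_cocycle_group)
  show ?thesis
    using Z.coset_mult_one[OF subgroup.subset[OF subgroup_coboundaries]]
    by (simp add: ext_group_def ext_class_def)
qed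

end

section \<open>Composition products\<close>

lemma chain_lifts_cocycle:
  assumes K: "left_module R K" and F: "free_resolution R X F" and G: "free_resolution R Y G"
    and h: "h \<in> chain_lifts R F j G f" and a: "is_cocycle R K G i a"
  shows "is_cocycle R K F (j + i) (a \<circ> h i)"
  unfolding is_cocycle_def
proof
  show "a \<circ> h i \<in> mod_hom R (cmod F (j + i)) K"
    by (rule mod_hom_comp[OF chain_lifts_mod_hom[OF h] is_cocycle_mod_hom[OF a]])
  show "\<forall>x\<in>carrier (cmod F (Suc (j + i))). (a \<circ> h i) (diff F (j + i) x) = \<zero>\<^bsub>K\<^esub>"
    using chain_lifts_diff[OF h] mod_hom_closed[OF chain_lifts_mod_hom[OF h, of "Suc i"]]
      is_cocycle_diff[OF a] by (metis add_Suc_right comp_apply)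
qed

lemma chain_lifts_cong:
  "\<lbrakk>h \<in> chain_lifts R F j G f; \<And>x. x \<in> carrier (cmod F j) \<Longrightarrow> f x = f' x\<rbrakk> \<Longrightarrow> h \<in> chain_lifts R F j G f'"
  by (simp add: chain_lifts_def)

text \<open>Since \<open>k\<close> starts at \<open>cmod G l\<close>, the component of
  \<open>h\<close> that it meets has index \<open>l + m\<close>. Associativity of the Yoneda product
  and its compatibility with induced maps both rest on this.\<close>

lemma chain_lifts_comp:
  assumes h: "h \<in> chain_lifts R F j G f" and k: "k \<in> chain_lifts R G l L b"
  shows "(\<lambda>m. k m \<circ> h (l + m)) \<in> chain_lifts R F (j + l) L (b \<circ> h l)"
  unfolding chain_lifts_def
proof (intro CollectI conjI allI ballI)
  show "k m \<circ> h (l + m) \<in> mod_hom R (cmod F (j + l + m)) (cmod L m)" for m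
    using mod_hom_comp[OF chain_lifts_mod_hom[OF h, of "l + m"] chain_lifts_mod_hom[OF k, of m]]
    by (simp add: add.assoc)
  show "aug L ((k 0 \<circ> h (l + 0)) x) = (b \<circ> h l) x" if "x \<in> carrier (cmod F (j + l))" for x
    using chain_lifts_aug[OF k] mod_hom_closed[OF chain_lifts_mod_hom[OF h, of l] that] by simp
  show "diff L m ((k (Suc m) \<circ> h (l + Suc m)) x) = (k m \<circ> h (l + m)) (diff F (j + l + m) x)"
    if "x \<in> carrier (cmod F (Suc (j + l + m)))" for m x
    using chain_lifts_diff[OF k, of "h (Suc (l + m)) x" m] that
      mod_hom_closed[OF chain_lifts_mod_hom[OF h, of "Suc (l + m)"], of x]
      chain_lifts_diff[OF h, of x "l + m"]
    by (simp add: add.assoc)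
qed

lemma chain_lifts_sum:
  assumes G: "free_resolution R Y G"
    and h: "h \<in> chain_lifts R F j G f" and h': "h' \<in> chain_lifts R F j G f'" and F: "free_resolution R X F"
  shows "(\<lambda>m x. h m x \<oplus>\<^bsub>cmod G m\<^esub> h' m x) \<in> chain_lifts R F j G (\<lambda>x. f x \<oplus>\<^bsub>Y\<^esub> f' x)"
  unfolding chain_lifts_def
proof (intro CollectI conjI allI ballI)
  note cl = mod_hom_closed[OF chain_lifts_mod_hom[OF h]] mod_hom_closed[OF chain_lifts_mod_hom[OF h']]
  show "(\<lambda>x. h m x \<oplus>\<^bsub>cmod G m\<^esub> h' m x) \<in> mod_hom R (cmod F (j + m)) (cmod G m)" for m
    by (rule mod_hom_sum[OF chain_lifts_mod_hom[OF h] chain_lifts_mod_hom[OF h'] free_resolution_cmod[OF G]])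
  show "aug G (h 0 x \<oplus>\<^bsub>cmod G 0\<^esub> h' 0 x) = f x \<oplus>\<^bsub>Y\<^esub> f' x" if "x \<in> carrier (cmod F j)" for x
    using mod_hom_add[OF free_resolution_aug[OF G] cl(1)[of x 0] cl(2)[of x 0]] that
      chain_lifts_aug[OF h that] chain_lifts_aug[OF h' that] by simp
  show "diff G m (h (Suc m) x \<oplus>\<^bsub>cmod G (Suc m)\<^esub> h' (Suc m) x) =
      h m (diff F (j + m) x) \<oplus>\<^bsub>cmod G m\<^esub> h' m (diff F (j + m) x)"
    if "x \<in> carrier (cmod F (Suc (j + m)))" for m x
    using mod_hom_add[OF free_resolution_diff[OF G] cl(1)[of x "Suc m"] cl(2)[of x "Suc m"]] that
      chain_lifts_diff[OF h that] chain_lifts_diff[OF h' that] by simp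
qed

lemma chain_lifts_id: "(\<lambda>m x. x) \<in> chain_lifts R F 0 F f"
  if "free_resolution R X F" "\<And>x. x \<in> carrier (cmod F 0) \<Longrightarrow> aug F x = f x"
  using that by (simp add: chain_lifts_def mod_hom_id)

text \<open>In a homotopy \<open>h = h' + d s + s d\<close> the cocycle \<open>a\<close> kills
  \<open>d s\<close>, and \<open>a s d\<close> is the coboundary of \<open>a s\<close>. For
  \<open>i = 0\<close> the term \<open>s d\<close> is absent and the two cocycles coincide.\<close>

lemma chain_lifts_class_eq:
  assumes K: "left_module R K" and F: "free_resolution R X F" and G: "free_resolution R Y G"
    and h: "h \<in> chain_lifts R F j G f" and h': "h' \<in> chain_lifts R F j G f" and a: "is_cocycle R K G i a"
  shows "ext_class R K F (j + i) (a \<circ> h i) = ext_class R K F (j + i) (a \<circ> h' i)"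
proof -
  interpret F: ext_data R K X F by (rule ext_data.intro[OF K F])
  interpret K: left_module R K by (rule K)
  note am = is_cocycle_mod_hom[OF a]
  note cl = mod_hom_closed[OF chain_lifts_mod_hom[OF h']]
  from chain_lifts_homotopic[OF F G h h']
  obtain s where s: "\<And>m. s m \<in> mod_hom R (cmod F (j + m)) (cmod G (Suc m))"
    "\<And>x. x \<in> carrier (cmod F j) \<Longrightarrow> h 0 x = h' 0 x \<oplus>\<^bsub>cmod G 0\<^esub> diff G 0 (s 0 x)"
    "\<And>m x. x \<in> carrier (cmod F (Suc (j + m))) \<Longrightarrow> h (Suc m) x =
      h' (Suc m) x \<oplus>\<^bsub>cmod G (Suc m)\<^esub> diff G (Suc m) (s (Suc m) x) \<oplus>\<^bsub>cmod G (Suc m)\<^esub> s m (diff F (j + m) x)"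
    by metis
  show ?thesis
  proof (cases i)
    case 0
    have "a (h 0 x) = a (h' 0 x)" if x: "x \<in> carrier (cmod F j)" for x
    proof -
      have sx: "s 0 x \<in> carrier (cmod G (Suc 0))" using mod_hom_closed[OF s(1)[of 0]] x by simp
      have "a (h 0 x) = a (h' 0 x) \<oplus>\<^bsub>K\<^esub> a (diff G 0 (s 0 x))"
        using mod_hom_add[OF am] cl[of x 0] diff_closed[OF G sx] x 0 s(2)[OF x] by simp
      then show ?thesis
        using is_cocycle_diff[OF a] sx 0 mod_hom_closed[OF am] cl[of x 0] x by simp
    qed
    then show ?thesis using 0 by (intro F.ext_class_cong) simp
  next
    case (Suc m)
    have "a (h (Suc m) x) = a (h' (Suc m) x) \<oplus>\<^bsub>K\<^esub> (a \<circ> s m) (diff F (j + m) x)"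
      if x: "x \<in> carrier (cmod F (Suc (j + m)))" for x
    proof -
      interpret G: left_module R "cmod G (Suc m)" by (rule free_resolution_cmod[OF G])
      have sx: "s (Suc m) x \<in> carrier (cmod G (Suc (Suc m)))" using mod_hom_closed[OF s(1)[of "Suc m"]] x by simp
      have c: "h' (Suc m) x \<in> carrier (cmod G (Suc m))" using cl[of x "Suc m"] x by simp
      have d: "diff G (Suc m) (s (Suc m) x) \<in> carrier (cmod G (Suc m))" by (rule diff_closed[OF G sx])
      have e: "s m (diff F (j + m) x) \<in> carrier (cmod G (Suc m))"
        by (rule mod_hom_closed[OF s(1) diff_closed[OF F x]])
      have "a (diff G (Suc m) (s (Suc m) x)) = \<zero>\<^bsub>K\<^esub>" using is_cocycle_diff[OF a] sx Suc by simp
      moreover have "a (h' (Suc m) x \<oplus>\<^bsub>cmod G (Suc m)\<^esub> diff G (Suc m) (s (Suc m) x) \<oplus>\<^bsub>cmod G (Suc m)\<^esub> s m (diff F (j + m) x)) =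
          a (h' (Suc m) x) \<oplus>\<^bsub>K\<^esub> a (diff G (Suc m) (s (Suc m) x)) \<oplus>\<^bsub>K\<^esub> a (s m (diff F (j + m) x))"
        using mod_hom_add[OF am[unfolded Suc]] c d e by simp
      ultimately show ?thesis using mod_hom_closed[OF am[unfolded Suc] c] by (simp add: s(3)[OF x])
    qed
    moreover have "a \<circ> s m \<in> mod_hom R (cmod F (j + m)) K"
      using mod_hom_comp[OF s(1)[of m]] am Suc by simp
    moreover note chain_lifts_cocycle[OF K F G h a] chain_lifts_cocycle[OF K F G h' a]
    ultimately show ?thesis
      using F.ext_class_coboundary[of "j + m" "a \<circ> h (Suc m)" "a \<circ> h' (Suc m)" "a \<circ> s m"] Suc by simp
  qed
qed

text \<open>If \<open>a - a' = g d\<close>, composing with \<open>h\<close> gives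
  \<open>g d h = (g h) d\<close>, again a coboundary.\<close>

lemma chain_lifts_class_eq_left:
  assumes K: "left_module R K" and F: "free_resolution R X F" and G: "free_resolution R Y G"
    and h: "h \<in> chain_lifts R F j G f" and a: "is_cocycle R K G i a" "is_cocycle R K G i a'"
    and aa': "cohomologous R K G i a a'"
  shows "ext_class R K F (j + i) (a \<circ> h i) = ext_class R K F (j + i) (a' \<circ> h i)"
proof -
  interpret F: ext_data R K X F by (rule ext_data.intro[OF K F])
  note cl = mod_hom_closed[OF chain_lifts_mod_hom[OF h]]
  show ?thesis
  proof (cases i)
    case 0
    then show ?thesis using aa' cl[of _ 0] by (intro F.ext_class_cong) (simp add: cohomologous_def)
  next
    case (Suc m)
    then obtain g where g: "g \<in> mod_hom R (cmod G m) K"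
      "\<And>x. x \<in> carrier (cmod G (Suc m)) \<Longrightarrow> a x = a' x \<oplus>\<^bsub>K\<^esub> g (diff G m x)"
      using aa' by (auto simp: cohomologous_def)
    have "(a \<circ> h (Suc m)) x = (a' \<circ> h (Suc m)) x \<oplus>\<^bsub>K\<^esub> (g \<circ> h m) (diff F (j + m) x)"
      if "x \<in> carrier (cmod F (Suc (j + m)))" for x
      using g(2)[of "h (Suc m) x"] cl[of x "Suc m"] that chain_lifts_diff[OF h that] by simp
    then show ?thesis
      using F.ext_class_coboundary[of "j + m" "a \<circ> h (Suc m)" "a' \<circ> h (Suc m)" "g \<circ> h m"]
        mod_hom_comp[OF chain_lifts_mod_hom[OF h, of m] g(1)]
        chain_lifts_cocycle[OF K F G h a(1)] chain_lifts_cocycle[OF K F G h a(2)] Suc by simp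
  qed
qed

text \<open>If \<open>f - f' = g d\<close>, a lift \<open>t\<close> of \<open>g\<close> along
  \<open>aug G\<close> turns \<open>h'\<close> into a lift of \<open>f\<close> by adding
  \<open>t d\<close> in degree 0 only. The result is still a chain map because
  \<open>d d = 0\<close>, and its effect on the class is the coboundary of
  \<open>a t\<close>.\<close>

lemma chain_lifts_class_eq_right:
  assumes K: "left_module R K" and F: "free_resolution R X F" and G: "free_resolution R K G"
    and h: "h \<in> chain_lifts R F j G f" and h': "h' \<in> chain_lifts R F j G f'"
    and ff': "cohomologous R K F j f f'" and a: "is_cocycle R K G i a"
  shows "ext_class R K F (j + i) (a \<circ> h i) = ext_class R K F (j + i) (a \<circ> h' i)"
proof (cases j)
  case 0
  then have "h' \<in> chain_lifts R F j G f"
    using ff' by (intro chain_lifts_cong[OF h']) (simp add: cohomologous_def)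
  then show ?thesis by (rule chain_lifts_class_eq[OF K F G h _ a])
next
  case (Suc l)
  interpret F: ext_data R K X F by (rule ext_data.intro[OF K F])
  obtain g where g: "g \<in> mod_hom R (cmod F l) K"
    "\<And>x. x \<in> carrier (cmod F (Suc l)) \<Longrightarrow> f x = f' x \<oplus>\<^bsub>K\<^esub> g (diff F l x)"
    using ff' Suc by (auto simp: cohomologous_def)
  have "g ` carrier (cmod F l) \<subseteq> aug G ` carrier (cmod G 0)"
    using aug_surj[OF G] mod_hom_closed[OF g(1)] by auto
  from free_module_lift[OF free_resolution_free[OF F] free_resolution_cmod[OF G] K
    free_resolution_aug[OF G] g(1) this]
  obtain t where t: "t \<in> mod_hom R (cmod F l) (cmod G 0)"
    "\<And>x. x \<in> carrier (cmod F l) \<Longrightarrow> aug G (t x) = g x" by blast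
  let ?h = "\<lambda>m. if m = 0 then (\<lambda>x. h' 0 x \<oplus>\<^bsub>cmod G 0\<^esub> (t \<circ> diff F l) x) else h' m"
  note cl = mod_hom_closed[OF chain_lifts_mod_hom[OF h']]
  have td: "t \<circ> diff F l \<in> mod_hom R (cmod F j) (cmod G 0)"
    unfolding Suc by (rule mod_hom_comp[OF free_resolution_diff[OF F] t(1)])
  have h0: "(\<lambda>x. h' 0 x \<oplus>\<^bsub>cmod G 0\<^esub> (t \<circ> diff F l) x) \<in> mod_hom R (cmod F j) (cmod G 0)"
    by (rule mod_hom_sum[OF chain_lifts_mod_hom[OF h', of 0, unfolded add_0_right] td free_resolution_cmod[OF G]])
  have "?h \<in> chain_lifts R F j G f"
    unfolding chain_lifts_def
  proof (intro CollectI conjI allI ballI)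
    show "?h m \<in> mod_hom R (cmod F (j + m)) (cmod G m)" for m
      using h0 chain_lifts_mod_hom[OF h'] by simp
    show "aug G (?h 0 x) = f x" if x: "x \<in> carrier (cmod F j)" for x
      using mod_hom_add[OF free_resolution_aug[OF G] _ mod_hom_closed[OF td x]] cl[of x 0] x
        chain_lifts_aug[OF h' x] t(2)[OF diff_closed[OF F]] g(2) Suc by simp
    show "diff G m (?h (Suc m) x) = ?h m (diff F (j + m) x)" if x: "x \<in> carrier (cmod F (Suc (j + m)))" for m x
    proof (cases "m = 0")
      case True
      interpret G: left_module R "cmod G 0" by (rule free_resolution_cmod[OF G])
      have "diff F l (diff F j x) = \<zero>\<^bsub>cmod F l\<^esub>" using diff_diff[OF F] x Suc True by simp
      then show ?thesis
        using True chain_lifts_diff[OF h' x] mod_hom_zero[OF t(1) free_resolution_cmod[OF F] free_resolution_cmod[OF G]]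
          cl[of "diff F j x" 0] diff_closed[OF F, of x j] x by simp
    qed (use chain_lifts_diff[OF h' x] in simp)
  qed
  from chain_lifts_class_eq[OF K F G h this a]
  have "ext_class R K F (j + i) (a \<circ> h i) = ext_class R K F (j + i) (a \<circ> ?h i)" .
  also have "\<dots> = ext_class R K F (j + i) (a \<circ> h' i)"
  proof (cases "i = 0")
    case True
    have at: "a \<circ> t \<in> mod_hom R (cmod F l) K" using mod_hom_comp[OF t(1)] is_cocycle_mod_hom[OF a] True by simp
    have eq: "(a \<circ> (\<lambda>x. h' 0 x \<oplus>\<^bsub>cmod G 0\<^esub> (t \<circ> diff F l) x)) x = (a \<circ> h' 0) x \<oplus>\<^bsub>K\<^esub> (a \<circ> t) (diff F l x)"
      if "x \<in> carrier (cmod F (Suc l))" for x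
      using mod_hom_add[OF is_cocycle_mod_hom[OF a]] True cl[of x 0] mod_hom_closed[OF td] that Suc by simp
    have "ext_class R K F (Suc l) (a \<circ> (\<lambda>x. h' 0 x \<oplus>\<^bsub>cmod G 0\<^esub> (t \<circ> diff F l) x)) = ext_class R K F (Suc l) (a \<circ> h' 0)"
    proof (rule F.ext_class_coboundary)
      show "is_cocycle R K F (Suc l) (a \<circ> (\<lambda>x. h' 0 x \<oplus>\<^bsub>cmod G 0\<^esub> (t \<circ> diff F l) x))"
        using chain_lifts_cocycle[OF K F G \<open>?h \<in> _\<close> a] True Suc by simp
      show "is_cocycle R K F (Suc l) (a \<circ> h' 0)"
        using chain_lifts_cocycle[OF K F G h' a] True Suc by simp
    qed (fact at, fact eq)
    then show ?thesis using True Suc by simp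
  qed simp
  finally show ?thesis .
qed

lemma the_elem_eqI: "\<lbrakk>y \<in> A; \<And>x. x \<in> A \<Longrightarrow> x = y\<rbrakk> \<Longrightarrow> the_elem A = y"
proof -
  assume "y \<in> A" "\<And>x. x \<in> A \<Longrightarrow> x = y"
  then have "A = {y}" by blast
  then show ?thesis by simp
qed

text \<open>The set in the definition of \<open>yoneda\<close> is a singleton, by independence of
  the lift and of both representatives. Every product is thereby reduced to one choice of cocycles
  and of a lift.\<close>

lemma yoneda_class:
  assumes K: "left_module R K" and F: "free_resolution R X F" and G: "free_resolution R K G"
    and a: "is_cocycle R K G i a" and f: "is_cocycle R K F j f" and h: "h \<in> chain_lifts R F j G f"
  shows "yoneda R K G F i (ext_class R K G i a) j (ext_class R K F j f) = ext_class R K F (j + i) (a \<circ> h i)"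
proof -
  interpret F: ext_data R K X F by (rule ext_data.intro[OF K F])
  interpret G: ext_data R K K G by (rule ext_data.intro[OF K G])
  have main: "ext_class R K F (j + i) (a' \<circ> h' i) = ext_class R K F (j + i) (a \<circ> h i)"
    if a': "a' \<in> ext_class R K G i a" and f': "f' \<in> ext_class R K F j f" and h': "h' \<in> chain_lifts R F j G f'" for a' f' h'
  proof -
    note A = G.ext_class_member[OF a a'] and FF = F.ext_class_member[OF f f']
    have "cohomologous R K G i a' a" "cohomologous R K F j f' f"
      using G.ext_class_eq_iff[OF A(1) a] A(2) F.ext_class_eq_iff[OF FF(1) f] FF(2) by simp_all
    then show ?thesis
      using chain_lifts_class_eq_left[OF K F G h' A(1) a] chain_lifts_class_eq_right[OF K F G h' h _ a] by simp
  qed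
  have "h \<in> chain_lifts R F j G (restrict f (carrier (cmod F j)))"
    by (rule chain_lifts_cong[OF h]) simp
  with G.ext_class_self[OF a] F.ext_class_self[OF f] main[symmetric]
  have "ext_class R K F (j + i) (a \<circ> h i) \<in> {ext_class R K F (j + i) (\<alpha> \<circ> h i) | \<alpha> f' h.
       \<alpha> \<in> ext_class R K G i a \<and> f' \<in> ext_class R K F j f \<and> h \<in> chain_lifts R F j G f'}"
    by blast
  then show ?thesis unfolding yoneda_def by (rule the_elem_eqI) (use main in blast)
qed

lemma ext_map_deg_class:
  assumes K: "left_module R K" and F: "free_resolution R X F" and G: "free_resolution R Y G"
    and a: "is_cocycle R K G n a" and h: "h \<in> chain_lifts R F 0 G (\<phi> \<circ> aug F)"
  shows "ext_map_deg R K F G \<phi> n (ext_class R K G n a) = ext_class R K F n (a \<circ> h n)"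
proof -
  interpret G: ext_data R K Y G by (rule ext_data.intro[OF K G])
  have main: "ext_class R K F n (a' \<circ> h' n) = ext_class R K F n (a \<circ> h n)"
    if a': "a' \<in> ext_class R K G n a" and h': "h' \<in> chain_lifts R F 0 G (\<phi> \<circ> aug F)" for a' h'
  proof -
    note A = G.ext_class_member[OF a a']
    have "cohomologous R K G n a' a" using G.ext_class_eq_iff[OF A(1) a] A(2) by simp
    then show ?thesis
      using chain_lifts_class_eq_left[OF K F G h' A(1) a] chain_lifts_class_eq[OF K F G h' h a] by simp
  qed
  with G.ext_class_self[OF a] main[symmetric] h
  have "ext_class R K F n (a \<circ> h n) \<in> {ext_class R K F n (\<alpha> \<circ> h n) | \<alpha> h.
       \<alpha> \<in> ext_class R K G n a \<and> h \<in> chain_lifts R F 0 G (\<phi> \<circ> aug F)}"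
    by blast
  then show ?thesis unfolding ext_map_deg_def by (rule the_elem_eqI) (use main in blast)
qed

lemma cocycle_lift_exists:
  assumes "free_resolution R X F" "free_resolution R K G" "is_cocycle R K F j f"
  obtains h where "h \<in> chain_lifts R F j G f"
  using chain_lifts_exist[OF assms(1,2) is_cocycle_mod_hom[OF assms(3)]] is_cocycle_diff[OF assms(3)] by metis

lemma mod_hom_lift_exists:
  assumes F: "free_resolution R X F" and G: "free_resolution R Y G" and \<phi>: "\<phi> \<in> mod_hom R X Y"
  obtains h where "h \<in> chain_lifts R F 0 G (\<phi> \<circ> aug F)"
proof -
  have "(\<phi> \<circ> aug F) (diff F 0 x) = \<zero>\<^bsub>Y\<^esub>" if "x \<in> carrier (cmod F (Suc 0))" for x
    using mod_hom_zero[OF \<phi> free_resolution_left_module[OF F] free_resolution_left_module[OF G]]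
    by (simp add: aug_diff[OF F that])
  then show thesis
    using chain_lifts_exist[OF F G mod_hom_comp[OF free_resolution_aug[OF F] \<phi>]] that by metis
qed

section \<open>The Yoneda product in single degrees\<close>

locale ext_action =
  fixes R :: "('r, 'z) ring_scheme" and K :: "('r, 'k) module" and G :: "('r, 'g, 'k) resolution"
    and X :: "('r, 'x) module" and F :: "('r, 'f, 'x) resolution"
  assumes K: "left_module R K" and G: "free_resolution R K G" and F: "free_resolution R X F"
begin

sublocale F: ext_data R K X F by (rule ext_data.intro[OF K F])
sublocale G: ext_data R K K G by (rule ext_data.intro[OF K G])

lemma yoneda_closed:
  assumes "a \<in> carrier (ext_group R K G i)" "x \<in> carrier (ext_group R K F j)"
  shows "yoneda R K G F i a j x \<in> carrier (ext_group R K F (j + i))"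
proof -
  obtain \<alpha> where a: "is_cocycle R K G i \<alpha>" "a = ext_class R K G i \<alpha>" by (rule G.ext_group_cases[OF assms(1)])
  obtain f where f: "is_cocycle R K F j f" "x = ext_class R K F j f" by (rule F.ext_group_cases[OF assms(2)])
  obtain h where h: "h \<in> chain_lifts R F j G f" by (rule cocycle_lift_exists[OF F G f(1)])
  show ?thesis unfolding a(2) f(2) yoneda_class[OF K F G a(1) f(1) h]
    by (rule F.ext_class_carrier[OF chain_lifts_cocycle[OF K F G h a(1)]])
qed

lemma yoneda_mult_left:
  assumes "a \<in> carrier (ext_group R K G i)" "b \<in> carrier (ext_group R K G i)" "x \<in> carrier (ext_group R K F j)"
  shows "yoneda R K G F i (a \<otimes>\<^bsub>ext_group R K G i\<^esub> b) j x =
    yoneda R K G F i a j x \<otimes>\<^bsub>ext_group R K F (j + i)\<^esub> yoneda R K G F i b j x"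
proof -
  obtain \<alpha> where a: "is_cocycle R K G i \<alpha>" "a = ext_class R K G i \<alpha>" by (rule G.ext_group_cases[OF assms(1)])
  obtain \<beta> where b: "is_cocycle R K G i \<beta>" "b = ext_class R K G i \<beta>" by (rule G.ext_group_cases[OF assms(2)])
  obtain f where f: "is_cocycle R K F j f" "x = ext_class R K F j f" by (rule F.ext_group_cases[OF assms(3)])
  obtain h where h: "h \<in> chain_lifts R F j G f" by (rule cocycle_lift_exists[OF F G f(1)])
  show ?thesis
    unfolding a(2) b(2) f(2) G.ext_class_mult[OF a(1) b(1)] yoneda_class[OF K F G a(1) f(1) h]
      yoneda_class[OF K F G b(1) f(1) h] yoneda_class[OF K F G G.is_cocycle_add[OF a(1) b(1)] f(1) h]
      F.ext_class_mult[OF chain_lifts_cocycle[OF K F G h a(1)] chain_lifts_cocycle[OF K F G h b(1)]]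
    by (simp add: comp_def)
qed

lemma yoneda_mult_right:
  assumes "a \<in> carrier (ext_group R K G i)" "x \<in> carrier (ext_group R K F j)" "y \<in> carrier (ext_group R K F j)"
  shows "yoneda R K G F i a j (x \<otimes>\<^bsub>ext_group R K F j\<^esub> y) =
    yoneda R K G F i a j x \<otimes>\<^bsub>ext_group R K F (j + i)\<^esub> yoneda R K G F i a j y"
proof -
  obtain \<alpha> where a: "is_cocycle R K G i \<alpha>" "a = ext_class R K G i \<alpha>" by (rule G.ext_group_cases[OF assms(1)])
  obtain f where f: "is_cocycle R K F j f" "x = ext_class R K F j f" by (rule F.ext_group_cases[OF assms(2)])
  obtain g where g: "is_cocycle R K F j g" "y = ext_class R K F j g" by (rule F.ext_group_cases[OF assms(3)])
  obtain h where h: "h \<in> chain_lifts R F j G f" by (rule cocycle_lift_exists[OF F G f(1)])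
  obtain k where k: "k \<in> chain_lifts R F j G g" by (rule cocycle_lift_exists[OF F G g(1)])
  show ?thesis
    unfolding a(2) g(2) f(2) F.ext_class_mult[OF f(1) g(1)] yoneda_class[OF K F G a(1) f(1) h]
      yoneda_class[OF K F G a(1) g(1) k]
      yoneda_class[OF K F G a(1) F.is_cocycle_add[OF f(1) g(1)] chain_lifts_sum[OF G h k F]]
      F.ext_class_mult[OF chain_lifts_cocycle[OF K F G h a(1)] chain_lifts_cocycle[OF K F G k a(1)]]
    by (rule F.ext_class_cong)
      (simp add: mod_hom_add[OF is_cocycle_mod_hom[OF a(1)]] mod_hom_closed[OF chain_lifts_mod_hom[OF h]]
        mod_hom_closed[OF chain_lifts_mod_hom[OF k]])
qed

text \<open>If \<open>h\<close> lifts \<open>f\<close> and \<open>k\<close> lifts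
  \<open>\<beta>\<close>, both sides are the class of
  \<open>\<alpha> o k i o h (l + i)\<close>.\<close>

lemma yoneda_assoc:
  assumes "a \<in> carrier (ext_group R K G i)" "b \<in> carrier (ext_group R K G l)" "x \<in> carrier (ext_group R K F j)"
  shows "yoneda R K G F i a (j + l) (yoneda R K G F l b j x) =
    yoneda R K G F (l + i) (yoneda R K G G i a l b) j x"
proof -
  obtain \<alpha> where a: "is_cocycle R K G i \<alpha>" "a = ext_class R K G i \<alpha>" by (rule G.ext_group_cases[OF assms(1)])
  obtain \<beta> where b: "is_cocycle R K G l \<beta>" "b = ext_class R K G l \<beta>" by (rule G.ext_group_cases[OF assms(2)])
  obtain f where f: "is_cocycle R K F j f" "x = ext_class R K F j f" by (rule F.ext_group_cases[OF assms(3)])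
  obtain h where h: "h \<in> chain_lifts R F j G f" by (rule cocycle_lift_exists[OF F G f(1)])
  obtain k where k: "k \<in> chain_lifts R G l G \<beta>" by (rule cocycle_lift_exists[OF G G b(1)])
  show ?thesis
    unfolding a(2) b(2) f(2) yoneda_class[OF K F G b(1) f(1) h] yoneda_class[OF K G G a(1) b(1) k]
      yoneda_class[OF K F G a(1) chain_lifts_cocycle[OF K F G h b(1)] chain_lifts_comp[OF h k]]
      yoneda_class[OF K F G chain_lifts_cocycle[OF K G G k a(1)] f(1) h]
    by (simp add: comp_assoc add.assoc)
qed

lemma is_cocycle_aug: "is_cocycle R K G 0 (aug G)"
  by (simp add: is_cocycle_def free_resolution_aug[OF G] aug_diff[OF G])

text \<open>The unit is the class of \<open>aug G\<close>, and \<open>aug G o h 0 = f\<close> is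
  part of being a lift of \<open>f\<close>.\<close>

lemma yoneda_one_left:
  assumes "x \<in> carrier (ext_group R K F j)"
  shows "yoneda R K G F 0 (ext_class R K G 0 (aug G)) j x = x"
proof -
  obtain f where f: "is_cocycle R K F j f" "x = ext_class R K F j f" by (rule F.ext_group_cases[OF assms])
  obtain h where h: "h \<in> chain_lifts R F j G f" by (rule cocycle_lift_exists[OF F G f(1)])
  show ?thesis unfolding f(2) yoneda_class[OF K F G is_cocycle_aug f(1) h] add_0_right
    by (rule F.ext_class_cong) (simp add: chain_lifts_aug[OF h])
qed

lemma yoneda_one_right:
  assumes "a \<in> carrier (ext_group R K G i)"
  shows "yoneda R K G G i a 0 (ext_class R K G 0 (aug G)) = a"
proof -
  obtain \<alpha> where a: "is_cocycle R K G i \<alpha>" "a = ext_class R K G i \<alpha>" by (rule G.ext_group_cases[OF assms])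
  show ?thesis
    unfolding a(2) yoneda_class[OF K G G a(1) is_cocycle_aug chain_lifts_id[OF G refl]]
    by (simp add: comp_def)
qed

end

section \<open>Functoriality of Ext in its first argument\<close>

locale ext_functor =
  fixes R :: "('r, 'z) ring_scheme" and K :: "('r, 'k) module"
    and X :: "('r, 'x) module" and F :: "('r, 'f, 'x) resolution"
    and Y :: "('r, 'y) module" and G :: "('r, 'g, 'y) resolution"
  assumes K: "left_module R K" and F: "free_resolution R X F" and G: "free_resolution R Y G"
begin

sublocale F: ext_data R K X F by (rule ext_data.intro[OF K F])
sublocale G: ext_data R K Y G by (rule ext_data.intro[OF K G])

lemma ext_map_deg_closed:
  assumes \<phi>: "\<phi> \<in> mod_hom R X Y" and "a \<in> carrier (ext_group R K G n)"
  shows "ext_map_deg R K F G \<phi> n a \<in> carrier (ext_group R K F n)"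
proof -
  obtain \<alpha> where a: "is_cocycle R K G n \<alpha>" "a = ext_class R K G n \<alpha>" by (rule G.ext_group_cases[OF assms(2)])
  obtain h where h: "h \<in> chain_lifts R F 0 G (\<phi> \<circ> aug F)" by (rule mod_hom_lift_exists[OF F G \<phi>])
  show ?thesis unfolding a(2) ext_map_deg_class[OF K F G a(1) h]
    using F.ext_class_carrier[OF chain_lifts_cocycle[OF K F G h a(1)]] by simp
qed

lemma ext_map_deg_mult:
  assumes \<phi>: "\<phi> \<in> mod_hom R X Y" and "a \<in> carrier (ext_group R K G n)" "b \<in> carrier (ext_group R K G n)"
  shows "ext_map_deg R K F G \<phi> n (a \<otimes>\<^bsub>ext_group R K G n\<^esub> b) =
    ext_map_deg R K F G \<phi> n a \<otimes>\<^bsub>ext_group R K F n\<^esub> ext_map_deg R K F G \<phi> n b"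
proof -
  obtain \<alpha> where a: "is_cocycle R K G n \<alpha>" "a = ext_class R K G n \<alpha>" by (rule G.ext_group_cases[OF assms(2)])
  obtain \<beta> where b: "is_cocycle R K G n \<beta>" "b = ext_class R K G n \<beta>" by (rule G.ext_group_cases[OF assms(3)])
  obtain h where h: "h \<in> chain_lifts R F 0 G (\<phi> \<circ> aug F)" by (rule mod_hom_lift_exists[OF F G \<phi>])
  have "is_cocycle R K F n (\<alpha> \<circ> h n)" "is_cocycle R K F n (\<beta> \<circ> h n)"
    using chain_lifts_cocycle[OF K F G h a(1)] chain_lifts_cocycle[OF K F G h b(1)] by simp_all
  then show ?thesis
    unfolding a(2) b(2) G.ext_class_mult[OF a(1) b(1)] ext_map_deg_class[OF K F G a(1) h]
      ext_map_deg_class[OF K F G b(1) h] ext_map_deg_class[OF K F G G.is_cocycle_add[OF a(1) b(1)] h]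
    by (simp add: F.ext_class_mult comp_def)
qed

lemma ext_map_deg_one:
  assumes \<phi>: "\<phi> \<in> mod_hom R X Y"
  shows "ext_map_deg R K F G \<phi> n \<one>\<^bsub>ext_group R K G n\<^esub> = \<one>\<^bsub>ext_group R K F n\<^esub>"
proof -
  obtain h where h: "h \<in> chain_lifts R F 0 G (\<phi> \<circ> aug F)" by (rule mod_hom_lift_exists[OF F G \<phi>])
  show ?thesis
    unfolding G.ext_class_one F.ext_class_one ext_map_deg_class[OF K F G G.is_cocycle_zero h]
    by (simp add: comp_def)
qed

lemma ext_map_deg_inv:
  assumes \<phi>: "\<phi> \<in> mod_hom R X Y" and a: "a \<in> carrier (ext_group R K G n)"
  shows "ext_map_deg R K F G \<phi> n (inv\<^bsub>ext_group R K G n\<^esub> a) =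
    inv\<^bsub>ext_group R K F n\<^esub> ext_map_deg R K F G \<phi> n a"
proof -
  interpret EF: comm_group "ext_group R K F n" by (rule F.comm_group_ext_group)
  interpret EG: comm_group "ext_group R K G n" by (rule G.comm_group_ext_group)
  have "ext_map_deg R K F G \<phi> n (inv\<^bsub>ext_group R K G n\<^esub> a) \<otimes>\<^bsub>ext_group R K F n\<^esub>
      ext_map_deg R K F G \<phi> n a = \<one>\<^bsub>ext_group R K F n\<^esub>"
    using ext_map_deg_mult[OF \<phi> EG.inv_closed[OF a] a] ext_map_deg_one[OF \<phi>] a by simp
  then show ?thesis
    using EF.inv_equality[OF _ ext_map_deg_closed[OF \<phi> a] ext_map_deg_closed[OF \<phi> EG.inv_closed[OF a]]]
    by simp
qed

text \<open>A sum of lifts lifts the sum. The hypothesis on \<open>\<chi>\<close> speaks of the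
  carrier only, so that differently written maps can be related, such as the identity of a product
  and the sum of its two projections followed by inclusions.\<close>

lemma ext_map_deg_sum:
  assumes \<phi>: "\<phi> \<in> mod_hom R X Y" and \<psi>: "\<psi> \<in> mod_hom R X Y" and "a \<in> carrier (ext_group R K G n)"
    and \<chi>: "\<And>x. x \<in> carrier X \<Longrightarrow> \<chi> x = \<phi> x \<oplus>\<^bsub>Y\<^esub> \<psi> x"
  shows "ext_map_deg R K F G \<chi> n a =
    ext_map_deg R K F G \<phi> n a \<otimes>\<^bsub>ext_group R K F n\<^esub> ext_map_deg R K F G \<psi> n a"
proof -
  obtain \<alpha> where a: "is_cocycle R K G n \<alpha>" "a = ext_class R K G n \<alpha>" by (rule G.ext_group_cases[OF assms(3)])
  obtain h where h: "h \<in> chain_lifts R F 0 G (\<phi> \<circ> aug F)" by (rule mod_hom_lift_exists[OF F G \<phi>])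
  obtain k where k: "k \<in> chain_lifts R F 0 G (\<psi> \<circ> aug F)" by (rule mod_hom_lift_exists[OF F G \<psi>])
  have hk: "(\<lambda>m x. h m x \<oplus>\<^bsub>cmod G m\<^esub> k m x) \<in> chain_lifts R F 0 G (\<chi> \<circ> aug F)"
    by (rule chain_lifts_cong[OF chain_lifts_sum[OF G h k F]]) (simp add: \<chi> aug_closed[OF F])
  have c: "is_cocycle R K F n (\<alpha> \<circ> h n)" "is_cocycle R K F n (\<alpha> \<circ> k n)"
    using chain_lifts_cocycle[OF K F G h a(1)] chain_lifts_cocycle[OF K F G k a(1)] by simp_all
  show ?thesis
    unfolding a(2) ext_map_deg_class[OF K F G a(1) h] ext_map_deg_class[OF K F G a(1) k]
      ext_map_deg_class[OF K F G a(1) hk] F.ext_class_mult[OF c]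
    by (rule F.ext_class_cong)
      (use mod_hom_closed[OF chain_lifts_mod_hom[OF h]] mod_hom_closed[OF chain_lifts_mod_hom[OF k]] in
        \<open>simp add: mod_hom_add[OF is_cocycle_mod_hom[OF a(1)]]\<close>)
qed

text \<open>As \<open>\<phi>\<close> agrees with \<open>\<phi> + \<phi>\<close> on the carrier, the
  value is an idempotent of a group.\<close>

lemma ext_map_deg_zero:
  assumes "a \<in> carrier (ext_group R K G n)" and eq: "\<And>x. x \<in> carrier X \<Longrightarrow> \<phi> x = \<zero>\<^bsub>Y\<^esub>"
  shows "ext_map_deg R K F G \<phi> n a = \<one>\<^bsub>ext_group R K F n\<^esub>"
proof -
  interpret EF: comm_group "ext_group R K F n" by (rule F.comm_group_ext_group)
  interpret Y: left_module R Y by (rule free_resolution_left_module[OF G])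
  have z: "(\<lambda>x. \<zero>\<^bsub>Y\<^esub>) \<in> mod_hom R X Y" by (rule mod_hom_zero_map[OF Y.left_module_axioms])
  have phi: "\<phi> \<in> mod_hom R X Y"
    by (rule mod_hom_cong[OF z _ free_resolution_left_module[OF F]]) (simp add: eq)
  have "ext_map_deg R K F G \<phi> n a =
    ext_map_deg R K F G \<phi> n a \<otimes>\<^bsub>ext_group R K F n\<^esub> ext_map_deg R K F G \<phi> n a"
    by (rule ext_map_deg_sum[OF phi phi assms(1)]) (simp add: eq)
  then show ?thesis using ext_map_deg_closed[OF phi assms(1)] by (metis EF.l_cancel_one')
qed

text \<open>With \<open>h\<close> a lift of \<open>\<phi>\<close> and \<open>k\<close> a lift of the
  cocycle \<open>f\<close>, the composite of \<open>k\<close> with \<open>h\<close> lifts the pulled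
  back cocycle. Both sides then have the representative \<open>\<alpha> o k i o h (j + i)\<close>.
  Linearity of induced maps over the Ext algebra comes from here.\<close>

lemma ext_map_deg_yoneda:
  assumes H: "free_resolution R K H" and \<phi>: "\<phi> \<in> mod_hom R X Y"
    and "a \<in> carrier (ext_group R K H i)" "x \<in> carrier (ext_group R K G j)"
  shows "ext_map_deg R K F G \<phi> (j + i) (yoneda R K H G i a j x) =
    yoneda R K H F i a j (ext_map_deg R K F G \<phi> j x)"
proof -
  interpret H: ext_data R K K H by (rule ext_data.intro[OF K H])
  obtain \<alpha> where a: "is_cocycle R K H i \<alpha>" "a = ext_class R K H i \<alpha>" by (rule H.ext_group_cases[OF assms(3)])
  obtain f where f: "is_cocycle R K G j f" "x = ext_class R K G j f" by (rule G.ext_group_cases[OF assms(4)])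
  obtain h where h: "h \<in> chain_lifts R F 0 G (\<phi> \<circ> aug F)" by (rule mod_hom_lift_exists[OF F G \<phi>])
  obtain k where k: "k \<in> chain_lifts R G j H f" by (rule cocycle_lift_exists[OF G H f(1)])
  note c = chain_lifts_cocycle[OF K F G h f(1), unfolded add_0_left]
  show ?thesis
    unfolding a(2) f(2) yoneda_class[OF K G H a(1) f(1) k] ext_map_deg_class[OF K F G f(1) h]
      ext_map_deg_class[OF K F G chain_lifts_cocycle[OF K G H k a(1)] h]
      yoneda_class[OF K F H a(1) c chain_lifts_comp[OF h k, unfolded add_0_left]]
    by (simp add: comp_assoc)
qed

lemma ext_map_deg_comp:
  assumes H: "free_resolution R Z H" and \<phi>: "\<phi> \<in> mod_hom R X Y" and \<psi>: "\<psi> \<in> mod_hom R Y Z"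
    and "a \<in> carrier (ext_group R K H n)"
  shows "ext_map_deg R K F G \<phi> n (ext_map_deg R K G H \<psi> n a) = ext_map_deg R K F H (\<psi> \<circ> \<phi>) n a"
proof -
  interpret H: ext_data R K Z H by (rule ext_data.intro[OF K H])
  obtain \<alpha> where a: "is_cocycle R K H n \<alpha>" "a = ext_class R K H n \<alpha>" by (rule H.ext_group_cases[OF assms(4)])
  obtain h where h: "h \<in> chain_lifts R F 0 G (\<phi> \<circ> aug F)" by (rule mod_hom_lift_exists[OF F G \<phi>])
  obtain k where k: "k \<in> chain_lifts R G 0 H (\<psi> \<circ> aug G)" by (rule mod_hom_lift_exists[OF G H \<psi>])
  note c = chain_lifts_cocycle[OF K G H k a(1), unfolded add_0_left]
  have hk: "(\<lambda>m. k m \<circ> h m) \<in> chain_lifts R F 0 H (\<psi> \<circ> \<phi> \<circ> aug F)"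
    using chain_lifts_comp[OF h k] by (auto intro: chain_lifts_cong simp: chain_lifts_aug[OF h])
  show ?thesis
    unfolding a(2) ext_map_deg_class[OF K G H a(1) k] ext_map_deg_class[OF K F G c h]
      ext_map_deg_class[OF K F H a(1) hk]
    by (simp add: comp_assoc)
qed

end

lemma ext_map_deg_id:
  assumes K: "left_module R K" and F: "free_resolution R X F" and "a \<in> carrier (ext_group R K F n)"
    and eq: "\<And>x. x \<in> carrier X \<Longrightarrow> \<phi> x = x"
  shows "ext_map_deg R K F F \<phi> n a = a"
proof -
  interpret F: ext_data R K X F by (rule ext_data.intro[OF K F])
  obtain \<alpha> where a: "is_cocycle R K F n \<alpha>" "a = ext_class R K F n \<alpha>" by (rule F.ext_group_cases[OF assms(3)])
  have "(\<lambda>m x. x) \<in> chain_lifts R F 0 F (\<phi> \<circ> aug F)"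
    by (rule chain_lifts_id[OF F]) (simp add: eq aug_closed[OF F])
  from ext_map_deg_class[OF K F F a(1) this] show ?thesis unfolding a(2) by (simp add: comp_def)
qed

section \<open>The Ext algebra and its modules\<close>

lemma finprod_hom:
  assumes "comm_monoid G" "comm_monoid H" "f \<in> hom G H" "f \<one>\<^bsub>G\<^esub> = \<one>\<^bsub>H\<^esub>"
  shows "\<lbrakk>finite A; e \<in> A \<rightarrow> carrier G\<rbrakk> \<Longrightarrow> f (finprod G e A) = finprod H (\<lambda>i. f (e i)) A"
proof (induction A rule: finite_induct)
  interpret G: comm_monoid G by fact
  interpret H: comm_monoid H by fact
  {
    case empty
    then show ?case using assms(4) by simp
  next
    case (insert i A)
    then have "e \<in> A \<rightarrow> carrier G" "e i \<in> carrier G" by auto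
    moreover from this have "(\<lambda>i. f (e i)) \<in> A \<rightarrow> carrier H" "f (e i) \<in> carrier H"
      using assms(3) by (auto simp: hom_def)
    ultimately show ?case using insert assms(3) by (simp add: hom_def)
  }
qed

text \<open>Runs through the triangle \<open>l + k \<le> n\<close> by antidiagonals and by rows, as
  needed for associativity of the total product. Membership in the carrier is asked for inside the
  triangle only; in the application the other terms belong to other degrees.\<close>

lemma (in comm_monoid) finprod_triangle:
  assumes "\<And>l k. l + k \<le> n \<Longrightarrow> f l k \<in> carrier G"
  shows "finprod G (\<lambda>i. finprod G (\<lambda>l. f l (i - l)) {..i}) {..n} =
    finprod G (\<lambda>l. finprod G (\<lambda>k. f l k) {..n - l}) {..n::nat}"
  using assms
proof (induction n)
  case 0
  then show ?case by simp
next
  case (Suc n)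
  have cl: "f l k \<in> carrier G" if "l + k \<le> Suc n" for l k using Suc.prems that by simp
  have IH: "finprod G (\<lambda>i. finprod G (\<lambda>l. f l (i - l)) {..i}) {..n} =
    finprod G (\<lambda>l. finprod G (\<lambda>k. f l k) {..n - l}) {..n}" using Suc.IH cl by simp
  \<comment> \<open>Raising the bound by one adds to row \<open>l\<close> the single entry on the
    new antidiagonal \<open>l + k = Suc n\<close>.\<close>
  have "finprod G (\<lambda>l. finprod G (\<lambda>k. f l k) {..Suc n - l}) {..n} =
      finprod G (\<lambda>l. f l (Suc n - l) \<otimes> finprod G (\<lambda>k. f l k) {..n - l}) {..n}"
    using cl by (intro finprod_cong') (auto simp: Suc_diff_le Pi_iff)
  also have "\<dots> = finprod G (\<lambda>l. f l (Suc n - l)) {..n} \<otimes> finprod G (\<lambda>l. finprod G (\<lambda>k. f l k) {..n - l}) {..n}"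
    using cl by (intro finprod_multf) (auto simp: Pi_iff intro!: finprod_closed)
  finally have r: "finprod G (\<lambda>l. finprod G (\<lambda>k. f l k) {..Suc n - l}) {..n} = \<dots>" .
  have "finprod G (\<lambda>i. finprod G (\<lambda>l. f l (i - l)) {..i}) {..Suc n} =
      (f (Suc n) 0 \<otimes> finprod G (\<lambda>l. f l (Suc n - l)) {..n}) \<otimes>
      finprod G (\<lambda>i. finprod G (\<lambda>l. f l (i - l)) {..i}) {..n}"
    using cl by (simp add: Pi_iff)
  also have "\<dots> = finprod G (\<lambda>l. finprod G (\<lambda>k. f l k) {..Suc n - l}) {..Suc n}"
    unfolding IH using cl r by (simp add: Pi_iff m_assoc)
  finally show ?case .
qed

text \<open>Uniqueness of the homogeneous decomposition: the additive projection
  \<open>pr j\<close>, applied to any decomposition, isolates its component of degree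
  \<open>j\<close>. In \<open>sum\<close> the index set may exceed the support, so that the supports
  of two coordinates can be merged.\<close>

lemma gradingI:
  assumes A: "abelian_group A" and g: "\<And>i. additive_subgroup (g i) A"
    and pr: "\<And>i x. x \<in> carrier A \<Longrightarrow> pr i x \<in> g i"
    and add: "\<And>i x y. \<lbrakk>x \<in> carrier A; y \<in> carrier A\<rbrakk> \<Longrightarrow> pr i (x \<oplus>\<^bsub>A\<^esub> y) = pr i x \<oplus>\<^bsub>A\<^esub> pr i y"
    and id: "\<And>i x. x \<in> g i \<Longrightarrow> pr i x = x"
    and zero: "\<And>i j x. \<lbrakk>x \<in> g i; j \<noteq> i\<rbrakk> \<Longrightarrow> pr j x = \<zero>\<^bsub>A\<^esub>"
    and sum: "\<And>x. x \<in> carrier A \<Longrightarrow>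
      \<exists>I. finite I \<and> (\<forall>i. i \<notin> I \<longrightarrow> pr i x = \<zero>\<^bsub>A\<^esub>) \<and> x = finsum A (\<lambda>i. pr i x) I"
  shows "grading A g"
proof -
  interpret abelian_group A by fact
  have gA: "x \<in> carrier A" if "x \<in> g i" for x i
    using additive_subgroup.a_subset[OF g] that by blast
  have supp: "finsum A c {i. c i \<noteq> \<zero>\<^bsub>A\<^esub>} = finsum A c I"
    if "finite I" "\<And>i. c i \<in> carrier A" "\<And>i. i \<notin> I \<Longrightarrow> c i = \<zero>\<^bsub>A\<^esub>" for c I
    by (rule add.finprod_mono_neutral_cong_left) (use that in auto)
  have pr0: "pr j \<zero>\<^bsub>A\<^esub> = \<zero>\<^bsub>A\<^esub>" for j
    by (rule id) (rule additive_subgroup.zero_closed[OF g])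
  have prsum: "pr j (finsum A c I) = finsum A (\<lambda>i. pr j (c i)) I"
    if "finite I" "\<And>i. c i \<in> carrier A" for c I j
    using that(1)
  proof (induction I rule: finite_induct)
    case (insert i I)
    have "pr j (c i) \<in> carrier A" "(\<lambda>i. pr j (c i)) \<in> I \<rightarrow> carrier A" "finsum A c I \<in> carrier A"
      using gA[OF pr[OF that(2)]] that(2) by (auto intro!: finsum_closed)
    with insert that(2) show ?case by (simp add: add Pi_iff)
  qed (simp add: pr0)
  have "\<exists>!c. (\<forall>i. c i \<in> g i) \<and> finite {i. c i \<noteq> \<zero>\<^bsub>A\<^esub>} \<and> x = finsum A c {i. c i \<noteq> \<zero>\<^bsub>A\<^esub>}"
    if x: "x \<in> carrier A" for x
  proof (rule ex1I[of _ "\<lambda>i. pr i x"])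
    obtain I where I: "finite I" "\<And>i. i \<notin> I \<Longrightarrow> pr i x = \<zero>\<^bsub>A\<^esub>" "x = finsum A (\<lambda>i. pr i x) I"
      using sum[OF x] by blast
    have "finite {i. pr i x \<noteq> \<zero>\<^bsub>A\<^esub>}" by (rule finite_subset[OF _ I(1)]) (use I(2) in blast)
    moreover have "x = finsum A (\<lambda>i. pr i x) {i. pr i x \<noteq> \<zero>\<^bsub>A\<^esub>}"
      using supp[of I "\<lambda>i. pr i x"] I gA[OF pr[OF x]] by simp
    ultimately show "(\<forall>i. pr i x \<in> g i) \<and> finite {i. pr i x \<noteq> \<zero>\<^bsub>A\<^esub>} \<and> x = finsum A (\<lambda>i. pr i x) {i. pr i x \<noteq> \<zero>\<^bsub>A\<^esub>}"
      using pr[OF x] by simp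
  next
    fix c assume c: "(\<forall>i. c i \<in> g i) \<and> finite {i. c i \<noteq> \<zero>\<^bsub>A\<^esub>} \<and> x = finsum A c {i. c i \<noteq> \<zero>\<^bsub>A\<^esub>}"
    then have cA: "c i \<in> carrier A" for i using gA by blast
    show "c = (\<lambda>i. pr i x)"
    proof
      fix j
      \<comment> \<open>With \<open>j\<close> added, the term selected by \<open>j = i\<close> has
        an index to land on even when \<open>c j\<close> is zero.\<close>
      let ?I = "insert j {i. c i \<noteq> \<zero>\<^bsub>A\<^esub>}"
      have I: "finite ?I" using c by simp
      have "x = finsum A c ?I" using c supp[OF I cA] by auto
      then have "pr j x = finsum A (\<lambda>i. pr j (c i)) ?I" using prsum[OF I cA] by simp
      also have "\<dots> = finsum A (\<lambda>i. if j = i then c i else \<zero>\<^bsub>A\<^esub>) ?I"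
      proof (rule add.finprod_cong')
        fix i assume "i \<in> ?I"
        have "pr j (c i) = \<zero>\<^bsub>A\<^esub>" if "j \<noteq> i" using c zero[OF _ that] by blast
        then show "pr j (c i) = (if j = i then c i else \<zero>\<^bsub>A\<^esub>)" using c id by simp
      qed (use cA in auto)
      also have "\<dots> = c j" by (rule add.finprod_singleton) (use I cA in auto)
      finally show "c j = pr j x" by simp
    qed
  qed
  then show ?thesis unfolding grading_def using A g by blast
qed

section \<open>The direct sum of the Ext groups and its grading\<close>

context ext_data begin

lemma ext_carrierI:
  "\<lbrakk>\<And>n. x n \<in> carrier (ext_group R K F n); finite {n. x n \<noteq> \<one>\<^bsub>ext_group R K F n\<^esub>}\<rbrakk> \<Longrightarrow> x \<in> ext_carrier R K F"
  by (simp add: ext_carrier_def)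

lemma ext_carrier_closed: "x \<in> ext_carrier R K F \<Longrightarrow> x n \<in> carrier (ext_group R K F n)"
  by (simp add: ext_carrier_def)

lemma ext_carrier_bounded:
  assumes "x \<in> ext_carrier R K F"
  shows "\<exists>N. \<forall>n\<ge>N. x n = \<one>\<^bsub>ext_group R K F n\<^esub>"
proof -
  have "finite {n. x n \<noteq> \<one>\<^bsub>ext_group R K F n\<^esub>}" using assms by (simp add: ext_carrier_def)
  then obtain N where "\<forall>n\<in>{n. x n \<noteq> \<one>\<^bsub>ext_group R K F n\<^esub>}. n < N"
    using finite_nat_set_iff_bounded by auto
  then show ?thesis by (intro exI[of _ N]) (auto simp: not_less[symmetric])
qed

lemma ext_carrierI_bounded:
  assumes "\<And>n. x n \<in> carrier (ext_group R K F n)" "\<And>n. n \<ge> N \<Longrightarrow> x n = \<one>\<^bsub>ext_group R K F n\<^esub>"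
  shows "x \<in> ext_carrier R K F"
proof (rule ext_carrierI[OF assms(1)])
  have "{n. x n \<noteq> \<one>\<^bsub>ext_group R K F n\<^esub>} \<subseteq> {..<N}" using assms(2) by (auto simp: not_less[symmetric])
  then show "finite {n. x n \<noteq> \<one>\<^bsub>ext_group R K F n\<^esub>}" by (rule finite_subset) simp
qed

lemma comm_monoid_ext_group: "comm_monoid (ext_group R K F n)"
  by (rule comm_group.axioms(1)[OF comm_group_ext_group])

lemma ext_add_closed:
  assumes x: "x \<in> ext_carrier R K F" and y: "y \<in> ext_carrier R K F"
  shows "(\<lambda>n. x n \<otimes>\<^bsub>ext_group R K F n\<^esub> y n) \<in> ext_carrier R K F"
proof (rule ext_carrierI)
  interpret E: comm_group "ext_group R K F n" for n by (rule comm_group_ext_group)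
  show "x n \<otimes>\<^bsub>ext_group R K F n\<^esub> y n \<in> carrier (ext_group R K F n)" for n
    using ext_carrier_closed[OF x] ext_carrier_closed[OF y] by simp
  have "{n. x n \<otimes>\<^bsub>ext_group R K F n\<^esub> y n \<noteq> \<one>\<^bsub>ext_group R K F n\<^esub>} \<subseteq>
      {n. x n \<noteq> \<one>\<^bsub>ext_group R K F n\<^esub>} \<union> {n. y n \<noteq> \<one>\<^bsub>ext_group R K F n\<^esub>}" by auto
  then show "finite {n. x n \<otimes>\<^bsub>ext_group R K F n\<^esub> y n \<noteq> \<one>\<^bsub>ext_group R K F n\<^esub>}"
    by (rule finite_subset) (use x y in \<open>simp add: ext_carrier_def\<close>)
qed

text \<open>\<open>ext_algebra\<close> and \<open>ext_module\<close> are records of different types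
  with the same kind of additive part; prescribing only that part of \<open>A\<close> serves
  both.\<close>

lemma abelian_group_ext:
  fixes A :: "(nat \<Rightarrow> ('f \<Rightarrow> 'k) set, 'u) ring_scheme"
  assumes "carrier A = ext_carrier R K F" "\<zero>\<^bsub>A\<^esub> = (\<lambda>n. \<one>\<^bsub>ext_group R K F n\<^esub>)"
    "add A = (\<lambda>x y n. x n \<otimes>\<^bsub>ext_group R K F n\<^esub> y n)"
  shows "abelian_group A"
proof (rule abelian_groupI; (simp only: assms)?)
  interpret E: comm_group "ext_group R K F n" for n by (rule comm_group_ext_group)
  show "(\<lambda>n. x n \<otimes>\<^bsub>ext_group R K F n\<^esub> y n) \<in> ext_carrier R K F"
    if "x \<in> ext_carrier R K F" "y \<in> ext_carrier R K F" for x y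
    by (rule ext_add_closed[OF that])
  show "(\<lambda>n. \<one>\<^bsub>ext_group R K F n\<^esub>) \<in> ext_carrier R K F" by (rule ext_carrierI) simp_all
  show "(\<lambda>n. x n \<otimes>\<^bsub>ext_group R K F n\<^esub> y n \<otimes>\<^bsub>ext_group R K F n\<^esub> z n) =
      (\<lambda>n. x n \<otimes>\<^bsub>ext_group R K F n\<^esub> (y n \<otimes>\<^bsub>ext_group R K F n\<^esub> z n))"
    if "x \<in> ext_carrier R K F" "y \<in> ext_carrier R K F" "z \<in> ext_carrier R K F" for x y z
    using ext_carrier_closed[OF that(1)] ext_carrier_closed[OF that(2)] ext_carrier_closed[OF that(3)]
    by (simp add: E.m_assoc)
  show "(\<lambda>n. x n \<otimes>\<^bsub>ext_group R K F n\<^esub> y n) = (\<lambda>n. y n \<otimes>\<^bsub>ext_group R K F n\<^esub> x n)"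
    if "x \<in> ext_carrier R K F" "y \<in> ext_carrier R K F" for x y
    using ext_carrier_closed[OF that(1)] ext_carrier_closed[OF that(2)] by (simp add: E.m_comm)
  show "(\<lambda>n. \<one>\<^bsub>ext_group R K F n\<^esub> \<otimes>\<^bsub>ext_group R K F n\<^esub> x n) = x"
    if "x \<in> ext_carrier R K F" for x
    by (rule ext) (rule E.l_one[OF ext_carrier_closed[OF that]])
  show "\<exists>y\<in>ext_carrier R K F. (\<lambda>n. y n \<otimes>\<^bsub>ext_group R K F n\<^esub> x n) = (\<lambda>n. \<one>\<^bsub>ext_group R K F n\<^esub>)"
    if x: "x \<in> ext_carrier R K F" for x
  proof (rule bexI[of _ "\<lambda>n. inv\<^bsub>ext_group R K F n\<^esub> x n"])
    show "(\<lambda>n. inv\<^bsub>ext_group R K F n\<^esub> x n) \<in> ext_carrier R K F"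
    proof (rule ext_carrierI)
      have "{n. inv\<^bsub>ext_group R K F n\<^esub> x n \<noteq> \<one>\<^bsub>ext_group R K F n\<^esub>} \<subseteq> {n. x n \<noteq> \<one>\<^bsub>ext_group R K F n\<^esub>}"
        using E.inv_one by (intro Collect_mono impI notI) (erule notE, erule ssubst)
      then show "finite {n. inv\<^bsub>ext_group R K F n\<^esub> x n \<noteq> \<one>\<^bsub>ext_group R K F n\<^esub>}"
        by (rule finite_subset) (use x in \<open>simp add: ext_carrier_def\<close>)
    qed (use ext_carrier_closed[OF x] in simp)
    show "(\<lambda>n. inv\<^bsub>ext_group R K F n\<^esub> x n \<otimes>\<^bsub>ext_group R K F n\<^esub> x n) = (\<lambda>n. \<one>\<^bsub>ext_group R K F n\<^esub>)"
      using ext_carrier_closed[OF x] by (simp add: E.l_inv)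
  qed
qed

lemma ext_a_inv:
  fixes A :: "(nat \<Rightarrow> ('f \<Rightarrow> 'k) set, 'u) ring_scheme"
  assumes A: "carrier A = ext_carrier R K F" "\<zero>\<^bsub>A\<^esub> = (\<lambda>n. \<one>\<^bsub>ext_group R K F n\<^esub>)"
    "add A = (\<lambda>x y n. x n \<otimes>\<^bsub>ext_group R K F n\<^esub> y n)" and x: "x \<in> ext_carrier R K F"
  shows "\<ominus>\<^bsub>A\<^esub> x = (\<lambda>n. inv\<^bsub>ext_group R K F n\<^esub> x n)"
proof
  fix n
  interpret A: abelian_group A by (rule abelian_group_ext[OF A])
  interpret E: comm_group "ext_group R K F n" by (rule comm_group_ext_group)
  have "\<ominus>\<^bsub>A\<^esub> x \<oplus>\<^bsub>A\<^esub> x = \<zero>\<^bsub>A\<^esub>" using x A(1) by (simp add: A.l_neg)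
  then have "(\<ominus>\<^bsub>A\<^esub> x) n \<otimes>\<^bsub>ext_group R K F n\<^esub> x n = \<one>\<^bsub>ext_group R K F n\<^esub>"
    by (simp add: A fun_eq_iff)
  moreover have "\<ominus>\<^bsub>A\<^esub> x \<in> ext_carrier R K F" using A.a_inv_closed[of x] x by (simp add: A(1))
  ultimately show "(\<ominus>\<^bsub>A\<^esub> x) n = inv\<^bsub>ext_group R K F n\<^esub> x n"
    using E.inv_equality[OF _ ext_carrier_closed[OF x] ext_carrier_closed] by simp
qed

lemma finsum_ext:
  fixes A :: "(nat \<Rightarrow> ('f \<Rightarrow> 'k) set, 'u) ring_scheme"
  assumes A: "carrier A = ext_carrier R K F" "\<zero>\<^bsub>A\<^esub> = (\<lambda>n. \<one>\<^bsub>ext_group R K F n\<^esub>)"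
    "add A = (\<lambda>x y n. x n \<otimes>\<^bsub>ext_group R K F n\<^esub> y n)"
  shows "\<lbrakk>finite I; c \<in> I \<rightarrow> ext_carrier R K F\<rbrakk> \<Longrightarrow>
    finsum A c I n = finprod (ext_group R K F n) (\<lambda>i. c i n) I"
proof (induction I rule: finite_induct)
  interpret A: abelian_group A by (rule abelian_group_ext[OF A])
  interpret E: comm_group "ext_group R K F n" by (rule comm_group_ext_group)
  {
    case empty
    then show ?case by (simp add: A)
  next
    case (insert i I)
    then have "c \<in> I \<rightarrow> ext_carrier R K F" "c i \<in> ext_carrier R K F" by auto
    moreover from this have "(\<lambda>i. c i n) \<in> I \<rightarrow> carrier (ext_group R K F n)" "c i n \<in> carrier (ext_group R K F n)"
      by (auto intro: ext_carrier_closed)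
    ultimately show ?case using insert by (simp add: A(1)) (simp add: A(3))
  }
qed

lemma ext_gradingD: "\<lbrakk>x \<in> ext_grading R K F i; int n \<noteq> i\<rbrakk> \<Longrightarrow> x n = \<one>\<^bsub>ext_group R K F n\<^esub>"
  by (simp add: ext_grading_def)

lemma ext_grading_carrier: "x \<in> ext_grading R K F i \<Longrightarrow> x \<in> ext_carrier R K F"
  by (simp add: ext_grading_def)

lemma ext_gradingI:
  "\<lbrakk>x \<in> ext_carrier R K F; \<And>n. int n \<noteq> i \<Longrightarrow> x n = \<one>\<^bsub>ext_group R K F n\<^esub>\<rbrakk> \<Longrightarrow> x \<in> ext_grading R K F i"
  by (simp add: ext_grading_def)

lemma additive_subgroup_ext_grading:
  fixes A :: "(nat \<Rightarrow> ('f \<Rightarrow> 'k) set, 'u) ring_scheme"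
  assumes A: "carrier A = ext_carrier R K F" "\<zero>\<^bsub>A\<^esub> = (\<lambda>n. \<one>\<^bsub>ext_group R K F n\<^esub>)"
    "add A = (\<lambda>x y n. x n \<otimes>\<^bsub>ext_group R K F n\<^esub> y n)"
  shows "additive_subgroup (ext_grading R K F i) A"
proof (rule additive_subgroup.intro)
  interpret A: abelian_group A by (rule abelian_group_ext[OF A])
  interpret E: comm_group "ext_group R K F n" for n by (rule comm_group_ext_group)
  show "subgroup (ext_grading R K F i) (add_monoid A)"
  proof (rule A.add.subgroupI)
    show "ext_grading R K F i \<subseteq> carrier A" by (auto simp: A ext_grading_def)
    have "\<zero>\<^bsub>A\<^esub> \<in> carrier A" by simp
    then have "\<zero>\<^bsub>A\<^esub> \<in> ext_grading R K F i" by (simp add: A ext_grading_def)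
    then show "ext_grading R K F i \<noteq> {}" by auto
  next
    fix x assume x: "x \<in> ext_grading R K F i"
    have "\<ominus>\<^bsub>A\<^esub> x \<in> ext_carrier R K F"
      using A.a_inv_closed[of x] ext_grading_carrier[OF x] by (simp add: A(1))
    then show "\<ominus>\<^bsub>A\<^esub> x \<in> ext_grading R K F i"
      using x by (simp add: ext_a_inv[OF A ext_grading_carrier[OF x]] ext_grading_def)
  next
    fix x y assume "x \<in> ext_grading R K F i" "y \<in> ext_grading R K F i"
    then show "x \<oplus>\<^bsub>A\<^esub> y \<in> ext_grading R K F i"
      using ext_add_closed[of x y] by (simp add: A ext_grading_def)
  qed
qed

definition ext_component :: "int \<Rightarrow> (nat \<Rightarrow> ('f \<Rightarrow> 'k) set) \<Rightarrow> nat \<Rightarrow> ('f \<Rightarrow> 'k) set" where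
  "ext_component i x = (\<lambda>n. if int n = i then x n else \<one>\<^bsub>ext_group R K F n\<^esub>)"

lemma ext_component_carrier:
  assumes "x \<in> ext_carrier R K F"
  shows "ext_component i x \<in> ext_grading R K F i"
proof (rule ext_gradingI)
  interpret E: comm_group "ext_group R K F n" for n by (rule comm_group_ext_group)
  have "{n. ext_component i x n \<noteq> \<one>\<^bsub>ext_group R K F n\<^esub>} \<subseteq> {n. x n \<noteq> \<one>\<^bsub>ext_group R K F n\<^esub>}"
    by (auto simp: ext_component_def)
  moreover have "finite {n. x n \<noteq> \<one>\<^bsub>ext_group R K F n\<^esub>}" using assms by (simp add: ext_carrier_def)
  ultimately have "finite {n. ext_component i x n \<noteq> \<one>\<^bsub>ext_group R K F n\<^esub>}" by (rule finite_subset)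
  moreover have "ext_component i x n \<in> carrier (ext_group R K F n)" for n
    using ext_carrier_closed[OF assms, of n] by (simp add: ext_component_def)
  ultimately show "ext_component i x \<in> ext_carrier R K F" by (intro ext_carrierI)
qed (simp add: ext_component_def)

lemma ext_component_add:
  "ext_component i (\<lambda>n. x n \<otimes>\<^bsub>ext_group R K F n\<^esub> y n) =
    (\<lambda>n. ext_component i x n \<otimes>\<^bsub>ext_group R K F n\<^esub> ext_component i y n)"
proof -
  interpret E: comm_group "ext_group R K F n" for n by (rule comm_group_ext_group)
  show ?thesis by (rule ext) (simp add: ext_component_def)
qed

lemma ext_component_id: "x \<in> ext_grading R K F i \<Longrightarrow> ext_component i x = x"
  by (rule ext) (auto simp: ext_component_def ext_grading_def)

lemma ext_component_other:
  "\<lbrakk>x \<in> ext_grading R K F i; j \<noteq> i\<rbrakk> \<Longrightarrow> ext_component j x = (\<lambda>n. \<one>\<^bsub>ext_group R K F n\<^esub>)"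
  by (rule ext) (auto simp: ext_component_def ext_grading_def)

text \<open>The sum formula is given for every finite \<open>J\<close> containing the support, so
  that two elements can be decomposed over a common index set.\<close>

lemma ext_component_sum:
  fixes A :: "(nat \<Rightarrow> ('f \<Rightarrow> 'k) set, 'u) ring_scheme"
  assumes A: "carrier A = ext_carrier R K F" "\<zero>\<^bsub>A\<^esub> = (\<lambda>n. \<one>\<^bsub>ext_group R K F n\<^esub>)"
    "add A = (\<lambda>x y n. x n \<otimes>\<^bsub>ext_group R K F n\<^esub> y n)" and x: "x \<in> ext_carrier R K F"
  obtains I where "finite I" "\<And>i. i \<notin> I \<Longrightarrow> ext_component i x = (\<lambda>n. \<one>\<^bsub>ext_group R K F n\<^esub>)"
    "\<And>J. \<lbrakk>I \<subseteq> J; finite J\<rbrakk> \<Longrightarrow> x = finsum A (\<lambda>i. ext_component i x) J"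
proof
  let ?I = "int ` {n. x n \<noteq> \<one>\<^bsub>ext_group R K F n\<^esub>}"
  show "finite ?I" using x by (simp add: ext_carrier_def)
  show "ext_component i x = (\<lambda>n. \<one>\<^bsub>ext_group R K F n\<^esub>)" if "i \<notin> ?I" for i
    by (rule ext) (use that in \<open>auto simp: ext_component_def\<close>)
  show "x = finsum A (\<lambda>i. ext_component i x) J" if J: "?I \<subseteq> J" "finite J" for J
  proof
    fix n
    interpret E: comm_group "ext_group R K F n" by (rule comm_group_ext_group)
    have "finsum A (\<lambda>i. ext_component i x) J n = finprod (ext_group R K F n) (\<lambda>i. ext_component i x n) J"
      by (rule finsum_ext[OF A J(2)]) (use ext_component_carrier[OF x] ext_grading_carrier in blast)
    also have "\<dots> = finprod (ext_group R K F n) (\<lambda>i. if int n = i then x n else \<one>\<^bsub>ext_group R K F n\<^esub>) J"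
      by (simp add: ext_component_def)
    also have "\<dots> = x n"
    proof (cases "int n \<in> J")
      case True
      then show ?thesis using J by (subst E.finprod_singleton) (use ext_carrier_closed[OF x] in auto)
    next
      case False
      then have "x n = \<one>\<^bsub>ext_group R K F n\<^esub>" using J by auto
      then show ?thesis by (simp only: if_cancel E.finprod_one)
    qed
    finally show "x n = finsum A (\<lambda>i. ext_component i x) J n" by simp
  qed
qed

lemma grading_ext:
  fixes A :: "(nat \<Rightarrow> ('f \<Rightarrow> 'k) set, 'u) ring_scheme"
  assumes A: "carrier A = ext_carrier R K F" "\<zero>\<^bsub>A\<^esub> = (\<lambda>n. \<one>\<^bsub>ext_group R K F n\<^esub>)"
    "add A = (\<lambda>x y n. x n \<otimes>\<^bsub>ext_group R K F n\<^esub> y n)"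
  shows "grading A (ext_grading R K F)"
proof (rule gradingI[where pr = ext_component])
  show "abelian_group A" by (rule abelian_group_ext[OF A])
  show "additive_subgroup (ext_grading R K F i) A" for i by (rule additive_subgroup_ext_grading[OF A])
  show "\<exists>I. finite I \<and> (\<forall>i. i \<notin> I \<longrightarrow> ext_component i x = \<zero>\<^bsub>A\<^esub>) \<and> x = finsum A (\<lambda>i. ext_component i x) I"
    if "x \<in> carrier A" for x
  proof -
    have x: "x \<in> ext_carrier R K F" using that by (simp add: A(1))
    obtain I where "finite I" "\<And>i. i \<notin> I \<Longrightarrow> ext_component i x = (\<lambda>n. \<one>\<^bsub>ext_group R K F n\<^esub>)"
      "\<And>J. \<lbrakk>I \<subseteq> J; finite J\<rbrakk> \<Longrightarrow> x = finsum A (\<lambda>i. ext_component i x) J"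
      by (rule ext_component_sum[OF A x]) blast
    then show ?thesis by (intro exI[of _ I]) (simp add: A(2))
  qed
qed (simp_all add: A ext_component_carrier ext_component_add ext_component_id ext_component_other)

end

section \<open>The total product on the direct sums\<close>

context ext_action begin

lemma yoneda_hom_left:
  "x \<in> carrier (ext_group R K F j) \<Longrightarrow>
    (\<lambda>a. yoneda R K G F i a j x) \<in> hom (ext_group R K G i) (ext_group R K F (j + i))"
  by (auto simp: hom_def yoneda_closed yoneda_mult_left)

lemma yoneda_hom_right:
  "a \<in> carrier (ext_group R K G i) \<Longrightarrow>
    (\<lambda>x. yoneda R K G F i a j x) \<in> hom (ext_group R K F j) (ext_group R K F (j + i))"
  by (auto simp: hom_def yoneda_closed yoneda_mult_right)

lemma groups: "group (ext_group R K F n)" "group (ext_group R K G n)"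
  by (rule comm_group.axioms(2)[OF F.comm_group_ext_group] comm_group.axioms(2)[OF G.comm_group_ext_group])+

lemma yoneda_unit_left:
  "x \<in> carrier (ext_group R K F j) \<Longrightarrow> yoneda R K G F i \<one>\<^bsub>ext_group R K G i\<^esub> j x = \<one>\<^bsub>ext_group R K F (j + i)\<^esub>"
  using hom_one[OF yoneda_hom_left groups(2) groups(1)] by simp

lemma yoneda_unit_right:
  "a \<in> carrier (ext_group R K G i) \<Longrightarrow> yoneda R K G F i a j \<one>\<^bsub>ext_group R K F j\<^esub> = \<one>\<^bsub>ext_group R K F (j + i)\<^esub>"
  using hom_one[OF yoneda_hom_right groups(1) groups(1)] by simp

lemma yoneda_closed_le:
  assumes "a \<in> ext_carrier R K G" "x \<in> ext_carrier R K F" "i \<le> n"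
  shows "yoneda R K G F i (a i) (n - i) (x (n - i)) \<in> carrier (ext_group R K F n)"
  using yoneda_closed[OF G.ext_carrier_closed[OF assms(1), of i] F.ext_carrier_closed[OF assms(2), of "n - i"]] assms(3)
  by simp

text \<open>Common criterion for the two vanishing statements about products: in high degree, which
  gives finite support, and off degree \<open>i + j\<close>, which gives the grading.\<close>

lemma ext_prod_one:
  assumes "a \<in> ext_carrier R K G" "x \<in> ext_carrier R K F"
    and "\<And>i. i \<le> n \<Longrightarrow> a i = \<one>\<^bsub>ext_group R K G i\<^esub> \<or> x (n - i) = \<one>\<^bsub>ext_group R K F (n - i)\<^esub>"
  shows "ext_prod R K G F a x n = \<one>\<^bsub>ext_group R K F n\<^esub>"
proof -
  interpret E: comm_group "ext_group R K F n" by (rule F.comm_group_ext_group)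
  have "yoneda R K G F i (a i) (n - i) (x (n - i)) = \<one>\<^bsub>ext_group R K F n\<^esub>" if "i \<le> n" for i
    using yoneda_unit_left[OF F.ext_carrier_closed[OF assms(2)], of i "n - i"]
      yoneda_unit_right[OF G.ext_carrier_closed[OF assms(1)], of i "n - i"] assms(3)[OF that] that
    by auto
  then show ?thesis unfolding ext_prod_def by (intro E.finprod_one_eqI) simp
qed

lemma ext_prod_closed:
  assumes a: "a \<in> ext_carrier R K G" and x: "x \<in> ext_carrier R K F"
  shows "ext_prod R K G F a x \<in> ext_carrier R K F"
proof -
  interpret E: comm_group "ext_group R K F n" for n by (rule F.comm_group_ext_group)
  obtain A where A: "\<And>n. n \<ge> A \<Longrightarrow> a n = \<one>\<^bsub>ext_group R K G n\<^esub>" using G.ext_carrier_bounded[OF a] by blast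
  obtain N where N: "\<And>n. n \<ge> N \<Longrightarrow> x n = \<one>\<^bsub>ext_group R K F n\<^esub>" using F.ext_carrier_bounded[OF x] by blast
  show ?thesis
  proof (rule F.ext_carrierI_bounded)
    show "ext_prod R K G F a x n \<in> carrier (ext_group R K F n)" for n
      unfolding ext_prod_def by (rule E.finprod_closed) (simp add: yoneda_closed_le[OF a x])
    \<comment> \<open>A term with both factors nontrivial needs \<open>i < A\<close> and
      \<open>n - i < N\<close>, hence \<open>n < A + N\<close>.\<close>
    show "ext_prod R K G F a x n = \<one>\<^bsub>ext_group R K F n\<^esub>" if "n \<ge> A + N" for n
    proof (rule ext_prod_one[OF a x])
      fix i assume "i \<le> n"
      with that have "A \<le> i \<or> N \<le> n - i" by linarith
      then show "a i = \<one>\<^bsub>ext_group R K G i\<^esub> \<or> x (n - i) = \<one>\<^bsub>ext_group R K F (n - i)\<^esub>"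
        using A N by blast
    qed
  qed
qed

lemma ext_prod_add_left:
  assumes a: "a \<in> ext_carrier R K G" and b: "b \<in> ext_carrier R K G" and x: "x \<in> ext_carrier R K F"
  shows "ext_prod R K G F (\<lambda>n. a n \<otimes>\<^bsub>ext_group R K G n\<^esub> b n) x =
    (\<lambda>n. ext_prod R K G F a x n \<otimes>\<^bsub>ext_group R K F n\<^esub> ext_prod R K G F b x n)"
proof
  fix n
  interpret E: comm_group "ext_group R K F n" by (rule F.comm_group_ext_group)
  have *: "yoneda R K G F i (a i \<otimes>\<^bsub>ext_group R K G i\<^esub> b i) (n - i) (x (n - i)) =
      yoneda R K G F i (a i) (n - i) (x (n - i)) \<otimes>\<^bsub>ext_group R K F n\<^esub> yoneda R K G F i (b i) (n - i) (x (n - i))"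
    if "i \<le> n" for i
    using yoneda_mult_left[OF G.ext_carrier_closed[OF a, of i] G.ext_carrier_closed[OF b, of i]
      F.ext_carrier_closed[OF x, of "n - i"]] that by simp
  show "ext_prod R K G F (\<lambda>n. a n \<otimes>\<^bsub>ext_group R K G n\<^esub> b n) x n =
      ext_prod R K G F a x n \<otimes>\<^bsub>ext_group R K F n\<^esub> ext_prod R K G F b x n"
    unfolding ext_prod_def
    by (rule trans[OF E.finprod_cong' E.finprod_multf])
      (simp_all add: * yoneda_closed_le[OF a x] yoneda_closed_le[OF b x])
qed

lemma ext_prod_add_right:
  assumes a: "a \<in> ext_carrier R K G" and x: "x \<in> ext_carrier R K F" and y: "y \<in> ext_carrier R K F"
  shows "ext_prod R K G F a (\<lambda>n. x n \<otimes>\<^bsub>ext_group R K F n\<^esub> y n) =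
    (\<lambda>n. ext_prod R K G F a x n \<otimes>\<^bsub>ext_group R K F n\<^esub> ext_prod R K G F a y n)"
proof
  fix n
  interpret E: comm_group "ext_group R K F n" by (rule F.comm_group_ext_group)
  have *: "yoneda R K G F i (a i) (n - i) (x (n - i) \<otimes>\<^bsub>ext_group R K F (n - i)\<^esub> y (n - i)) =
      yoneda R K G F i (a i) (n - i) (x (n - i)) \<otimes>\<^bsub>ext_group R K F n\<^esub> yoneda R K G F i (a i) (n - i) (y (n - i))"
    if "i \<le> n" for i
    using yoneda_mult_right[OF G.ext_carrier_closed[OF a, of i] F.ext_carrier_closed[OF x, of "n - i"]
      F.ext_carrier_closed[OF y, of "n - i"]] that by simp
  show "ext_prod R K G F a (\<lambda>n. x n \<otimes>\<^bsub>ext_group R K F n\<^esub> y n) n =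
      ext_prod R K G F a x n \<otimes>\<^bsub>ext_group R K F n\<^esub> ext_prod R K G F a y n"
    unfolding ext_prod_def
    by (rule trans[OF E.finprod_cong' E.finprod_multf])
      (simp_all add: * yoneda_closed_le[OF a x] yoneda_closed_le[OF a y])
qed

end

context ext_action begin

text \<open>The algebra acts on itself: with \<open>X = K\<close> and \<open>F = G\<close> the facts
  about the action become facts about its multiplication.\<close>

interpretation GG: ext_action R K G K G by (rule ext_action.intro[OF K G G])

text \<open>Since the product is additive in either argument, both sides unfold to the terms
  \<open>a l\<close> times \<open>b k\<close> times \<open>x (n - l - k)\<close> with
  \<open>l + k \<le> n\<close>: on the left by antidiagonals, on the right by rows.\<close>

lemma ext_prod_assoc:
  assumes a: "a \<in> ext_carrier R K G" and b: "b \<in> ext_carrier R K G" and x: "x \<in> ext_carrier R K F"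
  shows "ext_prod R K G F (ext_prod R K G G a b) x = ext_prod R K G F a (ext_prod R K G F b x)"
proof
  fix n
  interpret E: comm_group "ext_group R K F n" for n by (rule F.comm_group_ext_group)
  interpret EG: comm_group "ext_group R K G n" for n by (rule G.comm_group_ext_group)
  note cl = G.ext_carrier_closed[OF a] G.ext_carrier_closed[OF b] F.ext_carrier_closed[OF x]
  let ?t = "\<lambda>l k. yoneda R K G F l (a l) (n - l) (yoneda R K G F k (b k) (n - l - k) (x (n - l - k)))"
  have tcl: "?t l k \<in> carrier (ext_group R K F n)" if "l + k \<le> n" for l k
    using yoneda_closed[OF cl(1)[of l] yoneda_closed_le[OF b x, of k "n - l"]] that by simp
  have L: "yoneda R K G F i (ext_prod R K G G a b i) (n - i) (x (n - i)) =
      finprod (ext_group R K F n) (\<lambda>l. ?t l (i - l)) {..i}" if i: "i \<le> n" for i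
  proof -
    have "yoneda R K G F i (ext_prod R K G G a b i) (n - i) (x (n - i)) =
        finprod (ext_group R K F (n - i + i))
          (\<lambda>l. yoneda R K G F i (yoneda R K G G l (a l) (i - l) (b (i - l))) (n - i) (x (n - i))) {..i}"
      unfolding ext_prod_def
      by (rule finprod_hom[OF G.comm_monoid_ext_group F.comm_monoid_ext_group yoneda_hom_left[OF cl(3)]
        yoneda_unit_left[OF cl(3)]]) (simp_all add: GG.yoneda_closed_le[OF a b])
    also have "\<dots> = finprod (ext_group R K F n) (\<lambda>l. ?t l (i - l)) {..i}"
    proof -
      have eq: "yoneda R K G F i (yoneda R K G G l (a l) (i - l) (b (i - l))) (n - i) (x (n - i)) = ?t l (i - l)"
        if "l \<le> i" for l
        using yoneda_assoc[OF cl(1)[of l] cl(2)[of "i - l"] cl(3)[of "n - i"]] that i by simp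
      have "finprod (ext_group R K F n) (\<lambda>l. yoneda R K G F i (yoneda R K G G l (a l) (i - l) (b (i - l)))
          (n - i) (x (n - i))) {..i} = finprod (ext_group R K F n) (\<lambda>l. ?t l (i - l)) {..i}"
      proof (rule E.finprod_cong'[OF refl])
        show "(\<lambda>l. ?t l (i - l)) \<in> {..i} \<rightarrow> carrier (ext_group R K F n)"
        proof
          fix l assume "l \<in> {..i}"
          then show "?t l (i - l) \<in> carrier (ext_group R K F n)" using i by (intro tcl) simp
        qed
      qed (use eq in simp)
      then show ?thesis using i by simp
    qed
    finally show ?thesis .
  qed
  have R: "yoneda R K G F l (a l) (n - l) (ext_prod R K G F b x (n - l)) =
      finprod (ext_group R K F n) (\<lambda>k. ?t l k) {..n - l}" if l: "l \<le> n" for l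
  proof -
    have "yoneda R K G F l (a l) (n - l) (ext_prod R K G F b x (n - l)) =
        finprod (ext_group R K F (n - l + l)) (\<lambda>k. ?t l k) {..n - l}"
      unfolding ext_prod_def
      by (rule finprod_hom[OF F.comm_monoid_ext_group F.comm_monoid_ext_group yoneda_hom_right[OF cl(1)]
        yoneda_unit_right[OF cl(1)]]) (auto simp del: diff_diff_left intro: yoneda_closed_le[OF b x])
    then show ?thesis using l by simp
  qed
  have "ext_prod R K G F (ext_prod R K G G a b) x n =
      finprod (ext_group R K F n) (\<lambda>i. finprod (ext_group R K F n) (\<lambda>l. ?t l (i - l)) {..i}) {..n}"
    unfolding ext_prod_def[of R K G F "ext_prod R K G G a b"]
  proof (rule E.finprod_cong'[OF refl])
    show "(\<lambda>i. finprod (ext_group R K F n) (\<lambda>l. ?t l (i - l)) {..i}) \<in> {..n} \<rightarrow> carrier (ext_group R K F n)"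
      by (intro Pi_I E.finprod_closed tcl) simp
    show "yoneda R K G F i (ext_prod R K G G a b i) (n - i) (x (n - i)) =
      finprod (ext_group R K F n) (\<lambda>l. ?t l (i - l)) {..i}" if "i \<in> {..n}" for i
      using that by (intro L) simp
  qed
  also have "\<dots> = finprod (ext_group R K F n) (\<lambda>l. finprod (ext_group R K F n) (\<lambda>k. ?t l k) {..n - l}) {..n}"
    by (rule E.finprod_triangle[OF tcl])
  also have "\<dots> = ext_prod R K G F a (ext_prod R K G F b x) n"
    unfolding ext_prod_def[of R K G F a]
  proof (rule E.finprod_cong'[OF refl])
    show "(\<lambda>l. yoneda R K G F l (a l) (n - l) (ext_prod R K G F b x (n - l))) \<in> {..n} \<rightarrow> carrier (ext_group R K F n)"
      using yoneda_closed_le[OF a ext_prod_closed[OF b x]] by simp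
    show "finprod (ext_group R K F n) (\<lambda>k. ?t l k) {..n - l} =
      yoneda R K G F l (a l) (n - l) (ext_prod R K G F b x (n - l))" if "l \<in> {..n}" for l
      using that by (intro R[symmetric]) simp
  qed
  finally show "ext_prod R K G F (ext_prod R K G G a b) x n = ext_prod R K G F a (ext_prod R K G F b x) n" .
qed

abbreviation ext_one :: "nat \<Rightarrow> ('g \<Rightarrow> 'k) set" where
  "ext_one \<equiv> \<lambda>n. if n = 0 then ext_class R K G 0 (aug G) else \<one>\<^bsub>ext_group R K G n\<^esub>"

lemma ext_one_carrier: "ext_one \<in> ext_carrier R K G"
proof (rule G.ext_carrierI_bounded[of _ 1])
  interpret EG: comm_group "ext_group R K G n" for n by (rule G.comm_group_ext_group)
  show "ext_one n \<in> carrier (ext_group R K G n)" for n by (simp add: G.ext_class_carrier is_cocycle_aug)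
qed simp

lemma ext_prod_one_left:
  assumes x: "x \<in> ext_carrier R K F"
  shows "ext_prod R K G F ext_one x = x"
proof
  fix n
  interpret E: comm_group "ext_group R K F n" by (rule F.comm_group_ext_group)
  have "ext_prod R K G F ext_one x n =
      finprod (ext_group R K F n) (\<lambda>i. if 0 = i then x n else \<one>\<^bsub>ext_group R K F n\<^esub>) {..n}"
    unfolding ext_prod_def
  proof (rule E.finprod_cong'[OF refl])
    fix i assume "i \<in> {..n}"
    then show "yoneda R K G F i (ext_one i) (n - i) (x (n - i)) = (if 0 = i then x n else \<one>\<^bsub>ext_group R K F n\<^esub>)"
      using yoneda_one_left[OF F.ext_carrier_closed[OF x]]
        yoneda_unit_left[OF F.ext_carrier_closed[OF x], of i "n - i"] by simp
  qed (simp add: F.ext_carrier_closed[OF x])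
  also have "\<dots> = x n" by (rule E.finprod_singleton) (simp_all add: F.ext_carrier_closed[OF x])
  finally show "ext_prod R K G F ext_one x n = x n" .
qed

lemma ext_prod_one_right:
  assumes x: "x \<in> ext_carrier R K G"
  shows "ext_prod R K G G x ext_one = x"
proof
  fix n
  interpret E: comm_group "ext_group R K G n" by (rule G.comm_group_ext_group)
  have "ext_prod R K G G x ext_one n =
      finprod (ext_group R K G n) (\<lambda>i. if n = i then x n else \<one>\<^bsub>ext_group R K G n\<^esub>) {..n}"
    unfolding ext_prod_def
  proof (rule E.finprod_cong'[OF refl])
    fix i assume "i \<in> {..n}"
    then show "yoneda R K G G i (x i) (n - i) (ext_one (n - i)) = (if n = i then x n else \<one>\<^bsub>ext_group R K G n\<^esub>)"
      using yoneda_one_right[OF G.ext_carrier_closed[OF x]]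
        GG.yoneda_unit_right[OF G.ext_carrier_closed[OF x], of i "n - i"] by simp
  qed (use G.ext_carrier_closed[OF x] in auto)
  also have "\<dots> = x n" by (rule E.finprod_singleton) (use G.ext_carrier_closed[OF x] in auto)
  finally show "ext_prod R K G G x ext_one n = x n" .
qed

end

context ext_action begin

interpretation GG: ext_action R K G K G by (rule ext_action.intro[OF K G G])

lemma ring_ext_algebra: "ring (ext_algebra R K G)"
proof (rule ringI)
  show "abelian_group (ext_algebra R K G)" by (rule G.abelian_group_ext) (simp_all add: ext_algebra_def)
  show "Group.monoid (ext_algebra R K G)"
    by (rule monoidI)
      (simp_all add: ext_algebra_def GG.ext_prod_closed GG.ext_prod_assoc ext_one_carrier
        GG.ext_prod_one_left ext_prod_one_right)
qed (simp_all add: ext_algebra_def GG.ext_prod_add_left GG.ext_prod_add_right)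

lemma left_module_ext: "left_module (ext_algebra R K G) (ext_module R K G F)"
proof (rule left_module.intro)
  show "ring (ext_algebra R K G)" by (rule ring_ext_algebra)
  show "abelian_group (ext_module R K G F)" by (rule F.abelian_group_ext) (simp_all add: ext_module_def)
  show "left_module_axioms (ext_algebra R K G) (ext_module R K G F)"
    by (rule left_module_axioms.intro)
      (simp_all add: ext_algebra_def ext_module_def ext_prod_closed ext_prod_assoc
        ext_prod_one_left ext_prod_add_left ext_prod_add_right)
qed

lemma ext_prod_grading:
  assumes a: "a \<in> ext_grading R K G i" and x: "x \<in> ext_grading R K F j"
  shows "ext_prod R K G F a x \<in> ext_grading R K F (i + j)"
proof (rule F.ext_gradingI)
  note c = G.ext_grading_carrier[OF a] F.ext_grading_carrier[OF x]
  show "ext_prod R K G F a x \<in> ext_carrier R K F" by (rule ext_prod_closed[OF c])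
  fix n assume n: "int n \<noteq> i + j"
  show "ext_prod R K G F a x n = \<one>\<^bsub>ext_group R K F n\<^esub>"
  proof (rule ext_prod_one[OF c])
    fix l assume "l \<le> n"
    with n have "int l \<noteq> i \<or> int (n - l) \<noteq> j" by auto
    then show "a l = \<one>\<^bsub>ext_group R K G l\<^esub> \<or> x (n - l) = \<one>\<^bsub>ext_group R K F (n - l)\<^esub>"
      using G.ext_gradingD[OF a] F.ext_gradingD[OF x] by blast
  qed
qed

end

context ext_action begin

interpretation GG: ext_action R K G K G by (rule ext_action.intro[OF K G G])

lemma graded_ring_ext_algebra: "graded_ring (ext_algebra R K G) (ext_grading R K G)"
  unfolding graded_ring_def
proof (intro conjI allI ballI ring_ext_algebra)
  show "grading (ext_algebra R K G) (ext_grading R K G)"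
    by (rule G.grading_ext) (simp_all add: ext_algebra_def)
  show "\<one>\<^bsub>ext_algebra R K G\<^esub> \<in> ext_grading R K G 0"
    using ext_one_carrier by (simp add: ext_algebra_def ext_grading_def)
qed (simp add: ext_algebra_def GG.ext_prod_grading)

lemma graded_module_ext:
  "graded_module (ext_algebra R K G) (ext_grading R K G) (ext_module R K G F) (ext_grading R K F)"
  unfolding graded_module_def
proof (intro conjI allI ballI graded_ring_ext_algebra left_module_ext)
  show "grading (ext_module R K G F) (ext_grading R K F)"
    by (rule F.grading_ext) (simp_all add: ext_module_def)
qed (simp add: ext_module_def ext_prod_grading)

end

text \<open>The direct sum of two Ext modules is not the \<open>ext_module\<close> of one of the
  given resolutions, so its grading is established separately, with componentwise projections and
  the union of the two supports.\<close>

lemma graded_module_ext_prod: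
  assumes K: "left_module R K" and G: "free_resolution R K G" and F: "free_resolution R X F"
    and F': "free_resolution R Y F'"
  shows "graded_module (ext_algebra R K G) (ext_grading R K G)
    (module_prod (ext_module R K G F) (ext_module R K G F')) (\<lambda>i. ext_grading R K F i \<times> ext_grading R K F' i)"
proof -
  interpret F: ext_action R K G X F by (rule ext_action.intro[OF K G F])
  interpret F': ext_action R K G Y F' by (rule ext_action.intro[OF K G F'])
  let ?E = "ext_algebra R K G" and ?M = "ext_module R K G F" and ?N = "ext_module R K G F'"
  interpret P: left_module ?E "module_prod ?M ?N"
    by (rule left_module_prod[OF F.left_module_ext F'.left_module_ext])
  have M: "carrier ?M = ext_carrier R K F" "\<zero>\<^bsub>?M\<^esub> = (\<lambda>n. \<one>\<^bsub>ext_group R K F n\<^esub>)"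
    "add ?M = (\<lambda>x y n. x n \<otimes>\<^bsub>ext_group R K F n\<^esub> y n)" by (simp_all add: ext_module_def)
  have N: "carrier ?N = ext_carrier R K F'" "\<zero>\<^bsub>?N\<^esub> = (\<lambda>n. \<one>\<^bsub>ext_group R K F' n\<^esub>)"
    "add ?N = (\<lambda>x y n. x n \<otimes>\<^bsub>ext_group R K F' n\<^esub> y n)" by (simp_all add: ext_module_def)
  interpret SM: additive_subgroup "ext_grading R K F i" ?M for i by (rule F.F.additive_subgroup_ext_grading[OF M])
  interpret SN: additive_subgroup "ext_grading R K F' i" ?N for i by (rule F'.F.additive_subgroup_ext_grading[OF N])
  let ?pr = "\<lambda>i p. (F.F.ext_component i (fst p), F'.F.ext_component i (snd p))"
  have "grading (module_prod ?M ?N) (\<lambda>i. ext_grading R K F i \<times> ext_grading R K F' i)"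
  proof (rule gradingI[where pr = ?pr])
    show "abelian_group (module_prod ?M ?N)" by (rule P.M.abelian_group_axioms)
    show "additive_subgroup (ext_grading R K F i \<times> ext_grading R K F' i) (module_prod ?M ?N)" for i
    proof (rule additive_subgroup.intro, rule P.M.add.subgroupI)
      show "ext_grading R K F i \<times> ext_grading R K F' i \<subseteq> carrier (module_prod ?M ?N)"
        using SM.a_subset[of i] SN.a_subset[of i] by auto
      show "ext_grading R K F i \<times> ext_grading R K F' i \<noteq> {}" using SM.zero_closed SN.zero_closed by blast
    next
      fix p assume p: "p \<in> ext_grading R K F i \<times> ext_grading R K F' i"
      then have "fst p \<in> carrier ?M" "snd p \<in> carrier ?N" using SM.a_subset[of i] SN.a_subset[of i] by auto
      then have "\<ominus>\<^bsub>module_prod ?M ?N\<^esub> p = (\<ominus>\<^bsub>?M\<^esub> fst p, \<ominus>\<^bsub>?N\<^esub> snd p)"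
        using module_prod_a_inv[OF F.left_module_ext F'.left_module_ext, of "fst p" "snd p"] by simp
      then show "\<ominus>\<^bsub>module_prod ?M ?N\<^esub> p \<in> ext_grading R K F i \<times> ext_grading R K F' i"
        using p subgroup.m_inv_closed[OF SM.a_subgroup] subgroup.m_inv_closed[OF SN.a_subgroup]
        by (auto simp: a_inv_def)
    next
      fix p q assume "p \<in> ext_grading R K F i \<times> ext_grading R K F' i" "q \<in> ext_grading R K F i \<times> ext_grading R K F' i"
      then show "p \<oplus>\<^bsub>module_prod ?M ?N\<^esub> q \<in> ext_grading R K F i \<times> ext_grading R K F' i"
        using SM.a_closed SN.a_closed by auto
    qed
    show "\<exists>I. finite I \<and> (\<forall>i. i \<notin> I \<longrightarrow> ?pr i p = \<zero>\<^bsub>module_prod ?M ?N\<^esub>) \<and>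
        p = finsum (module_prod ?M ?N) (\<lambda>i. ?pr i p) I" if p: "p \<in> carrier (module_prod ?M ?N)" for p
    proof -
      have c: "fst p \<in> ext_carrier R K F" "snd p \<in> ext_carrier R K F'" using p M(1) N(1) by auto
      obtain I where I: "finite I" "\<And>i. i \<notin> I \<Longrightarrow> F.F.ext_component i (fst p) = (\<lambda>n. \<one>\<^bsub>ext_group R K F n\<^esub>)"
        "\<And>J. \<lbrakk>I \<subseteq> J; finite J\<rbrakk> \<Longrightarrow> fst p = finsum ?M (\<lambda>i. F.F.ext_component i (fst p)) J"
        by (rule F.F.ext_component_sum[OF M c(1)]) blast
      obtain J where J: "finite J" "\<And>i. i \<notin> J \<Longrightarrow> F'.F.ext_component i (snd p) = (\<lambda>n. \<one>\<^bsub>ext_group R K F' n\<^esub>)"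
        "\<And>I. \<lbrakk>J \<subseteq> I; finite I\<rbrakk> \<Longrightarrow> snd p = finsum ?N (\<lambda>i. F'.F.ext_component i (snd p)) I"
        by (rule F'.F.ext_component_sum[OF N c(2)]) blast
      let ?s = "finsum (module_prod ?M ?N) (\<lambda>i. ?pr i p) (I \<union> J)"
      have cl: "(\<lambda>i. ?pr i p) \<in> (I \<union> J) \<rightarrow> carrier (module_prod ?M ?N)"
        using F.F.ext_component_carrier[OF c(1)] F'.F.ext_component_carrier[OF c(2)]
          SM.a_subset SN.a_subset by (simp add: Pi_iff) blast
      have "fst ?s = finsum ?M (\<lambda>i. fst (?pr i p)) (I \<union> J)"
        by (rule mod_hom_finsum[OF mod_hom_fst P.left_module_axioms F.left_module_ext _ cl]) (use I J in simp)
      moreover have "snd ?s = finsum ?N (\<lambda>i. snd (?pr i p)) (I \<union> J)"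
        by (rule mod_hom_finsum[OF mod_hom_snd P.left_module_axioms F'.left_module_ext _ cl]) (use I J in simp)
      ultimately have "p = ?s" using I(3)[of "I \<union> J"] J(3)[of "I \<union> J"] I(1) J(1) by (simp add: prod_eq_iff)
      then show ?thesis using I(1,2) J(1,2) by (intro exI[of _ "I \<union> J"]) (simp add: M N)
    qed
  qed (auto simp: M(1,3) N(1,3) F.F.ext_component_carrier F'.F.ext_component_carrier
      F.F.ext_component_add F'.F.ext_component_add F.F.ext_component_id F'.F.ext_component_id
      F.F.ext_component_other F'.F.ext_component_other M(2) N(2))
  then show ?thesis
    unfolding graded_module_def using F.graded_ring_ext_algebra P.left_module_axioms
    by (auto simp: ext_module_def F.ext_prod_grading F'.ext_prod_grading)
qed

section \<open>Induced maps on the direct sums\<close>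

context ext_functor begin

lemma ext_map_deg_hom:
  "\<phi> \<in> mod_hom R X Y \<Longrightarrow> ext_map_deg R K F G \<phi> n \<in> hom (ext_group R K G n) (ext_group R K F n)"
  by (auto simp: hom_def ext_map_deg_closed ext_map_deg_mult)

lemma ext_map_carrier:
  assumes \<phi>: "\<phi> \<in> mod_hom R X Y" and x: "x \<in> ext_carrier R K G"
  shows "ext_map R K F G \<phi> x \<in> ext_carrier R K F"
proof -
  obtain N where N: "\<And>n. n \<ge> N \<Longrightarrow> x n = \<one>\<^bsub>ext_group R K G n\<^esub>" using G.ext_carrier_bounded[OF x] by blast
  show ?thesis
    by (rule F.ext_carrierI_bounded[of _ N])
      (simp_all add: ext_map_def N ext_map_deg_one[OF \<phi>] ext_map_deg_closed[OF \<phi> G.ext_carrier_closed[OF x]])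
qed

text \<open>Linearity reduces to \<open>ext_map_deg_yoneda\<close> in single degrees, because a
  group homomorphism passes through the finite sum that defines the product.\<close>

lemma ext_map_mod_hom:
  assumes H: "free_resolution R K H" and \<phi>: "\<phi> \<in> mod_hom R X Y"
  shows "ext_map R K F G \<phi> \<in> mod_hom (ext_algebra R K H) (ext_module R K H G) (ext_module R K H F)"
proof (rule mod_homI)
  interpret HF: ext_action R K H X F by (rule ext_action.intro[OF K H F])
  interpret HG: ext_action R K H Y G by (rule ext_action.intro[OF K H G])
  fix x assume x: "x \<in> carrier (ext_module R K H G)"
  then show "ext_map R K F G \<phi> x \<in> carrier (ext_module R K H F)"
    by (simp add: ext_module_def ext_map_carrier[OF \<phi>])
  {
    fix y assume "y \<in> carrier (ext_module R K H G)"
    with x show "ext_map R K F G \<phi> (x \<oplus>\<^bsub>ext_module R K H G\<^esub> y) =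
        ext_map R K F G \<phi> x \<oplus>\<^bsub>ext_module R K H F\<^esub> ext_map R K F G \<phi> y"
      by (simp add: ext_module_def ext_map_def ext_map_deg_mult[OF \<phi>] G.ext_carrier_closed)
  }
  fix a assume "a \<in> carrier (ext_algebra R K H)"
  then have a: "a \<in> ext_carrier R K H" by (simp add: ext_algebra_def)
  have x: "x \<in> ext_carrier R K G" using x by (simp add: ext_module_def)
  have "ext_map_deg R K F G \<phi> n (ext_prod R K H G a x n) = ext_prod R K H F a (ext_map R K F G \<phi> x) n" for n
  proof -
    interpret E: comm_group "ext_group R K F n" by (rule F.comm_group_ext_group)
    have "ext_map_deg R K F G \<phi> n (ext_prod R K H G a x n) =
        finprod (ext_group R K F n) (\<lambda>i. ext_map_deg R K F G \<phi> n (yoneda R K H G i (a i) (n - i) (x (n - i)))) {..n}"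
      unfolding ext_prod_def
      by (rule finprod_hom[OF G.comm_monoid_ext_group F.comm_monoid_ext_group ext_map_deg_hom[OF \<phi>]
        ext_map_deg_one[OF \<phi>]]) (simp_all add: HG.yoneda_closed_le[OF a x])
    also have "\<dots> = ext_prod R K H F a (ext_map R K F G \<phi> x) n"
      unfolding ext_prod_def
    proof (rule E.finprod_cong'[OF refl])
      show "(\<lambda>i. yoneda R K H F i (a i) (n - i) (ext_map R K F G \<phi> x (n - i))) \<in> {..n} \<rightarrow> carrier (ext_group R K F n)"
        by (simp add: HF.yoneda_closed_le[OF a ext_map_carrier[OF \<phi> x]])
      fix i assume "i \<in> {..n}"
      then show "ext_map_deg R K F G \<phi> n (yoneda R K H G i (a i) (n - i) (x (n - i))) =
          yoneda R K H F i (a i) (n - i) (ext_map R K F G \<phi> x (n - i))"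
        using ext_map_deg_yoneda[OF H \<phi> HF.G.ext_carrier_closed[OF a, of i] G.ext_carrier_closed[OF x, of "n - i"]]
        by (simp add: ext_map_def)
    qed
    finally show ?thesis .
  qed
  then show "ext_map R K F G \<phi> (a \<odot>\<^bsub>ext_module R K H G\<^esub> x) = a \<odot>\<^bsub>ext_module R K H F\<^esub> ext_map R K F G \<phi> x"
    by (simp add: ext_module_def ext_map_def fun_eq_iff)
qed

lemma ext_map_grading:
  assumes \<phi>: "\<phi> \<in> mod_hom R X Y" and x: "x \<in> ext_grading R K G i"
  shows "ext_map R K F G \<phi> x \<in> ext_grading R K F i"
  using ext_map_carrier[OF \<phi> G.ext_grading_carrier[OF x]] G.ext_gradingD[OF x] ext_map_deg_one[OF \<phi>]
  by (intro F.ext_gradingI) (simp_all add: ext_map_def)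

end

section \<open>Syzygies and mapping cones\<close>

text \<open>Forgetting the term of degree 0 leaves a resolution of the first syzygy, augmented by
  \<open>diff F 0\<close>. Chain maps that exist only from degree 1 on thus become instances of
  \<open>chain_lifts\<close>.\<close>

definition shift_resolution :: "('r, 'f, 'x) resolution \<Rightarrow> ('r, 'f, 'f) resolution" where
  "shift_resolution F = \<lparr>cmod = (\<lambda>n. cmod F (Suc n)), diff = (\<lambda>n. diff F (Suc n)), aug = diff F 0\<rparr>"

text \<open>Kept inside \<open>cmod F 0\<close> with the same operations, so that a map into the
  syzygy is a map into \<open>cmod F 0\<close> whose values are boundaries.\<close>

definition syzygy :: "('r, 'f, 'x) resolution \<Rightarrow> ('r, 'f) module" where
  "syzygy F = (cmod F 0)\<lparr>carrier := diff F 0 ` carrier (cmod F (Suc 0))\<rparr>"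

lemma shift_resolution_simps [simp]:
  "cmod (shift_resolution F) n = cmod F (Suc n)" "diff (shift_resolution F) n = diff F (Suc n)"
  "aug (shift_resolution F) = diff F 0"
  by (simp_all add: shift_resolution_def)

lemma mod_hom_syzygy:
  "f \<in> mod_hom R M (syzygy F) \<longleftrightarrow>
    f \<in> mod_hom R M (cmod F 0) \<and> f ` carrier M \<subseteq> diff F 0 ` carrier (cmod F (Suc 0))"
  if "free_resolution R X F"
proof -
  have "f x \<in> carrier (cmod F 0)" if "f x \<in> diff F 0 ` carrier (cmod F (Suc 0))" for x
    using diff_closed[OF \<open>free_resolution R X F\<close>] that by auto
  then show ?thesis unfolding mod_hom_def syzygy_def Pi_iff image_subset_iff by auto
qed

lemma free_resolution_shift:
  assumes F: "free_resolution R X F"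
  shows "free_resolution R (syzygy F) (shift_resolution F)"
proof -
  interpret F0: left_module R "cmod F 0" by (rule free_resolution_cmod[OF F])
  interpret F1: left_module R "cmod F (Suc 0)" by (rule free_resolution_cmod[OF F])
  note d = free_resolution_diff[OF F, of 0]
  have "left_module R (syzygy F)"
    unfolding syzygy_def
  proof (rule left_module_submodule[OF F0.left_module_axioms])
    show "diff F 0 ` carrier (cmod F (Suc 0)) \<subseteq> carrier (cmod F 0)" using diff_closed[OF F] by auto
    show "\<zero>\<^bsub>cmod F 0\<^esub> \<in> diff F 0 ` carrier (cmod F (Suc 0))"
      using mod_hom_zero[OF d F1.left_module_axioms F0.left_module_axioms] F1.M.zero_closed by (metis imageI)
    fix x assume "x \<in> diff F 0 ` carrier (cmod F (Suc 0))"
    then obtain x' where x: "x' \<in> carrier (cmod F (Suc 0))" "x = diff F 0 x'" by auto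
    show "a \<odot>\<^bsub>cmod F 0\<^esub> x \<in> diff F 0 ` carrier (cmod F (Suc 0))" if "a \<in> carrier R" for a
      using mod_hom_smult[OF d that x(1)] F1.smult_closed[OF that x(1)] x(2) by (metis imageI)
    fix y assume "y \<in> diff F 0 ` carrier (cmod F (Suc 0))"
    then obtain y' where y: "y' \<in> carrier (cmod F (Suc 0))" "y = diff F 0 y'" by auto
    show "x \<oplus>\<^bsub>cmod F 0\<^esub> y \<in> diff F 0 ` carrier (cmod F (Suc 0))"
      using mod_hom_add[OF d x(1) y(1)] F1.M.a_closed[OF x(1) y(1)] x(2) y(2) by (metis imageI)
  qed
  moreover have "diff F 0 \<in> mod_hom R (cmod F (Suc 0)) (syzygy F)"
    unfolding mod_hom_syzygy[OF F] using d by simp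
  moreover have "carrier (syzygy F) = diff F 0 ` carrier (cmod F (Suc 0))" "\<zero>\<^bsub>syzygy F\<^esub> = \<zero>\<^bsub>cmod F 0\<^esub>"
    by (simp_all add: syzygy_def)
  ultimately show ?thesis using F unfolding free_resolution_def by simp
qed

lemma is_cocycle_shift: "is_cocycle R K (shift_resolution F) m f \<longleftrightarrow> is_cocycle R K F (Suc m) f"
  by (simp add: is_cocycle_def)

text \<open>Degree \<open>n\<close> consists of \<open>cmod B n\<close> and
  \<open>cmod A (n - 1)\<close>. What would be degree -1 of \<open>A\<close> is represented by the
  zero submodule of \<open>cmod A 0\<close>, so that all degrees share one type. The sign on
  \<open>diff A\<close> makes the two contributions of \<open>h\<close> to \<open>d d\<close>
  cancel.\<close>

definition mapping_cone ::
  "('r, 'f, 'x) resolution \<Rightarrow> ('r, 'g, 'y) resolution \<Rightarrow> (nat \<Rightarrow> 'f \<Rightarrow> 'g) \<Rightarrow> ('y \<Rightarrow> 'v) \<Rightarrow>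
   ('r, 'g \<times> 'f, 'v) resolution" where
  "mapping_cone A B h p =
    \<lparr>cmod = (\<lambda>n. module_prod (cmod B n)
       (case n of 0 \<Rightarrow> (cmod A 0)\<lparr>carrier := {\<zero>\<^bsub>cmod A 0\<^esub>}\<rparr> | Suc m \<Rightarrow> cmod A m)),
     diff = (\<lambda>n z. (diff B n (fst z) \<oplus>\<^bsub>cmod B n\<^esub> h n (snd z),
       case n of 0 \<Rightarrow> \<zero>\<^bsub>cmod A 0\<^esub> | Suc m \<Rightarrow> \<ominus>\<^bsub>cmod A m\<^esub> diff A m (snd z))),
     aug = (\<lambda>z. p (aug B (fst z)))\<rparr>"

lemma mapping_cone_simps [simp]:
  "cmod (mapping_cone A B h p) 0 = module_prod (cmod B 0) ((cmod A 0)\<lparr>carrier := {\<zero>\<^bsub>cmod A 0\<^esub>}\<rparr>)"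
  "cmod (mapping_cone A B h p) (Suc m) = module_prod (cmod B (Suc m)) (cmod A m)"
  "diff (mapping_cone A B h p) 0 z = (diff B 0 (fst z) \<oplus>\<^bsub>cmod B 0\<^esub> h 0 (snd z), \<zero>\<^bsub>cmod A 0\<^esub>)"
  "diff (mapping_cone A B h p) (Suc m) z = (diff B (Suc m) (fst z) \<oplus>\<^bsub>cmod B (Suc m)\<^esub> h (Suc m) (snd z),
     \<ominus>\<^bsub>cmod A m\<^esub> diff A m (snd z))"
  "aug (mapping_cone A B h p) z = p (aug B (fst z))"
  by (simp_all add: mapping_cone_def)

lemma free_module_zero:
  assumes "left_module R M"
  shows "free_module R (M\<lparr>carrier := {\<zero>\<^bsub>M\<^esub>}\<rparr>)"
proof -
  interpret M: left_module R M by fact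
  have l: "left_module R (M\<lparr>carrier := {\<zero>\<^bsub>M\<^esub>}\<rparr>)" by (rule left_module_submodule) (use assms in auto)
  interpret Z: left_module R "M\<lparr>carrier := {\<zero>\<^bsub>M\<^esub>}\<rparr>" by (rule l)
  have "lin_span R (M\<lparr>carrier := {\<zero>\<^bsub>M\<^esub>}\<rparr>) {} = {\<zero>\<^bsub>M\<^esub>}"
    using Z.M.finsum_empty by (auto simp: lin_span_def)
  then have "is_basis R (M\<lparr>carrier := {\<zero>\<^bsub>M\<^esub>}\<rparr>) {}" by (simp add: is_basis_def)
  with l show ?thesis by (auto simp: free_module_def)
qed

locale cone =
  fixes R :: "('r, 'z) ring_scheme" and A :: "('r, 'a) module" and B :: "('r, 'b) module"
    and V :: "('r, 'v) module" and i :: "'a \<Rightarrow> 'b" and p :: "'b \<Rightarrow> 'v"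
    and FA :: "('r, 'f, 'a) resolution" and FB :: "('r, 'g, 'b) resolution" and h :: "nat \<Rightarrow> 'f \<Rightarrow> 'g"
  assumes FA: "free_resolution R A FA" and FB: "free_resolution R B FB"
    and exact: "short_exact R A B V i p" and h: "h \<in> chain_lifts R FA 0 FB (i \<circ> aug FA)"
    and nontriv: "\<one>\<^bsub>R\<^esub> \<noteq> \<zero>\<^bsub>R\<^esub>"
begin

abbreviation C :: "('r, 'g \<times> 'f, 'v) resolution" where "C \<equiv> mapping_cone FA FB h p"

interpretation A: left_module R "cmod FA n" for n by (rule free_resolution_cmod[OF FA])
interpretation B: left_module R "cmod FB n" for n by (rule free_resolution_cmod[OF FB])

lemma h_hom: "h n \<in> mod_hom R (cmod FA n) (cmod FB n)"
  using chain_lifts_mod_hom[OF h, of n] by simp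

lemma h_diff: "x \<in> carrier (cmod FA (Suc n)) \<Longrightarrow> diff FB n (h (Suc n) x) = h n (diff FA n x)"
  using chain_lifts_diff[OF h, of x n] by simp

lemma p_hom: "p \<in> mod_hom R B V" using exact by (simp add: short_exact_def)

lemma left_module_V: "left_module R V" using exact by (simp add: short_exact_def)

lemma cone_free: "free_module R (cmod C n)"
  by (cases n) (auto intro!: free_module_prod free_module_zero A.left_module_axioms
      free_resolution_free[OF FA] free_resolution_free[OF FB] nontriv)

lemma cone_diff: "diff C n \<in> mod_hom R (cmod C (Suc n)) (cmod C n)"
proof -
  have 1: "(\<lambda>z. diff FB n (fst z) \<oplus>\<^bsub>cmod FB n\<^esub> h n (snd z)) \<in> mod_hom R (cmod C (Suc n)) (cmod FB n)"
  proof -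
    have "(\<lambda>z. (diff FB n \<circ> fst) z \<oplus>\<^bsub>cmod FB n\<^esub> (h n \<circ> snd) z) \<in>
        mod_hom R (module_prod (cmod FB (Suc n)) (cmod FA n)) (cmod FB n)"
      by (rule mod_hom_sum[OF mod_hom_comp[OF mod_hom_fst free_resolution_diff[OF FB]]
        mod_hom_comp[OF mod_hom_snd h_hom] B.left_module_axioms])
    then show ?thesis by simp
  qed
  show ?thesis
  proof (cases n)
    case 0
    have "(\<lambda>z. \<zero>\<^bsub>cmod FA 0\<^esub>) \<in> mod_hom R (cmod C (Suc n)) ((cmod FA 0)\<lparr>carrier := {\<zero>\<^bsub>cmod FA 0\<^esub>}\<rparr>)"
      by (auto simp: mod_hom_def)
    from mod_hom_Pair[OF 1 this] show ?thesis using 0 by (simp add: mapping_cone_def)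
  next
    case (Suc m)
    have "(\<lambda>z. \<ominus>\<^bsub>cmod FA m\<^esub> diff FA m (snd z)) \<in> mod_hom R (cmod C (Suc n)) (cmod FA m)"
    proof -
      have "(\<lambda>z. \<ominus>\<^bsub>cmod FA m\<^esub> (diff FA m \<circ> snd) z) \<in>
          mod_hom R (module_prod (cmod FB (Suc n)) (cmod FA (Suc m))) (cmod FA m)"
        by (rule mod_hom_uminus[OF mod_hom_comp[OF mod_hom_snd free_resolution_diff[OF FA]] A.left_module_axioms])
      then show ?thesis using Suc by simp
    qed
    from mod_hom_Pair[OF 1 this] show ?thesis using Suc by (simp add: mapping_cone_def)
  qed
qed

text \<open>\<open>x + h w\<close> is a cycle of \<open>FB\<close>, hence some \<open>d y\<close>,
  and \<open>(y, - w)\<close> is sent to \<open>(x, d w)\<close>. So a cycle of the cone is a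
  boundary as soon as its second component is a boundary of \<open>FA\<close>.\<close>

lemma cone_cycle_lift:
  assumes x: "x \<in> carrier (cmod FB (Suc n))" and w: "w \<in> carrier (cmod FA (Suc n))"
    and z: "diff FB n x \<oplus>\<^bsub>cmod FB n\<^esub> h n (diff FA n w) = \<zero>\<^bsub>cmod FB n\<^esub>"
  shows "(x, diff FA n w) \<in> diff C (Suc n) ` carrier (cmod C (Suc (Suc n)))"
proof -
  have hw: "h (Suc n) w \<in> carrier (cmod FB (Suc n))" by (rule mod_hom_closed[OF h_hom w])
  have "diff FB n (x \<oplus>\<^bsub>cmod FB (Suc n)\<^esub> h (Suc n) w) = \<zero>\<^bsub>cmod FB n\<^esub>"
    using z by (simp add: mod_hom_add[OF free_resolution_diff[OF FB] x hw] h_diff[OF w])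
  then obtain y where y: "y \<in> carrier (cmod FB (Suc (Suc n)))"
    "x \<oplus>\<^bsub>cmod FB (Suc n)\<^esub> h (Suc n) w = diff FB (Suc n) y"
    using diff_exact[OF FB B.M.a_closed[OF x hw]] by auto
  have "diff FB (Suc n) y \<oplus>\<^bsub>cmod FB (Suc n)\<^esub> h (Suc n) (\<ominus>\<^bsub>cmod FA (Suc n)\<^esub> w) = x"
    unfolding y(2)[symmetric] mod_hom_a_inv[OF h_hom A.left_module_axioms B.left_module_axioms w]
    using x hw by (simp add: B.M.a_assoc B.M.r_neg)
  moreover have "\<ominus>\<^bsub>cmod FA n\<^esub> diff FA n (\<ominus>\<^bsub>cmod FA (Suc n)\<^esub> w) = diff FA n w"
    using mod_hom_a_inv[OF free_resolution_diff[OF FA] A.left_module_axioms A.left_module_axioms w]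
      diff_closed[OF FA w] by simp
  ultimately have "diff C (Suc n) (y, \<ominus>\<^bsub>cmod FA (Suc n)\<^esub> w) = (x, diff FA n w)" by simp
  moreover have "(y, \<ominus>\<^bsub>cmod FA (Suc n)\<^esub> w) \<in> carrier (cmod C (Suc (Suc n)))" using y w by simp
  ultimately show ?thesis by (metis imageI)
qed

text \<open>By \<open>cone_cycle_lift\<close>, exactness in positive degrees comes down to the
  second component of a cycle being a boundary of \<open>FA\<close>. At the bottom, exactness of
  \<open>A\<close>, \<open>B\<close>, \<open>V\<close> is combined with the augmentations of
  \<open>FA\<close> and \<open>FB\<close>.\<close>

lemma cone_resolution: "free_resolution R V C"
  unfolding free_resolution_def
proof (intro conjI allI left_module_V cone_free cone_diff)
  have inj: "inj_on i (carrier A)" and im: "i ` carrier A = {y \<in> carrier B. p y = \<zero>\<^bsub>V\<^esub>}"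
    and surj: "p ` carrier B = carrier V" and i_hom: "i \<in> mod_hom R A B"
    using exact by (simp_all add: short_exact_def)
  note lA = free_resolution_left_module[OF FA] and lB = free_resolution_left_module[OF FB]
  have hc: "h n w \<in> carrier (cmod FB n)" if "w \<in> carrier (cmod FA n)" for n w
    by (rule mod_hom_closed[OF h_hom that])
  have ha: "aug FB (h 0 w) = i (aug FA w)" if "w \<in> carrier (cmod FA 0)" for w
    using chain_lifts_aug[OF h that] by simp
  show "aug C \<in> mod_hom R (cmod C 0) V"
    using mod_hom_comp[OF mod_hom_comp[OF mod_hom_fst free_resolution_aug[OF FB]] p_hom]
    by (simp add: comp_def mapping_cone_def)
  show "aug C ` carrier (cmod C 0) = carrier V"
  proof -
    have "carrier V = p ` aug FB ` carrier (cmod FB 0)" using surj aug_surj[OF FB] by simp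
    then show ?thesis by force
  qed
  show "diff C 0 ` carrier (cmod C (Suc 0)) = {x \<in> carrier (cmod C 0). aug C x = \<zero>\<^bsub>V\<^esub>}"
  proof (intro equalityI subsetI)
    fix z assume "z \<in> diff C 0 ` carrier (cmod C (Suc 0))"
    then obtain x w where z: "x \<in> carrier (cmod FB (Suc 0))" "w \<in> carrier (cmod FA 0)"
      "z = (diff FB 0 x \<oplus>\<^bsub>cmod FB 0\<^esub> h 0 w, \<zero>\<^bsub>cmod FA 0\<^esub>)" by auto
    interpret B': left_module R B by (rule lB)
    have "aug FB (diff FB 0 x \<oplus>\<^bsub>cmod FB 0\<^esub> h 0 w) = i (aug FA w)"
      using mod_hom_add[OF free_resolution_aug[OF FB] diff_closed[OF FB z(1)] hc[OF z(2)]]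
        aug_diff[OF FB z(1)] ha[OF z(2)] mod_hom_closed[OF i_hom aug_closed[OF FA z(2)]] by simp
    moreover have "p (i (aug FA w)) = \<zero>\<^bsub>V\<^esub>" using im aug_closed[OF FA z(2)] by blast
    ultimately show "z \<in> {x \<in> carrier (cmod C 0). aug C x = \<zero>\<^bsub>V\<^esub>}"
      using z diff_closed[OF FB z(1)] hc[OF z(2)] by simp
  next
    fix z assume "z \<in> {x \<in> carrier (cmod C 0). aug C x = \<zero>\<^bsub>V\<^esub>}"
    then obtain x where z: "z = (x, \<zero>\<^bsub>cmod FA 0\<^esub>)" "x \<in> carrier (cmod FB 0)" "p (aug FB x) = \<zero>\<^bsub>V\<^esub>" by auto
    \<comment> \<open>\<open>aug FB x\<close> comes from \<open>A\<close>. Subtracting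
      \<open>h 0 w\<close>, for \<open>w\<close> over its preimage, leaves an element with zero
      augmentation, to which exactness of \<open>FB\<close> applies.\<close>
    then have "aug FB x \<in> i ` carrier A" using im aug_closed[OF FB z(2)] by auto
    then obtain w where w: "w \<in> carrier (cmod FA 0)" "aug FB x = i (aug FA w)"
      using aug_surj[OF FA] by (metis imageE)
    interpret B': left_module R B by (rule lB)
    have "aug FB (x \<ominus>\<^bsub>cmod FB 0\<^esub> h 0 w) = \<zero>\<^bsub>B\<^esub>"
      using mod_hom_a_minus[OF free_resolution_aug[OF FB] B.left_module_axioms lB z(2) hc[OF w(1)]] w(2) ha[OF w(1)]
        aug_closed[OF FB z(2)] by (simp add: B'.M.minus_eq_zero_iff)
    then obtain y where y: "y \<in> carrier (cmod FB (Suc 0))" "x \<ominus>\<^bsub>cmod FB 0\<^esub> h 0 w = diff FB 0 y"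
      using aug_exact[OF FB] z(2) hc[OF w(1)] by (metis B.M.minus_closed imageE)
    then have "x = diff FB 0 y \<oplus>\<^bsub>cmod FB 0\<^esub> h 0 w"
      using B.M.minus_eq_iff_eq_add[OF z(2) hc[OF w(1)] diff_closed[OF FB y(1)]] by simp
    then have "z = diff C 0 (y, w)" using z(1) by simp
    then show "z \<in> diff C 0 ` carrier (cmod C (Suc 0))" using y w by force
  qed
  fix n
  show "diff C (Suc n) ` carrier (cmod C (Suc (Suc n))) = {x \<in> carrier (cmod C (Suc n)). diff C n x = \<zero>\<^bsub>cmod C n\<^esub>}"
  proof (intro equalityI subsetI)
    fix z assume "z \<in> diff C (Suc n) ` carrier (cmod C (Suc (Suc n)))"
    then obtain x w where z: "x \<in> carrier (cmod FB (Suc (Suc n)))" "w \<in> carrier (cmod FA (Suc n))"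
      "z = (diff FB (Suc n) x \<oplus>\<^bsub>cmod FB (Suc n)\<^esub> h (Suc n) w, \<ominus>\<^bsub>cmod FA n\<^esub> diff FA n w)" by auto
    have "diff FB n (fst z) \<oplus>\<^bsub>cmod FB n\<^esub> h n (snd z) = \<zero>\<^bsub>cmod FB n\<^esub>"
      using z hc[OF z(2)] diff_closed[OF FB z(1)] diff_closed[OF FA z(2)] diff_diff[OF FB z(1)] h_diff[OF z(2)]
        hc[OF diff_closed[OF FA z(2)]]
      by (simp add: mod_hom_add[OF free_resolution_diff[OF FB]] B.M.r_neg
          mod_hom_a_inv[OF h_hom A.left_module_axioms B.left_module_axioms])
    moreover have "\<ominus>\<^bsub>cmod FA m\<^esub> diff FA m (snd z) = \<zero>\<^bsub>cmod FA m\<^esub>" if "n = Suc m" for m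
      using z(2,3) diff_diff[OF FA] diff_closed[OF FA z(2)] that
      by (simp add: mod_hom_a_inv[OF free_resolution_diff[OF FA] A.left_module_axioms A.left_module_axioms])
    ultimately have "diff C n z = \<zero>\<^bsub>cmod C n\<^esub>" by (cases n) simp_all
    then show "z \<in> {x \<in> carrier (cmod C (Suc n)). diff C n x = \<zero>\<^bsub>cmod C n\<^esub>}"
      using z hc[OF z(2)] diff_closed[OF FB z(1)] diff_closed[OF FA z(2)] by simp
  next
    fix z assume "z \<in> {x \<in> carrier (cmod C (Suc n)). diff C n x = \<zero>\<^bsub>cmod C n\<^esub>}"
    then obtain x w where z: "z = (x, w)" "x \<in> carrier (cmod FB (Suc n))" "w \<in> carrier (cmod FA n)"
      "diff C n (x, w) = \<zero>\<^bsub>cmod C n\<^esub>" by auto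
    have zero: "diff FB n x \<oplus>\<^bsub>cmod FB n\<^esub> h n w = \<zero>\<^bsub>cmod FB n\<^esub>" using z(4) by (cases n) simp_all
    \<comment> \<open>For \<open>n = 0\<close> no differential of \<open>FA\<close> tests
      \<open>w\<close>; applying \<open>aug FB\<close> to the cycle equation gives
      \<open>i (aug FA w) = 0\<close> instead, and \<open>i\<close> is injective.\<close>
    have "w \<in> diff FA n ` carrier (cmod FA (Suc n))"
    proof (cases n)
      case 0
      interpret B': left_module R B by (rule lB)
      have x0: "x \<in> carrier (cmod FB (Suc 0))" and w0: "w \<in> carrier (cmod FA 0)" using z 0 by simp_all
      have "aug FB (diff FB 0 x \<oplus>\<^bsub>cmod FB 0\<^esub> h 0 w) = i (aug FA w)"
        using mod_hom_add[OF free_resolution_aug[OF FB] diff_closed[OF FB x0] hc[OF w0]]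
          aug_diff[OF FB x0] ha[OF w0] mod_hom_closed[OF i_hom aug_closed[OF FA w0]] by simp
      then have "i (aug FA w) = i \<zero>\<^bsub>A\<^esub>"
        using zero 0 mod_hom_zero[OF free_resolution_aug[OF FB] B.left_module_axioms lB] mod_hom_zero[OF i_hom lA lB] by simp
      then have "aug FA w = \<zero>\<^bsub>A\<^esub>"
        using inj aug_closed[OF FA w0] abelian_monoid.zero_closed lA
        by (metis inj_onD left_module.axioms(2) abelian_group.axioms(1))
      then show ?thesis using aug_exact[OF FA w0] 0 by simp
    next
      case (Suc m)
      then have "\<ominus>\<^bsub>cmod FA m\<^esub> diff FA m w = \<zero>\<^bsub>cmod FA m\<^esub>" "w \<in> carrier (cmod FA (Suc m))" using z by simp_all
      then have "diff FA m w = \<zero>\<^bsub>cmod FA m\<^esub>"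
        using diff_closed[OF FA, of w m] by simp
      then show ?thesis using diff_exact[OF FA] \<open>w \<in> carrier (cmod FA (Suc m))\<close> Suc by simp
    qed
    then obtain w' where w': "w' \<in> carrier (cmod FA (Suc n))" "w = diff FA n w'" by auto
    show "z \<in> diff C (Suc n) ` carrier (cmod C (Suc (Suc n)))"
      using cone_cycle_lift[OF z(2) w'(1)] zero w'(2) z(1) by simp
  qed
qed

text \<open>A lift of \<open>p\<close> into the cone. At \<open>n = 0\<close> the truncated
  \<open>n - 1\<close> names \<open>cmod FA 0\<close>, whose zero is the only second component that
  occurs in degree 0 of the cone.\<close>

lemma cone_inclusion: "(\<lambda>n x. (x, \<zero>\<^bsub>cmod FA (n - 1)\<^esub>)) \<in> chain_lifts R FB 0 C (p \<circ> aug FB)"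
  unfolding chain_lifts_def
proof (intro CollectI conjI allI ballI)
  show "(\<lambda>x. (x, \<zero>\<^bsub>cmod FA (n - 1)\<^esub>)) \<in> mod_hom R (cmod FB (0 + n)) (cmod C n)" for n
    by (cases n) (auto intro!: mod_homI)
  show "diff C n (x, \<zero>\<^bsub>cmod FA (Suc n - 1)\<^esub>) = (diff FB (0 + n) x, \<zero>\<^bsub>cmod FA (n - 1)\<^esub>)"
    if "x \<in> carrier (cmod FB (Suc (0 + n)))" for n x
    using that diff_closed[OF FB, of x n]
    by (cases n) (simp_all add: mod_hom_zero[OF h_hom A.left_module_axioms B.left_module_axioms]
        mod_hom_zero[OF free_resolution_diff[OF FA] A.left_module_axioms A.left_module_axioms])
qed simp

end

section \<open>Two exactness statements of the long exact sequence\<close>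

text \<open>The connecting homomorphism of the long exact sequence sends a cocycle \<open>w\<close> on \<open>FA n\<close> to the
  cocycle \<open>(x, y) \<mapsto> w y\<close> on the cone.\<close>

locale cone_ext = cone R A B V i p FA FB h for R :: "('r, 'z) ring_scheme" and A :: "('r, 'a) module"
    and B :: "('r, 'b) module" and V :: "('r, 'v) module" and i p FA FB h +
  fixes K :: "('r, 'k) module" and FV :: "('r, 'l, 'v) resolution"
  assumes K: "left_module R K" and FV: "free_resolution R V FV"
begin

interpretation A: left_module R "cmod FA n" for n by (rule free_resolution_cmod[OF FA])
interpretation B: left_module R "cmod FB n" for n by (rule free_resolution_cmod[OF FB])
interpretation K: left_module R K by (rule K)
interpretation EA: ext_data R K A FA by (rule ext_data.intro[OF K FA])
interpretation EB: ext_data R K B FB by (rule ext_data.intro[OF K FB])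
interpretation EC: ext_data R K V C by (rule ext_data.intro[OF K cone_resolution])
interpretation BV: ext_functor R K B FB V FV by (rule ext_functor.intro[OF K FB FV])
interpretation AB: ext_functor R K A FA B FB by (rule ext_functor.intro[OF K FA FB])
interpretation VC: ext_functor R K V FV V C by (rule ext_functor.intro[OF K FV cone_resolution])
interpretation CV: ext_functor R K V C V FV by (rule ext_functor.intro[OF K cone_resolution FV])
interpretation BC: ext_functor R K B FB V C by (rule ext_functor.intro[OF K FB cone_resolution])

text \<open>If \<open>f h = u d\<close>, the cochain \<open>(x, y) \<mapsto> f x + u y\<close> is a
  cocycle on the cone, the sign in the differential cancelling \<open>u d\<close> against
  \<open>f h\<close>. It restricts to \<open>f\<close> along the inclusion of
  \<open>FB\<close>.\<close>

lemma ext_exact_middle: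
  assumes a: "a \<in> carrier (ext_group R K FB n)" and ia: "ext_map_deg R K FA FB i n a = \<one>\<^bsub>ext_group R K FA n\<^esub>"
  shows "\<exists>z\<in>carrier (ext_group R K FV n). a = ext_map_deg R K FB FV p n z"
proof -
  obtain f where f: "is_cocycle R K FB n f" "a = ext_class R K FB n f" by (rule EB.ext_group_cases[OF a])
  have fh: "is_cocycle R K FA n (f \<circ> h n)" using chain_lifts_cocycle[OF K FA FB h f(1)] by simp
  have "ext_class R K FA n (f \<circ> h n) = ext_class R K FA n (\<lambda>x. \<zero>\<^bsub>K\<^esub>)"
    using ia ext_map_deg_class[OF K FA FB f(1) h] f(2) EA.ext_class_one by simp
  then have coh: "cohomologous R K FA n (f \<circ> h n) (\<lambda>x. \<zero>\<^bsub>K\<^esub>)"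
    using EA.ext_class_eq_iff[OF fh EA.is_cocycle_zero] by simp
  have fc: "f x \<in> carrier K" if "x \<in> carrier (cmod FB n)" for x by (rule is_cocycle_closed[OF f(1) that])
  have fhom: "f \<in> mod_hom R (cmod FB n) K" by (rule is_cocycle_mod_hom[OF f(1)])
  have hc: "h n w \<in> carrier (cmod FB n)" if "w \<in> carrier (cmod FA n)" for w
    by (rule mod_hom_closed[OF h_hom that])
  have "\<exists>q. is_cocycle R K C n q \<and> (\<forall>x\<in>carrier (cmod FB n). q (x, \<zero>\<^bsub>cmod FA (n - 1)\<^esub>) = f x)"
  proof (cases n)
    case 0
    \<comment> \<open>In degree 0 the triviality of the pullback means that \<open>f h\<close> is
      zero, so \<open>f\<close> extends to the cone by zero.\<close>
    have "is_cocycle R K C n (f \<circ> fst)"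
      unfolding is_cocycle_def
    proof (intro conjI ballI)
      show "f \<circ> fst \<in> mod_hom R (cmod C n) K" using 0 mod_hom_comp[OF mod_hom_fst] fhom by simp
      fix z assume "z \<in> carrier (cmod C (Suc n))"
      then obtain x w where z: "z = (x, w)" "x \<in> carrier (cmod FB (Suc n))" "w \<in> carrier (cmod FA n)" by auto
      have "f (h 0 w) = \<zero>\<^bsub>K\<^esub>" using coh 0 z by (simp add: cohomologous_def)
      then show "(f \<circ> fst) (diff C n z) = \<zero>\<^bsub>K\<^esub>"
        using z 0 mod_hom_add[OF fhom diff_closed[OF FB z(2)] hc[OF z(3)]] is_cocycle_diff[OF f(1) z(2)] by simp
    qed
    then show ?thesis using 0 by (intro exI[of _ "f \<circ> fst"]) simp
  next
    case (Suc m)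
    then obtain u where u: "u \<in> mod_hom R (cmod FA m) K"
      "\<And>w. w \<in> carrier (cmod FA n) \<Longrightarrow> f (h n w) = \<zero>\<^bsub>K\<^esub> \<oplus>\<^bsub>K\<^esub> u (diff FA m w)"
      using coh by (auto simp: cohomologous_def)
    let ?q = "\<lambda>z. f (fst z) \<oplus>\<^bsub>K\<^esub> u (snd z)"
    have q: "is_cocycle R K C n ?q"
      unfolding is_cocycle_def
    proof (intro conjI ballI)
      show "?q \<in> mod_hom R (cmod C n) K"
        using mod_hom_sum[OF mod_hom_comp[OF mod_hom_fst fhom] mod_hom_comp[OF mod_hom_snd u(1)] K] Suc
        by (simp add: comp_def)
      fix z assume "z \<in> carrier (cmod C (Suc n))"
      then obtain x w where z: "z = (x, w)" "x \<in> carrier (cmod FB (Suc n))" "w \<in> carrier (cmod FA n)" by auto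
      have dw: "diff FA m w \<in> carrier (cmod FA m)" using diff_closed[OF FA, of w m] z(3) Suc by simp
      have "f (diff FB n x \<oplus>\<^bsub>cmod FB n\<^esub> h n w) = u (diff FA m w)"
        using mod_hom_add[OF fhom diff_closed[OF FB z(2)] hc[OF z(3)]] is_cocycle_diff[OF f(1) z(2)]
          u(2)[OF z(3)] mod_hom_closed[OF u(1) dw] by simp
      moreover have "u (\<ominus>\<^bsub>cmod FA m\<^esub> diff FA m w) = \<ominus>\<^bsub>K\<^esub> u (diff FA m w)"
        by (rule mod_hom_a_inv[OF u(1) A.left_module_axioms K dw])
      ultimately show "?q (diff C n z) = \<zero>\<^bsub>K\<^esub>"
        using z Suc mod_hom_closed[OF u(1) dw] by (simp add: K.M.r_neg)
    qed
    show ?thesis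
      using q Suc fc mod_hom_zero[OF u(1) A.left_module_axioms K] by (intro exI[of _ ?q]) simp
  qed
  then obtain q where q: "is_cocycle R K C n q"
    "\<And>x. x \<in> carrier (cmod FB n) \<Longrightarrow> q (x, \<zero>\<^bsub>cmod FA (n - 1)\<^esub>) = f x" by blast
  \<comment> \<open>The class on the cone is transported to \<open>FV\<close> by a lift of the
    identity of \<open>V\<close>; composing with \<open>p\<close> gives back the restriction to
    \<open>FB\<close>.\<close>
  let ?z = "ext_map_deg R K FV C (\<lambda>x. x) n (ext_class R K C n q)"
  note qc = EC.ext_class_carrier[OF q(1)]
  have "ext_map_deg R K FB FV p n ?z = ext_map_deg R K FB C p n (ext_class R K C n q)"
    using BV.ext_map_deg_comp[OF cone_resolution p_hom mod_hom_id qc] by (simp add: comp_def)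
  also have "\<dots> = ext_class R K FB n (q \<circ> (\<lambda>x. (x, \<zero>\<^bsub>cmod FA (n - 1)\<^esub>)))"
    by (rule ext_map_deg_class[OF K FB cone_resolution q(1) cone_inclusion])
  also have "\<dots> = a" unfolding f(2) by (rule EB.ext_class_cong) (use q(2) in simp)
  finally show ?thesis using VC.ext_map_deg_closed[OF mod_hom_id qc] by (intro bexI[of _ ?z]) simp
qed

text \<open>The connecting class of \<open>f\<close> restricts to zero on \<open>FB\<close>, hence
  is zero by \<open>inj\<close>. A cochain \<open>g\<close> on the cone that bounds it gives the
  wanted preimage by restriction to \<open>FB\<close>.\<close>

lemma ext_exact_surj:
  assumes w: "w \<in> carrier (ext_group R K FA n)"
    and inj: "\<And>z. \<lbrakk>z \<in> carrier (ext_group R K FV (Suc n));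
      ext_map_deg R K FB FV p (Suc n) z = \<one>\<^bsub>ext_group R K FB (Suc n)\<^esub>\<rbrakk> \<Longrightarrow> z = \<one>\<^bsub>ext_group R K FV (Suc n)\<^esub>"
  shows "\<exists>a\<in>carrier (ext_group R K FB n). w = ext_map_deg R K FA FB i n a"
proof -
  obtain f where f: "is_cocycle R K FA n f" "w = ext_class R K FA n f" by (rule EA.ext_group_cases[OF w])
  note fhom = is_cocycle_mod_hom[OF f(1)]
  have q: "is_cocycle R K C (Suc n) (f \<circ> snd)"
    unfolding is_cocycle_def
  proof (intro conjI ballI)
    show "f \<circ> snd \<in> mod_hom R (cmod C (Suc n)) K" using mod_hom_comp[OF mod_hom_snd fhom] by simp
    fix z assume "z \<in> carrier (cmod C (Suc (Suc n)))"
    then have z: "snd z \<in> carrier (cmod FA (Suc n))" by auto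
    then show "(f \<circ> snd) (diff C (Suc n) z) = \<zero>\<^bsub>K\<^esub>"
      using is_cocycle_diff[OF f(1) z] mod_hom_a_inv[OF fhom A.left_module_axioms K diff_closed[OF FA z]] by simp
  qed
  let ?q = "ext_class R K C (Suc n) (f \<circ> snd)"
  note qc = EC.ext_class_carrier[OF q]
  let ?z = "ext_map_deg R K FV C (\<lambda>x. x) (Suc n) ?q"
  have "ext_map_deg R K FB FV p (Suc n) ?z = ext_map_deg R K FB C p (Suc n) ?q"
    using BV.ext_map_deg_comp[OF cone_resolution p_hom mod_hom_id qc] by (simp add: comp_def)
  also have "\<dots> = ext_class R K FB (Suc n) (f \<circ> snd \<circ> (\<lambda>x. (x, \<zero>\<^bsub>cmod FA (Suc n - 1)\<^esub>)))"
    by (rule ext_map_deg_class[OF K FB cone_resolution q cone_inclusion])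
  also have "\<dots> = \<one>\<^bsub>ext_group R K FB (Suc n)\<^esub>"
    unfolding EB.ext_class_one
    by (rule EB.ext_class_cong) (simp add: mod_hom_zero[OF fhom A.left_module_axioms K])
  finally have z1: "?z = \<one>\<^bsub>ext_group R K FV (Suc n)\<^esub>" using inj VC.ext_map_deg_closed[OF mod_hom_id qc] by simp
  \<comment> \<open>Going from the cone to \<open>FV\<close> and back along identity maps induces
    the identity, so triviality of \<open>?z\<close> passes back to \<open>?q\<close>.\<close>
  have "?q = ext_map_deg R K C FV (\<lambda>x. x) (Suc n) ?z"
    using CV.ext_map_deg_comp[OF cone_resolution mod_hom_id mod_hom_id qc]
      ext_map_deg_id[OF K cone_resolution qc] by (simp add: comp_def)
  also have "\<dots> = ext_class R K C (Suc n) (\<lambda>x. \<zero>\<^bsub>K\<^esub>)"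
    unfolding z1 CV.ext_map_deg_one[OF mod_hom_id] EC.ext_class_one ..
  finally have "cohomologous R K C (Suc n) (f \<circ> snd) (\<lambda>x. \<zero>\<^bsub>K\<^esub>)"
    using EC.ext_class_eq_iff[OF q EC.is_cocycle_zero] by simp
  then obtain g where g: "g \<in> mod_hom R (cmod C n) K"
    "\<And>z. z \<in> carrier (cmod C (Suc n)) \<Longrightarrow> f (snd z) = \<zero>\<^bsub>K\<^esub> \<oplus>\<^bsub>K\<^esub> g (diff C n z)"
    by (auto simp: cohomologous_def)
  let ?in = "\<lambda>x. (x, \<zero>\<^bsub>cmod FA (n - 1)\<^esub>)"
  have incl: "?in \<in> mod_hom R (cmod FB n) (cmod C n)"
    using chain_lifts_mod_hom[OF cone_inclusion, of n] by simp
  \<comment> \<open>Evaluating \<open>g d\<close> at \<open>(x, 0)\<close> shows that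
    \<open>?f\<close> is a cocycle; evaluating it at \<open>(0, y)\<close> shows that
    \<open>f\<close> is \<open>?f o h n\<close> up to a coboundary.\<close>
  let ?f = "g \<circ> ?in"
  have f'hom: "?f \<in> mod_hom R (cmod FB n) K" by (rule mod_hom_comp[OF incl g(1)])
  have gd: "g (diff C n z) = f (snd z)" if "z \<in> carrier (cmod C (Suc n))" for z
    using g(2)[OF that] mod_hom_closed[OF g(1) mod_hom_closed[OF cone_diff that]] by simp
  have f': "is_cocycle R K FB n ?f"
    unfolding is_cocycle_def
  proof (intro conjI ballI f'hom)
    fix x assume x: "x \<in> carrier (cmod FB (Suc n))"
    have "?in (diff FB n x) = diff C n (x, \<zero>\<^bsub>cmod FA n\<^esub>)"
      using chain_lifts_diff[OF cone_inclusion, of x n] x by simp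
    then show "?f (diff FB n x) = \<zero>\<^bsub>K\<^esub>"
      using gd[of "(x, \<zero>\<^bsub>cmod FA n\<^esub>)"] x mod_hom_zero[OF fhom A.left_module_axioms K] by simp
  qed
  have hc: "h n y \<in> carrier (cmod FB n)" if "y \<in> carrier (cmod FA n)" for y
    by (rule mod_hom_closed[OF h_hom that])
  note fh = chain_lifts_cocycle[OF K FA FB h f', unfolded add_0_left]
  have "cohomologous R K FA n f (?f \<circ> h n)"
  proof (cases n)
    case 0
    have "f y = g (h 0 y, \<zero>\<^bsub>cmod FA 0\<^esub>)" if "y \<in> carrier (cmod FA 0)" for y
      using gd[of "(\<zero>\<^bsub>cmod FB (Suc 0)\<^esub>, y)"] that hc[of y] 0
      by (simp add: mod_hom_zero[OF free_resolution_diff[OF FB] B.left_module_axioms B.left_module_axioms])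
    then show ?thesis using 0 by (simp add: cohomologous_def)
  next
    case (Suc m)
    \<comment> \<open>The differential sends \<open>(0, y)\<close> to \<open>(h y, - d y)\<close>;
      \<open>?u\<close> and its sign account for the second component.\<close>
    let ?u = "\<lambda>y. g (\<zero>\<^bsub>cmod FB n\<^esub>, \<ominus>\<^bsub>cmod FA m\<^esub> y)"
    have "(\<lambda>y. (\<zero>\<^bsub>cmod FB n\<^esub>, \<ominus>\<^bsub>cmod FA m\<^esub> y)) \<in> mod_hom R (cmod FA m) (cmod C n)"
      using mod_hom_Pair[OF mod_hom_zero_map[OF B.left_module_axioms]
        mod_hom_uminus[OF mod_hom_id A.left_module_axioms]] Suc by simp
    from mod_hom_comp[OF this g(1)] have u: "?u \<in> mod_hom R (cmod FA m) K" by (simp add: comp_def)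
    have "f y = ?f (h n y) \<oplus>\<^bsub>K\<^esub> ?u (diff FA m y)" if y: "y \<in> carrier (cmod FA (Suc m))" for y
    proof -
      have dy: "diff FA m y \<in> carrier (cmod FA m)" by (rule diff_closed[OF FA y])
      have "f y = g (h n y, \<ominus>\<^bsub>cmod FA m\<^esub> diff FA m y)"
        using gd[of "(\<zero>\<^bsub>cmod FB (Suc n)\<^esub>, y)"] y hc[of y] Suc
        by (simp add: mod_hom_zero[OF free_resolution_diff[OF FB] B.left_module_axioms B.left_module_axioms])
      also have "(h n y, \<ominus>\<^bsub>cmod FA m\<^esub> diff FA m y) = ?in (h n y) \<oplus>\<^bsub>cmod C n\<^esub> (\<zero>\<^bsub>cmod FB n\<^esub>, \<ominus>\<^bsub>cmod FA m\<^esub> diff FA m y)"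
        using hc[of y] y Suc dy by simp
      also have "g \<dots> = ?f (h n y) \<oplus>\<^bsub>K\<^esub> ?u (diff FA m y)"
        using mod_hom_add[OF g(1), of "?in (h n y)" "(\<zero>\<^bsub>cmod FB n\<^esub>, \<ominus>\<^bsub>cmod FA m\<^esub> diff FA m y)"] hc[of y] y Suc dy
        by simp
      finally show ?thesis .
    qed
    with u Suc show ?thesis by (auto simp: cohomologous_def)
  qed
  then have "w = ext_map_deg R K FA FB i n (ext_class R K FB n ?f)"
    unfolding f(2) ext_map_deg_class[OF K FA FB f' h] using EA.ext_class_eq_iff[OF f(1) fh] by simp
  then show ?thesis using EB.ext_class_carrier[OF f'] by blast
qed

end

section \<open>Injectivity of the map from Ext of the common quotient\<close>

text \<open>Compares two lifted maps in \<open>ext_injective\<close>. There \<open>a\<close> is the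
  image in \<open>FV\<close> of \<open>t d x\<close> and \<open>r\<close> that of its correction
  from \<open>FM\<close>, \<open>s\<close> is the image of the correction from \<open>FN\<close>,
  and \<open>d\<close> is the boundary of \<open>x\<close>.\<close>

lemma (in abelian_group) homotopy_identity:
  assumes "a \<in> carrier G" "r \<in> carrier G" "s \<in> carrier G" "d \<in> carrier G"
  shows "a \<ominus> r = (\<zero> \<ominus> s) \<oplus> (d \<oplus> ((a \<ominus> d) \<ominus> (r \<ominus> s)))"
proof -
  have "(\<zero> \<ominus> s) \<oplus> (d \<oplus> ((a \<ominus> d) \<ominus> (r \<ominus> s))) = (a \<ominus> r) \<oplus> ((d \<ominus> d) \<oplus> (s \<ominus> s))"
    using assms by (simp add: minus_eq minus_add a_ac)
  then show ?thesis using assms by (simp add: minus_eq r_neg)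
qed

text \<open>\<open>A\<close> ends in degree 1 of \<open>F\<close> and above, so only the components
  \<open>h (Suc i)\<close> are composed with it. \<open>h 0\<close> survives in the map being
  lifted: \<open>d h A = h 0 d A = h 0 u\<close> at the bottom.\<close>

lemma chain_lifts_shift:
  assumes h: "h \<in> chain_lifts R F 0 G f" and A: "A \<in> chain_lifts R L j (shift_resolution F) u"
  shows "(\<lambda>i. h (Suc i) \<circ> A i) \<in> chain_lifts R L j (shift_resolution G) (\<lambda>x. h 0 (u x))"
  unfolding chain_lifts_def
proof (intro CollectI conjI allI ballI)
  have Ac: "A i x \<in> carrier (cmod F (Suc i))" if "x \<in> carrier (cmod L (j + i))" for i x
    using mod_hom_closed[OF chain_lifts_mod_hom[OF A, of i] that] by simp
  show "h (Suc i) \<circ> A i \<in> mod_hom R (cmod L (j + i)) (cmod (shift_resolution G) i)" for i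
    using mod_hom_comp[OF chain_lifts_mod_hom[OF A, of i]] chain_lifts_mod_hom[OF h, of "Suc i"] by simp
  show "aug (shift_resolution G) ((h (Suc 0) \<circ> A 0) x) = h 0 (u x)" if x: "x \<in> carrier (cmod L j)" for x
    using chain_lifts_diff[OF h, of "A 0 x" 0] Ac[of x 0] x chain_lifts_aug[OF A x] by simp
  show "diff (shift_resolution G) i ((h (Suc (Suc i)) \<circ> A (Suc i)) x) = (h (Suc i) \<circ> A i) (diff L (j + i) x)"
    if x: "x \<in> carrier (cmod L (Suc (j + i)))" for i x
    using chain_lifts_diff[OF h, of "A (Suc i) x" "Suc i"] Ac[of x "Suc i"] x chain_lifts_diff[OF A x] by simp
qed

text \<open>\<open>B\<close> indexes a basis of \<open>V\<close>, and \<open>c b x\<close> is the coordinate of the boundary of \<open>x\<close> at \<open>b\<close>,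
  lifted to \<open>R\<close>.\<close>

locale boundary_coefficients = ext_data R K V FV
  for R :: "('r, 'z) ring_scheme" and K :: "('r, 'k) module" and V :: "('r, 'v) module"
    and FV :: "('r, 'b, 'v) resolution" +
  fixes B :: "'i set" and c :: "'i \<Rightarrow> 'b \<Rightarrow> 'r"
  assumes B: "finite B"
    and c_closed: "\<And>b x. \<lbrakk>b \<in> B; x \<in> carrier (cmod FV (Suc 0))\<rbrakk> \<Longrightarrow> c b x \<in> carrier R"
    and c_add: "\<And>b x y. \<lbrakk>b \<in> B; x \<in> carrier (cmod FV (Suc 0)); y \<in> carrier (cmod FV (Suc 0))\<rbrakk> \<Longrightarrow>
      c b (x \<oplus>\<^bsub>cmod FV (Suc 0)\<^esub> y) = c b x \<oplus>\<^bsub>R\<^esub> c b y"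
    and c_smult: "\<And>b a x. \<lbrakk>b \<in> B; a \<in> carrier R; x \<in> carrier (cmod FV (Suc 0))\<rbrakk> \<Longrightarrow>
      c b (a \<odot>\<^bsub>cmod FV (Suc 0)\<^esub> x) = a \<otimes>\<^bsub>R\<^esub> c b x"
    and c_diff: "\<And>b x. \<lbrakk>b \<in> B; x \<in> carrier (cmod FV (Suc (Suc 0)))\<rbrakk> \<Longrightarrow> c b (diff FV (Suc 0) x) = \<zero>\<^bsub>R\<^esub>"
    and c_kill: "\<And>b x k. \<lbrakk>b \<in> B; x \<in> carrier (cmod FV (Suc 0)); k \<in> carrier K\<rbrakk> \<Longrightarrow> c b x \<odot>\<^bsub>K\<^esub> k = \<zero>\<^bsub>K\<^esub>"
begin

interpretation K: left_module R K by (rule K)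
interpretation V: left_module R V by (rule free_resolution_left_module[OF F])
interpretation C: left_module R "cmod FV n" for n by (rule free_resolution_cmod[OF F])

lemmas lC = C.left_module_axioms and dC = free_resolution_diff[OF F]

text \<open>The correction term, over whatever module \<open>L\<close> contains the family
  \<open>e\<close>; \<open>M\<close>, \<open>N\<close> and low terms of all three resolutions occur
  as \<open>L\<close>.\<close>

definition comb :: "('r, 'x) module \<Rightarrow> ('i \<Rightarrow> 'x) \<Rightarrow> 'b \<Rightarrow> 'x" where
  "comb L e x = finsum L (\<lambda>b. c b x \<odot>\<^bsub>L\<^esub> e b) B"

lemma comb_hom:
  "\<lbrakk>left_module R L; e \<in> B \<rightarrow> carrier L\<rbrakk> \<Longrightarrow> comb L e \<in> mod_hom R (cmod FV (Suc 0)) L"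
  unfolding comb_def by (rule mod_hom_finsum_smult[OF lC _ B]) (auto simp: c_closed c_add c_smult)

lemma comb_cong:
  assumes "left_module R L" "\<forall>b\<in>B. e b = e' b" "e' \<in> B \<rightarrow> carrier L"
    and "x \<in> carrier (cmod FV (Suc 0))"
  shows "comb L e x = comb L e' x"
proof -
  interpret L: left_module R L by fact
  show ?thesis unfolding comb_def by (rule L.M.finsum_cong') (use assms c_closed in auto)
qed

text \<open>The coefficients do not refer to \<open>L\<close>, so a linear map carries the
  correction from one module to another by acting on the family alone.\<close>

lemma comb_map:
  assumes g: "g \<in> mod_hom R L L'" and L: "left_module R L" and L': "left_module R L'"
    and e: "e \<in> B \<rightarrow> carrier L" and x: "x \<in> carrier (cmod FV (Suc 0))"
  shows "g (comb L e x) = comb L' (\<lambda>b. g (e b)) x"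
proof -
  interpret L: left_module R L by (rule L)
  interpret L': left_module R L' by (rule L')
  have "g (comb L e x) = finsum L' (\<lambda>b. g (c b x \<odot>\<^bsub>L\<^esub> e b)) B"
    unfolding comb_def by (rule mod_hom_finsum[OF g L L' B]) (use e x c_closed in auto)
  also have "\<dots> = comb L' (\<lambda>b. g (e b)) x"
    unfolding comb_def
    by (rule L'.M.finsum_cong') (auto simp: mod_hom_smult[OF g c_closed[OF _ x] funcset_mem[OF e]]
        intro!: L'.smult_closed c_closed x mod_hom_closed[OF g] funcset_mem[OF e])
  finally show ?thesis .
qed

lemma comb_diff:
  assumes "left_module R L" "e \<in> B \<rightarrow> carrier L" "x \<in> carrier (cmod FV (Suc (Suc 0)))"
  shows "comb L e (diff FV (Suc 0) x) = \<zero>\<^bsub>L\<^esub>"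
proof -
  interpret L: left_module R L by fact
  show ?thesis unfolding comb_def by (rule L.M.add.finprod_one_eqI) (simp add: c_diff assms(3) funcset_mem[OF assms(2)])
qed

lemma comb_kill:
  assumes g: "g \<in> mod_hom R L K" and L: "left_module R L"
    and e: "e \<in> B \<rightarrow> carrier L" and x: "x \<in> carrier (cmod FV (Suc 0))"
  shows "g (comb L e x) = \<zero>\<^bsub>K\<^esub>"
  unfolding comb_map[OF g L K e x] unfolding comb_def
  by (rule K.M.add.finprod_one_eqI) (simp add: c_kill x mod_hom_closed[OF g funcset_mem[OF e]])

lemma comb_minus:
  assumes L: "left_module R L" and e: "e \<in> B \<rightarrow> carrier L" "e' \<in> B \<rightarrow> carrier L"
    and x: "x \<in> carrier (cmod FV (Suc 0))"
  shows "comb L (\<lambda>b. e b \<ominus>\<^bsub>L\<^esub> e' b) x = comb L e x \<ominus>\<^bsub>L\<^esub> comb L e' x"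
proof -
  interpret L: left_module R L by (rule L)
  have "comb L (\<lambda>b. e b \<ominus>\<^bsub>L\<^esub> e' b) x = finsum L (\<lambda>b. c b x \<odot>\<^bsub>L\<^esub> e b \<oplus>\<^bsub>L\<^esub> c b x \<odot>\<^bsub>L\<^esub> (\<ominus>\<^bsub>L\<^esub> e' b)) B"
    unfolding comb_def by (rule L.M.finsum_cong') (auto simp: a_minus_def L.smult_r_distr c_closed x funcset_mem[OF e(1)] funcset_mem[OF e(2)])
  also have "\<dots> = comb L e x \<oplus>\<^bsub>L\<^esub> comb L (\<lambda>b. \<ominus>\<^bsub>L\<^esub> e' b) x"
    unfolding comb_def by (rule L.M.finsum_addf) (auto simp: c_closed x funcset_mem[OF e(1)] funcset_mem[OF e(2)])
  also have "comb L (\<lambda>b. \<ominus>\<^bsub>L\<^esub> e' b) x = \<ominus>\<^bsub>L\<^esub> comb L e' x"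
    by (rule comb_map[OF mod_hom_uminus[OF mod_hom_id L] L L e(2) x, symmetric])
  finally show ?thesis by (simp add: a_minus_def)
qed

text \<open>The correction by \<open>comb\<close> makes \<open>t \<circ> diff FV 0\<close> land in the syzygy, and it is invisible to cochains
  with values in \<open>K\<close>.\<close>

lemma shifted_lift:
  assumes G: "free_resolution R Y G" and h: "h \<in> chain_lifts R G 0 FV \<phi>"
    and t: "t \<in> mod_hom R (cmod FV 0) (cmod G 0)" and e: "e \<in> B \<rightarrow> carrier (cmod G 0)"
    and te: "\<And>x. x \<in> carrier (cmod FV (Suc 0)) \<Longrightarrow> aug G (t (diff FV 0 x)) = comb Y (\<lambda>b. aug G (e b)) x"
    and f: "is_cocycle R K FV (Suc l) f" and fh: "cohomologous R K G (Suc l) (f \<circ> h (Suc l)) (\<lambda>x. \<zero>\<^bsub>K\<^esub>)"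
  obtains L where "L \<in> chain_lifts R FV (Suc 0) (shift_resolution FV)
      (\<lambda>x. h 0 (t (diff FV 0 x)) \<ominus>\<^bsub>cmod FV 0\<^esub> h 0 (comb (cmod G 0) e x))"
    and "is_cocycle R K FV (Suc l) (f \<circ> L l)" and "ext_class R K FV (Suc l) (f \<circ> L l) = \<one>\<^bsub>ext_group R K FV (Suc l)\<^esub>"
proof -
  interpret G: left_module R "cmod G n" for n by (rule free_resolution_cmod[OF G])
  interpret Y: left_module R Y by (rule free_resolution_left_module[OF G])
  note lG = G.left_module_axioms and lY = Y.left_module_axioms and aG = free_resolution_aug[OF G]
  have h0: "h 0 \<in> mod_hom R (cmod G 0) (cmod FV 0)" using chain_lifts_mod_hom[OF h, of 0] by simp
  let ?r = "comb (cmod G 0) e"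
  let ?u = "\<lambda>x. t (diff FV 0 x) \<ominus>\<^bsub>cmod G 0\<^esub> ?r x"
  note r = comb_hom[OF lG e]
  have td: "t (diff FV 0 x) \<in> carrier (cmod G 0)" if "x \<in> carrier (cmod FV (Suc 0))" for x
    by (rule mod_hom_closed[OF t diff_closed[OF F that]])
  have u0: "?u \<in> mod_hom R (cmod FV (Suc 0)) (cmod G 0)"
    using mod_hom_minus[OF mod_hom_comp[OF dC t] r lG] by (simp add: comp_def)
  have "?u ` carrier (cmod FV (Suc 0)) \<subseteq> diff G 0 ` carrier (cmod G (Suc 0))"
  proof (rule image_subsetI)
    fix x assume x: "x \<in> carrier (cmod FV (Suc 0))"
    have "aug G (?u x) = \<zero>\<^bsub>Y\<^esub>"
      unfolding mod_hom_a_minus[OF aG lG lY td[OF x] mod_hom_closed[OF r x]] comb_map[OF aG lG lY e x] te[OF x, symmetric]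
      using aug_closed[OF G td[OF x]] by (simp add: Y.M.minus_eq_zero_iff)
    then show "?u x \<in> diff G 0 ` carrier (cmod G (Suc 0))"
      by (rule aug_exact[OF G mod_hom_closed[OF u0 x]])
  qed
  with u0 have u: "?u \<in> mod_hom R (cmod FV (Suc 0)) (syzygy G)" unfolding mod_hom_syzygy[OF G] ..
  \<comment> \<open>As a map into the syzygy of \<open>Y\<close>, \<open>?u\<close> lifts to the
    shifted resolution; composing with \<open>h\<close> then leads back to
    \<open>FV\<close>.\<close>
  obtain A where A: "A \<in> chain_lifts R FV (Suc 0) (shift_resolution G) ?u"
  proof (rule chain_lifts_exist[OF F free_resolution_shift[OF G] u])
    fix x assume x: "x \<in> carrier (cmod FV (Suc (Suc 0)))"
    have "t (diff FV 0 (diff FV (Suc 0) x)) = \<zero>\<^bsub>cmod G 0\<^esub>"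
      unfolding diff_diff[OF F x] by (rule mod_hom_zero[OF t lC lG])
    then show "?u (diff FV (Suc 0) x) = \<zero>\<^bsub>syzygy G\<^esub>"
      unfolding comb_diff[OF lG e x] by (simp add: syzygy_def G.M.minus_eq_zero_iff)
  qed
  let ?L = "\<lambda>i. h (Suc i) \<circ> A i"
  have L: "?L \<in> chain_lifts R FV (Suc 0) (shift_resolution FV)
      (\<lambda>x. h 0 (t (diff FV 0 x)) \<ominus>\<^bsub>cmod FV 0\<^esub> h 0 (?r x))"
    by (rule chain_lifts_cong[OF chain_lifts_shift[OF h A]])
      (rule mod_hom_a_minus[OF h0 lG lC td mod_hom_closed[OF r]])
  have fL: "is_cocycle R K FV (Suc l) (f \<circ> ?L l)"
    using chain_lifts_cocycle[OF K F free_resolution_shift[OF F] L] f by (simp add: is_cocycle_shift)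
  obtain g where g: "g \<in> mod_hom R (cmod G l) K"
    "\<And>y. y \<in> carrier (cmod G (Suc l)) \<Longrightarrow> f (h (Suc l) y) = \<zero>\<^bsub>K\<^esub> \<oplus>\<^bsub>K\<^esub> g (diff G l y)"
    using fh by (auto simp: cohomologous_def)
  have Ac: "A l x \<in> carrier (cmod G (Suc l))" if "x \<in> carrier (cmod FV (Suc l))" for x
    using mod_hom_closed[OF chain_lifts_mod_hom[OF A, of l]] that by simp
  \<comment> \<open>Here \<open>f\<close> composed with \<open>?L l\<close> is \<open>g d A\<close>.
    In higher degree \<open>d A = A d\<close>; for \<open>l = 0\<close>, \<open>d A\<close> is
    \<open>t d\<close> minus the correction, and \<open>g\<close> kills the correction.\<close>
  have "\<exists>q\<in>mod_hom R (cmod FV l) K. \<forall>x\<in>carrier (cmod FV (Suc l)). g (diff G l (A l x)) = q (diff FV l x)"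
  proof (cases l)
    case 0
    have g0: "g \<in> mod_hom R (cmod G 0) K" using g(1) 0 by simp
    have "g (diff G 0 (A 0 x)) = (g \<circ> t) (diff FV 0 x)" if x: "x \<in> carrier (cmod FV (Suc 0))" for x
      using chain_lifts_aug[OF A x] mod_hom_a_minus[OF g0 lG K td[OF x] mod_hom_closed[OF r x]]
        comb_kill[OF g0 lG e x] mod_hom_closed[OF g0 td[OF x]] by (simp add: a_minus_def)
    with mod_hom_comp[OF t g0] show ?thesis unfolding 0 by blast
  next
    case (Suc k)
    have "g \<circ> A k \<in> mod_hom R (cmod FV l) K" using mod_hom_comp[OF chain_lifts_mod_hom[OF A, of k]] g(1) Suc by simp
    moreover have "g (diff G l (A l x)) = (g \<circ> A k) (diff FV l x)" if "x \<in> carrier (cmod FV (Suc l))" for x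
      using chain_lifts_diff[OF A, of x k] that Suc by simp
    ultimately show ?thesis by blast
  qed
  then obtain q where q: "q \<in> mod_hom R (cmod FV l) K"
    "\<And>x. x \<in> carrier (cmod FV (Suc l)) \<Longrightarrow> g (diff G l (A l x)) = q (diff FV l x)" by blast
  have "ext_class R K FV (Suc l) (f \<circ> ?L l) = \<one>\<^bsub>ext_group R K FV (Suc l)\<^esub>"
    unfolding ext_class_one
    by (rule ext_class_coboundary[OF fL is_cocycle_zero q(1)]) (simp add: g(2)[OF Ac] q(2))
  with L fL show thesis by (rule that)
qed

text \<open>What is used of the fiber product is isolated in the hypotheses: on boundaries
  \<open>\<phi>\<close> is a combination with the coefficients \<open>c b x\<close>, the same
  coefficients give zero in \<open>N\<close>, and \<open>u b\<close> and \<open>v b\<close> agree in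
  \<open>V\<close>.\<close>

lemma ext_injective:
  fixes FM :: "('r, 'c, 'm) resolution" and FN :: "('r, 'd, 'n) resolution"
  assumes FM: "free_resolution R M FM" and FN: "free_resolution R N FN"
    and \<mu>: "\<mu> \<in> mod_hom R M V" and \<nu>: "\<nu> \<in> mod_hom R N V"
    and u: "u \<in> B \<rightarrow> carrier M" and v: "v \<in> B \<rightarrow> carrier N"
    and uv: "\<And>b. b \<in> B \<Longrightarrow> \<mu> (u b) = \<nu> (v b)"
    and \<phi>: "\<phi> \<in> mod_hom R (cmod FV 0) M" and \<mu>\<phi>: "\<And>x. x \<in> carrier (cmod FV 0) \<Longrightarrow> \<mu> (\<phi> x) = aug FV x"
    and \<phi>d: "\<And>x. x \<in> carrier (cmod FV (Suc 0)) \<Longrightarrow> \<phi> (diff FV 0 x) = comb M u x"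
    and cv: "\<And>x. x \<in> carrier (cmod FV (Suc 0)) \<Longrightarrow> comb N v x = \<zero>\<^bsub>N\<^esub>"
    and z: "z \<in> carrier (ext_group R K FV j)"
    and \<mu>z: "ext_map_deg R K FM FV \<mu> j z = \<one>\<^bsub>ext_group R K FM j\<^esub>"
    and \<nu>z: "ext_map_deg R K FN FV \<nu> j z = \<one>\<^bsub>ext_group R K FN j\<^esub>"
  shows "z = \<one>\<^bsub>ext_group R K FV j\<^esub>"
proof -
  interpret EM: ext_data R K M FM by (rule ext_data.intro[OF K FM])
  interpret EN: ext_data R K N FN by (rule ext_data.intro[OF K FN])
  note lM = free_resolution_left_module[OF FM] and lN = free_resolution_left_module[OF FN]
    and lV = V.left_module_axioms and cM = free_resolution_cmod[OF FM] and cN = free_resolution_cmod[OF FN]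
  obtain f where f: "is_cocycle R K FV j f" "z = ext_class R K FV j f" by (rule ext_group_cases[OF z])
  obtain hM where hM: "hM \<in> chain_lifts R FM 0 FV (\<mu> \<circ> aug FM)" by (rule mod_hom_lift_exists[OF FM F \<mu>])
  obtain hN where hN: "hN \<in> chain_lifts R FN 0 FV (\<nu> \<circ> aug FN)" by (rule mod_hom_lift_exists[OF FN F \<nu>])
  have hMh: "hM 0 \<in> mod_hom R (cmod FM 0) (cmod FV 0)" using chain_lifts_mod_hom[OF hM, of 0] by simp
  have hNh: "hN 0 \<in> mod_hom R (cmod FN 0) (cmod FV 0)" using chain_lifts_mod_hom[OF hN, of 0] by simp
  have fM: "cohomologous R K FM j (f \<circ> hM j) (\<lambda>x. \<zero>\<^bsub>K\<^esub>)"
    using \<mu>z EM.ext_class_eq_iff[OF chain_lifts_cocycle[OF K FM F hM f(1), unfolded add_0_left] EM.is_cocycle_zero]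
    unfolding f(2) ext_map_deg_class[OF K FM F f(1) hM] EM.ext_class_one by simp
  have fN: "cohomologous R K FN j (f \<circ> hN j) (\<lambda>x. \<zero>\<^bsub>K\<^esub>)"
    using \<nu>z EN.ext_class_eq_iff[OF chain_lifts_cocycle[OF K FN F hN f(1), unfolded add_0_left] EN.is_cocycle_zero]
    unfolding f(2) ext_map_deg_class[OF K FN F f(1) hN] EN.ext_class_one by simp
  obtain t where t: "t \<in> mod_hom R (cmod FV 0) (cmod FM 0)" "\<And>x. x \<in> carrier (cmod FV 0) \<Longrightarrow> aug FM (t x) = \<phi> x"
    using free_module_lift[OF free_resolution_free[OF F] cM lM
      free_resolution_aug[OF FM] \<phi>] mod_hom_closed[OF \<phi>] aug_surj[OF FM] by blast
  \<comment> \<open>\<open>t\<close> lifts \<open>\<phi>\<close>, and \<open>\<phi>\<close> followed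
    by \<open>\<mu>\<close> is the augmentation, so \<open>hM 0 o t\<close> and the identity agree
    up to boundaries of \<open>FV\<close>.\<close>
  have ht: "hM 0 (t x) \<ominus>\<^bsub>cmod FV 0\<^esub> x \<in> diff FV 0 ` carrier (cmod FV (Suc 0))" if x: "x \<in> carrier (cmod FV 0)" for x
  proof (rule aug_exact[OF F])
    have tx: "t x \<in> carrier (cmod FM 0)" by (rule mod_hom_closed[OF t(1) x])
    then have htx: "hM 0 (t x) \<in> carrier (cmod FV 0)" by (rule mod_hom_closed[OF hMh])
    show "hM 0 (t x) \<ominus>\<^bsub>cmod FV 0\<^esub> x \<in> carrier (cmod FV 0)" using htx x by simp
    show "aug FV (hM 0 (t x) \<ominus>\<^bsub>cmod FV 0\<^esub> x) = \<zero>\<^bsub>V\<^esub>"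
      using mod_hom_a_minus[OF free_resolution_aug[OF F] lC lV htx x]
        chain_lifts_aug[OF hM tx] t(2)[OF x] \<mu>\<phi>[OF x] aug_closed[OF F x] by (simp add: V.M.minus_eq_zero_iff)
  qed
  show ?thesis
  proof (cases j)
    case 0
    have "f x = \<zero>\<^bsub>K\<^esub>" if x: "x \<in> carrier (cmod FV 0)" for x
    proof -
      have f0: "f \<in> mod_hom R (cmod FV 0) K" using is_cocycle_mod_hom[OF f(1)] 0 by simp
      have tx: "t x \<in> carrier (cmod FM 0)" by (rule mod_hom_closed[OF t(1) x])
      then have htx: "hM 0 (t x) \<in> carrier (cmod FV 0)" by (rule mod_hom_closed[OF hMh])
      \<comment> \<open>A cocycle of degree 0 vanishes on boundaries, so \<open>f x\<close> can be
        computed on \<open>FM\<close>, where the pullback of \<open>f\<close> is zero.\<close>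
      have "f (hM 0 (t x) \<ominus>\<^bsub>cmod FV 0\<^esub> x) = \<zero>\<^bsub>K\<^esub>"
        using ht[OF x] is_cocycle_diff[OF f(1)] 0 by auto
      then have "f (hM 0 (t x)) = f x"
        using mod_hom_a_minus[OF f0 lC K htx x] mod_hom_closed[OF f0] htx x
        by (simp add: K.M.minus_eq_zero_iff)
      then show ?thesis using fM tx 0 by (simp add: cohomologous_def)
    qed
    then show ?thesis unfolding f(2) ext_class_one using 0 by (intro ext_class_cong) simp
  next
    case (Suc l)
    have fl: "is_cocycle R K FV (Suc l) f" using f(1) Suc by simp
    note fh = is_cocycle_mod_hom[OF fl]
    have fs: "is_cocycle R K (shift_resolution FV) l f" using fl by (simp add: is_cocycle_shift)
    have "\<forall>b\<in>B. \<exists>e. e \<in> carrier (cmod FM 0) \<and> aug FM e = u b" using u aug_surj[OF FM] by (metis PiE imageE)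
    from bchoice[OF this] obtain eM where eM: "eM \<in> B \<rightarrow> carrier (cmod FM 0)" "\<forall>b\<in>B. aug FM (eM b) = u b" by auto
    have "\<forall>b\<in>B. \<exists>e. e \<in> carrier (cmod FN 0) \<and> aug FN e = v b" using v aug_surj[OF FN] by (metis PiE imageE)
    from bchoice[OF this] obtain eN where eN: "eN \<in> B \<rightarrow> carrier (cmod FN 0)" "\<forall>b\<in>B. aug FN (eN b) = v b" by auto
    have hMe: "(\<lambda>b. hM 0 (eM b)) \<in> B \<rightarrow> carrier (cmod FV 0)" using eM(1) mod_hom_closed[OF hMh] by auto
    have hNe: "(\<lambda>b. hN 0 (eN b)) \<in> B \<rightarrow> carrier (cmod FV 0)" using eN(1) mod_hom_closed[OF hNh] by auto
    \<comment> \<open>The chosen lifts of \<open>u b\<close> and \<open>v b\<close> have the same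
      image in \<open>V\<close>, so in \<open>FV\<close> they differ by the boundary of some
      \<open>y b\<close>. This makes the two corrections homotopic.\<close>
    have "\<forall>b\<in>B. \<exists>y. y \<in> carrier (cmod FV (Suc 0)) \<and> diff FV 0 y = hM 0 (eM b) \<ominus>\<^bsub>cmod FV 0\<^esub> hN 0 (eN b)"
    proof
      fix b assume b: "b \<in> B"
      have "aug FV (hM 0 (eM b) \<ominus>\<^bsub>cmod FV 0\<^esub> hN 0 (eN b)) = \<zero>\<^bsub>V\<^esub>"
        using mod_hom_a_minus[OF free_resolution_aug[OF F] lC lV funcset_mem[OF hMe b] funcset_mem[OF hNe b]]
          chain_lifts_aug[OF hM funcset_mem[OF eM(1) b]] chain_lifts_aug[OF hN funcset_mem[OF eN(1) b]] uv[OF b] eM(2) eN(2) b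
          mod_hom_closed[OF \<nu> funcset_mem[OF v b]] by (simp add: V.M.minus_eq_zero_iff)
      then show "\<exists>y. y \<in> carrier (cmod FV (Suc 0)) \<and> diff FV 0 y = hM 0 (eM b) \<ominus>\<^bsub>cmod FV 0\<^esub> hN 0 (eN b)"
        using aug_exact[OF F] funcset_mem[OF hMe b] funcset_mem[OF hNe b] by (metis C.M.minus_closed imageE)
    qed
    from bchoice[OF this] obtain y where y: "y \<in> B \<rightarrow> carrier (cmod FV (Suc 0))"
      "\<forall>b\<in>B. diff FV 0 (y b) = hM 0 (eM b) \<ominus>\<^bsub>cmod FV 0\<^esub> hN 0 (eN b)" by auto
    obtain s where s: "s \<in> mod_hom R (cmod FV 0) (cmod FV (Suc 0))"
      "\<And>x. x \<in> carrier (cmod FV 0) \<Longrightarrow> diff FV 0 (s x) = hM 0 (t x) \<ominus>\<^bsub>cmod FV 0\<^esub> x"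
      using free_module_lift[OF free_resolution_free[OF F] lC lC
        dC mod_hom_minus[OF mod_hom_comp[OF t(1) hMh] mod_hom_id lC]] ht
      by (auto simp: image_subset_iff)
    let ?rM = "comb (cmod FM 0) eM" and ?rN = "comb (cmod FN 0) eN" and ?ry = "comb (cmod FV (Suc 0)) y"
    note rM = comb_hom[OF cM eM(1)] and rN = comb_hom[OF cN eN(1)] and ry = comb_hom[OF lC y(1)]
    have teM: "aug FM (t (diff FV 0 x)) = comb M (\<lambda>b. aug FM (eM b)) x" if x: "x \<in> carrier (cmod FV (Suc 0))" for x
      unfolding t(2)[OF diff_closed[OF F x]] \<phi>d[OF x] by (rule comb_cong[OF lM eM(2) u x, symmetric])
    obtain L1 where L1: "L1 \<in> chain_lifts R FV (Suc 0) (shift_resolution FV)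
        (\<lambda>x. hM 0 (t (diff FV 0 x)) \<ominus>\<^bsub>cmod FV 0\<^esub> hM 0 (?rM x))"
      "is_cocycle R K FV (Suc l) (f \<circ> L1 l)" "ext_class R K FV (Suc l) (f \<circ> L1 l) = \<one>\<^bsub>ext_group R K FV (Suc l)\<^esub>"
      by (rule shifted_lift[OF FM hM t(1) eM(1) teM fl fM[unfolded Suc]])
    \<comment> \<open>The zero map takes the place of \<open>t\<close>: the combination of the
      \<open>v b\<close> is already zero, so on the side of \<open>N\<close> the negative of the
      correction is what gets lifted.\<close>
    have teN: "aug FN ((\<lambda>x. \<zero>\<^bsub>cmod FN 0\<^esub>) (diff FV 0 x)) = comb N (\<lambda>b. aug FN (eN b)) x"
      if x: "x \<in> carrier (cmod FV (Suc 0))" for x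
      using comb_cong[OF lN eN(2) v x] cv[OF x] mod_hom_zero[OF free_resolution_aug[OF FN] cN lN] by simp
    obtain L2 where L2: "L2 \<in> chain_lifts R FV (Suc 0) (shift_resolution FV)
        (\<lambda>x. hN 0 \<zero>\<^bsub>cmod FN 0\<^esub> \<ominus>\<^bsub>cmod FV 0\<^esub> hN 0 (?rN x))"
      "is_cocycle R K FV (Suc l) (f \<circ> L2 l)" "ext_class R K FV (Suc l) (f \<circ> L2 l) = \<one>\<^bsub>ext_group R K FV (Suc l)\<^esub>"
      by (rule shifted_lift[OF FN hN mod_hom_zero_map[OF cN] eN(1) teN fl fN[unfolded Suc]])
    \<comment> \<open>By the choice of \<open>s\<close> and of the \<open>y b\<close>,
      \<open>d ?k = (hM t d - d) - (hM rM - hN rN)\<close>. Adding \<open>?k\<close> to the identity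
      therefore accounts for the difference between the maps lifted by \<open>L1\<close> and
      \<open>L2\<close>.\<close>
    let ?k = "\<lambda>x. s (diff FV 0 x) \<ominus>\<^bsub>cmod FV (Suc 0)\<^esub> ?ry x"
    have sd: "s (diff FV 0 x) \<in> carrier (cmod FV (Suc 0))" if "x \<in> carrier (cmod FV (Suc 0))" for x
      by (rule mod_hom_closed[OF s(1) diff_closed[OF F that]])
    have k: "?k \<in> mod_hom R (cmod FV (Suc 0)) (cmod FV (Suc 0))"
      using mod_hom_minus[OF mod_hom_comp[OF dC s(1)] ry lC] by (simp add: comp_def)
    have kd: "?k (diff FV (Suc 0) x) = \<zero>\<^bsub>cmod FV (Suc 0)\<^esub>" if x: "x \<in> carrier (cmod FV (Suc (Suc 0)))" for x
    proof -
      have "s (diff FV 0 (diff FV (Suc 0) x)) = \<zero>\<^bsub>cmod FV (Suc 0)\<^esub>"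
        unfolding diff_diff[OF F x] by (rule mod_hom_zero[OF s(1) lC lC])
      then show ?thesis unfolding comb_diff[OF lC y(1) x] by (simp add: C.M.minus_eq_zero_iff)
    qed
    text \<open>\<open>f \<circ> ?L3\<close> differs from \<open>f\<close> by a coboundary, \<open>L1\<close> and \<open>L2\<close> factor through \<open>FM\<close> and \<open>FN\<close>, and
      \<open>L1\<close> and \<open>L2 + ?L3\<close> lift the same map.\<close>
    let ?L3 = "\<lambda>i::nat. if i = 0 then (\<lambda>x. x \<oplus>\<^bsub>cmod FV (Suc 0)\<^esub> ?k x) else (\<lambda>x. x)"
    have L3: "?L3 \<in> chain_lifts R FV (Suc 0) (shift_resolution FV) (\<lambda>x. diff FV 0 x \<oplus>\<^bsub>cmod FV 0\<^esub> diff FV 0 (?k x))"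
      unfolding chain_lifts_def
    proof (intro CollectI conjI allI ballI)
      show "?L3 i \<in> mod_hom R (cmod FV (Suc 0 + i)) (cmod (shift_resolution FV) i)" for i
        using mod_hom_sum[OF mod_hom_id k lC] mod_hom_id[of R "cmod FV (Suc i)"] by simp
      show "aug (shift_resolution FV) (?L3 0 x) = diff FV 0 x \<oplus>\<^bsub>cmod FV 0\<^esub> diff FV 0 (?k x)"
        if x: "x \<in> carrier (cmod FV (Suc 0))" for x
        using mod_hom_add[OF dC x mod_hom_closed[OF k x]] by simp
      show "diff (shift_resolution FV) i (?L3 (Suc i) x) = ?L3 i (diff FV (Suc 0 + i) x)"
        if x: "x \<in> carrier (cmod FV (Suc (Suc 0 + i)))" for i x
      proof (cases "i = 0")
        case True
        then show ?thesis using kd[of x] x diff_closed[OF F, of x "Suc 0"] by simp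
      qed simp
    qed
    have "hM 0 (t (diff FV 0 x)) \<ominus>\<^bsub>cmod FV 0\<^esub> hM 0 (?rM x) = (hN 0 \<zero>\<^bsub>cmod FN 0\<^esub> \<ominus>\<^bsub>cmod FV 0\<^esub> hN 0 (?rN x))
        \<oplus>\<^bsub>cmod FV 0\<^esub> (diff FV 0 x \<oplus>\<^bsub>cmod FV 0\<^esub> diff FV 0 (?k x))" if x: "x \<in> carrier (cmod FV (Suc 0))" for x
    proof -
      note dx = diff_closed[OF F x]
      have "diff FV 0 (?ry x) = comb (cmod FV 0) (\<lambda>b. diff FV 0 (y b)) x" by (rule comb_map[OF dC lC lC y(1) x])
      also have "\<dots> = comb (cmod FV 0) (\<lambda>b. hM 0 (eM b) \<ominus>\<^bsub>cmod FV 0\<^esub> hN 0 (eN b)) x"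
        by (rule comb_cong[OF lC y(2) _ x]) (use hMe hNe in auto)
      also have "\<dots> = hM 0 (?rM x) \<ominus>\<^bsub>cmod FV 0\<^esub> hN 0 (?rN x)"
        unfolding comb_map[OF hMh cM lC eM(1) x] comb_map[OF hNh cN lC eN(1) x] by (rule comb_minus[OF lC hMe hNe x])
      finally have "diff FV 0 (?k x) = (hM 0 (t (diff FV 0 x)) \<ominus>\<^bsub>cmod FV 0\<^esub> diff FV 0 x) \<ominus>\<^bsub>cmod FV 0\<^esub>
          (hM 0 (?rM x) \<ominus>\<^bsub>cmod FV 0\<^esub> hN 0 (?rN x))"
        unfolding mod_hom_a_minus[OF dC lC lC sd[OF x] mod_hom_closed[OF ry x]] s(2)[OF dx] by simp
      then show ?thesis
        unfolding mod_hom_zero[OF hNh cN lC]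
        using C.M.homotopy_identity[OF mod_hom_closed[OF hMh mod_hom_closed[OF t(1) dx]]
          mod_hom_closed[OF hMh mod_hom_closed[OF rM x]] mod_hom_closed[OF hNh mod_hom_closed[OF rN x]] dx] by simp
    qed
    then have L23: "(\<lambda>i x. L2 i x \<oplus>\<^bsub>cmod (shift_resolution FV) i\<^esub> ?L3 i x) \<in> chain_lifts R FV (Suc 0) (shift_resolution FV)
        (\<lambda>x. hM 0 (t (diff FV 0 x)) \<ominus>\<^bsub>cmod FV 0\<^esub> hM 0 (?rM x))"
      by (intro chain_lifts_cong[OF chain_lifts_sum[OF free_resolution_shift[OF F] L2(1) L3 F]]) (simp add: syzygy_def)
    have c3: "is_cocycle R K FV (Suc l) (f \<circ> ?L3 l)"
      using chain_lifts_cocycle[OF K F free_resolution_shift[OF F] L3 fs] by simp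
    have e3: "ext_class R K FV (Suc l) (f \<circ> ?L3 l) = z"
    proof (cases l)
      case 0
      have f1: "f \<in> mod_hom R (cmod FV (Suc 0)) K" using fh 0 by simp
      have eq: "(f \<circ> ?L3 0) x = f x \<oplus>\<^bsub>K\<^esub> (f \<circ> s) (diff FV 0 x)" if x: "x \<in> carrier (cmod FV (Suc 0))" for x
      proof -
        have "f (?k x) = f (s (diff FV 0 x))"
          unfolding mod_hom_a_minus[OF f1 lC K sd[OF x] mod_hom_closed[OF ry x]] comb_kill[OF f1 lC y(1) x]
          using mod_hom_closed[OF f1 sd[OF x]] by (simp add: a_minus_def)
        then show ?thesis using mod_hom_add[OF f1 x mod_hom_closed[OF k x]] by simp
      qed
      have "ext_class R K FV (Suc 0) (f \<circ> ?L3 0) = ext_class R K FV (Suc 0) f"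
      proof (rule ext_class_coboundary)
        show "is_cocycle R K FV (Suc 0) (f \<circ> ?L3 0)" using c3 unfolding 0 .
        show "is_cocycle R K FV (Suc 0) f" using fl unfolding 0 .
      qed (fact mod_hom_comp[OF s(1) f1], fact eq)
      then show ?thesis unfolding f(2) Suc 0 .
    next
      case (Suc l')
      then show ?thesis using f \<open>j = Suc l\<close> by (simp add: comp_def)
    qed
    \<comment> \<open>Two lifts of one map give one class: the trivial class obtained through
      \<open>M\<close> equals the trivial class obtained through \<open>N\<close> times the class of
      \<open>f\<close>.\<close>
    have "\<one>\<^bsub>ext_group R K FV (Suc l)\<^esub> = ext_class R K FV (Suc l) (f \<circ> (\<lambda>x. L2 l x \<oplus>\<^bsub>cmod FV (Suc l)\<^esub> ?L3 l x))"
      using chain_lifts_class_eq[OF K F free_resolution_shift[OF F] L1(1) L23 fs] L1(3) by simp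
    also have "\<dots> = ext_class R K FV (Suc l) (\<lambda>x. (f \<circ> L2 l) x \<oplus>\<^bsub>K\<^esub> (f \<circ> ?L3 l) x)"
    proof (rule ext_class_cong)
      fix x assume x: "x \<in> carrier (cmod FV (Suc l))"
      have "?L3 l x \<in> carrier (cmod FV (Suc l))" "L2 l x \<in> carrier (cmod FV (Suc l))"
        using mod_hom_closed[OF chain_lifts_mod_hom[OF L3, of l], of x]
          mod_hom_closed[OF chain_lifts_mod_hom[OF L2(1), of l], of x] x by simp_all
      then show "(f \<circ> (\<lambda>x. L2 l x \<oplus>\<^bsub>cmod FV (Suc l)\<^esub> ?L3 l x)) x = (f \<circ> L2 l) x \<oplus>\<^bsub>K\<^esub> (f \<circ> ?L3 l) x"
        using mod_hom_add[OF fh] by simp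
    qed
    also have "\<dots> = \<one>\<^bsub>ext_group R K FV (Suc l)\<^esub> \<otimes>\<^bsub>ext_group R K FV (Suc l)\<^esub> z"
      unfolding ext_class_mult[OF L2(2) c3, symmetric] L2(3) e3 ..
    also have "\<dots> = z"
      using monoid.l_one[OF comm_monoid.axioms(1)[OF comm_monoid_ext_group], of z] z Suc by simp
    finally show ?thesis using Suc by simp
  qed
qed

end

section \<open>Coordinates on a finitely generated vector space\<close>

lemma lin_span_zero: "left_module R M \<Longrightarrow> \<zero>\<^bsub>M\<^esub> \<in> lin_span R M B"
proof -
  assume "left_module R M"
  then interpret left_module R M .
  show ?thesis unfolding lin_span_def by (rule CollectI, rule exI[of _ "{}"]) simp
qed

lemma lin_spanI:
  "\<lbrakk>finite A; A \<subseteq> B; c \<in> A \<rightarrow> carrier R; x = finsum M (\<lambda>b. c b \<odot>\<^bsub>M\<^esub> b) A\<rbrakk> \<Longrightarrow> x \<in> lin_span R M B"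
  by (auto simp: lin_span_def)

lemma lin_span_smult:
  assumes "left_module R M" "B \<subseteq> carrier M" "b \<in> B" "a \<in> carrier R"
  shows "a \<odot>\<^bsub>M\<^esub> b \<in> lin_span R M B"
proof -
  interpret left_module R M by fact
  show ?thesis by (rule lin_spanI[of "{b}" _ "\<lambda>_. a"]) (use assms in auto)
qed

lemma lin_span_finsum:
  assumes "left_module R M" "B \<subseteq> carrier M"
  shows "\<lbrakk>finite D; \<And>d. d \<in> D \<Longrightarrow> e d \<in> lin_span R M B\<rbrakk> \<Longrightarrow> finsum M e D \<in> lin_span R M B"
proof (induction D rule: finite_induct)
  interpret left_module R M by fact
  {
    case empty
    then show ?case by (simp add: lin_span_zero assms(1))
  next
    case (insert d D)
    have "e d \<in> carrier M" "e \<in> D \<rightarrow> carrier M"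
      using insert lin_span_closed[OF assms] by auto
    then show ?case using insert lin_span_add[OF assms] by simp
  }
qed

text \<open>For the graded case, where finite generation of \<open>V\<close> is read off the degree
  0 term of its resolution.\<close>

lemma fin_gen_image:
  assumes M: "left_module R M" and N: "left_module R N" and g: "g \<in> mod_hom R M N"
    and surj: "g ` carrier M = carrier N" and fg: "fin_gen R M"
  shows "fin_gen R N"
proof -
  interpret M: left_module R M by (rule M)
  obtain A where A: "finite A" "A \<subseteq> carrier M" "lin_span R M A = carrier M"
    using fg by (auto simp: fin_gen_def)
  have gA: "g ` A \<subseteq> carrier N" using A(2) mod_hom_closed[OF g] by auto
  have "carrier N \<subseteq> lin_span R N (g ` A)"
  proof
    fix y assume "y \<in> carrier N"
    then obtain x where x: "x \<in> lin_span R M A" "y = g x" using surj A(3) by auto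
    then obtain D c where D: "finite D" "D \<subseteq> A" "c \<in> D \<rightarrow> carrier R" "x = finsum M (\<lambda>b. c b \<odot>\<^bsub>M\<^esub> b) D"
      by (auto elim: lin_spanE)
    have cD: "c b \<in> carrier R" "b \<in> carrier M" if "b \<in> D" for b using D A(2) that by auto
    have "y = finsum N (\<lambda>b. g (c b \<odot>\<^bsub>M\<^esub> b)) D"
      unfolding x(2) D(4) by (rule mod_hom_finsum[OF g M N D(1)]) (use cD in auto)
    also have "\<dots> \<in> lin_span R N (g ` A)"
    proof (rule lin_span_finsum[OF N gA D(1)])
      fix b assume b: "b \<in> D"
      show "g (c b \<odot>\<^bsub>M\<^esub> b) \<in> lin_span R N (g ` A)"
        unfolding mod_hom_smult[OF g cD[OF b]] by (rule lin_span_smult[OF N gA]) (use b D(2) cD in auto)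
    qed
    finally show "y \<in> lin_span R N (g ` A)" .
  qed
  then show ?thesis unfolding fin_gen_def
    using A(1) gA lin_span_closed[OF N gA] by (intro exI[of _ "g ` A"]) auto
qed

text \<open>A generating set of least cardinality is independent and so has linear coordinate
  functions. It is these functions that are later lifted from \<open>K\<close> to the ring.\<close>

lemma fin_gen_coordinates:
  assumes K: "field K" and V: "left_module K V" and fg: "fin_gen K V"
  obtains B c where "finite B" "B \<subseteq> carrier V"
    "\<And>b v. \<lbrakk>b \<in> B; v \<in> carrier V\<rbrakk> \<Longrightarrow> c b v \<in> carrier K"
    "\<And>b v w. \<lbrakk>b \<in> B; v \<in> carrier V; w \<in> carrier V\<rbrakk> \<Longrightarrow> c b (v \<oplus>\<^bsub>V\<^esub> w) = c b v \<oplus>\<^bsub>K\<^esub> c b w"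
    "\<And>b a v. \<lbrakk>b \<in> B; a \<in> carrier K; v \<in> carrier V\<rbrakk> \<Longrightarrow> c b (a \<odot>\<^bsub>V\<^esub> v) = a \<otimes>\<^bsub>K\<^esub> c b v"
    "\<And>v. v \<in> carrier V \<Longrightarrow> finsum V (\<lambda>b. c b v \<odot>\<^bsub>V\<^esub> b) B = v"
proof -
  interpret K: field K by (rule K)
  interpret V: left_module K V by (rule V)
  let ?P = "\<lambda>A. finite A \<and> A \<subseteq> carrier V \<and> lin_span K V A = carrier V"
  have "\<exists>A. ?P A" using fg by (auto simp: fin_gen_def)
  then have "\<exists>A. ?P A \<and> (\<forall>A'. ?P A' \<longrightarrow> card A \<le> card A')"
    using ex_has_least_nat[of ?P _ card] by blast
  then obtain B where B: "finite B" "B \<subseteq> carrier V" "lin_span K V B = carrier V"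
    and min: "\<And>A'. ?P A' \<Longrightarrow> card B \<le> card A'" by blast
  have Bc: "b \<in> carrier V" if "b \<in> B" for b using B(2) that by auto
  let ?s = "\<lambda>e. finsum V (\<lambda>b. e b \<odot>\<^bsub>V\<^esub> b) B"
  have scl: "?s e \<in> carrier V" if "\<And>b. b \<in> B \<Longrightarrow> e b \<in> carrier K" for e
    by (rule V.M.finsum_closed) (use that Bc in auto)
  have comb: "?s (\<lambda>b. d b \<oplus>\<^bsub>K\<^esub> q \<otimes>\<^bsub>K\<^esub> e b) = ?s d \<oplus>\<^bsub>V\<^esub> q \<odot>\<^bsub>V\<^esub> ?s e"
    if d: "\<And>b. b \<in> B \<Longrightarrow> d b \<in> carrier K" and e: "\<And>b. b \<in> B \<Longrightarrow> e b \<in> carrier K" and q: "q \<in> carrier K" for d e q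
  proof -
    have "?s (\<lambda>b. d b \<oplus>\<^bsub>K\<^esub> q \<otimes>\<^bsub>K\<^esub> e b) = finsum V (\<lambda>b. d b \<odot>\<^bsub>V\<^esub> b \<oplus>\<^bsub>V\<^esub> q \<odot>\<^bsub>V\<^esub> (e b \<odot>\<^bsub>V\<^esub> b)) B"
      by (rule V.M.finsum_cong') (use d e q Bc in \<open>auto simp: V.smult_l_distr V.smult_assoc1\<close>)
    also have "\<dots> = ?s d \<oplus>\<^bsub>V\<^esub> finsum V (\<lambda>b. q \<odot>\<^bsub>V\<^esub> (e b \<odot>\<^bsub>V\<^esub> b)) B"
      by (rule V.M.finsum_addf) (use d e q Bc in auto)
    also have "finsum V (\<lambda>b. q \<odot>\<^bsub>V\<^esub> (e b \<odot>\<^bsub>V\<^esub> b)) B = q \<odot>\<^bsub>V\<^esub> ?s e"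
      by (rule V.finsum_smult[symmetric]) (use B e q Bc in auto)
    finally show ?thesis .
  qed
  have full: "\<exists>e. (\<forall>b\<in>B. e b \<in> carrier K) \<and> ?s e = v" if "v \<in> carrier V" for v
  proof -
    have "v \<in> lin_span K V B" using that B(3) by simp
    then obtain D d where D: "finite D" "D \<subseteq> B" "d \<in> D \<rightarrow> carrier K" "v = finsum V (\<lambda>b. d b \<odot>\<^bsub>V\<^esub> b) D"
      by (rule lin_spanE)
    have dD: "d b \<in> carrier K" if "b \<in> D" for b using D(3) that by auto
    have "v = ?s (\<lambda>b. if b \<in> D then d b else \<zero>\<^bsub>K\<^esub>)"
      unfolding D(4) by (rule V.M.add.finprod_mono_neutral_cong_left) (use B(1) D(2) dD Bc in auto)
    then show ?thesis using dD by (intro exI[of _ "\<lambda>b. if b \<in> D then d b else \<zero>\<^bsub>K\<^esub>"]) simp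
  qed
  have indep: "e b0 = \<zero>\<^bsub>K\<^esub>"
    if e: "\<And>b. b \<in> B \<Longrightarrow> e b \<in> carrier K" and e0: "?s e = \<zero>\<^bsub>V\<^esub>" and b0: "b0 \<in> B" for e b0
  proof (rule ccontr)
    assume nz: "e b0 \<noteq> \<zero>\<^bsub>K\<^esub>"
    then have u: "e b0 \<in> Units K" using e[OF b0] by (simp add: K.field_Units)
    let ?B = "B - {b0}"
    have "carrier V \<subseteq> lin_span K V ?B"
    proof
      fix v assume "v \<in> carrier V"
      then obtain d where d: "\<And>b. b \<in> B \<Longrightarrow> d b \<in> carrier K" "?s d = v" using full by blast
      \<comment> \<open>The multiple of the relation \<open>e\<close> that cancels the coefficient
        of \<open>v\<close> at \<open>b0\<close>. So \<open>B\<close> without \<open>b0\<close>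
        still spans, against minimality.\<close>
      let ?q = "\<ominus>\<^bsub>K\<^esub> (d b0 \<otimes>\<^bsub>K\<^esub> inv\<^bsub>K\<^esub> e b0)"
      let ?e = "\<lambda>b. d b \<oplus>\<^bsub>K\<^esub> ?q \<otimes>\<^bsub>K\<^esub> e b"
      have q: "?q \<in> carrier K" using d(1)[OF b0] u by simp
      have "?e b0 = \<zero>\<^bsub>K\<^esub>"
        using d(1)[OF b0] e[OF b0] u by (simp add: K.l_minus K.m_assoc K.r_neg)
      moreover have ec: "?e b \<in> carrier K" if "b \<in> B" for b using d(1)[OF that] e[OF that] q by simp
      moreover have "v = ?s ?e"
      proof -
        have "?s ?e = ?s d \<oplus>\<^bsub>V\<^esub> ?q \<odot>\<^bsub>V\<^esub> ?s e" by (rule comb[OF d(1) e q])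
        then show ?thesis unfolding e0 d(2) V.smult_r_null[OF q] V.M.r_zero[OF \<open>v \<in> carrier V\<close>] by (rule sym)
      qed
      ultimately have "v = finsum V (\<lambda>b. ?e b \<odot>\<^bsub>V\<^esub> b) ?B"
        by (simp only:) (rule V.M.add.finprod_mono_neutral_cong_right, use B(1) ec Bc b0 in auto)
      then show "v \<in> lin_span K V ?B"
        by (intro lin_spanI[of ?B _ ?e]) (use B(1) ec in auto)
    qed
    then have "?P ?B" using B lin_span_closed[OF V, of ?B] by blast
    then have "card B \<le> card ?B" by (rule min)
    then show False using b0 B(1) by (metis card_Diff1_less not_less)
  qed
  have uniq: "e b = e' b" if e: "\<And>b. b \<in> B \<Longrightarrow> e b \<in> carrier K" and e': "\<And>b. b \<in> B \<Longrightarrow> e' b \<in> carrier K"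
    and eq: "?s e = ?s e'" and b: "b \<in> B" for e e' b
  proof -
    \<comment> \<open>The difference is written with the factor \<open>- 1\<close> to fit the shape
      of \<open>comb\<close>.\<close>
    have "e b \<oplus>\<^bsub>K\<^esub> (\<ominus>\<^bsub>K\<^esub> \<one>\<^bsub>K\<^esub>) \<otimes>\<^bsub>K\<^esub> e' b = \<zero>\<^bsub>K\<^esub>"
    proof (rule indep[OF _ _ b])
      show "?s (\<lambda>b. e b \<oplus>\<^bsub>K\<^esub> (\<ominus>\<^bsub>K\<^esub> \<one>\<^bsub>K\<^esub>) \<otimes>\<^bsub>K\<^esub> e' b) = \<zero>\<^bsub>V\<^esub>"
      proof -
        have "?s (\<lambda>b. e b \<oplus>\<^bsub>K\<^esub> (\<ominus>\<^bsub>K\<^esub> \<one>\<^bsub>K\<^esub>) \<otimes>\<^bsub>K\<^esub> e' b) = ?s e \<oplus>\<^bsub>V\<^esub> (\<ominus>\<^bsub>K\<^esub> \<one>\<^bsub>K\<^esub>) \<odot>\<^bsub>V\<^esub> ?s e'"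
          by (rule comb[OF e e' K.a_inv_closed[OF K.one_closed]])
        then show ?thesis using scl[OF e'] unfolding eq by (simp add: V.smult_l_minus V.M.r_neg)
      qed
    qed (use e e' in auto)
    then have "e b \<ominus>\<^bsub>K\<^esub> e' b = \<zero>\<^bsub>K\<^esub>" using e'[OF b] by (simp add: K.l_minus a_minus_def)
    then show ?thesis using e[OF b] e'[OF b] by (simp add: K.minus_eq_zero_iff)
  qed
  have "\<forall>v\<in>carrier V. \<exists>e. (\<forall>b\<in>B. e b \<in> carrier K) \<and> ?s e = v" using full by blast
  from bchoice[OF this] obtain c where
    c: "\<forall>v\<in>carrier V. (\<forall>b\<in>B. c v b \<in> carrier K) \<and> ?s (c v) = v" by (elim exE)
  then have c1: "c v b \<in> carrier K" if "v \<in> carrier V" "b \<in> B" for v b using that by blast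
  have c2: "?s (c v) = v" if "v \<in> carrier V" for v using c that by blast
  show thesis
  proof (rule that[OF B(1,2), of "\<lambda>b v. c v b"])
    show "c v b \<in> carrier K" if "b \<in> B" "v \<in> carrier V" for b v by (rule c1[OF that(2,1)])
    show "?s (c v) = v" if "v \<in> carrier V" for v by (rule c2[OF that])
    show "c (v \<oplus>\<^bsub>V\<^esub> w) b = c v b \<oplus>\<^bsub>K\<^esub> c w b" if "b \<in> B" "v \<in> carrier V" "w \<in> carrier V" for b v w
    proof (rule uniq[of "c (v \<oplus>\<^bsub>V\<^esub> w)" "\<lambda>b. c v b \<oplus>\<^bsub>K\<^esub> c w b", OF _ _ _ that(1)])
      have "?s (\<lambda>b. c v b \<oplus>\<^bsub>K\<^esub> c w b) = ?s (\<lambda>b. c v b \<oplus>\<^bsub>K\<^esub> \<one>\<^bsub>K\<^esub> \<otimes>\<^bsub>K\<^esub> c w b)"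
        by (rule V.M.finsum_cong') (use c1 that Bc in auto)
      also have "\<dots> = v \<oplus>\<^bsub>V\<^esub> w" using comb[of "c v" "c w" "\<one>\<^bsub>K\<^esub>"] c1 c2 that by simp
      finally show "?s (c (v \<oplus>\<^bsub>V\<^esub> w)) = ?s (\<lambda>b. c v b \<oplus>\<^bsub>K\<^esub> c w b)" using c2 that by simp
    qed (use c1 that in auto)
    show "c (a \<odot>\<^bsub>V\<^esub> v) b = a \<otimes>\<^bsub>K\<^esub> c v b" if "b \<in> B" "a \<in> carrier K" "v \<in> carrier V" for b a v
    proof (rule uniq[of "c (a \<odot>\<^bsub>V\<^esub> v)" "\<lambda>b. a \<otimes>\<^bsub>K\<^esub> c v b", OF _ _ _ that(1)])
      have "?s (\<lambda>b. a \<otimes>\<^bsub>K\<^esub> c v b) = finsum V (\<lambda>b. a \<odot>\<^bsub>V\<^esub> (c v b \<odot>\<^bsub>V\<^esub> b)) B"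
        by (rule V.M.finsum_cong') (use c1 that Bc in \<open>auto simp: V.smult_assoc1\<close>)
      also have "\<dots> = a \<odot>\<^bsub>V\<^esub> ?s (c v)"
        by (rule V.finsum_smult[symmetric]) (use B c1 that Bc in auto)
      finally show "?s (c (a \<odot>\<^bsub>V\<^esub> v)) = ?s (\<lambda>b. a \<otimes>\<^bsub>K\<^esub> c v b)" using c2 that by simp
    qed (use c1 that in auto)
  qed
qed

section \<open>The short exact sequence of Ext modules\<close>

lemma mod_hom_inj_on:
  assumes f: "f \<in> mod_hom R M N" and M: "left_module R M" and N: "left_module R N"
    and ker: "\<And>x. \<lbrakk>x \<in> carrier M; f x = \<zero>\<^bsub>N\<^esub>\<rbrakk> \<Longrightarrow> x = \<zero>\<^bsub>M\<^esub>"
  shows "inj_on f (carrier M)"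
proof (rule inj_onI)
  interpret M: left_module R M by (rule M)
  interpret N: left_module R N by (rule N)
  fix x y assume xy: "x \<in> carrier M" "y \<in> carrier M" "f x = f y"
  have "f (x \<ominus>\<^bsub>M\<^esub> y) = \<zero>\<^bsub>N\<^esub>"
    unfolding mod_hom_a_minus[OF f M N xy(1,2)]
    using xy mod_hom_closed[OF f] by (simp add: N.M.minus_eq_zero_iff)
  then have "x \<ominus>\<^bsub>M\<^esub> y = \<zero>\<^bsub>M\<^esub>" using ker xy by simp
  then show "x = y" using xy by (simp add: M.M.minus_eq_zero_iff)
qed

text \<open>The formal part of the theorem, with the injectivity statement as the assumption
  \<open>inj\<close>. \<open>FP\<close> is an arbitrary resolution of the product rather than the
  sum of \<open>FM\<close> and \<open>FN\<close>, so Ext of the product is split by induced maps and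
  not on cochains.\<close>

locale pullback_ext =
  fixes R :: "('r, 'z) ring_scheme" and K :: "('r, 'k) module" and V :: "('r, 'v) module"
    and M :: "('r, 'm) module" and N :: "('r, 'n) module" and W :: "('r, 'm \<times> 'n) module"
    and \<mu> :: "'m \<Rightarrow> 'v" and \<nu> :: "'n \<Rightarrow> 'v"
    and Fk :: "('r, 'a, 'k) resolution" and FV :: "('r, 'b, 'v) resolution"
    and FM :: "('r, 'c, 'm) resolution" and FN :: "('r, 'd, 'n) resolution"
    and FP :: "('r, 'e, 'm \<times> 'n) resolution" and FW :: "('r, 'f, 'm \<times> 'n) resolution"
  assumes Fk: "free_resolution R K Fk" and FV: "free_resolution R V FV"
    and FM: "free_resolution R M FM" and FN: "free_resolution R N FN"
    and FP: "free_resolution R (module_prod M N) FP" and FW: "free_resolution R W FW"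
    and \<mu>: "\<mu> \<in> mod_hom R M V" and \<nu>: "\<nu> \<in> mod_hom R N V" and nontriv: "\<one>\<^bsub>R\<^esub> \<noteq> \<zero>\<^bsub>R\<^esub>"
    and exact: "short_exact R W (module_prod M N) V (\<lambda>w. w) (\<lambda>(m, n). \<mu> m \<ominus>\<^bsub>V\<^esub> \<nu> n)"
    and inj: "\<And>n z. \<lbrakk>z \<in> carrier (ext_group R K FV n);
      ext_map_deg R K FM FV \<mu> n z = \<one>\<^bsub>ext_group R K FM n\<^esub>;
      ext_map_deg R K FN FV \<nu> n z = \<one>\<^bsub>ext_group R K FN n\<^esub>\<rbrakk> \<Longrightarrow> z = \<one>\<^bsub>ext_group R K FV n\<^esub>"
begin

abbreviation HV where "HV \<equiv> ext_group R K FV"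
abbreviation HM where "HM \<equiv> ext_group R K FM"
abbreviation HN where "HN \<equiv> ext_group R K FN"
abbreviation HP where "HP \<equiv> ext_group R K FP"
abbreviation HW where "HW \<equiv> ext_group R K FW"
abbreviation XV where "XV \<equiv> ext_module R K Fk FV"
abbreviation XM where "XM \<equiv> ext_module R K Fk FM"
abbreviation XN where "XN \<equiv> ext_module R K Fk FN"
abbreviation XP where "XP \<equiv> ext_module R K Fk FP"
abbreviation XW where "XW \<equiv> ext_module R K Fk FW"
abbreviation p where "p \<equiv> \<lambda>(m, n). \<mu> m \<ominus>\<^bsub>V\<^esub> \<nu> n"
abbreviation P where "P \<equiv> module_prod M N"

lemma K: "left_module R K" by (rule free_resolution_left_module[OF Fk])

lemma p_hom: "p \<in> mod_hom R P V" and incl_hom: "(\<lambda>w. w) \<in> mod_hom R W P"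
  using exact by (simp_all add: short_exact_def)

interpretation M: left_module R M by (rule free_resolution_left_module[OF FM])
interpretation N: left_module R N by (rule free_resolution_left_module[OF FN])
interpretation V: left_module R V by (rule free_resolution_left_module[OF FV])

interpretation EV: ext_action R K Fk V FV by (rule ext_action.intro[OF K Fk FV])
interpretation EM: ext_action R K Fk M FM by (rule ext_action.intro[OF K Fk FM])
interpretation EN: ext_action R K Fk N FN by (rule ext_action.intro[OF K Fk FN])
interpretation EP: ext_action R K Fk P FP by (rule ext_action.intro[OF K Fk FP])
interpretation EW: ext_action R K Fk W FW by (rule ext_action.intro[OF K Fk FW])

interpretation GV: comm_group "HV n" for n by (rule EV.F.comm_group_ext_group)
interpretation GM: comm_group "HM n" for n by (rule EM.F.comm_group_ext_group)
interpretation GN: comm_group "HN n" for n by (rule EN.F.comm_group_ext_group)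
interpretation GP: comm_group "HP n" for n by (rule EP.F.comm_group_ext_group)
interpretation GW: comm_group "HW n" for n by (rule EW.F.comm_group_ext_group)

lemmas MV = ext_functor.intro[OF K FM FV] and NV = ext_functor.intro[OF K FN FV]
  and PV = ext_functor.intro[OF K FP FV] and PM = ext_functor.intro[OF K FP FM]
  and PN = ext_functor.intro[OF K FP FN] and WP = ext_functor.intro[OF K FW FP]
  and WV = ext_functor.intro[OF K FW FV] and PP = ext_functor.intro[OF K FP FP]
  and MP = ext_functor.intro[OF K FM FP] and NP = ext_functor.intro[OF K FN FP]
  and MN = ext_functor.intro[OF K FM FN] and NM = ext_functor.intro[OF K FN FM]

section \<open>Ext of the product as a direct sum, degree by degree\<close>

abbreviation fst_deg where "fst_deg \<equiv> ext_map_deg R K FP FM fst"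
abbreviation snd_deg where "snd_deg \<equiv> ext_map_deg R K FP FN snd"
abbreviation mu_deg where "mu_deg \<equiv> ext_map_deg R K FM FV \<mu>"
abbreviation nu_deg where "nu_deg \<equiv> ext_map_deg R K FN FV \<nu>"
abbreviation p_deg where "p_deg \<equiv> ext_map_deg R K FP FV p"
abbreviation incl_deg where "incl_deg \<equiv> ext_map_deg R K FW FP (\<lambda>w. w)"
abbreviation in1_deg where "in1_deg \<equiv> ext_map_deg R K FM FP (\<lambda>m. (m, \<zero>\<^bsub>N\<^esub>))"
abbreviation in2_deg where "in2_deg \<equiv> ext_map_deg R K FN FP (\<lambda>n. (\<zero>\<^bsub>M\<^esub>, n))"

lemma in1_hom: "(\<lambda>m. (m, \<zero>\<^bsub>N\<^esub>)) \<in> mod_hom R M P"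
  by (rule mod_hom_Pair[OF mod_hom_id mod_hom_zero_map[OF N.left_module_axioms]])

lemma in2_hom: "(\<lambda>n. (\<zero>\<^bsub>M\<^esub>, n)) \<in> mod_hom R N P"
  by (rule mod_hom_Pair[OF mod_hom_zero_map[OF M.left_module_axioms] mod_hom_id])

lemmas fst_closed = ext_functor.ext_map_deg_closed[OF PM mod_hom_fst]
  and snd_closed = ext_functor.ext_map_deg_closed[OF PN mod_hom_snd]
  and mu_closed = ext_functor.ext_map_deg_closed[OF MV \<mu>]
  and nu_closed = ext_functor.ext_map_deg_closed[OF NV \<nu>]
  and p_closed = ext_functor.ext_map_deg_closed[OF PV p_hom]
  and in1_closed = ext_functor.ext_map_deg_closed[OF MP in1_hom]
  and in2_closed = ext_functor.ext_map_deg_closed[OF NP in2_hom]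

text \<open>The identity \<open>p = \<mu> fst - \<nu> snd\<close> is used in the form
  \<open>\<mu> fst = p + \<nu> snd\<close>, to which additivity of induced maps applies
  directly.\<close>

lemma theta_mu_nu_deg:
  assumes z: "z \<in> carrier (HV n)"
  shows "fst_deg n (mu_deg n z) \<otimes>\<^bsub>HP n\<^esub> snd_deg n (inv\<^bsub>HN n\<^esub> nu_deg n z) = p_deg n z"
proof -
  note \<mu>f = mod_hom_comp[OF mod_hom_fst \<mu>, of N] and \<nu>s = mod_hom_comp[OF mod_hom_snd \<nu>, of M]
  let ?b = "ext_map_deg R K FP FV (\<nu> \<circ> snd) n z"
  have b: "?b \<in> carrier (HP n)" by (rule ext_functor.ext_map_deg_closed[OF PV \<nu>s z])
  have 1: "fst_deg n (mu_deg n z) = ext_map_deg R K FP FV (\<mu> \<circ> fst) n z"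
    by (rule ext_functor.ext_map_deg_comp[OF PM FV mod_hom_fst \<mu> z])
  have 2: "snd_deg n (inv\<^bsub>HN n\<^esub> nu_deg n z) = inv\<^bsub>HP n\<^esub> ?b"
    unfolding ext_functor.ext_map_deg_inv[OF PN mod_hom_snd nu_closed[OF z]]
      ext_functor.ext_map_deg_comp[OF PN FV mod_hom_snd \<nu> z] ..
  have 3: "ext_map_deg R K FP FV (\<mu> \<circ> fst) n z = p_deg n z \<otimes>\<^bsub>HP n\<^esub> ?b"
  proof (rule ext_functor.ext_map_deg_sum[OF PV p_hom \<nu>s z])
    fix x assume "x \<in> carrier P"
    then obtain m k where x: "x = (m, k)" "m \<in> carrier M" "k \<in> carrier N" by auto
    show "(\<mu> \<circ> fst) x = p x \<oplus>\<^bsub>V\<^esub> (\<nu> \<circ> snd) x"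
      using mod_hom_closed[OF \<mu> x(2)] mod_hom_closed[OF \<nu> x(3)] unfolding x(1)
      by (simp add: a_minus_def V.M.a_assoc V.M.l_neg)
  qed
  show ?thesis unfolding 1 2 3 using p_closed[OF z] b by (simp add: GP.m_assoc)
qed

text \<open>The inclusion of \<open>M\<close> is a section of \<open>fst\<close> and is killed by
  \<open>snd\<close>. With \<open>in2_theta\<close> and \<open>theta_in\<close> it follows that
  \<open>in1_deg\<close> and \<open>in2_deg\<close> are the components of the inverse of the
  splitting.\<close>

lemma in1_theta:
  assumes x: "x \<in> carrier (HM n)" and y: "y \<in> carrier (HN n)"
  shows "in1_deg n (fst_deg n x \<otimes>\<^bsub>HP n\<^esub> snd_deg n y) = x"
proof -
  have 1: "in1_deg n (fst_deg n x) = x"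
    using ext_functor.ext_map_deg_comp[OF MP FM in1_hom mod_hom_fst x] ext_map_deg_id[OF K FM x] by simp
  have 2: "in1_deg n (snd_deg n y) = \<one>\<^bsub>HM n\<^esub>"
    using ext_functor.ext_map_deg_comp[OF MP FN in1_hom mod_hom_snd y]
      ext_functor.ext_map_deg_zero[OF MN y, of "snd \<circ> (\<lambda>m. (m, \<zero>\<^bsub>N\<^esub>))"] by simp
  show ?thesis
    unfolding ext_functor.ext_map_deg_mult[OF MP in1_hom fst_closed[OF x] snd_closed[OF y]] 1 2
    by (rule GM.r_one[OF x])
qed

lemma in2_theta:
  assumes x: "x \<in> carrier (HM n)" and y: "y \<in> carrier (HN n)"
  shows "in2_deg n (fst_deg n x \<otimes>\<^bsub>HP n\<^esub> snd_deg n y) = y"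
proof -
  have 1: "in2_deg n (snd_deg n y) = y"
    using ext_functor.ext_map_deg_comp[OF NP FN in2_hom mod_hom_snd y] ext_map_deg_id[OF K FN y] by simp
  have 2: "in2_deg n (fst_deg n x) = \<one>\<^bsub>HN n\<^esub>"
    using ext_functor.ext_map_deg_comp[OF NP FM in2_hom mod_hom_fst x]
      ext_functor.ext_map_deg_zero[OF NM x, of "fst \<circ> (\<lambda>n. (\<zero>\<^bsub>M\<^esub>, n))"] by simp
  show ?thesis
    unfolding ext_functor.ext_map_deg_mult[OF NP in2_hom fst_closed[OF x] snd_closed[OF y]] 1 2
    by (rule GN.l_one[OF y])
qed

text \<open>The identity of \<open>P\<close> is the sum of the two projections followed by the
  inclusions.\<close>

lemma theta_in:
  assumes a: "a \<in> carrier (HP n)"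
  shows "fst_deg n (in1_deg n a) \<otimes>\<^bsub>HP n\<^esub> snd_deg n (in2_deg n a) = a"
proof -
  let ?i = "(\<lambda>m. (m, \<zero>\<^bsub>N\<^esub>)) \<circ> fst" and ?j = "(\<lambda>n. (\<zero>\<^bsub>M\<^esub>, n)) \<circ> snd"
  have "fst_deg n (in1_deg n a) = ext_map_deg R K FP FP ?i n a"
    by (rule ext_functor.ext_map_deg_comp[OF PM FP mod_hom_fst in1_hom a])
  moreover have "snd_deg n (in2_deg n a) = ext_map_deg R K FP FP ?j n a"
    by (rule ext_functor.ext_map_deg_comp[OF PN FP mod_hom_snd in2_hom a])
  moreover have "ext_map_deg R K FP FP (\<lambda>x. x) n a =
      ext_map_deg R K FP FP ?i n a \<otimes>\<^bsub>HP n\<^esub> ext_map_deg R K FP FP ?j n a"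
    by (rule ext_functor.ext_map_deg_sum[OF PP mod_hom_comp[OF mod_hom_fst in1_hom]
      mod_hom_comp[OF mod_hom_snd in2_hom] a]) auto
  ultimately show ?thesis using ext_map_deg_id[OF K FP a, of "\<lambda>x. x"] by simp
qed

lemma incl_p:
  assumes z: "z \<in> carrier (HV n)"
  shows "incl_deg n (p_deg n z) = \<one>\<^bsub>HW n\<^esub>"
proof -
  have "p x = \<zero>\<^bsub>V\<^esub>" if "x \<in> carrier W" for x
    using exact that by (auto simp: short_exact_def)
  then show ?thesis
    unfolding ext_functor.ext_map_deg_comp[OF WP FV incl_hom p_hom z]
    by (intro ext_functor.ext_map_deg_zero[OF WV z]) simp
qed

text \<open>When \<open>p_deg n z\<close> is trivial, its components under the splitting are
  trivial; these are \<open>mu_deg n z\<close> and the inverse of \<open>nu_deg n z\<close>, so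
  \<open>inj\<close> applies.\<close>

lemma p_deg_injective:
  assumes z: "z \<in> carrier (HV n)" and pz: "p_deg n z = \<one>\<^bsub>HP n\<^esub>"
  shows "z = \<one>\<^bsub>HV n\<^esub>"
proof (rule inj[OF z])
  note t = theta_mu_nu_deg[OF z] and c = mu_closed[OF z] GN.inv_closed[OF nu_closed[OF z]]
  show "mu_deg n z = \<one>\<^bsub>HM n\<^esub>"
    using in1_theta[OF c] ext_functor.ext_map_deg_one[OF MP in1_hom, of n] unfolding t pz by simp
  have "inv\<^bsub>HN n\<^esub> nu_deg n z = \<one>\<^bsub>HN n\<^esub>"
    using in2_theta[OF c] ext_functor.ext_map_deg_one[OF NP in2_hom, of n] unfolding t pz by simp
  then show "nu_deg n z = \<one>\<^bsub>HN n\<^esub>" using nu_closed[OF z] by simp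
qed

lemma cone_ext_exists: "\<exists>h. cone_ext R W P V (\<lambda>w. w) p FW FP h K FV"
proof -
  obtain h where "h \<in> chain_lifts R FW 0 FP ((\<lambda>w. w) \<circ> aug FW)" by (rule mod_hom_lift_exists[OF FW FP incl_hom])
  then show ?thesis
    by (intro exI[of _ h] cone_ext.intro cone.intro cone_ext_axioms.intro FW FP exact nontriv K FV)
qed

lemma exact_middle_deg:
  assumes x: "x \<in> carrier (HM n)" and y: "y \<in> carrier (HN n)"
    and xy: "incl_deg n (fst_deg n x \<otimes>\<^bsub>HP n\<^esub> snd_deg n y) = \<one>\<^bsub>HW n\<^esub>"
  shows "\<exists>z\<in>carrier (HV n). x = mu_deg n z \<and> y = inv\<^bsub>HN n\<^esub> nu_deg n z"
proof -
  obtain h where "cone_ext R W P V (\<lambda>w. w) p FW FP h K FV" using cone_ext_exists by blast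
  from cone_ext.ext_exact_middle[OF this _ xy] fst_closed[OF x] snd_closed[OF y]
  obtain z where z: "z \<in> carrier (HV n)"
    "fst_deg n x \<otimes>\<^bsub>HP n\<^esub> snd_deg n y = p_deg n z" by auto
  note c = mu_closed[OF z(1)] GN.inv_closed[OF nu_closed[OF z(1)]]
  have "x = mu_deg n z" using in1_theta[OF x y] in1_theta[OF c] unfolding theta_mu_nu_deg[OF z(1)] z(2) by simp
  moreover have "y = inv\<^bsub>HN n\<^esub> nu_deg n z"
    using in2_theta[OF x y] in2_theta[OF c] unfolding theta_mu_nu_deg[OF z(1)] z(2) by simp
  ultimately show ?thesis using z(1) by blast
qed

lemma exact_right_deg:
  assumes w: "w \<in> carrier (HW n)"
  shows "\<exists>x\<in>carrier (HM n). \<exists>y\<in>carrier (HN n).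
    w = incl_deg n (fst_deg n x \<otimes>\<^bsub>HP n\<^esub> snd_deg n y)"
proof -
  obtain h where "cone_ext R W P V (\<lambda>w. w) p FW FP h K FV" using cone_ext_exists by blast
  \<comment> \<open>The obstruction to extending \<open>w\<close> lies in degree
    \<open>Suc n\<close> of Ext of \<open>V\<close>, where injectivity removes it.\<close>
  from cone_ext.ext_exact_surj[OF this w p_deg_injective]
  obtain a where a: "a \<in> carrier (HP n)" "w = incl_deg n a" by auto
  show ?thesis
    by (rule bexI[OF _ in1_closed[OF a(1)]], rule bexI[OF _ in2_closed[OF a(1)]])
      (simp only: theta_in[OF a(1)] a(2))
qed

section \<open>The sequence of total Ext modules\<close>

abbreviation E where "E \<equiv> ext_algebra R K Fk"
abbreviation theta where "theta \<equiv> \<lambda>(\<xi>, \<eta>). ext_map R K FP FM fst \<xi> \<oplus>\<^bsub>XP\<^esub> ext_map R K FP FN snd \<eta>"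
abbreviation munu where "munu \<equiv> \<lambda>\<zeta>. (ext_map R K FM FV \<mu> \<zeta>, \<ominus>\<^bsub>XN\<^esub> ext_map R K FN FV \<nu> \<zeta>)"

lemma ext_module_simps:
  "carrier (ext_module R K Fk F) = ext_carrier R K F"
  "\<zero>\<^bsub>ext_module R K Fk F\<^esub> = (\<lambda>n. \<one>\<^bsub>ext_group R K F n\<^esub>)"
  "\<xi> \<oplus>\<^bsub>ext_module R K Fk F\<^esub> \<eta> = (\<lambda>n. \<xi> n \<otimes>\<^bsub>ext_group R K F n\<^esub> \<eta> n)"
  by (simp_all add: ext_module_def)

lemma theta_apply: "theta z n = fst_deg n (fst z n) \<otimes>\<^bsub>HP n\<^esub> snd_deg n (snd z n)"
  by (simp add: ext_module_simps ext_map_def split: prod.split)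

lemma munu_apply:
  assumes "\<zeta> \<in> ext_carrier R K FV"
  shows "fst (munu \<zeta>) n = mu_deg n (\<zeta> n)" "snd (munu \<zeta>) n = inv\<^bsub>HN n\<^esub> nu_deg n (\<zeta> n)"
proof -
  have "\<ominus>\<^bsub>XN\<^esub> ext_map R K FN FV \<nu> \<zeta> = (\<lambda>n. inv\<^bsub>HN n\<^esub> ext_map R K FN FV \<nu> \<zeta> n)"
    by (rule EN.F.ext_a_inv) (simp_all add: ext_module_def ext_functor.ext_map_carrier[OF NV \<nu> assms])
  then show "fst (munu \<zeta>) n = mu_deg n (\<zeta> n)" "snd (munu \<zeta>) n = inv\<^bsub>HN n\<^esub> nu_deg n (\<zeta> n)"
    by (simp_all add: ext_map_def)
qed

lemma munu_hom: "munu \<in> mod_hom E XV (module_prod XM XN)"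
  by (intro mod_hom_Pair mod_hom_uminus ext_functor.ext_map_mod_hom[OF MV Fk \<mu>]
    ext_functor.ext_map_mod_hom[OF NV Fk \<nu>] EN.left_module_ext)

lemma theta_hom: "theta \<in> mod_hom E (module_prod XM XN) XP"
  using mod_hom_sum[OF mod_hom_comp[OF mod_hom_fst ext_functor.ext_map_mod_hom[OF PM Fk mod_hom_fst]]
    mod_hom_comp[OF mod_hom_snd ext_functor.ext_map_mod_hom[OF PN Fk mod_hom_snd]] EP.left_module_ext]
  by (simp add: comp_def case_prod_unfold)

lemma incl_theta_hom: "(\<lambda>z. ext_map R K FW FP (\<lambda>w. w) (theta z)) \<in>
    mod_hom E (module_prod XM XN) XW"
  using mod_hom_comp[OF theta_hom ext_functor.ext_map_mod_hom[OF WP Fk incl_hom]] by (simp add: comp_def)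

lemma theta_munu:
  assumes "\<zeta> \<in> ext_carrier R K FV"
  shows "theta (munu \<zeta>) = ext_map R K FP FV p \<zeta>"
proof
  fix n
  have "theta (munu \<zeta>) n = fst_deg n (fst (munu \<zeta>) n) \<otimes>\<^bsub>HP n\<^esub> snd_deg n (snd (munu \<zeta>) n)"
    by (rule theta_apply)
  also have "\<dots> = p_deg n (\<zeta> n)"
    unfolding munu_apply[OF assms] by (rule theta_mu_nu_deg[OF EV.F.ext_carrier_closed[OF assms]])
  finally show "theta (munu \<zeta>) n = ext_map R K FP FV p \<zeta> n" by (simp only: ext_map_def[of R K FP FV])
qed

lemma munu_injective: "inj_on munu (carrier XV)"
proof (rule mod_hom_inj_on[OF munu_hom EV.left_module_ext left_module_prod[OF EM.left_module_ext EN.left_module_ext]])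
  fix \<zeta> assume z: "\<zeta> \<in> carrier XV"
    and 0: "munu \<zeta> = \<zero>\<^bsub>module_prod XM XN\<^esub>"
  have z: "\<zeta> \<in> ext_carrier R K FV" using z by (simp add: ext_module_simps)
  have "\<zeta> n = \<one>\<^bsub>HV n\<^esub>" for n
  proof (rule inj[OF EV.F.ext_carrier_closed[OF z]])
    show "mu_deg n (\<zeta> n) = \<one>\<^bsub>HM n\<^esub>"
      using munu_apply(1)[OF z, of n] unfolding 0 by (simp add: ext_module_simps)
    have "inv\<^bsub>HN n\<^esub> nu_deg n (\<zeta> n) = \<one>\<^bsub>HN n\<^esub>"
      using munu_apply(2)[OF z, of n] unfolding 0 by (simp add: ext_module_simps)
    then show "nu_deg n (\<zeta> n) = \<one>\<^bsub>HN n\<^esub>"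
      using nu_closed[OF EV.F.ext_carrier_closed[OF z], of n] by simp
  qed
  then show "\<zeta> = \<zero>\<^bsub>XV\<^esub>" by (auto simp: ext_module_simps)
qed

lemma incl_theta_apply:
  "ext_map R K FW FP (\<lambda>w. w) (theta z) n =
    incl_deg n (fst_deg n (fst z n) \<otimes>\<^bsub>HP n\<^esub> snd_deg n (snd z n))"
  by (simp only: ext_map_def[of R K FW] theta_apply)

lemma munu_image:
  "munu ` carrier XV =
    {z \<in> carrier (module_prod XM XN).
      ext_map R K FW FP (\<lambda>w. w) (theta z) = \<zero>\<^bsub>XW\<^esub>}" (is "_ = ?ker")
proof (intro equalityI subsetI)
  fix z assume "z \<in> munu ` carrier XV"
  then obtain \<zeta> where z: "\<zeta> \<in> carrier XV" "z = munu \<zeta>" by blast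
  then have z': "\<zeta> \<in> ext_carrier R K FV" by (simp add: ext_module_simps)
  have "ext_map R K FW FP (\<lambda>w. w) (theta z) = \<zero>\<^bsub>XW\<^esub>"
    unfolding z(2) arg_cong[where f = "ext_map R K FW FP (\<lambda>w. w)", OF theta_munu[OF z']] ext_module_simps(2)
    by (rule ext) (simp only: ext_map_def incl_p[OF EV.F.ext_carrier_closed[OF z']])
  moreover have "z \<in> carrier (module_prod XM XN)"
    unfolding z(2) by (rule mod_hom_closed[OF munu_hom z(1)])
  ultimately show "z \<in> ?ker" by blast
next
  fix z assume "z \<in> ?ker"
  then have z: "fst z \<in> ext_carrier R K FM" "snd z \<in> ext_carrier R K FN"
    and 0: "ext_map R K FW FP (\<lambda>w. w) (theta z) = (\<lambda>n. \<one>\<^bsub>HW n\<^esub>)"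
    by (auto simp: ext_module_simps)
  have "\<forall>n. \<exists>w. w \<in> carrier (HV n) \<and> fst z n = mu_deg n w \<and>
      snd z n = inv\<^bsub>HN n\<^esub> nu_deg n w"
  proof
    fix n
    have "incl_deg n (fst_deg n (fst z n) \<otimes>\<^bsub>HP n\<^esub> snd_deg n (snd z n)) = \<one>\<^bsub>HW n\<^esub>"
      unfolding incl_theta_apply[symmetric] 0 ..
    from exact_middle_deg[OF EM.F.ext_carrier_closed[OF z(1)] EN.F.ext_carrier_closed[OF z(2)] this]
    show "\<exists>w. w \<in> carrier (HV n) \<and> fst z n = mu_deg n w \<and>
      snd z n = inv\<^bsub>HN n\<^esub> nu_deg n w" by blast
  qed
  from choice[OF this] obtain \<zeta> where zeta: "\<And>n. \<zeta> n \<in> carrier (HV n)"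
    "\<And>n. fst z n = mu_deg n (\<zeta> n)" "\<And>n. snd z n = inv\<^bsub>HN n\<^esub> nu_deg n (\<zeta> n)" by auto
  have "\<zeta> \<in> ext_carrier R K FV"
  proof (rule EV.F.ext_carrierI[OF zeta(1)])
    \<comment> \<open>By \<open>inj\<close> the degreewise preimage is trivial wherever both
      components of \<open>z\<close> are, which bounds the support of the chosen family.\<close>
    have "\<zeta> n = \<one>\<^bsub>HV n\<^esub>"
      if "fst z n = \<one>\<^bsub>HM n\<^esub>" "snd z n = \<one>\<^bsub>HN n\<^esub>" for n
    proof (rule inj[OF zeta(1)])
      show "mu_deg n (\<zeta> n) = \<one>\<^bsub>HM n\<^esub>" using zeta(2)[of n] that(1) by simp
      have "inv\<^bsub>HN n\<^esub> nu_deg n (\<zeta> n) = \<one>\<^bsub>HN n\<^esub>" using zeta(3)[of n] that(2) by simp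
      then show "nu_deg n (\<zeta> n) = \<one>\<^bsub>HN n\<^esub>" using nu_closed[OF zeta(1), of n] by simp
    qed
    then have "{n. \<zeta> n \<noteq> \<one>\<^bsub>HV n\<^esub>} \<subseteq>
        {n. fst z n \<noteq> \<one>\<^bsub>HM n\<^esub>} \<union> {n. snd z n \<noteq> \<one>\<^bsub>HN n\<^esub>}" by blast
    moreover have "finite {n. fst z n \<noteq> \<one>\<^bsub>HM n\<^esub>}" "finite {n. snd z n \<noteq> \<one>\<^bsub>HN n\<^esub>}"
      using z by (simp_all add: ext_carrier_def)
    ultimately show "finite {n. \<zeta> n \<noteq> \<one>\<^bsub>HV n\<^esub>}" by (meson finite_UnI finite_subset)
  qed
  moreover from munu_apply[OF this] have "z = munu \<zeta>"
    by (intro prod_eqI ext) (simp_all only: zeta(2,3))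
  ultimately show "z \<in> munu ` carrier XV" by (auto simp: ext_module_simps)
qed

lemma incl_theta_surj:
  "(\<lambda>z. ext_map R K FW FP (\<lambda>w. w) (theta z)) ` carrier (module_prod XM XN) =
    carrier XW" (is "?f ` ?C = ?D")
proof
  show "?f ` ?C \<subseteq> ?D" using mod_hom_closed[OF incl_theta_hom] by blast
  show "?D \<subseteq> ?f ` ?C"
  proof
    fix w assume "w \<in> ?D"
    then have w: "w \<in> ext_carrier R K FW" by (simp add: ext_module_simps)
    \<comment> \<open>The last conjunct prescribes the trivial preimage wherever \<open>w n\<close>
      is trivial, so that the chosen family has finite support.\<close>
    have "\<forall>n. \<exists>q. fst q \<in> carrier (HM n) \<and> snd q \<in> carrier (HN n) \<and>
        w n = incl_deg n (fst_deg n (fst q) \<otimes>\<^bsub>HP n\<^esub> snd_deg n (snd q)) \<and>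
        (w n = \<one>\<^bsub>HW n\<^esub> \<longrightarrow> q = (\<one>\<^bsub>HM n\<^esub>, \<one>\<^bsub>HN n\<^esub>))"
    proof
      fix n
      show "\<exists>q. fst q \<in> carrier (HM n) \<and> snd q \<in> carrier (HN n) \<and>
        w n = incl_deg n (fst_deg n (fst q) \<otimes>\<^bsub>HP n\<^esub> snd_deg n (snd q)) \<and>
        (w n = \<one>\<^bsub>HW n\<^esub> \<longrightarrow> q = (\<one>\<^bsub>HM n\<^esub>, \<one>\<^bsub>HN n\<^esub>))"
      proof (cases "w n = \<one>\<^bsub>HW n\<^esub>")
        case True
        then show ?thesis
          by (intro exI[of _ "(\<one>\<^bsub>HM n\<^esub>, \<one>\<^bsub>HN n\<^esub>)"])
            (simp add: ext_functor.ext_map_deg_one[OF PM mod_hom_fst] ext_functor.ext_map_deg_one[OF PN mod_hom_snd]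
              ext_functor.ext_map_deg_one[OF WP incl_hom])
      next
        case False
        obtain x y where "x \<in> carrier (HM n)" "y \<in> carrier (HN n)"
          "w n = incl_deg n (fst_deg n x \<otimes>\<^bsub>HP n\<^esub> snd_deg n y)"
          using exact_right_deg[OF EW.F.ext_carrier_closed[OF w, of n]] by blast
        with False show ?thesis by (intro exI[of _ "(x, y)"]) simp
      qed
    qed
    from choice[OF this] obtain q where
      q: "\<forall>n. fst (q n) \<in> carrier (HM n) \<and> snd (q n) \<in> carrier (HN n) \<and>
        w n = incl_deg n (fst_deg n (fst (q n)) \<otimes>\<^bsub>HP n\<^esub> snd_deg n (snd (q n))) \<and>
        (w n = \<one>\<^bsub>HW n\<^esub> \<longrightarrow> q n = (\<one>\<^bsub>HM n\<^esub>, \<one>\<^bsub>HN n\<^esub>))" by (elim exE)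
    let ?z = "(\<lambda>n. fst (q n), \<lambda>n. snd (q n))"
    have fin: "finite {n. w n \<noteq> \<one>\<^bsub>HW n\<^esub>}" using w by (simp add: ext_carrier_def)
    have qn: "fst (q n) \<in> carrier (HM n)" "snd (q n) \<in> carrier (HN n)" for n
      using q by blast+
    have q1: "q n = (\<one>\<^bsub>HM n\<^esub>, \<one>\<^bsub>HN n\<^esub>)" if "w n = \<one>\<^bsub>HW n\<^esub>" for n
      using q that by blast
    have s1: "{n. fst (q n) \<noteq> \<one>\<^bsub>HM n\<^esub>} \<subseteq> {n. w n \<noteq> \<one>\<^bsub>HW n\<^esub>}"
      using q1 by (auto simp del: split_paired_All)
    have s2: "{n. snd (q n) \<noteq> \<one>\<^bsub>HN n\<^esub>} \<subseteq> {n. w n \<noteq> \<one>\<^bsub>HW n\<^esub>}"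
      using q1 by (auto simp del: split_paired_All)
    have "?z \<in> ?C"
      using EM.F.ext_carrierI[of "\<lambda>n. fst (q n)", OF qn(1) finite_subset[OF s1 fin]]
        EN.F.ext_carrierI[of "\<lambda>n. snd (q n)", OF qn(2) finite_subset[OF s2 fin]]
      by (simp add: ext_module_simps)
    moreover have "w = ?f ?z"
    proof
      fix n
      have "w n = incl_deg n (fst_deg n (fst (q n)) \<otimes>\<^bsub>HP n\<^esub> snd_deg n (snd (q n)))"
        using q by blast
      also have "\<dots> = ?f ?z n" unfolding incl_theta_apply fst_conv snd_conv ..
      finally show "w n = ?f ?z n" .
    qed
    ultimately show "w \<in> ?f ` ?C" by (rule rev_image_eqI)
  qed
qed

lemma ext_graded_short_exact:
  "graded_short_exact E (ext_grading R K Fk)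
     XV (ext_grading R K FV)
     (module_prod XM XN) (\<lambda>i. ext_grading R K FM i \<times> ext_grading R K FN i)
     XW (ext_grading R K FW)
     munu (\<lambda>z. ext_map R K FW FP (\<lambda>w. w) (theta z))"
  unfolding graded_short_exact_def
proof (intro conjI EV.graded_module_ext EW.graded_module_ext graded_module_ext_prod[OF K Fk FM FN])
  show "deg_zero_map (ext_grading R K FV) (\<lambda>i. ext_grading R K FM i \<times> ext_grading R K FN i) munu"
    unfolding deg_zero_map_def
  proof (intro allI image_subsetI)
    fix i \<zeta> assume z: "\<zeta> \<in> ext_grading R K FV i"
    have "snd (munu \<zeta>) \<in> ext_grading R K FN i"
    proof (rule EN.F.ext_gradingI)
      have "munu \<zeta> \<in> carrier (module_prod XM XN)"
        by (rule mod_hom_closed[OF munu_hom]) (simp add: ext_module_simps EV.F.ext_grading_carrier[OF z])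
      then show "snd (munu \<zeta>) \<in> ext_carrier R K FN" by (simp add: ext_module_simps)
      show "snd (munu \<zeta>) n = \<one>\<^bsub>HN n\<^esub>" if "int n \<noteq> i" for n
        unfolding munu_apply[OF EV.F.ext_grading_carrier[OF z]] EV.F.ext_gradingD[OF z that]
          ext_functor.ext_map_deg_one[OF NV \<nu>] by simp
    qed
    with ext_functor.ext_map_grading[OF MV \<mu> z]
    show "munu \<zeta> \<in> ext_grading R K FM i \<times> ext_grading R K FN i" by simp
  qed
  show "deg_zero_map (\<lambda>i. ext_grading R K FM i \<times> ext_grading R K FN i) (ext_grading R K FW)
      (\<lambda>z. ext_map R K FW FP (\<lambda>w. w) (theta z))"
    unfolding deg_zero_map_def
  proof (intro allI image_subsetI)
    fix i z assume "z \<in> ext_grading R K FM i \<times> ext_grading R K FN i"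
    then have z: "fst z \<in> ext_grading R K FM i" "snd z \<in> ext_grading R K FN i" by auto
    have "theta z \<in> ext_grading R K FP i"
    proof (rule EP.F.ext_gradingI)
      have "theta z \<in> carrier XP"
        by (rule mod_hom_closed[OF theta_hom])
          (use EM.F.ext_grading_carrier[OF z(1)] EN.F.ext_grading_carrier[OF z(2)] in \<open>simp add: ext_module_simps mem_Times_iff\<close>)
      then show "theta z \<in> ext_carrier R K FP" by (simp add: ext_module_simps)
      show "theta z n = \<one>\<^bsub>HP n\<^esub>" if "int n \<noteq> i" for n
        unfolding theta_apply EM.F.ext_gradingD[OF z(1) that] EN.F.ext_gradingD[OF z(2) that]
          ext_functor.ext_map_deg_one[OF PM mod_hom_fst] ext_functor.ext_map_deg_one[OF PN mod_hom_snd] by simp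
    qed
    then show "ext_map R K FW FP (\<lambda>w. w) (theta z) \<in> ext_grading R K FW i"
      by (rule ext_functor.ext_map_grading[OF WP incl_hom])
  qed
  show "short_exact E XV (module_prod XM XN)
      XW munu (\<lambda>z. ext_map R K FW FP (\<lambda>w. w) (theta z))"
    unfolding short_exact_def
    by (intro conjI EV.left_module_ext EW.left_module_ext left_module_prod[OF EM.left_module_ext EN.left_module_ext]
      munu_hom incl_theta_hom munu_injective munu_image incl_theta_surj)
qed

end

section \<open>Modules over the fiber product\<close>

lemma restrict_scalars_simps [simp]:
  "carrier (restrict_scalars \<phi> M) = carrier M" "\<zero>\<^bsub>restrict_scalars \<phi> M\<^esub> = \<zero>\<^bsub>M\<^esub>"
  "x \<oplus>\<^bsub>restrict_scalars \<phi> M\<^esub> y = x \<oplus>\<^bsub>M\<^esub> y" "a \<odot>\<^bsub>restrict_scalars \<phi> M\<^esub> x = \<phi> a \<odot>\<^bsub>M\<^esub> x"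
  by (simp_all add: restrict_scalars_def)

text \<open>Negation is determined by carrier, zero and addition, which restriction of scalars
  leaves alone.\<close>

lemma restrict_scalars_a_minus [simp]: "x \<ominus>\<^bsub>restrict_scalars \<phi> M\<^esub> y = x \<ominus>\<^bsub>M\<^esub> y"
  by (simp add: a_minus_def a_inv_def m_inv_def restrict_scalars_def)

lemma finsum_restrict_scalars [simp]: "finsum (restrict_scalars \<phi> M) e A = finsum M e A"
  by (simp add: finsum_def finprod_def restrict_scalars_def)

lemma self_module_simps [simp]:
  "carrier (self_module S) = carrier S" "\<zero>\<^bsub>self_module S\<^esub> = \<zero>\<^bsub>S\<^esub>"
  "x \<oplus>\<^bsub>self_module S\<^esub> y = x \<oplus>\<^bsub>S\<^esub> y" "a \<odot>\<^bsub>self_module S\<^esub> x = a \<otimes>\<^bsub>S\<^esub> x"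
  by (simp_all add: self_module_def)

lemma left_module_self: "ring S \<Longrightarrow> left_module S (self_module S)"
proof -
  assume "ring S"
  then interpret S: ring S .
  have "abelian_group (self_module S)"
    by (rule abelian_groupI) (auto simp: S.a_ac intro!: bexI[of _ "\<ominus>\<^bsub>S\<^esub> x" for x] S.l_neg)
  then show ?thesis
    by (intro left_module.intro left_module_axioms.intro S.ring_axioms)
      (auto simp: S.l_distr S.r_distr S.m_assoc)
qed

lemma left_module_restrict_scalars:
  assumes "left_module S M" "ring R" "\<phi> \<in> ring_hom R S"
  shows "left_module R (restrict_scalars \<phi> M)"
proof -
  interpret M: left_module S M by fact
  note h = ring_hom_closed[OF assms(3)] ring_hom_add[OF assms(3)] ring_hom_mult[OF assms(3)] ring_hom_one[OF assms(3)]
  have "abelian_group (restrict_scalars \<phi> M)"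
  proof (rule abelian_groupI)
    fix x assume "x \<in> carrier (restrict_scalars \<phi> M)"
    then show "\<exists>y\<in>carrier (restrict_scalars \<phi> M). y \<oplus>\<^bsub>restrict_scalars \<phi> M\<^esub> x = \<zero>\<^bsub>restrict_scalars \<phi> M\<^esub>"
      by (intro bexI[of _ "\<ominus>\<^bsub>M\<^esub> x"]) (auto simp: M.M.l_neg)
  qed (auto simp: M.M.a_ac)
  then show ?thesis
    by (intro left_module.intro left_module_axioms.intro assms(2))
      (auto simp: h M.smult_l_distr M.smult_r_distr M.smult_assoc1)
qed

lemma fiber_ring_simps [simp]:
  "carrier (fiber_ring S T \<pi>S \<pi>T) = {(s, t) \<in> carrier S \<times> carrier T. \<pi>S s = \<pi>T t}"
  "\<zero>\<^bsub>fiber_ring S T \<pi>S \<pi>T\<^esub> = (\<zero>\<^bsub>S\<^esub>, \<zero>\<^bsub>T\<^esub>)" "\<one>\<^bsub>fiber_ring S T \<pi>S \<pi>T\<^esub> = (\<one>\<^bsub>S\<^esub>, \<one>\<^bsub>T\<^esub>)"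
  "x \<oplus>\<^bsub>fiber_ring S T \<pi>S \<pi>T\<^esub> y = (fst x \<oplus>\<^bsub>S\<^esub> fst y, snd x \<oplus>\<^bsub>T\<^esub> snd y)"
  "x \<otimes>\<^bsub>fiber_ring S T \<pi>S \<pi>T\<^esub> y = (fst x \<otimes>\<^bsub>S\<^esub> fst y, snd x \<otimes>\<^bsub>T\<^esub> snd y)"
  by (simp_all add: fiber_ring_def RDirProd_def DirProd_def monoid.defs split: prod.splits)

text \<open>Lift the coordinates of \<open>V\<close> along \<open>\<pi>S\<close> to maps \<open>t b\<close> from \<open>FV 0\<close> to \<open>S\<close>. On boundaries they
  take values in the kernel of \<open>\<pi>S\<close>, so that \<open>(t b x, 0)\<close> is an element of the fiber product: it acts on
  \<open>M\<close> as \<open>t b x\<close> does and annihilates both \<open>N\<close> and the residue field.\<close>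

lemma fiber_ext_injective:
  fixes K :: "'k ring" and S :: "'s ring" and T :: "'t ring"
    and \<pi>S :: "'s \<Rightarrow> 'k" and \<pi>T :: "'t \<Rightarrow> 'k"
    and M :: "('s, 'm) module" and N :: "('t, 'n) module" and V :: "('k, 'v) module"
    and FV :: "('s \<times> 't, 'b, 'v) resolution" and FM :: "('s \<times> 't, 'c, 'm) resolution"
    and FN :: "('s \<times> 't, 'd, 'n) resolution"
  defines "R \<equiv> fiber_ring S T \<pi>S \<pi>T"
    and "kR \<equiv> restrict_scalars (\<pi>S \<circ> fst) (self_module K)" and "VR \<equiv> restrict_scalars (\<pi>S \<circ> fst) V"
    and "MR \<equiv> restrict_scalars fst M" and "NR \<equiv> restrict_scalars snd N"
  assumes K: "field K" and S: "ring S" and T: "ring T" and \<pi>S: "\<pi>S \<in> ring_hom S K" and surj: "\<pi>S ` carrier S = carrier K"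
    and \<pi>T: "\<pi>T \<in> ring_hom T K" and M: "left_module S M" and N: "left_module T N" and V: "left_module K V"
    and fg: "fin_gen K V" and \<mu>: "\<mu> \<in> mod_hom S M (restrict_scalars \<pi>S V)" and \<mu>s: "\<mu> ` carrier M = carrier V"
    and \<mu>R: "\<mu> \<in> mod_hom R MR VR" and \<nu>R: "\<nu> \<in> mod_hom R NR VR" and \<nu>s: "\<nu> ` carrier N = carrier V"
    and kR: "left_module R kR" and FV: "free_resolution R VR FV" and FM: "free_resolution R MR FM"
    and FN: "free_resolution R NR FN" and z: "z \<in> carrier (ext_group R kR FV j)"
    and \<mu>z: "ext_map_deg R kR FM FV \<mu> j z = \<one>\<^bsub>ext_group R kR FM j\<^esub>"
    and \<nu>z: "ext_map_deg R kR FN FV \<nu> j z = \<one>\<^bsub>ext_group R kR FN j\<^esub>"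
  shows "z = \<one>\<^bsub>ext_group R kR FV j\<^esub>"
proof -
  interpret K: field K by (rule K)
  interpret S: ring S by (rule S)
  interpret T: ring T by (rule T)
  interpret M: left_module S M by (rule M)
  interpret N: left_module T N by (rule N)
  interpret V: left_module K V by (rule V)
  interpret kR: left_module R kR by (rule kR)
  interpret F0: left_module R "cmod FV 0" by (rule free_resolution_cmod[OF FV])
  interpret F1: left_module R "cmod FV (Suc 0)" by (rule free_resolution_cmod[OF FV])
  have Rc: "fst a \<in> carrier S" "snd a \<in> carrier T" "\<pi>S (fst a) = \<pi>T (snd a)" if "a \<in> carrier R" for a
    using that by (auto simp: R_def)
  have \<pi>S0: "\<pi>S \<zero>\<^bsub>S\<^esub> = \<zero>\<^bsub>K\<^esub>" by (rule ring_hom_zero[OF \<pi>S S K.ring_axioms])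
  have \<pi>T0: "\<pi>T \<zero>\<^bsub>T\<^esub> = \<zero>\<^bsub>K\<^esub>" by (rule ring_hom_zero[OF \<pi>T T K.ring_axioms])
  have fst_hom: "fst \<in> ring_hom R S" by (rule ring_hom_memI) (auto simp: R_def)
  \<comment> \<open>With \<open>S\<close> regarded as an \<open>R\<close>-module, lifting the
    coordinates along \<open>\<pi>S\<close> becomes a lifting problem over \<open>R\<close> for the
    free module \<open>cmod FV 0\<close>.\<close>
  define SR where "SR = (restrict_scalars fst (self_module S) :: ('s \<times> 't, 's) module)"
  have SR: "left_module R SR"
    unfolding SR_def by (rule left_module_restrict_scalars[OF left_module_self[OF S] kR.R.ring_axioms fst_hom])
  interpret SR: left_module R SR by (rule SR)
  have \<pi>S_hom: "\<pi>S \<in> mod_hom R SR kR"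
    by (rule mod_homI)
      (auto simp: SR_def kR_def ring_hom_closed[OF \<pi>S] ring_hom_add[OF \<pi>S] ring_hom_mult[OF \<pi>S] Rc)
  have augK: "aug FV x \<in> carrier V" if "x \<in> carrier (cmod FV 0)" for x
    using aug_closed[OF FV that] by (simp add: VR_def)
  obtain B c where B: "finite B" "B \<subseteq> carrier V"
    and c: "\<And>b v. \<lbrakk>b \<in> B; v \<in> carrier V\<rbrakk> \<Longrightarrow> c b v \<in> carrier K"
    and c_add: "\<And>b v w. \<lbrakk>b \<in> B; v \<in> carrier V; w \<in> carrier V\<rbrakk> \<Longrightarrow> c b (v \<oplus>\<^bsub>V\<^esub> w) = c b v \<oplus>\<^bsub>K\<^esub> c b w"
    and c_smult: "\<And>b a v. \<lbrakk>b \<in> B; a \<in> carrier K; v \<in> carrier V\<rbrakk> \<Longrightarrow> c b (a \<odot>\<^bsub>V\<^esub> v) = a \<otimes>\<^bsub>K\<^esub> c b v"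
    and c_sum: "\<And>v. v \<in> carrier V \<Longrightarrow> finsum V (\<lambda>b. c b v \<odot>\<^bsub>V\<^esub> b) B = v"
    by (rule fin_gen_coordinates[OF K V fg]) blast
  have "\<exists>t. \<forall>b\<in>B. t b \<in> mod_hom R (cmod FV 0) SR \<and> (\<forall>x\<in>carrier (cmod FV 0). \<pi>S (t b x) = c b (aug FV x))"
  proof (intro bchoice ballI)
    fix b assume b: "b \<in> B"
    have "(\<lambda>x. c b (aug FV x)) \<in> mod_hom R (cmod FV 0) kR"
    proof (rule mod_homI)
      fix x assume x: "x \<in> carrier (cmod FV 0)"
      then show "c b (aug FV x) \<in> carrier kR" using c[OF b augK] by (simp add: kR_def)
      show "c b (aug FV (x \<oplus>\<^bsub>cmod FV 0\<^esub> y)) = c b (aug FV x) \<oplus>\<^bsub>kR\<^esub> c b (aug FV y)" if y: "y \<in> carrier (cmod FV 0)" for y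
        using mod_hom_add[OF free_resolution_aug[OF FV] x y] c_add[OF b augK[OF x] augK[OF y]]
        by (simp add: kR_def VR_def)
      show "c b (aug FV (a \<odot>\<^bsub>cmod FV 0\<^esub> x)) = a \<odot>\<^bsub>kR\<^esub> c b (aug FV x)" if a: "a \<in> carrier R" for a
        using mod_hom_smult[OF free_resolution_aug[OF FV] a x]
          c_smult[OF b ring_hom_closed[OF \<pi>S Rc(1)[OF a]] augK[OF x]] by (simp add: kR_def VR_def)
    qed
    moreover from this have "(\<lambda>x. c b (aug FV x)) ` carrier (cmod FV 0) \<subseteq> \<pi>S ` carrier SR"
      using c[OF b augK] surj by (auto simp: SR_def)
    ultimately show "\<exists>t. t \<in> mod_hom R (cmod FV 0) SR \<and> (\<forall>x\<in>carrier (cmod FV 0). \<pi>S (t x) = c b (aug FV x))"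
      using free_module_lift[OF free_resolution_free[OF FV] SR kR \<pi>S_hom] by blast
  qed
  then obtain t where t: "\<And>b. b \<in> B \<Longrightarrow> t b \<in> mod_hom R (cmod FV 0) SR"
    "\<And>b x. \<lbrakk>b \<in> B; x \<in> carrier (cmod FV 0)\<rbrakk> \<Longrightarrow> \<pi>S (t b x) = c b (aug FV x)" by blast
  have tS: "t b x \<in> carrier S" if "b \<in> B" "x \<in> carrier (cmod FV 0)" for b x
    using mod_hom_closed[OF t(1)[OF that(1)] that(2)] by (simp add: SR_def)
  have c0: "c b \<zero>\<^bsub>V\<^esub> = \<zero>\<^bsub>K\<^esub>" if b: "b \<in> B" for b
  proof -
    have "c b (\<zero>\<^bsub>K\<^esub> \<odot>\<^bsub>V\<^esub> \<zero>\<^bsub>V\<^esub>) = \<zero>\<^bsub>K\<^esub> \<otimes>\<^bsub>K\<^esub> c b \<zero>\<^bsub>V\<^esub>" by (rule c_smult[OF b]) simp_all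
    then show ?thesis using c[OF b V.M.zero_closed] by simp
  qed
  \<comment> \<open>Boundaries have zero augmentation, hence zero coordinates.\<close>
  have td: "\<pi>S (t b (diff FV 0 x)) = \<zero>\<^bsub>K\<^esub>" if "b \<in> B" "x \<in> carrier (cmod FV (Suc 0))" for b x
    using t(2)[OF that(1) diff_closed[OF FV that(2)]] aug_diff[OF FV that(2)] c0[OF that(1)] by (simp add: VR_def)
  note ts = tS[OF _ diff_closed[OF FV]]
  have "\<exists>u. \<forall>b\<in>B. u b \<in> carrier M \<and> \<mu> (u b) = b" using B(2) \<mu>s by (intro bchoice) (metis imageE subsetD)
  then obtain u where u: "\<And>b. b \<in> B \<Longrightarrow> u b \<in> carrier M" "\<And>b. b \<in> B \<Longrightarrow> \<mu> (u b) = b" by blast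
  have "\<exists>u. \<forall>b\<in>B. u b \<in> carrier N \<and> \<nu> (u b) = b" using B(2) \<nu>s by (intro bchoice) (metis imageE subsetD)
  then obtain w where w: "\<And>b. b \<in> B \<Longrightarrow> w b \<in> carrier N" "\<And>b. b \<in> B \<Longrightarrow> \<nu> (w b) = b" by blast
  let ?c = "\<lambda>b x. (t b (diff FV 0 x), \<zero>\<^bsub>T\<^esub>)"
  let ?f = "\<lambda>x. finsum M (\<lambda>b. t b x \<odot>\<^bsub>M\<^esub> u b) B"
  have tcl: "(\<lambda>b. t b x \<odot>\<^bsub>M\<^esub> u b) \<in> B \<rightarrow> carrier M" if "x \<in> carrier (cmod FV 0)" for x
    using tS u(1) that by auto
  have f_hom: "?f \<in> mod_hom R (cmod FV 0) MR"
  proof -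
    have "(\<lambda>x. finsum MR (\<lambda>b. t b x \<odot>\<^bsub>M\<^esub> u b) B) \<in> mod_hom R (cmod FV 0) MR"
    proof (rule mod_hom_finsum_maps[OF F0.left_module_axioms free_resolution_left_module[OF FM] B(1)])
      fix b assume b: "b \<in> B"
      show "(\<lambda>x. t b x \<odot>\<^bsub>M\<^esub> u b) \<in> mod_hom R (cmod FV 0) MR"
      proof (rule mod_homI)
        fix x assume x: "x \<in> carrier (cmod FV 0)"
        then show "t b x \<odot>\<^bsub>M\<^esub> u b \<in> carrier MR" using tS[OF b] u(1)[OF b] by (simp add: MR_def)
        show "t b (x \<oplus>\<^bsub>cmod FV 0\<^esub> y) \<odot>\<^bsub>M\<^esub> u b = (t b x \<odot>\<^bsub>M\<^esub> u b) \<oplus>\<^bsub>MR\<^esub> (t b y \<odot>\<^bsub>M\<^esub> u b)"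
          if y: "y \<in> carrier (cmod FV 0)" for y
          using mod_hom_add[OF t(1)[OF b] x y] tS[OF b x] tS[OF b y] u(1)[OF b]
          by (simp add: MR_def SR_def M.smult_l_distr)
        show "t b (a \<odot>\<^bsub>cmod FV 0\<^esub> x) \<odot>\<^bsub>M\<^esub> u b = a \<odot>\<^bsub>MR\<^esub> (t b x \<odot>\<^bsub>M\<^esub> u b)" if a: "a \<in> carrier R" for a
          using mod_hom_smult[OF t(1)[OF b] a x] tS[OF b x] u(1)[OF b] Rc(1)[OF a]
          by (simp add: MR_def SR_def M.smult_assoc1)
      qed
    qed
    then show ?thesis by (simp add: MR_def)
  qed
  have \<mu>f: "\<mu> (?f x) = aug FV x" if x: "x \<in> carrier (cmod FV 0)" for x
  proof -
    \<comment> \<open>\<open>\<mu>\<close> is applied to a combination with coefficients in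
      \<open>S\<close>, so \<open>V\<close> is viewed over \<open>S\<close> here and not over
      \<open>R\<close>.\<close>
    have rV: "left_module S (restrict_scalars \<pi>S V)" by (rule left_module_restrict_scalars[OF V S \<pi>S])
    have "\<mu> (?f x) = finsum (restrict_scalars \<pi>S V) (\<lambda>b. \<mu> (t b x \<odot>\<^bsub>M\<^esub> u b)) B"
      by (rule mod_hom_finsum[OF \<mu> M rV B(1) tcl[OF x]])
    also have "\<dots> = finsum V (\<lambda>b. \<mu> (t b x \<odot>\<^bsub>M\<^esub> u b)) B" by simp
    also have "\<dots> = finsum V (\<lambda>b. c b (aug FV x) \<odot>\<^bsub>V\<^esub> b) B"
    proof (rule V.M.finsum_cong'[OF refl])
      show "(\<lambda>b. c b (aug FV x) \<odot>\<^bsub>V\<^esub> b) \<in> B \<rightarrow> carrier V" using c augK[OF x] B(2) by auto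
      show "\<mu> (t b x \<odot>\<^bsub>M\<^esub> u b) = c b (aug FV x) \<odot>\<^bsub>V\<^esub> b" if b: "b \<in> B" for b
        using mod_hom_smult[OF \<mu> tS[OF b x] u(1)[OF b]] t(2)[OF b x] u(2)[OF b] by simp
    qed
    also have "\<dots> = aug FV x" by (rule c_sum[OF augK[OF x]])
    finally show ?thesis .
  qed
  interpret bc: boundary_coefficients R kR VR FV B ?c
  proof (intro boundary_coefficients.intro ext_data.intro boundary_coefficients_axioms.intro kR FV B(1))
    show "?c b x \<in> carrier R" if "b \<in> B" "x \<in> carrier (cmod FV (Suc 0))" for b x
      using ts[OF that] td[OF that] \<pi>T0 by (simp add: R_def)
    show "?c b (x \<oplus>\<^bsub>cmod FV (Suc 0)\<^esub> y) = ?c b x \<oplus>\<^bsub>R\<^esub> ?c b y"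
      if "b \<in> B" "x \<in> carrier (cmod FV (Suc 0))" "y \<in> carrier (cmod FV (Suc 0))" for b x y
      using mod_hom_add[OF free_resolution_diff[OF FV] that(2,3)]
        mod_hom_add[OF t(1)[OF that(1)] diff_closed[OF FV that(2)] diff_closed[OF FV that(3)]]
      by (simp add: R_def SR_def)
    show "?c b (a \<odot>\<^bsub>cmod FV (Suc 0)\<^esub> x) = a \<otimes>\<^bsub>R\<^esub> ?c b x"
      if "b \<in> B" "a \<in> carrier R" "x \<in> carrier (cmod FV (Suc 0))" for b a x
      using mod_hom_smult[OF free_resolution_diff[OF FV] that(2,3)]
        mod_hom_smult[OF t(1)[OF that(1)] that(2) diff_closed[OF FV that(3)]] Rc(2)[OF that(2)]
      by (simp add: R_def SR_def)
    show "?c b (diff FV (Suc 0) x) = \<zero>\<^bsub>R\<^esub>" if "b \<in> B" "x \<in> carrier (cmod FV (Suc (Suc 0)))" for b x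
      using diff_diff[OF FV that(2)] mod_hom_zero[OF t(1)[OF that(1)] F0.left_module_axioms SR]
      by (simp add: R_def SR_def)
    show "?c b x \<odot>\<^bsub>kR\<^esub> k = \<zero>\<^bsub>kR\<^esub>" if "b \<in> B" "x \<in> carrier (cmod FV (Suc 0))" "k \<in> carrier kR" for b x k
      using td[OF that(1,2)] that(3) by (simp add: kR_def)
  qed
  show ?thesis
  proof (rule bc.ext_injective[OF FM FN \<mu>R \<nu>R, where u = u and v = w and \<phi> = ?f, OF _ _ _ f_hom \<mu>f _ _ z \<mu>z \<nu>z])
    show "u \<in> B \<rightarrow> carrier MR" using u(1) by (simp add: MR_def)
    show "w \<in> B \<rightarrow> carrier NR" using w(1) by (simp add: NR_def)
    show "\<mu> (u b) = \<nu> (w b)" if "b \<in> B" for b using u(2)[OF that] w(2)[OF that] by simp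
    show "?f (diff FV 0 x) = bc.comb MR u x" for x by (simp add: bc.comb_def MR_def)
    show "bc.comb NR w x = \<zero>\<^bsub>NR\<^esub>" for x
      using w(1) by (simp add: bc.comb_def NR_def) (rule N.M.add.finprod_one_eqI; simp)
  qed
qed

theorem theorem3:
  fixes K :: "'k ring" and S :: "'s ring" and T :: "'t ring"
    and \<pi>S :: "'s \<Rightarrow> 'k" and \<pi>T :: "'t \<Rightarrow> 'k"
    and M :: "('s, 'm) module" and N :: "('t, 'n) module" and V :: "('k, 'v) module"
    and \<mu> :: "'m \<Rightarrow> 'v" and \<nu> :: "'n \<Rightarrow> 'v"
    and \<sigma>S :: "'k \<Rightarrow> 's" and \<sigma>T :: "'k \<Rightarrow> 't"
    and gS :: "int \<Rightarrow> 's set" and gT :: "int \<Rightarrow> 't set"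
    and gM :: "int \<Rightarrow> 'm set" and gN :: "int \<Rightarrow> 'n set" and gV :: "int \<Rightarrow> 'v set"
    and R :: "('s \<times> 't) ring"
    and kR :: "('s \<times> 't, 'k) module" and VR :: "('s \<times> 't, 'v) module"
    and MR :: "('s \<times> 't, 'm) module" and NR :: "('s \<times> 't, 'n) module"
    and P W :: "('s \<times> 't, 'm \<times> 'n) module"
    and Fk :: "('s \<times> 't, 'a, 'k) resolution" and FV :: "('s \<times> 't, 'b, 'v) resolution"
    and FM :: "('s \<times> 't, 'c, 'm) resolution" and FN :: "('s \<times> 't, 'd, 'n) resolution"
    and FP :: "('s \<times> 't, 'e, 'm \<times> 'n) resolution"
    and FW :: "('s \<times> 't, 'f, 'm \<times> 'n) resolution"
  defines "R \<equiv> fiber_ring S T \<pi>S \<pi>T"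
    and "kR \<equiv> restrict_scalars (\<pi>S \<circ> fst) (self_module K)"
    and "VR \<equiv> restrict_scalars (\<pi>S \<circ> fst) V"
    and "MR \<equiv> restrict_scalars fst M"
    and "NR \<equiv> restrict_scalars snd N"
    and "P \<equiv> module_prod MR NR"
    and "W \<equiv> fiber_module MR NR \<mu> \<nu>"
  assumes "field K" and "ring S" and "ring T"
    and "\<pi>S \<in> ring_hom S K" and "\<pi>S ` carrier S = carrier K"
    and "\<pi>T \<in> ring_hom T K" and "\<pi>T ` carrier T = carrier K"
    and "left_module S M" and "left_module T N" and "left_module K V"
    and "local_case K S \<pi>S T \<pi>T M N V \<or>
         graded_case K S \<pi>S T \<pi>T M N V \<mu> \<nu> \<sigma>S \<sigma>T gS gT gM gN gV"
    and "\<mu> \<in> mod_hom S M (restrict_scalars \<pi>S V)" and "\<mu> ` carrier M = carrier V"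
    and "{m \<in> carrier M. \<mu> m = \<zero>\<^bsub>V\<^esub>} = ideal_smult (a_kernel S K \<pi>S) M"
    and "\<nu> \<in> mod_hom T N (restrict_scalars \<pi>T V)" and "\<nu> ` carrier N = carrier V"
    and "{n \<in> carrier N. \<nu> n = \<zero>\<^bsub>V\<^esub>} = ideal_smult (a_kernel T K \<pi>T) N"
    and "free_resolution R kR Fk" and "free_resolution R VR FV"
    and "free_resolution R MR FM" and "free_resolution R NR FN"
    and "free_resolution R P FP" and "free_resolution R W FW"
  shows "short_exact R W P VR (\<lambda>w. w) (\<lambda>(m, n). \<mu> m \<ominus>\<^bsub>V\<^esub> \<nu> n) \<and>
        (let E = ext_algebra R kR Fk;
             EV = ext_module R kR Fk FV; EM = ext_module R kR Fk FM;
             EN = ext_module R kR Fk FN; EP = ext_module R kR Fk FP;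
             EW = ext_module R kR Fk FW;
             \<comment> \<open>the canonical identification of \<open>Ext(M) \<oplus> Ext(N)\<close> with \<open>Ext(M \<times> N)\<close>\<close>
             \<theta> = (\<lambda>(\<xi>, \<eta>). ext_map R kR FP FM fst \<xi> \<oplus>\<^bsub>EP\<^esub> ext_map R kR FP FN snd \<eta>);
             \<mu>\<nu> = (\<lambda>\<zeta>. (ext_map R kR FM FV \<mu> \<zeta>, \<ominus>\<^bsub>EN\<^esub> ext_map R kR FN FV \<nu> \<zeta>))
         in (\<forall>\<zeta>\<in>carrier EV. \<theta> (\<mu>\<nu> \<zeta>) = ext_map R kR FP FV (\<lambda>(m, n). \<mu> m \<ominus>\<^bsub>V\<^esub> \<nu> n) \<zeta>) \<and>
            graded_short_exact E (ext_grading R kR Fk)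
              EV (ext_grading R kR FV)
              (module_prod EM EN) (\<lambda>i. ext_grading R kR FM i \<times> ext_grading R kR FN i)
              EW (ext_grading R kR FW)
              \<mu>\<nu> (\<lambda>z. ext_map R kR FW FP (\<lambda>w. w) (\<theta> z)))"
proof -
  interpret K: field K by fact
  interpret V: left_module K V by fact
  note \<mu> = \<open>\<mu> \<in> mod_hom S M (restrict_scalars \<pi>S V)\<close> and \<nu> = \<open>\<nu> \<in> mod_hom T N (restrict_scalars \<pi>T V)\<close>
  note \<pi>S = \<open>\<pi>S \<in> ring_hom S K\<close>
  have Rc: "fst a \<in> carrier S" "snd a \<in> carrier T" "\<pi>S (fst a) = \<pi>T (snd a)" if "a \<in> carrier R" for a
    using that by (auto simp: R_def)
  have \<mu>c: "\<mu> x \<in> carrier V" if "x \<in> carrier M" for x using mod_hom_closed[OF \<mu> that] by simp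
  have \<nu>c: "\<nu> x \<in> carrier V" if "x \<in> carrier N" for x using mod_hom_closed[OF \<nu> that] by simp
  have \<mu>R: "\<mu> \<in> mod_hom R MR VR"
    by (rule mod_homI) (use mod_hom_add[OF \<mu>] mod_hom_smult[OF \<mu>] \<mu>c Rc in \<open>simp_all add: MR_def VR_def\<close>)
  have \<nu>R: "\<nu> \<in> mod_hom R NR VR"
    by (rule mod_homI) (use mod_hom_add[OF \<nu>] mod_hom_smult[OF \<nu>] \<nu>c Rc in \<open>simp_all add: NR_def VR_def\<close>)
  have fg: "fin_gen K V"
    using \<open>local_case K S \<pi>S T \<pi>T M N V \<or> graded_case K S \<pi>S T \<pi>T M N V \<mu> \<nu> \<sigma>S \<sigma>T gS gT gM gN gV\<close>
  proof
    assume "local_case K S \<pi>S T \<pi>T M N V"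
    then show ?thesis by (simp add: local_case_def)
  next
    assume "graded_case K S \<pi>S T \<pi>T M N V \<mu> \<nu> \<sigma>S \<sigma>T gS gT gM gN gV"
    \<comment> \<open>A degreewise finite \<open>V\<close> that is bounded below may still have
      infinite dimension; the finitely generated free module mapping onto \<open>V\<close> in its
      resolution is what bounds it.\<close>
    then have "has_graded_minimal_fg_resolution K (concentrated K) {\<zero>\<^bsub>K\<^esub>} V gV" by (simp add: graded_case_def)
    then obtain F :: "('k, nat \<Rightarrow> 'k, 'v) resolution" where F: "free_resolution K V F" "minimal_fg K {\<zero>\<^bsub>K\<^esub>} F"
      by (auto simp: has_graded_minimal_fg_resolution_def)
    then have "fin_gen K (cmod F 0)" by (simp add: minimal_fg_def)
    from fin_gen_image[OF free_resolution_cmod[OF F(1)] V.left_module_axioms free_resolution_aug[OF F(1)] aug_surj[OF F(1)] this]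
    show ?thesis .
  qed
  have nontriv: "\<one>\<^bsub>R\<^esub> \<noteq> \<zero>\<^bsub>R\<^esub>"
    using ring_hom_one[OF \<pi>S] ring_hom_zero[OF \<pi>S \<open>ring S\<close> K.ring_axioms] K.one_not_zero by (auto simp: R_def)
  note kR = free_resolution_left_module[OF \<open>free_resolution R kR Fk\<close>]
    and lV = free_resolution_left_module[OF \<open>free_resolution R VR FV\<close>]
    and lP = free_resolution_left_module[OF \<open>free_resolution R P FP\<close>]
    and lW = free_resolution_left_module[OF \<open>free_resolution R W FW\<close>]
  have p: "(\<lambda>(m, n). \<mu> m \<ominus>\<^bsub>V\<^esub> \<nu> n) = (\<lambda>x. (\<mu> \<circ> fst) x \<ominus>\<^bsub>VR\<^esub> (\<nu> \<circ> snd) x)"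
    by (auto simp: VR_def)
  have exact: "short_exact R W P VR (\<lambda>w. w) (\<lambda>(m, n). \<mu> m \<ominus>\<^bsub>V\<^esub> \<nu> n)"
    unfolding short_exact_def
  proof (intro conjI lV lP lW)
    show "(\<lambda>w. w) \<in> mod_hom R W P"
      by (auto simp: mod_hom_def W_def P_def fiber_module_def)
    show "(\<lambda>(m, n). \<mu> m \<ominus>\<^bsub>V\<^esub> \<nu> n) \<in> mod_hom R P VR"
      unfolding p P_def by (rule mod_hom_minus[OF mod_hom_comp[OF mod_hom_fst \<mu>R] mod_hom_comp[OF mod_hom_snd \<nu>R] lV])
    show "(\<lambda>w. w) ` carrier W = {y \<in> carrier P. (\<lambda>(m, n). \<mu> m \<ominus>\<^bsub>V\<^esub> \<nu> n) y = \<zero>\<^bsub>VR\<^esub>}"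
      by (auto simp: W_def P_def fiber_module_def MR_def NR_def VR_def V.M.minus_eq_zero_iff \<mu>c \<nu>c)
    show "(\<lambda>(m, n). \<mu> m \<ominus>\<^bsub>V\<^esub> \<nu> n) ` carrier P = carrier VR"
    proof (intro equalityI subsetI)
      fix v assume "v \<in> (\<lambda>(m, n). \<mu> m \<ominus>\<^bsub>V\<^esub> \<nu> n) ` carrier P"
      then show "v \<in> carrier VR" by (auto simp: P_def MR_def NR_def VR_def \<mu>c \<nu>c)
    next
      fix v assume "v \<in> carrier VR"
      then have v: "v \<in> carrier V" by (simp add: VR_def)
      then obtain m where m: "m \<in> carrier M" "v = \<mu> m" using \<open>\<mu> ` carrier M = carrier V\<close> by auto
      obtain n where n: "n \<in> carrier N" "\<zero>\<^bsub>V\<^esub> = \<nu> n" using \<open>\<nu> ` carrier N = carrier V\<close> V.M.zero_closed by (metis imageE)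
      have "v = (\<lambda>(m, n). \<mu> m \<ominus>\<^bsub>V\<^esub> \<nu> n) (m, n)" using m n(2)[symmetric] v by (simp add: a_minus_def)
      moreover have "(m, n) \<in> carrier P" using m n by (simp add: P_def MR_def NR_def)
      ultimately show "v \<in> (\<lambda>(m, n). \<mu> m \<ominus>\<^bsub>V\<^esub> \<nu> n) ` carrier P" by (rule rev_image_eqI[rotated])
    qed
  qed simp
  have "pullback_ext R kR VR MR NR W \<mu> \<nu> Fk FV FM FN FP FW"
  proof (rule pullback_ext.intro)
    show "short_exact R W (module_prod MR NR) VR (\<lambda>w. w) (\<lambda>(m, n). \<mu> m \<ominus>\<^bsub>VR\<^esub> \<nu> n)"
      using exact by (simp add: P_def VR_def)
    show "free_resolution R (module_prod MR NR) FP" using \<open>free_resolution R P FP\<close> by (simp add: P_def)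
    fix n z assume "z \<in> carrier (ext_group R kR FV n)"
      "ext_map_deg R kR FM FV \<mu> n z = \<one>\<^bsub>ext_group R kR FM n\<^esub>"
      "ext_map_deg R kR FN FV \<nu> n z = \<one>\<^bsub>ext_group R kR FN n\<^esub>"
    then show "z = \<one>\<^bsub>ext_group R kR FV n\<^esub>"
      unfolding R_def kR_def VR_def MR_def NR_def
      by (rule fiber_ext_injective[OF \<open>field K\<close> \<open>ring S\<close> \<open>ring T\<close> \<pi>S \<open>\<pi>S ` carrier S = carrier K\<close>
        \<open>\<pi>T \<in> ring_hom T K\<close> \<open>left_module S M\<close> \<open>left_module T N\<close> \<open>left_module K V\<close> fg \<mu> \<open>\<mu> ` carrier M = carrier V\<close>
        \<mu>R[unfolded R_def MR_def VR_def] \<nu>R[unfolded R_def NR_def VR_def] \<open>\<nu> ` carrier N = carrier V\<close>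
        kR[unfolded R_def kR_def] \<open>free_resolution R VR FV\<close>[unfolded R_def VR_def]
        \<open>free_resolution R MR FM\<close>[unfolded R_def MR_def] \<open>free_resolution R NR FN\<close>[unfolded R_def NR_def]])
  qed fact+
  then interpret X: pullback_ext R kR VR MR NR W \<mu> \<nu> Fk FV FM FN FP FW .
  show ?thesis
    unfolding Let_def
  proof (intro conjI ballI exact)
    fix \<zeta> assume "\<zeta> \<in> carrier (ext_module R kR Fk FV)"
    then have "\<zeta> \<in> ext_carrier R kR FV" by (simp add: ext_module_def)
    from X.theta_munu[OF this]
    show "(\<lambda>(\<xi>, \<eta>). ext_map R kR FP FM fst \<xi> \<oplus>\<^bsub>ext_module R kR Fk FP\<^esub> ext_map R kR FP FN snd \<eta>)
        (ext_map R kR FM FV \<mu> \<zeta>, \<ominus>\<^bsub>ext_module R kR Fk FN\<^esub> ext_map R kR FN FV \<nu> \<zeta>) =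
      ext_map R kR FP FV (\<lambda>(m, n). \<mu> m \<ominus>\<^bsub>V\<^esub> \<nu> n) \<zeta>"
      by (simp add: VR_def)
  qed (rule X.ext_graded_short_exact)
qed

end
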